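(* Assume that (1) there exists $\bar{\mathcal H}>0$ such that $\frac1n\sum_{x=0}^n\big(\bar r_x^2(0)+\bar p_x^2(0)\big)\le\bar{\mathcal H}$ for all $n\ge1$; and (2) there exists a continuous function $r_{\rm ini}:[0,1]\to\mathbb R$ such that $\lim_{n\to\infty}\frac1n\sum_{x=1}^n\big(\bar r_x(0)-r_{\rm ini}(\tfrac xn)\big)^2=0$. Let $r(t,u)$ be the solution of $\partial_t r=\frac1{2\gamma}\partial_{uu}r$ on $(0,\infty)\times(0,1)$ with $r(t,0)=0$, $r(t,1)=\bar F$, $r(0,u)=r_{\rm ini}(u)$. Let $W_n(t)=\frac1n\int_0^{tn^2}\mathcal F_n(s)\bar p_n(s)\,ds$. Then for any $t>0$, $$\lim_{n\to\infty}W_n(t)=W(t):=\frac{\bar F}{2\gamma}\int_0^t(\partial_ur)(s,1)\,ds+\mathbb W^Q\,t,$$ where $$\mathbb W^Q=\sum_{\ell=1}^{\infty}|\hat{\mathcal F}(\ell)|^2\,(\ell\omega)\,\mathrm{Re}\sqrt{\frac{4}{(\ell\omega)^2-2i\gamma\ell\omega}-1}$$ and $w\mapsto\sqrt w$ is the branch of the inverse of $z\mapsto z^2$ with $\mathrm{Re}\sqrt w>0$ for $w\in\mathbb C\setminus(-\infty,0]$.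
   Context: Model. Fix $\gamma>0$, $T_->0$, $\theta>0$, $\omega=2\pi/\theta$, $\bar F\in\mathbb R$, and complex numbers $\hat{\mathcal F}(\ell)$, $\ell\in\mathbb Z\setminus\{0\}$ (not depending on $n$), with $\hat{\mathcal F}(-\ell)=\overline{\hat{\mathcal F}(\ell)}$, decaying fast enough (e.g. exponentially) that the force below is smooth; in particular $\sum_{\ell\ne0}|\hat{\mathcal F}(\ell)|<\infty$. For $n\ge1$ put $\tilde{\mathcal F}_n(t)=n^{-1/2}\sum_{\ell\neq0}\hat{\mathcal F}(\ell)e^{i\ell\omega t}$ and $\mathcal F_n(t)=\bar F+\tilde{\mathcal F}_n(t)$. The configuration $(\mathbf r,\mathbf p)=(r_1,\dots,r_n,p_0,\dots,p_n)\in\Omega_n=\mathbb R^n\times\mathbb R^{n+1}$ evolves by $dr_x=(p_x-p_{x-1})dt$ for $1\le x\le n$; $dp_0=r_1dt-2\gamma p_0dt+\sqrt{4\gamma T_-}\,dw_-(t)$; $dp_x=(r_{x+1}-r_x)dt-2p_x(t^-)dN_x(\gamma t)$ for $1\le x\le n-1$; $dp_n=(\mathcal F_n(t)-r_n)dt-2p_n(t^-)dN_n(\gamma t)$. Here $N_1,\dots,N_n$ are independent Poisson processes of intensity $1$ and $w_-$ is an independent standard Wiener process. The initial configuration has law $\mu_n$ (a probability measure on $\Omega_n$) and is independent of the noises; $\mathbb E_{\mu_n}$ is the corresponding expectation. Set $\bar r_x(t)=\mathbb E_{\mu_n}[r_x(t)]$, $\bar p_x(t)=\mathbb E_{\mu_n}[p_x(t)]$,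 with the convention $r_0\equiv\bar r_0\equiv0$. Solution of the stretch equation: let $\mathcal M_{\rm fin}([0,1])$ be the finite signed measures on $[0,1]$ with the weak topology. A solution is $r\in C([0,\infty);\mathcal M_{\rm fin}([0,1]))$ such that for all $\varphi\in C^2([0,1])$ with $\varphi(0)=\varphi(1)=0$ and all $t\ge 0$, $\int_0^1\varphi(u)\,r(t,du)-\int_0^1\varphi(u)r_{\rm ini}(u)\,du=\frac1{2\gamma}\int_0^t ds\int_0^1\varphi''(u)\,r(s,du)-\frac{\bar F t}{2\gamma}\varphi'(1)$. It is unique, and has a density, smooth on $(0,\infty)\times[0,1]$, denoted $r(t,u)$. *)

theory Defs
  imports "HOL-Probability.Probability"
begin

section \<open>The driving noises\<close>

definition indep_increments ::
  "'a measure \<Rightarrow> 'b measure \<Rightarrow> (real \<Rightarrow> 'a \<Rightarrow> 'b::minus) \<Rightarrow> bool" where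
  "indep_increments M S X \<longleftrightarrow>
     (\<forall>k (\<tau>::nat \<Rightarrow> real). 0 \<le> \<tau> 0 \<longrightarrow> mono \<tau> \<longrightarrow>
        prob_space.indep_vars M (\<lambda>_. S) (\<lambda>i \<omega>. X (\<tau> (Suc i)) \<omega> - X (\<tau> i) \<omega>) {..<k})"

text \<open>Only the restriction of a process to the times \<open>t \<ge> 0\<close> is meaningful. The differences in
  \<^term>\<open>nat\<close> below are genuine ones, since the paths are nondecreasing.\<close>

locale poisson_process = prob_space M for M :: "'a measure" +
  fixes N :: "real \<Rightarrow> 'a \<Rightarrow> nat"
  assumes measurable_N: "\<And>t. 0 \<le> t \<Longrightarrow> N t \<in> M \<rightarrow>\<^sub>M count_space UNIV"
    and start: "AE \<omega> in M. N 0 \<omega> = 0"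
    and paths_mono: "AE \<omega> in M. mono_on {0..} (\<lambda>t. N t \<omega>)"
    and paths_right_cont: "AE \<omega> in M. \<forall>t\<ge>0. continuous (at_right t) (\<lambda>s. real (N s \<omega>))"
    and increments: "indep_increments M (count_space UNIV) N"
    and increment_law: "\<And>s t. 0 \<le> s \<Longrightarrow> s < t \<Longrightarrow>
          distr M (count_space UNIV) (\<lambda>\<omega>. N t \<omega> - N s \<omega>) = measure_pmf (poisson_pmf (t - s))"

text \<open>The second argument of \<^const>\<open>normal_density\<close> is the standard deviation.\<close>

locale wiener_process = prob_space M for M :: "'a measure" +
  fixes w :: "real \<Rightarrow> 'a \<Rightarrow> real"
  assumes measurable_w: "\<And>t. 0 \<le> t \<Longrightarrow> w t \<in> borel_measurable M"
    and start: "AE \<omega> in M. w 0 \<omega> = 0"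
    and paths_cont: "AE \<omega> in M. continuous_on {0..} (\<lambda>t. w t \<omega>)"
    and increments: "indep_increments M borel w"
    and increment_law: "\<And>s t. 0 \<le> s \<Longrightarrow> s < t \<Longrightarrow>
          distributed M lborel (\<lambda>\<omega>. w t \<omega> - w s \<omega>) (normal_density 0 (sqrt (t - s)))"

section \<open>The force\<close>

definition angular_freq :: "real \<Rightarrow> real" where
  "angular_freq \<theta> = 2 * pi / \<theta>"

text \<open>Under \<open>Fhat (-l) = cnj (Fhat l)\<close> the series is real, so that \<^const>\<open>Re\<close> is a mere type
  conversion. The value of \<open>Fhat\<close> at \<open>0\<close> is never used.\<close>

definition force :: "real \<Rightarrow> real \<Rightarrow> (int \<Rightarrow> complex) \<Rightarrow> nat \<Rightarrow> real \<Rightarrow> real" where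
  "force \<theta> Fbar Fhat n t = Fbar + 1 / sqrt (real n) *
     Re (\<Sum>\<^sub>\<infinity>l\<in>-{0}. Fhat l * exp (\<i> * of_int l * of_real (angular_freq \<theta>) * of_real t))"

text \<open>Rapid decay of the Fourier coefficients, that is, smoothness of the force.\<close>

definition rapidly_decaying :: "(int \<Rightarrow> complex) \<Rightarrow> bool" where
  "rapidly_decaying Fhat \<longleftrightarrow>
     (\<forall>k::nat. (\<lambda>l. \<bar>real_of_int l\<bar> ^ k * norm (Fhat l)) summable_on -{0})"

section \<open>The chain\<close>

text \<open>The configuration space $\mathbb R^n\times\mathbb R^{n+1}$ of \<open>(r\<^sub>1,\<dots>,r\<^sub>n)\<close> and
  \<open>(p\<^sub>0,\<dots>,p\<^sub>n)\<close>.\<close>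

definition config_space :: "nat \<Rightarrow> ((nat \<Rightarrow> real) \<times> (nat \<Rightarrow> real)) measure" where
  "config_space n = (\<Pi>\<^sub>M x\<in>{1..n}. borel) \<Otimes>\<^sub>M (\<Pi>\<^sub>M x\<in>{0..n}. borel)"

definition config ::
  "nat \<Rightarrow> (nat \<Rightarrow> real \<Rightarrow> 'a \<Rightarrow> real) \<Rightarrow> (nat \<Rightarrow> real \<Rightarrow> 'a \<Rightarrow> real) \<Rightarrow> real \<Rightarrow> 'a
     \<Rightarrow> (nat \<Rightarrow> real) \<times> (nat \<Rightarrow> real)" where
  "config n r p t \<omega> = (\<lambda>x\<in>{1..n}. r x t \<omega>, \<lambda>x\<in>{0..n}. p x t \<omega>)"

datatype source = Initial | Wiener | Poisson nat

definition path_sigma :: "'a measure \<Rightarrow> (real \<Rightarrow> 'a \<Rightarrow> real) \<Rightarrow> 'a set set" where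
  "path_sigma M X =
     sets (vimage_algebra (space M) (\<lambda>\<omega>. \<lambda>t\<in>{0..}. X t \<omega>) (\<Pi>\<^sub>M t\<in>{0..}. borel))"

text \<open>The pathwise integral $\int_{(0,t]} f(s^-)\,dN(\gamma s)$ as a Lebesgue--Stieltjes integral;
  \<^term>\<open>max 0\<close> extends the integrator by a constant to negative times.\<close>

definition jump_integral :: "real \<Rightarrow> (real \<Rightarrow> nat) \<Rightarrow> (real \<Rightarrow> real) \<Rightarrow> real \<Rightarrow> real" where
  "jump_integral \<gamma> N f t =
     (LINT s:{0<..t}|interval_measure (\<lambda>s. real (N (\<gamma> * max 0 s))). Lim (at_left s) f)"

definition cadlag :: "(real \<Rightarrow> real) \<Rightarrow> bool" where
  "cadlag f \<longleftrightarrow> (\<forall>t\<ge>0. continuous (at_right t) f) \<and> (\<forall>t>0. \<exists>l. (f \<longlongrightarrow> l) (at_left t))"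

text \<open>A chain of length \<open>n\<close> started from the law \<open>\<mu>\<close>. The noise of the momentum \<open>p\<^sub>0\<close> is additive
  and the other noises are of bounded variation, so the stochastic equations are imposed path by
  path in integral form. Integrability of the initial configuration is what makes its averages
  meaningful.\<close>

locale chain = prob_space M for M :: "'a measure" +
  fixes \<gamma> Tminus \<theta> Fbar :: real and Fhat :: "int \<Rightarrow> complex" and n :: nat
    and \<mu> :: "((nat \<Rightarrow> real) \<times> (nat \<Rightarrow> real)) measure"
    and w :: "real \<Rightarrow> 'a \<Rightarrow> real" and N :: "nat \<Rightarrow> real \<Rightarrow> 'a \<Rightarrow> nat"
    and r p :: "nat \<Rightarrow> real \<Rightarrow> 'a \<Rightarrow> real"
  assumes wiener: "wiener_process M w"
    and poisson: "\<And>x. x \<in> {1..n} \<Longrightarrow> poisson_process M (N x)"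
    and independence:
      "indep_sets
         (\<lambda>i. case i of
                Initial \<Rightarrow> sets (vimage_algebra (space M) (config n r p 0) (config_space n))
              | Wiener \<Rightarrow> path_sigma M w
              | Poisson x \<Rightarrow> path_sigma M (\<lambda>t \<omega>. real (N x t \<omega>)))
         ({Initial, Wiener} \<union> Poisson ` {1..n})"
    and initial_law: "distr M (config_space n) (config n r p 0) = \<mu>"
    and r_initial_integrable: "\<And>x. x \<in> {1..n} \<Longrightarrow> integrable M (r x 0)"
    and p_initial_integrable: "\<And>x. x \<in> {0..n} \<Longrightarrow> integrable M (p x 0)"
    and r_measurable: "\<And>x t. x \<in> {1..n} \<Longrightarrow> 0 \<le> t \<Longrightarrow> r x t \<in> borel_measurable M"
    and p_measurable: "\<And>x t. x \<in> {0..n} \<Longrightarrow> 0 \<le> t \<Longrightarrow> p x t \<in> borel_measurable M"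
    and r_zero: "\<And>t \<omega>. r 0 t \<omega> = 0"
    and r_paths: "AE \<omega> in M. \<forall>x\<in>{1..n}. cadlag (\<lambda>t. r x t \<omega>)"
    and p_paths: "AE \<omega> in M. \<forall>x\<in>{0..n}. cadlag (\<lambda>t. p x t \<omega>)"
    and r_eq: "AE \<omega> in M. \<forall>t\<ge>0. \<forall>x\<in>{1..n}.
        r x t \<omega> = r x 0 \<omega> + (LBINT s:{0..t}. p x s \<omega> - p (x - 1) s \<omega>)"
    and p_left_eq: "AE \<omega> in M. \<forall>t\<ge>0.
        p 0 t \<omega> = p 0 0 \<omega> + (LBINT s:{0..t}. r 1 s \<omega> - 2 * \<gamma> * p 0 s \<omega>)
          + sqrt (4 * \<gamma> * Tminus) * w t \<omega>"
    and p_bulk_eq: "AE \<omega> in M. \<forall>t\<ge>0. \<forall>x\<in>{1..<n}.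
        p x t \<omega> = p x 0 \<omega> + (LBINT s:{0..t}. r (x + 1) s \<omega> - r x s \<omega>)
          - 2 * jump_integral \<gamma> (\<lambda>s. N x s \<omega>) (\<lambda>s. p x s \<omega>) t"
    and p_right_eq: "AE \<omega> in M. \<forall>t\<ge>0.
        p n t \<omega> = p n 0 \<omega> + (LBINT s:{0..t}. force \<theta> Fbar Fhat n s - r n s \<omega>)
          - 2 * jump_integral \<gamma> (\<lambda>s. N n s \<omega>) (\<lambda>s. p n s \<omega>) t"

definition avg :: "'a measure \<Rightarrow> (nat \<Rightarrow> real \<Rightarrow> 'a \<Rightarrow> real) \<Rightarrow> nat \<Rightarrow> real \<Rightarrow> real" where
  "avg M X x t = (\<integral>\<omega>. X x t \<omega> \<partial>M)"

definition work ::
  "real \<Rightarrow> real \<Rightarrow> (int \<Rightarrow> complex) \<Rightarrow> nat \<Rightarrow> 'a measure \<Rightarrow> (nat \<Rightarrow> real \<Rightarrow> 'a \<Rightarrow> real) \<Rightarrow> real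
     \<Rightarrow> real" where
  "work \<theta> Fbar Fhat n M p t =
     1 / real n * (LBINT s:{0..t * (real n)\<^sup>2}. force \<theta> Fbar Fhat n s * avg M p n s)"

section \<open>The stretch equation\<close>

text \<open>A finite signed measure on \<open>[0,1]\<close> is represented by a pair of finite measures, of which it
  is the difference; the representation is not unique, but only the difference is ever used.\<close>

type_synonym signed = "real measure \<times> real measure"

definition fin_signed :: "signed \<Rightarrow> bool" where
  "fin_signed \<nu> \<longleftrightarrow> finite_measure (fst \<nu>) \<and> finite_measure (snd \<nu>) \<and>
     sets (fst \<nu>) = sets (restrict_space borel {0..1}) \<and>
     sets (snd \<nu>) = sets (restrict_space borel {0..1})"

definition signed_measure :: "signed \<Rightarrow> real set \<Rightarrow> real" where
  "signed_measure \<nu> A = measure (fst \<nu>) A - measure (snd \<nu>) A"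

definition signed_integral :: "signed \<Rightarrow> (real \<Rightarrow> real) \<Rightarrow> real" where
  "signed_integral \<nu> \<phi> = (\<integral>u. \<phi> u \<partial>fst \<nu>) - (\<integral>u. \<phi> u \<partial>snd \<nu>)"

text \<open>\<open>\<phi>\<close> is of class $C^2$ on \<open>[0,1]\<close> with derivatives \<open>\<phi>1\<close> and \<open>\<phi>2\<close>, one-sided at the end
  points.\<close>

definition C2_with :: "(real \<Rightarrow> real) \<Rightarrow> (real \<Rightarrow> real) \<Rightarrow> (real \<Rightarrow> real) \<Rightarrow> bool" where
  "C2_with \<phi> \<phi>1 \<phi>2 \<longleftrightarrow>
     (\<forall>u\<in>{0..1}. (\<phi> has_real_derivative \<phi>1 u) (at u within {0..1})) \<and>
     (\<forall>u\<in>{0..1}. (\<phi>1 has_real_derivative \<phi>2 u) (at u within {0..1})) \<and>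
     continuous_on {0..1} \<phi>2"

text \<open>The second conjunct is continuity in time for the weak topology.\<close>

definition stretch_solution ::
  "real \<Rightarrow> real \<Rightarrow> (real \<Rightarrow> real) \<Rightarrow> (real \<Rightarrow> signed) \<Rightarrow> bool" where
  "stretch_solution \<gamma> Fbar rini R \<longleftrightarrow>
     (\<forall>t\<ge>0. fin_signed (R t)) \<and>
     (\<forall>\<phi>. continuous_on {0..1} \<phi> \<longrightarrow> continuous_on {0..} (\<lambda>t. signed_integral (R t) \<phi>)) \<and>
     (\<forall>\<phi> \<phi>1 \<phi>2. C2_with \<phi> \<phi>1 \<phi>2 \<longrightarrow> \<phi> 0 = 0 \<longrightarrow> \<phi> 1 = 0 \<longrightarrow>
        (\<forall>t\<ge>0. signed_integral (R t) \<phi> - (LBINT u:{0..1}. \<phi> u * rini u) =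
           1 / (2 * \<gamma>) * (LBINT s:{0..t}. signed_integral (R s) \<phi>2)
             - Fbar * t / (2 * \<gamma>) * \<phi>1 1))"

text \<open>\<open>r\<close> is the density, on \<open>(0,\<infinity>) \<times> [0,1]\<close>, of the solution. Continuity singles out one version
  of the density; it is the smooth one.\<close>

definition stretch_density ::
  "real \<Rightarrow> real \<Rightarrow> (real \<Rightarrow> real) \<Rightarrow> (real \<Rightarrow> real \<Rightarrow> real) \<Rightarrow> bool" where
  "stretch_density \<gamma> Fbar rini r \<longleftrightarrow>
     (\<exists>R. stretch_solution \<gamma> Fbar rini R \<and>
        (\<forall>t>0. \<forall>A\<in>sets borel. A \<subseteq> {0..1} \<longrightarrow> signed_measure (R t) A = (LBINT u:A. r t u))) \<and>
     continuous_on ({0<..} \<times> {0..1}) (\<lambda>(t, u). r t u)"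

section \<open>The limiting work\<close>

text \<open>\<^const>\<open>csqrt\<close> is the branch with positive real part off the half-line \<open>(-\<infinity>,0]\<close>.\<close>

definition work_Q :: "real \<Rightarrow> real \<Rightarrow> (int \<Rightarrow> complex) \<Rightarrow> real" where
  "work_Q \<gamma> \<theta> Fhat = (\<Sum>k. let l = Suc k; a = real l * angular_freq \<theta> in
     (norm (Fhat (int l)))\<^sup>2 * a *
       Re (csqrt (4 / ((of_real a)\<^sup>2 - 2 * \<i> * of_real \<gamma> * of_real a) - 1)))"

definition limit_work ::
  "real \<Rightarrow> real \<Rightarrow> real \<Rightarrow> (int \<Rightarrow> complex) \<Rightarrow> (real \<Rightarrow> real \<Rightarrow> real) \<Rightarrow> real \<Rightarrow> real" where
  "limit_work \<gamma> \<theta> Fbar Fhat r t =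
     Fbar / (2 * \<gamma>) * (LBINT s:{0..t}. vector_derivative (r s) (at 1 within {0..1}))
       + work_Q \<gamma> \<theta> Fhat * t"

end

theory Submission
  imports Defs "HOL-Real_Asymp.Real_Asymp"
begin

text \<open>Averaging over the noise turns the stochastic chain into a deterministic damped chain for the mean
  stretches and momenta, with damping \<open>2\<gamma>\<close> at every site: a jump \<open>p \<rightarrow> -p\<close> at rate \<open>\<gamma>\<close> contributes
  \<open>-2\<gamma>p\<close>, and the Wiener process has mean zero. The average is taken on an Euler scheme, where the next
  Poisson increment is independent of the past, and the mesh is then sent to zero by dominated
  convergence. In the deterministic chain the forcing splits into its constant part and its harmonics.
  Under the diffusive scaling the constant part drives the stretch equation, whose sine coefficients solve
  a relaxation equation; each harmonic is a wave that decays exponentially away from the forced end and is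
  governed by a root of the dispersion relation, which yields the quasi-static term of the limit.\<close>

text \<open>Energy alone bounds the integral of the last mean momentum over [0, t n^2] by order
  n^(3/2), a factor sqrt n too much for the constant force. Duality closes the gap: the chain is
  paired with a vector (u, v) such that exp (b s) times the pairing has the derivative v_n exp (b s)
  G - exp (b s) P_n. The momentum integral becomes a force integral plus two boundary terms in time,
  which energy bounds by order n. For a harmonic the normalisation is n^(3/2), and they vanish. At
  frequency zero it is only n; (u, v) is then the linear profile, and what survives is the change of
  the first moment of the stretch. This moment is identified mode by mode, with an L2 error, so no
  pointwise convergence of the profile is needed; the stretch equation is expanded in the same sine
  series. On the stochastic side the Wiener process enters additively at one site and is subtracted
  there. Each path then solves a linear equation driven by Poisson counts, and a Gronwall bound by
  an exponential of the number of jumps is integrable, since Poisson variables have exponential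
  moments. This bound dominates all the Euler schemes.\<close>

section \<open>The deterministic damped chain: duality and energy\<close>

lemma sum_by_parts_upper:
  fixes u :: "nat \<Rightarrow> 'a::real_vector" and P :: "nat \<Rightarrow> real"
  shows "(\<Sum>x<n. (P (Suc x) - P x) *\<^sub>R u (Suc x)) =
    (\<Sum>x\<le>n. P x *\<^sub>R (u x - u (Suc x))) + P n *\<^sub>R u (Suc n) - P 0 *\<^sub>R u 0"
  by (induction n) (simp_all add: algebra_simps)

lemma sum_by_parts_lower:
  fixes v :: "nat \<Rightarrow> 'a::real_vector" and R :: "nat \<Rightarrow> real"
  shows "(\<Sum>x\<le>n. (R (Suc x) - R x) *\<^sub>R v x) =
    (\<Sum>x<n. R (Suc x) *\<^sub>R (v x - v (Suc x))) + R (Suc n) *\<^sub>R v n - R 0 *\<^sub>R v 0"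
  by (induction n) (simp_all add: algebra_simps)

text \<open>The force appears as the stretch of a fictitious bond \<open>Suc n\<close>, and the free
  left end as \<open>R 0 = 0\<close>. With these conventions the momentum equation has one form at
  all sites, including the two ends.\<close>

locale damped_chain =
  fixes \<gamma> :: real and n :: nat and G :: "real \<Rightarrow> real" and R P :: "nat \<Rightarrow> real \<Rightarrow> real"
  assumes damping_pos: "\<gamma> > 0"
    and G_cont: "continuous_on {0..} G"
    and R_0: "R 0 t = 0"
    and R_end: "t \<ge> 0 \<Longrightarrow> R (Suc n) t = G t"
    and R_deriv: "\<lbrakk>x < n; t \<ge> 0\<rbrakk> \<Longrightarrow>
      (R (Suc x) has_real_derivative P (Suc x) t - P x t) (at t within {0..})"
    and P_deriv: "\<lbrakk>x \<le> n; t \<ge> 0\<rbrakk> \<Longrightarrow>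
      (P x has_real_derivative R (Suc x) t - R x t - 2 * \<gamma> * P x t) (at t within {0..})"
begin

lemma R_cont: "x < n \<Longrightarrow> continuous_on {0..} (R (Suc x))"
  by (rule DERIV_continuous_on[OF R_deriv]) auto
    
lemma P_cont: "x \<le> n \<Longrightarrow> continuous_on {0..} (P x)"
  by (rule DERIV_continuous_on[OF P_deriv]) auto

text \<open>Only \<open>u\<close> on the bonds 1 to n enters. The values of \<open>u\<close> at 0
  and at \<open>Suc n\<close> are thus free to carry boundary conditions. The target type is general
  because the dual vectors are complex for a harmonic and real otherwise.\<close>

definition pairing :: "(nat \<Rightarrow> 'b) \<Rightarrow> (nat \<Rightarrow> 'b) \<Rightarrow> real \<Rightarrow> 'b::real_normed_vector" where
  "pairing u v t = (\<Sum>x<n. R (Suc x) t *\<^sub>R u (Suc x)) + (\<Sum>x\<le>n. P x t *\<^sub>R v x)"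

text \<open>Summation by parts moves the difference operators onto the dual vector. The conditions
  on \<open>u\<close> remove the boundary terms of the stretch equations; those of the momentum
  equations leave only the force, since \<open>R 0\<close> vanishes.\<close>

lemma pairing_deriv:
  assumes "u 0 = 0" "u (Suc n) = 0" "t \<ge> 0"
  shows "(pairing u v has_vector_derivative
     (\<Sum>x\<le>n. P x t *\<^sub>R (u x - u (Suc x) - (2 * \<gamma>) *\<^sub>R v x))
      + (\<Sum>x<n. R (Suc x) t *\<^sub>R (v x - v (Suc x))) + G t *\<^sub>R v n) (at t within {0..})"
proof -
  have "(pairing u v has_vector_derivative
     (\<Sum>x<n. (P (Suc x) t - P x t) *\<^sub>R u (Suc x))
      + (\<Sum>x\<le>n. (R (Suc x) t - R x t - 2 * \<gamma> * P x t) *\<^sub>R v x)) (at t within {0..})"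
    unfolding pairing_def using assms
    by (auto intro!: derivative_eq_intros R_deriv P_deriv)
  moreover have "(\<Sum>x\<le>n. (R (Suc x) t - R x t - 2 * \<gamma> * P x t) *\<^sub>R v x) =
      (\<Sum>x\<le>n. (R (Suc x) t - R x t) *\<^sub>R v x) - (\<Sum>x\<le>n. P x t *\<^sub>R ((2 * \<gamma>) *\<^sub>R v x))"
    by (simp add: sum_subtractf[symmetric] algebra_simps)
  moreover have "(\<Sum>x<n. (P (Suc x) t - P x t) *\<^sub>R u (Suc x)) = (\<Sum>x\<le>n. P x t *\<^sub>R (u x - u (Suc x)))"
    using sum_by_parts_upper[of "\<lambda>x. P x t" u n] assms by simp
  moreover have "(\<Sum>x\<le>n. (R (Suc x) t - R x t) *\<^sub>R v x) =
      (\<Sum>x<n. R (Suc x) t *\<^sub>R (v x - v (Suc x))) + G t *\<^sub>R v n"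
    using sum_by_parts_lower[of "\<lambda>x. R x t" v n] assms by (simp add: R_0 R_end)
  moreover have "(\<Sum>x\<le>n. P x t *\<^sub>R (u x - u (Suc x) - (2 * \<gamma>) *\<^sub>R v x)) =
      (\<Sum>x\<le>n. P x t *\<^sub>R (u x - u (Suc x))) - (\<Sum>x\<le>n. P x t *\<^sub>R ((2 * \<gamma>) *\<^sub>R v x))"
    by (simp only: scaleR_right_diff_distrib[of _ "u _ - u (Suc _)"] sum_subtractf)
  ultimately show ?thesis
    by (simp only: add_diff_eq diff_add_eq add.assoc)
qed

definition energy :: "real \<Rightarrow> real" where
  "energy t = (\<Sum>x<n. (R (Suc x) t)\<^sup>2) + (\<Sum>x\<le>n. (P x t)\<^sup>2)"

text \<open>The exchange between bonds and sites cancels after summation by parts; what remains is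
  the work of the force on the last particle and the friction.\<close>

lemma energy_deriv:
  assumes "t \<ge> 0"
  shows "(energy has_real_derivative 2 * (G t * P n t) - 4 * \<gamma> * (\<Sum>x\<le>n. (P x t)\<^sup>2)) (at t within {0..})"
proof -
  have "(energy has_real_derivative (\<Sum>x<n. 2 * ((P (Suc x) t - P x t) * R (Suc x) t))
     + (\<Sum>x\<le>n. 2 * ((R (Suc x) t - R x t - 2 * \<gamma> * P x t) * P x t))) (at t within {0..})"
    unfolding energy_def using assms
    by (auto intro!: derivative_eq_intros R_deriv P_deriv sum.cong)
  moreover have "(\<Sum>x<n. (P (Suc x) t - P x t) * R (Suc x) t) =
    (\<Sum>x\<le>n. P x t * (R x t - R (Suc x) t)) + P n t * G t"
    using sum_by_parts_upper[of "\<lambda>x. P x t" "\<lambda>x. R x t" n] assms by (simp add: R_0 R_end)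
  moreover have "(\<Sum>x\<le>n. P x t * (P x t * 4)) = 4 * (\<Sum>x\<le>n. P x t * P x t)"
    by (simp add: sum_distrib_left mult_ac)
  ultimately show ?thesis
    by (elim DERIV_cong) (simp add: sum_distrib_left[symmetric] algebra_simps sum.distrib sum_subtractf power2_eq_square)
qed

text \<open>Half of the friction at the last site absorbs the work by completing the square, 2GP -
  2\<gamma>P^2 \<le> G^2/(2\<gamma>), which is the origin of the constant. The other half is kept on
  the left side, to control the last momentum in mean square over time.\<close>

lemma energy_bound:
  assumes "T \<ge> 0" "\<And>t. t \<ge> 0 \<Longrightarrow> \<bar>G t\<bar> \<le> B"
  shows "energy T + 2 * \<gamma> * integral {0..T} (\<lambda>s. (P n s)\<^sup>2) \<le> energy 0 + B\<^sup>2 / (2 * \<gamma>) * T"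
proof -
  let ?e' = "\<lambda>t. 2 * (G t * P n t) - 4 * \<gamma> * (\<Sum>x\<le>n. (P x t)\<^sup>2)"
  have c: "continuous_on {0..T} G" "\<And>x. x \<le> n \<Longrightarrow> continuous_on {0..T} (P x)"
    by (auto intro!: continuous_on_subset[OF G_cont] continuous_on_subset[OF P_cont])
  have "(?e' has_integral energy T - energy 0) {0..T}"
    using assms by (intro fundamental_theorem_of_calculus)
      (auto intro!: has_vector_derivative_within_subset[OF energy_deriv[unfolded has_real_derivative_iff_has_vector_derivative]])
  moreover have i2: "((\<lambda>s. (P n s)\<^sup>2) has_integral integral {0..T} (\<lambda>s. (P n s)\<^sup>2)) {0..T}"
    by (intro integrable_integral integrable_continuous_real continuous_intros c) auto
  ultimately have "((\<lambda>s. ?e' s + 2 * \<gamma> * (P n s)\<^sup>2) has_integral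
      energy T - energy 0 + 2 * \<gamma> * integral {0..T} (\<lambda>s. (P n s)\<^sup>2)) {0..T}"
    by (intro has_integral_add has_integral_mult_right)
  moreover have "((\<lambda>s. B\<^sup>2 / (2 * \<gamma>)) has_integral B\<^sup>2 / (2 * \<gamma>) * T) {0..T}"
    using has_integral_const_real[of "B\<^sup>2 / (2 * \<gamma>)" 0 T] assms(1) by (simp add: mult.commute)
  moreover have "?e' s + 2 * \<gamma> * (P n s)\<^sup>2 \<le> B\<^sup>2 / (2 * \<gamma>)" if "s \<in> {0..T}" for s
  proof -
    have "(P n s)\<^sup>2 \<le> (\<Sum>x\<le>n. (P x s)\<^sup>2)"
      by (intro member_le_sum) auto
    then have "?e' s + 2 * \<gamma> * (P n s)\<^sup>2 \<le> 2 * (G s * P n s) - 2 * \<gamma> * (P n s)\<^sup>2"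
      using damping_pos by (simp add: algebra_simps)
    also have "\<dots> = (G s)\<^sup>2 / (2 * \<gamma>) - (G s - 2 * \<gamma> * P n s)\<^sup>2 / (2 * \<gamma>)"
      using damping_pos by (simp add: field_simps power2_eq_square)
    also have "\<dots> \<le> (G s)\<^sup>2 / (2 * \<gamma>)" using damping_pos by simp
    also have "\<dots> \<le> B\<^sup>2 / (2 * \<gamma>)"
      using assms(2)[of s] that damping_pos by (intro divide_right_mono) (auto simp: abs_le_square_iff[symmetric])
    finally show ?thesis .
  qed
  ultimately have "energy T - energy 0 + 2 * \<gamma> * integral {0..T} (\<lambda>s. (P n s)\<^sup>2) \<le> B\<^sup>2 / (2 * \<gamma>) * T"
    by (rule has_integral_le)
  then show ?thesis by simp
qed

text \<open>The hypotheses say that (u, v) is an eigenvector of the adjoint dynamics with the value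
  -1 on the bond n+1. This inhomogeneous boundary value produces the boundary momentum in the
  derivative of exp (b s) times the pairing. It is used with an imaginary \<open>b\<close> for a
  harmonic and with \<open>b = 0\<close> for the constant force.\<close>

lemma boundary_work_identity:
  fixes u v :: "nat \<Rightarrow> 'a::{real_normed_field,banach}" and b :: 'a
  assumes "T \<ge> 0" "u 0 = 0"
    and v: "\<And>x. x < n \<Longrightarrow> u x - u (Suc x) = (of_real (2 * \<gamma>) - b) * v x"
    and v_end: "u n + 1 = (of_real (2 * \<gamma>) - b) * v n"
    and u: "\<And>x. x < n \<Longrightarrow> v (Suc x) - v x = b * u (Suc x)"
  shows "integral {0..T} (\<lambda>s. exp (b * of_real s) * of_real (P n s)) =
     v n * integral {0..T} (\<lambda>s. exp (b * of_real s) * of_real (G s)) - (exp (b * of_real T) * pairing u v T - pairing u v 0)"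
proof -
  \<comment> \<open>\<open>pairing_deriv\<close> asks for 0 at \<open>Suc n\<close>, whereas
    \<open>v_end\<close> treats that value as -1. Resetting it leaves the pairing unchanged, and the
    defect at the last site is the wanted term -P_n.\<close>
  define u' where "u' = u(Suc n := 0)"
  have pu: "pairing u' v = pairing u v"
    unfolding pairing_def u'_def by (auto intro!: ext sum.cong)
  have cG: "continuous_on {0..T} G" and cP: "continuous_on {0..T} (P n)"
    by (auto intro!: continuous_on_subset[OF G_cont] continuous_on_subset[OF P_cont])
  have d: "((\<lambda>s. exp (b * of_real s) * pairing u v s) has_vector_derivative
      v n * (exp (b * of_real t) * of_real (G t)) - exp (b * of_real t) * of_real (P n t)) (at t within {0..})" if t: "t \<ge> 0" for t
  proof -
    have e: "((\<lambda>s::real. exp (b * of_real s)) has_vector_derivative b * exp (b * of_real t)) (at t within {0..})"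
      by (rule has_vector_derivative_eq_rhs, rule has_vector_derivative_real_field)
        (auto intro!: derivative_eq_intros)
    let ?D = "(\<Sum>x\<le>n. P x t *\<^sub>R (u' x - u' (Suc x) - (2 * \<gamma>) *\<^sub>R v x))
      + (\<Sum>x<n. R (Suc x) t *\<^sub>R (v x - v (Suc x))) + G t *\<^sub>R v n"
    have D1: "(\<Sum>x\<le>n. P x t *\<^sub>R (u' x - u' (Suc x) - (2 * \<gamma>) *\<^sub>R v x)) =
       - b * (\<Sum>x\<le>n. P x t *\<^sub>R v x) - of_real (P n t)"
    proof -
      have "(\<Sum>x\<le>n. P x t *\<^sub>R (u' x - u' (Suc x) - (2 * \<gamma>) *\<^sub>R v x)) =
        (\<Sum>x\<le>n. P x t *\<^sub>R (- b * v x) - (if x = n then of_real (P n t) else 0))"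
      proof (intro sum.cong refl)
        fix x assume x: "x \<in> {..n}"
        show "P x t *\<^sub>R (u' x - u' (Suc x) - (2 * \<gamma>) *\<^sub>R v x) =
          P x t *\<^sub>R (- b * v x) - (if x = n then of_real (P n t) else 0)"
        proof (cases "x = n")
          case True
          then have "u' x - u' (Suc x) - (2 * \<gamma>) *\<^sub>R v x = - b * v x - 1"
            using v_end by (simp add: u'_def scaleR_conv_of_real algebra_simps)
          then show ?thesis using True by (simp only: scaleR_right_diff_distrib) (simp add: scaleR_conv_of_real)
        next
          case False
          then have "u' x - u' (Suc x) - (2 * \<gamma>) *\<^sub>R v x = - b * v x"
            using v[of x] x by (simp add: u'_def scaleR_conv_of_real algebra_simps)
          then show ?thesis using False by simp
        qed
      qed
      also have "\<dots> = - b * (\<Sum>x\<le>n. P x t *\<^sub>R v x) - of_real (P n t)"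
        by (simp add: sum_subtractf sum_distrib_left sum_negf scaleR_conv_of_real mult_ac)
      finally show ?thesis .
    qed
    have D2: "(\<Sum>x<n. R (Suc x) t *\<^sub>R (v x - v (Suc x))) = - b * (\<Sum>x<n. R (Suc x) t *\<^sub>R u (Suc x))"
      unfolding sum_distrib_left
    proof (intro sum.cong refl)
      fix x assume "x \<in> {..<n}"
      then have "v x - v (Suc x) = - b * u (Suc x)" using u[of x] by (simp add: algebra_simps)
      then show "R (Suc x) t *\<^sub>R (v x - v (Suc x)) = - b * R (Suc x) t *\<^sub>R u (Suc x)" by simp
    qed
    have D: "?D = - b * pairing u v t - of_real (P n t) + of_real (G t) * v n"
      unfolding D1 D2 by (simp add: pairing_def algebra_simps scaleR_conv_of_real)
    have "(pairing u' v has_vector_derivative ?D) (at t within {0..})"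
      using assms(2) t by (intro pairing_deriv) (auto simp: u'_def)
    from has_vector_derivative_mult[OF e this] show ?thesis
      unfolding D pu by (rule has_vector_derivative_eq_rhs) (simp add: algebra_simps)
  qed
  have "((\<lambda>s. v n * (exp (b * of_real s) * of_real (G s)) - exp (b * of_real s) * of_real (P n s)) has_integral
      exp (b * of_real T) * pairing u v T - exp (b * of_real 0) * pairing u v 0) {0..T}"
    using assms(1)
    by (intro fundamental_theorem_of_calculus[where f = "\<lambda>s. exp (b * of_real s) * pairing u v s"]
        has_vector_derivative_within_subset[OF d]) auto
  moreover have "((\<lambda>s. v n * (exp (b * of_real s) * of_real (G s)) - exp (b * of_real s) * of_real (P n s)) has_integral
      v n * integral {0..T} (\<lambda>s. exp (b * of_real s) * of_real (G s)) - integral {0..T} (\<lambda>s. exp (b * of_real s) * of_real (P n s))) {0..T}"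
    by (intro has_integral_diff has_integral_mult_right integrable_integral integrable_continuous_real continuous_intros cG cP)
  ultimately show ?thesis
    by (auto dest: has_integral_unique simp: algebra_simps)
qed

end

section \<open>Relaxation equations and Riemann sums\<close>

text \<open>With the integrating factor exp (\<kappa> s), the function f in the proof has a
  nonpositive derivative. One side is enough, because the estimate will be applied to both y and
  -y.\<close>

lemma relaxation_upper:
  fixes y y' :: "real \<Rightarrow> real"
  assumes "0 < \<kappa>" "0 \<le> t"
    and d: "\<And>s. 0 \<le> s \<Longrightarrow> (y has_real_derivative y' s) (at s within {0..})"
    and le: "\<And>s. \<lbrakk>0 \<le> s; s \<le> t\<rbrakk> \<Longrightarrow> y' s \<le> c - \<kappa> * y s"
  shows "y t \<le> exp (- \<kappa> * t) * y 0 + (1 - exp (- \<kappa> * t)) * (c / \<kappa>)"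
proof -
  define f where "f s = exp (\<kappa> * s) * (y s - c / \<kappa>)" for s
  have *: "(f has_real_derivative exp (\<kappa> * s) * (\<kappa> * y s - c + y' s)) (at s within {0..})" if "0 \<le> s" for s
  proof -
    have "(f has_real_derivative exp (\<kappa> * s) * (\<kappa> * 1) * (y s - c / \<kappa>) + (y' s - 0) * exp (\<kappa> * s)) (at s within {0..})"
      unfolding f_def
      by (intro DERIV_mult DERIV_diff DERIV_const d that) (auto intro!: derivative_eq_intros)
    then show ?thesis
      using assms(1) by (elim DERIV_cong) (simp add: algebra_simps)
  qed
  have fd: "(f has_derivative (\<lambda>h. h * (exp (\<kappa> * s) * (\<kappa> * y s - c + y' s)))) (at s within {0..t})" if "0 \<le> s" for s
    using has_derivative_subset[OF *[OF that, unfolded has_field_derivative_def], of "{0..t}"]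
    by (simp add: mult_commute_abs)
  from mvt_very_simple[OF assms(2) fd] obtain s where s: "0 \<le> s" "s \<le> t"
    "f t - f 0 = (t - 0) * (exp (\<kappa> * s) * (\<kappa> * y s - c + y' s))" by auto
  have "(t - 0) * (exp (\<kappa> * s) * (\<kappa> * y s - c + y' s)) \<le> 0"
    using le[OF s(1,2)] assms(2) by (intro mult_nonneg_nonpos) auto
  then have "f t \<le> f 0" using s(3) by simp
  then have "exp (- \<kappa> * t) * f t \<le> exp (- \<kappa> * t) * f 0"
    by (intro mult_left_mono) auto
  also have "f 0 = y 0 - c / \<kappa>"
    by (simp add: f_def)
  finally have "y t - c / \<kappa> \<le> exp (- \<kappa> * t) * (y 0 - c / \<kappa>)"
    by (simp add: f_def mult.assoc[symmetric] exp_add[symmetric])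
  then show ?thesis by (simp add: right_diff_distrib left_diff_distrib diff_divide_distrib)
qed

lemma relaxation_bound:
  fixes y e :: "real \<Rightarrow> real"
  assumes "0 < \<kappa>" "0 \<le> t"
    and d: "\<And>s. 0 \<le> s \<Longrightarrow> (y has_real_derivative c + e s - \<kappa> * y s) (at s within {0..})"
    and e: "\<And>s. \<lbrakk>0 \<le> s; s \<le> t\<rbrakk> \<Longrightarrow> \<bar>e s\<bar> \<le> \<epsilon>"
  shows "\<bar>y t - (exp (- \<kappa> * t) * y 0 + (1 - exp (- \<kappa> * t)) * (c / \<kappa>))\<bar> \<le> \<epsilon> / \<kappa>"
proof -
  have "\<epsilon> \<ge> 0" using e[of 0] assms by force
  have E: "(1 - exp (- \<kappa> * t)) * (\<epsilon> / \<kappa>) \<le> 1 * (\<epsilon> / \<kappa>)"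
    using assms \<open>\<epsilon> \<ge> 0\<close> by (intro mult_right_mono) auto
  have "y t \<le> exp (- \<kappa> * t) * y 0 + (1 - exp (- \<kappa> * t)) * ((c + \<epsilon>) / \<kappa>)"
    using e by (intro relaxation_upper[OF assms(1,2) d]) (auto simp: abs_le_iff)
  moreover have "- y t \<le> exp (- \<kappa> * t) * - y 0 + (1 - exp (- \<kappa> * t)) * ((- c + \<epsilon>) / \<kappa>)"
  proof (rule relaxation_upper[where y = "\<lambda>s. - y s", OF assms(1,2)])
    show "((\<lambda>s. - y s) has_real_derivative - (c + e s - \<kappa> * y s)) (at s within {0..})" if "0 \<le> s" for s
      using that by (intro derivative_intros d)
    show "- (c + e s - \<kappa> * y s) \<le> - c + \<epsilon> - \<kappa> * - y s" if "0 \<le> s" "s \<le> t" for s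
      using e[OF that] by (auto simp: abs_le_iff)
  qed
  moreover have "\<bar>z - (q + a)\<bar> \<le> e" if "z \<le> q + (a + b)" "- z \<le> - q + (- a + b)" "b \<le> 1 * e" for z q a b e :: real
    using that by linarith
  ultimately show ?thesis
    using E by (simp only: add_divide_distrib distrib_left minus_divide_left[symmetric] mult_minus_right)
qed

lemma integral_equal_pieces:
  fixes f :: "real \<Rightarrow> real"
  assumes "continuous_on {0..1} f" "n > 0" "m \<le> n"
  shows "integral {0..real m / real n} f = (\<Sum>x<m. integral {real x / real n..real (Suc x) / real n} f)"
  using assms(3)
proof (induction m)
  case (Suc m)
  have le: "0 \<le> real m / real n" "real m / real n \<le> real (Suc m) / real n"
    by (simp_all add: divide_right_mono)
  have bd: "real (Suc m) / real n \<le> 1"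
    using Suc.prems assms(2) by (simp add: divide_le_eq)
  have "integral {0..real m / real n} f + integral {real m / real n..real (Suc m) / real n} f = integral {0..real (Suc m) / real n} f"
    using le bd by (intro Henstock_Kurzweil_Integration.integral_combine integrable_continuous_real
        continuous_on_subset[OF assms(1)]) auto
  with Suc show ?case by simp
qed simp

text \<open>Two tags per cell are needed because the initial profile is compared at x/n while the
  chain modes are sampled at x/(n+1). Uniform continuity on the square makes the difference
  harmless.\<close>

lemma tagged_riemann_sum:
  fixes h :: "real \<times> real \<Rightarrow> real" and \<xi> \<eta> :: "nat \<Rightarrow> nat \<Rightarrow> real"
  assumes h: "continuous_on ({0..1} \<times> {0..1}) h"
    and tags: "\<And>n x. x < n \<Longrightarrow> \<xi> n x \<in> {real x / real n..real (Suc x) / real n}" "\<And>n x. x < n \<Longrightarrow> \<eta> n x \<in> {real x / real n..real (Suc x) / real n}"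
  shows "(\<lambda>n. 1 / real n * (\<Sum>x<n. h (\<xi> n x, \<eta> n x))) \<longlonglongrightarrow> integral {0..1} (\<lambda>u. h (u, u))"
proof (rule LIMSEQ_I)
  fix e :: real assume "e > 0"
  have "uniformly_continuous_on ({0..1} \<times> {0..1}) h"
    by (intro compact_uniformly_continuous h compact_Times) auto
  then obtain d where d: "d > 0" "\<And>a b. \<lbrakk>a \<in> {0..1} \<times> {0..1}; b \<in> {0..1} \<times> {0..1}; dist b a < d\<rbrakk>
      \<Longrightarrow> dist (h b) (h a) < e / 2"
    using \<open>e > 0\<close> unfolding uniformly_continuous_on_def by (meson half_gt_zero)
  \<comment> \<open>Each of the two tags is within 1/n of a point u of the cell, so the pair is
    within 2/n of (u, u).\<close>
  obtain n0 :: nat where n0: "n0 > 2 / d" using reals_Archimedean2 by blast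
  have hc: "continuous_on {0..1} (\<lambda>u. h (u, u))"
    by (rule continuous_on_compose2[OF h]) (auto intro!: continuous_intros)
  show "\<exists>n0. \<forall>n\<ge>n0. norm (1 / real n * (\<Sum>x<n. h (\<xi> n x, \<eta> n x)) - integral {0..1} (\<lambda>u. h (u, u))) < e"
  proof (intro exI[of _ "Suc n0"] allI impI)
    fix n assume n: "Suc n0 \<le> n"
    have npos: "n > 0" using n by simp
    have n2: "2 / real n < d"
    proof -
      have "2 / d < real n" using n n0 by linarith
      then show ?thesis using d(1) npos by (simp add: field_simps)
    qed
    have piece: "\<bar>1 / real n * h (\<xi> n x, \<eta> n x) - integral {real x / real n..real (Suc x) / real n} (\<lambda>u. h (u, u))\<bar> \<le> e / 2 * (1 / real n)"
      if x: "x < n" for x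
    proof -
      have sub: "{real x / real n..real (Suc x) / real n} \<subseteq> {0..1}" using x by (auto simp: field_simps)
      have len: "real (Suc x) / real n - real x / real n = 1 / n" by (simp add: diff_divide_distrib[symmetric])
      have le: "real x / real n \<le> real (Suc x) / real n" by (simp add: divide_right_mono)
      have i: "(\<lambda>u. h (u, u)) integrable_on {real x / real n..real (Suc x) / real n}"
        by (intro integrable_continuous_real continuous_on_subset[OF hc] sub)
      have "((\<lambda>u. h (\<xi> n x, \<eta> n x) - h (u, u)) has_integral
          1 / real n * h (\<xi> n x, \<eta> n x) - integral {real x / real n..real (Suc x) / real n} (\<lambda>u. h (u, u))) {real x / real n..real (Suc x) / real n}"
        using has_integral_const_real[of "h (\<xi> n x, \<eta> n x)" "real x / real n" "real (Suc x) / real n"]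
        unfolding content_real[OF le] len by (intro has_integral_diff integrable_integral i) simp
      moreover have "norm (h (\<xi> n x, \<eta> n x) - h (u, u)) \<le> e / 2" if u: "u \<in> {real x / real n..real (Suc x) / real n}" for u
      proof -
        have "dist (\<xi> n x, \<eta> n x) (u, u) \<le> dist (\<xi> n x) u + dist (\<eta> n x) u"
          by (simp add: dist_Pair_Pair sqrt_sum_squares_le_sum)
        also have "\<dots> \<le> 2 / real n"
          using tags[OF x] u len by (auto simp: dist_real_def)
        finally have dle: "dist (\<xi> n x, \<eta> n x) (u, u) \<le> 2 / real n" .
        have "dist (h (\<xi> n x, \<eta> n x)) (h (u, u)) < e / 2"
        proof (intro d(2))
          show "dist (\<xi> n x, \<eta> n x) (u, u) < d" using n2 dle by linarith
        qed (use subsetD[OF sub tags(1)[OF x]] subsetD[OF sub tags(2)[OF x]] subsetD[OF sub u] in auto)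
        then show ?thesis by (simp add: dist_norm)
      qed
      ultimately have "norm (1 / real n * h (\<xi> n x, \<eta> n x) - integral {real x / real n..real (Suc x) / real n} (\<lambda>u. h (u, u))) \<le> e / 2 * measure lborel (cbox (real x / real n) (real (Suc x) / real n))"
        using \<open>e > 0\<close> by (intro has_integral_bound[where f = "\<lambda>u. h (\<xi> n x, \<eta> n x) - h (u, u)"]) auto
      then show ?thesis by (simp only: cbox_interval content_real[OF le] len real_norm_def)
    qed
    have "1 / real n * (\<Sum>x<n. h (\<xi> n x, \<eta> n x)) - integral {0..1} (\<lambda>u. h (u, u)) =
       (\<Sum>x<n. 1 / real n * h (\<xi> n x, \<eta> n x) - integral {real x / real n..real (Suc x) / real n} (\<lambda>u. h (u, u)))"
      using integral_equal_pieces[OF hc npos order_refl] npos by (simp add: sum_subtractf sum_distrib_left)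
    also have "\<bar>\<dots>\<bar> \<le> (\<Sum>x<n. e / 2 * (1 / real n))"
      by (rule order_trans[OF sum_abs], rule sum_mono, rule piece) simp
    also have "(\<Sum>x<n. e / 2 * (1 / real n)) < e" using npos \<open>e > 0\<close> by simp
    finally show "norm (1 / real n * (\<Sum>x<n. h (\<xi> n x, \<eta> n x)) - integral {0..1} (\<lambda>u. h (u, u))) < e" by simp
  qed
qed

section \<open>Sine series on the unit interval\<close>

text \<open>The Dirichlet eigenfunctions; the shift to \<open>Suc k\<close> leaves out the zero
  function. They have square integral 1/2, whence the factors 2 in all expansions below.\<close>

definition sine :: "nat \<Rightarrow> real \<Rightarrow> real" where
  "sine k u = sin (Suc k * pi * u)"

lemma continuous_on_sine [continuous_intros]:
  fixes f :: "'a::t2_space \<Rightarrow> real"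
  shows "continuous_on A f \<Longrightarrow> continuous_on A (\<lambda>x. sine k (f x))"
  unfolding sine_def by (intro continuous_intros)

lemma has_integral_cos_pi:
  fixes m :: int assumes "m \<noteq> 0"
  shows "((\<lambda>u. cos (m * pi * u)) has_integral 0) {0..1}"
proof -
  have "((\<lambda>u. cos (m * pi * u)) has_integral sin (m * pi * 1) / (m * pi) - sin (m * pi * 0) / (m * pi)) {0..1}"
    using assms by (intro fundamental_theorem_of_calculus)
     (auto intro!: derivative_eq_intros simp: has_real_derivative_iff_has_vector_derivative[symmetric])
  then show ?thesis by (simp add: mult.commute[of _ pi])
qed

lemma sine_orthogonal:
  "((\<lambda>u. sine j u * sine k u) has_integral (if j = k then 1 / 2 else 0)) {0..1}"
proof -
  have eq: "sine j u * sine k u = (cos ((int j - int k) * pi * u) - cos ((int j + int k + 2) * pi * u)) / 2" for u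
    by (simp add: sine_def sin_times_sin algebra_simps)
  show ?thesis
  proof (cases "j = k")
    case True
    have "((\<lambda>u. (1 - cos ((int j + int k + 2) * pi * u)) / 2) has_integral (1 - 0) / 2) {0..1}"
      using has_integral_const_real[of "1::real" 0 1]
      by (intro has_integral_divide has_integral_diff has_integral_cos_pi) auto
    then show ?thesis unfolding eq using True by simp
  next
    case False
    have "((\<lambda>u. (cos ((int j - int k) * pi * u) - cos ((int j + int k + 2) * pi * u)) / 2) has_integral (0 - 0) / 2) {0..1}"
      using False by (intro has_integral_divide has_integral_diff has_integral_cos_pi) auto
    then show ?thesis unfolding eq using False by simp
  qed
qed

lemma identity_sine_coeff:
  "((\<lambda>u. u * sine k u) has_integral (- 1) ^ k / (Suc k * pi)) {0..1}"
proof -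
  let ?c = "Suc k * pi"
  let ?f = "\<lambda>u. sin (?c * u) / ?c\<^sup>2 - u * cos (?c * u) / ?c"
  have "((\<lambda>u. u * sine k u) has_integral ?f 1 - ?f 0) {0..1}"
  proof (intro fundamental_theorem_of_calculus)
    fix u :: real assume "u \<in> {0..1}"
    have "(?f has_real_derivative u * sine k u) (at u within {0..1})"
      by (auto intro!: derivative_eq_intros simp: sine_def power2_eq_square diff_divide_distrib simp del: of_nat_Suc)
    then show "(?f has_vector_derivative u * sine k u) (at u within {0..1})"
      by (simp add: has_real_derivative_iff_has_vector_derivative)
  qed simp
  moreover have "cos ?c = (-1) ^ Suc k" "sin ?c = 0"
    using cos_npi[of "Suc k"] sin_npi[of "Suc k"] by (simp_all del: of_nat_Suc)
  ultimately show ?thesis by simp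
qed

text \<open>Adding the mode K with coefficient 2 c_K changes the squared error by -4 c_K^2 + 4
  c_K^2/2 = -2 c_K^2, because by orthogonality the current remainder still has K-th coefficient
  c_K.\<close>

lemma sine_expansion_error:
  assumes h: "continuous_on {0..1} h"
    and c: "\<And>k. ((\<lambda>u. h u * sine k u) has_integral c k) {0..1}"
  shows "((\<lambda>u. (h u - (\<Sum>k<K. 2 * c k * sine k u))\<^sup>2) has_integral
    integral {0..1} (\<lambda>u. (h u)\<^sup>2) - 2 * (\<Sum>k<K. (c k)\<^sup>2)) {0..1}"
proof (induction K)
  case 0
  show ?case using h by (auto intro!: integrable_integral integrable_continuous_real continuous_intros)
next
  case (Suc K)
  let ?g = "\<lambda>u. h u - (\<Sum>k<K. 2 * c k * sine k u)"
  have gK: "((\<lambda>u. ?g u * sine K u) has_integral c K) {0..1}"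
  proof -
    have "((\<lambda>u. h u * sine K u - (\<Sum>k<K. 2 * c k * (sine k u * sine K u))) has_integral
       c K - (\<Sum>k<K. 2 * c k * (if k = K then 1 / 2 else 0))) {0..1}"
      by (intro has_integral_diff has_integral_sum has_integral_mult_right c sine_orthogonal) auto
    then show ?thesis by (simp add: left_diff_distrib sum_distrib_right mult.assoc)
  qed
  have "((\<lambda>u. (?g u)\<^sup>2 - 4 * c K * (?g u * sine K u) + 4 * (c K)\<^sup>2 * (sine K u * sine K u)) has_integral
    integral {0..1} (\<lambda>u. (h u)\<^sup>2) - 2 * (\<Sum>k<K. (c k)\<^sup>2) - 4 * c K * c K + 4 * (c K)\<^sup>2 * (if K = K then 1 / 2 else 0)) {0..1}"
    by (intro has_integral_add has_integral_diff has_integral_mult_right gK Suc sine_orthogonal)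
  moreover have "(?g u)\<^sup>2 - 4 * c K * (?g u * sine K u) + 4 * (c K)\<^sup>2 * (sine K u * sine K u) =
     (h u - (\<Sum>k<Suc K. 2 * c k * sine k u))\<^sup>2" for u
    by (simp add: power2_eq_square algebra_simps)
  ultimately show ?case by (simp add: power2_eq_square diff_diff_eq)
qed

lemma sine_bessel:
  assumes h: "continuous_on {0..1} h"
    and c: "\<And>k. ((\<lambda>u. h u * sine k u) has_integral c k) {0..1}"
  shows "summable (\<lambda>k. (c k)\<^sup>2)"
proof (rule summableI_nonneg_bounded[where x = "integral {0..1} (\<lambda>u. (h u)\<^sup>2) / 2"])
  fix K
  have "0 \<le> integral {0..1} (\<lambda>u. (h u)\<^sup>2) - 2 * (\<Sum>k<K. (c k)\<^sup>2)"
    by (rule has_integral_nonneg[OF sine_expansion_error[OF h c]]) auto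
  then show "(\<Sum>k<K. (c k)\<^sup>2) \<le> integral {0..1} (\<lambda>u. (h u)\<^sup>2) / 2" by simp
qed auto

text \<open>For this one function the completeness is a numerical identity: by the Basel sum the
  modes contribute 2/pi^2 * pi^2/6 = 1/3, which is the integral of u^2.\<close>

lemma identity_sine_expansion:
  "(\<lambda>K. integral {0..1} (\<lambda>u. (u - (\<Sum>k<K. 2 * ((- 1) ^ k / (Suc k * pi)) * sine k u))\<^sup>2)) \<longlonglongrightarrow> 0"
proof -
  have "((\<lambda>u::real. u\<^sup>2) has_integral 1 ^ 3 / 3 - 0 ^ 3 / 3) {0..1}"
    by (intro fundamental_theorem_of_calculus)
      (auto intro!: derivative_eq_intros simp: has_real_derivative_iff_has_vector_derivative[symmetric])
  then have u2: "integral {0..1} (\<lambda>u::real. u\<^sup>2) = 1 / 3" by (simp add: integral_unique)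
  have basel: "(\<lambda>K. \<Sum>k<K. 1 / (real k + 1)\<^sup>2) \<longlonglongrightarrow> pi\<^sup>2 / 6"
    using inverse_squares_sums by (simp add: sums_def add.commute)
  have sq: "((- 1) ^ k)\<^sup>2 = (1::real)" for k :: nat
    by (simp add: power_mult[symmetric] mult.commute[of _ 2])
  have "integral {0..1} (\<lambda>u. (u - (\<Sum>k<K. 2 * ((- 1) ^ k / (Suc k * pi)) * sine k u))\<^sup>2) =
     1 / 3 - 2 * (\<Sum>k<K. ((- 1) ^ k / (Suc k * pi))\<^sup>2)" for K
    using integral_unique[OF sine_expansion_error[OF continuous_on_id identity_sine_coeff]] u2 by (simp add: id_def)
  also have "\<dots> K = 1 / 3 - 2 * (1 / pi\<^sup>2 * (\<Sum>k<K. 1 / (real k + 1)\<^sup>2))" for K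
    using sq by (simp add: sum_distrib_left power_divide power_mult_distrib mult.commute add.commute)
  finally have "(\<lambda>K. integral {0..1} (\<lambda>u. (u - (\<Sum>k<K. 2 * ((- 1) ^ k / (Suc k * pi)) * sine k u))\<^sup>2)) =
     (\<lambda>K. 1 / 3 - 2 * (1 / pi\<^sup>2 * (\<Sum>k<K. 1 / (real k + 1)\<^sup>2)))" by simp
  moreover have "(\<lambda>K. 1 / 3 - 2 * (1 / pi\<^sup>2 * (\<Sum>k<K. 1 / (real k + 1)\<^sup>2))) \<longlonglongrightarrow> 1 / 3 - 2 * (1 / pi\<^sup>2 * (pi\<^sup>2 / 6))"
    by (intro tendsto_intros basel)
  ultimately show ?thesis by simp
qed

text \<open>The product of h with sin (pi u) is orthogonal to every polynomial in cos (pi u), and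
  polynomials in cos (pi u) are uniformly dense by the Weierstrass theorem. Hence h sin (pi u)
  vanishes, and so does h, first inside the interval and then at the ends by continuity.\<close>

lemma sine_complete:
  assumes h: "continuous_on {0..1} h"
    and c: "\<And>k. ((\<lambda>u. h u * sine k u) has_integral 0) {0..1}"
    and u: "u \<in> {0..1}"
  shows "h u = 0"
proof -
  \<comment> \<open>sin ((k+1)x) cos x is half the sum of the two neighbouring modes. For k = 0 the
    lower neighbour is sin 0, which is why that case is set to 0 instead of using k - 1.\<close>
  have cospow: "((\<lambda>u. h u * sine k u * cos (pi * u) ^ m) has_integral 0) {0..1}" for k m
  proof (induction m arbitrary: k)
    case (Suc m)
    have "((\<lambda>u. 1 / 2 * (h u * sine (Suc k) u * cos (pi * u) ^ m) +
        1 / 2 * (if k = 0 then 0 else h u * sine (k - 1) u * cos (pi * u) ^ m)) has_integral 1 / 2 * 0 + 1 / 2 * 0) {0..1}"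
      using Suc.IH[of "k - 1"] by (intro has_integral_add has_integral_mult_right Suc.IH) (cases "k = 0", auto)
    moreover have "1 / 2 * sine (Suc k) u + 1 / 2 * (if k = 0 then 0 else sine (k - 1) u) = sine k u * cos (pi * u)" for u
    proof -
      have "sine (Suc k) u = sin (Suc k * pi * u + pi * u)"
        by (simp add: sine_def algebra_simps)
      moreover have "(if k = 0 then 0 else sine (k - 1) u) = sin (Suc k * pi * u - pi * u)"
        by (cases k) (simp_all add: sine_def algebra_simps)
      ultimately show ?thesis by (simp only: sin_add sin_diff sine_def[of k]) (simp add: add_divide_distrib[symmetric])
    qed
    then have "h u * cos (pi * u) ^ m * (sine k u * cos (pi * u)) = 1 / 2 * (h u * sine (Suc k) u * cos (pi * u) ^ m) +
        1 / 2 * (if k = 0 then 0 else h u * sine (k - 1) u * cos (pi * u) ^ m)" for u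
      by (simp only: eq_commute[of _ "sine k _ * _"]) (simp add: algebra_simps)
    ultimately have "((\<lambda>u. h u * cos (pi * u) ^ m * (sine k u * cos (pi * u))) has_integral 0) {0..1}" by simp
    then show ?case by (simp add: mult_ac)
  qed (use c in simp)
  \<comment> \<open>h sin (pi u) rewritten as a continuous function of v = cos (pi u), so that
    polynomials in v can approximate it.\<close>
  define f where "f v = h (arccos v / pi) * sin (arccos v)" for v
  have fc: "continuous_on {-1..1} f"
    unfolding f_def
    by (intro continuous_intros continuous_on_compose2[OF h] continuous_on_arccos')
       (auto simp: arccos_lbound arccos_ubound divide_le_eq)
  let ?H = "\<lambda>u. h u * sin (pi * u)"
  have fH: "f (cos (pi * u)) = ?H u" if "u \<in> {0..1}" for u
    using that by (simp add: f_def arccos_cos)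
  have Hc: "continuous_on {0..1} ?H" by (intro continuous_intros h)
  have int0: "integral {0..1} (\<lambda>u. (?H u)\<^sup>2) \<le> e * integral {0..1} (\<lambda>u. \<bar>?H u\<bar>)" if "e > 0" for e
  proof -
    obtain g where g: "real_polynomial_function g" "\<And>x. x \<in> {-1..1} \<Longrightarrow> \<bar>f x - g x\<bar> < e"
      using Stone_Weierstrass_real_polynomial_function[OF _ fc \<open>e > 0\<close>] by auto
    obtain a N where ga: "g = (\<lambda>x. \<Sum>i\<le>N. a i * x ^ i)"
      using g(1) unfolding real_polynomial_function_iff_sum by blast
    have "((\<lambda>u. \<Sum>i\<le>N. a i * (h u * sine 0 u * cos (pi * u) ^ i)) has_integral (\<Sum>i\<le>N. a i * 0)) {0..1}"
      by (intro has_integral_sum has_integral_mult_right cospow) auto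
    then have z: "((\<lambda>u. ?H u * g (cos (pi * u))) has_integral 0) {0..1}"
      by (simp add: ga sine_def sum_distrib_left mult_ac)
    have "((\<lambda>u. (?H u)\<^sup>2 - ?H u * g (cos (pi * u))) has_integral integral {0..1} (\<lambda>u. (?H u)\<^sup>2) - 0) {0..1}"
      by (intro has_integral_diff z integrable_integral integrable_continuous_real continuous_intros h)
    moreover have "((\<lambda>u. e * \<bar>?H u\<bar>) has_integral e * integral {0..1} (\<lambda>u. \<bar>?H u\<bar>)) {0..1}"
      by (intro has_integral_mult_right integrable_integral integrable_continuous_real continuous_intros h)
    moreover have "(?H u)\<^sup>2 - ?H u * g (cos (pi * u)) \<le> e * \<bar>?H u\<bar>" if "u \<in> {0..1}" for u
    proof -
      have "(?H u)\<^sup>2 - ?H u * g (cos (pi * u)) = ?H u * (f (cos (pi * u)) - g (cos (pi * u)))"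
        by (simp add: fH[OF that] power2_eq_square right_diff_distrib)
      also have "\<dots> \<le> \<bar>?H u\<bar> * \<bar>f (cos (pi * u)) - g (cos (pi * u))\<bar>" by (metis abs_ge_self abs_mult)
      also have "\<dots> \<le> \<bar>?H u\<bar> * e"
        using g(2)[of "cos (pi * u)"] by (intro mult_left_mono) auto
      finally show ?thesis by (simp add: mult.commute)
    qed
    ultimately show ?thesis by (auto dest: has_integral_le)
  qed
  have "integral {0..1} (\<lambda>u. (?H u)\<^sup>2) \<le> 0"
  proof (rule ccontr)
    assume neg: "\<not> ?thesis"
    let ?A = "integral {0..1} (\<lambda>u. (?H u)\<^sup>2)" and ?B = "integral {0..1} (\<lambda>u. \<bar>?H u\<bar>)"
    have B: "?B \<ge> 0" by (intro integral_nonneg integrable_continuous_real continuous_intros h) auto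
    \<comment> \<open>If A were positive, the accuracy A/(B+1) would give A (B+1) \<le> A B. Adding
      1 avoids a case distinction on B = 0.\<close>
    have "?A \<le> ?A / (?B + 1) * ?B" using neg B by (intro int0) auto
    then have "?A * (?B + 1) \<le> ?A * ?B" using B by (simp add: field_simps)
    then show False using neg by (simp add: algebra_simps)
  qed
  moreover have "integral {0..1} (\<lambda>u. (?H u)\<^sup>2) \<ge> 0"
    by (intro integral_nonneg integrable_continuous_real continuous_intros h) auto
  ultimately have "integral {0..1} (\<lambda>u. (?H u)\<^sup>2) = 0" by linarith
  moreover have "((\<lambda>u. (?H u)\<^sup>2) has_integral integral {0..1} (\<lambda>u. (?H u)\<^sup>2)) {0..1}"
    by (intro integrable_integral integrable_continuous_real continuous_on_power Hc)
  ultimately have "((\<lambda>u. (?H u)\<^sup>2) has_integral 0) {0..1}" by (simp only:)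
  then have H0: "?H u = 0" if "u \<in> {0..1}" for u
  proof -
    have "(?H u)\<^sup>2 = 0"
    proof (rule has_integral_0_cbox_imp_0[where a = 0 and b = 1 and f = "\<lambda>u. (?H u)\<^sup>2", unfolded cbox_interval box_real])
      show "{0<..<1::real} \<noteq> {}" by simp
      show "continuous_on {0..1} (\<lambda>u. (?H u)\<^sup>2)" by (rule continuous_on_power[OF Hc])
      show "((\<lambda>u. (?H u)\<^sup>2) has_integral 0) {0..1}" by fact
      show "u \<in> {0..1}" by fact
    qed simp
    then show ?thesis by simp
  qed
  have inner: "h v = 0" if "v \<in> {0<..<1}" for v
  proof -
    have "sin (pi * v) > 0" using that by (intro sin_gt_zero) auto
    moreover have "v \<in> {0..1}" using that by simp
    ultimately show ?thesis using H0[of v] by (metis less_irrefl mult_eq_0_iff)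
  qed
  have cl: "closure {0<..<1::real} = {0..1}" by simp
  show ?thesis
    by (rule continuous_constant_on_closure[of "{0<..<1}" h 0, unfolded cl, OF h inner u])
qed

section \<open>The stretch equation: sine coefficients, slope and flux at the right end\<close>

lemma integral_at_0_deriv:
  fixes g :: "real \<Rightarrow> real"
  assumes "continuous_on {0..} g" "0 \<le> s"
  shows "((\<lambda>x. integral {0..x} g) has_real_derivative g s) (at s within {0..})"
proof -
  have "at s within {0..} = at s within {0..s + 1}"
    by (rule at_within_nhd[of s "{..<s + 1}"]) auto
  moreover have "((\<lambda>x. integral {0..x} g) has_real_derivative g s) (at s within {0..s + 1})"
    using assms by (intro integral_has_real_derivative) (auto elim!: continuous_on_subset)
  ultimately show ?thesis by simp
qed

lemma lbint_eq_integral: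
  fixes f :: "real \<Rightarrow> real"
  assumes "continuous_on {a..b} f"
  shows "(LBINT u:{a..b}. f u) = integral {a..b} f"
  by (rule set_borel_integral_eq_integral(2)[OF borel_integrable_atLeastAtMost'[OF assms]])

text \<open>An identity between differences of measures, stated with sums on both sides. In this
  form the induction over nonnegative functions never subtracts extended reals.\<close>

lemma nn_integral_sum_measures:
  assumes sets: "sets M2 = sets M1" "sets M3 = sets M1" "sets M4 = sets M1"
    and eq: "\<And>A. A \<in> sets M1 \<Longrightarrow> emeasure M1 A + emeasure M2 A = emeasure M3 A + emeasure M4 A"
    and f: "f \<in> borel_measurable M1"
  shows "(\<integral>\<^sup>+x. f x \<partial>M1) + (\<integral>\<^sup>+x. f x \<partial>M2) = (\<integral>\<^sup>+x. f x \<partial>M3) + (\<integral>\<^sup>+x. f x \<partial>M4)"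
  using f
proof (induction rule: borel_measurable_induct)
  case (cong f g)
  have "space M2 = space M1" "space M3 = space M1" "space M4 = space M1"
    using sets by (auto dest: sets_eq_imp_space_eq)
  then have "(\<integral>\<^sup>+x. f x \<partial>M') = (\<integral>\<^sup>+x. g x \<partial>M')" if "M' \<in> {M1, M2, M3, M4}" for M'
    using that cong by (intro nn_integral_cong) auto
  then show ?case using cong by simp
next
  case (set A)
  then show ?case using eq[of A] sets by (simp)
next
  case (mult u c)
  note [measurable_cong] = sets
  have "u \<in> borel_measurable M2" "u \<in> borel_measurable M3" "u \<in> borel_measurable M4"
    using mult(2) by (simp_all add: measurable_cong_sets[OF sets(1) refl] measurable_cong_sets[OF sets(2) refl] measurable_cong_sets[OF sets(3) refl])
  then show ?case using mult by (simp add: nn_integral_cmult distrib_left[symmetric])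
next
  case (add u v)
  have "u \<in> borel_measurable M2" "u \<in> borel_measurable M3" "u \<in> borel_measurable M4"
     "v \<in> borel_measurable M2" "v \<in> borel_measurable M3" "v \<in> borel_measurable M4"
    using add by (simp_all add: measurable_cong_sets[OF sets(1) refl] measurable_cong_sets[OF sets(2) refl] measurable_cong_sets[OF sets(3) refl])
  moreover have r: "(a + b) + (c + d) = (a + c) + (b + d)" for a b c d :: ennreal by (simp add: ac_simps)
  have "integral\<^sup>N M1 v + integral\<^sup>N M1 u + (integral\<^sup>N M2 v + integral\<^sup>N M2 u) =
    integral\<^sup>N M3 v + integral\<^sup>N M3 u + (integral\<^sup>N M4 v + integral\<^sup>N M4 u)"
    using add by (subst (1 2) r) simp
  ultimately show ?case using add by (simp add: nn_integral_add)
next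
  case (seq U)
  have m: "U i \<in> borel_measurable M2" "U i \<in> borel_measurable M3" "U i \<in> borel_measurable M4" for i
    using seq(1) by (simp_all add: measurable_cong_sets[OF sets(1) refl] measurable_cong_sets[OF sets(2) refl] measurable_cong_sets[OF sets(3) refl])
  have i: "incseq (\<lambda>i. \<integral>\<^sup>+x. U i x \<partial>M')" for M'
    using seq(3) by (auto simp: incseq_def le_fun_def intro!: nn_integral_mono)
  have S: "(Sup (range U)) = (\<lambda>x. SUP i. U i x)" by (auto simp: SUP_apply[abs_def] image_image)
  have c: "(\<integral>\<^sup>+x. (SUP i. U i x) \<partial>M') = (SUP i. \<integral>\<^sup>+x. U i x \<partial>M')" if "\<And>i. U i \<in> borel_measurable M'" for M'
    using seq(3) that by (intro nn_integral_monotone_convergence_SUP) auto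
  show ?case
    by (simp add: S c seq(1) m ennreal_SUP_add[OF i i, symmetric] seq)
qed

text \<open>With \<rho> = h - g split into positive and negative parts, the identity of set
  functions becomes M1 + g = M3 + h between finite positive measures, to which
  \<open>nn_integral_sum_measures\<close> applies.\<close>

lemma signed_integral_density:
  assumes R: "fin_signed R"
    and \<rho>: "continuous_on {0..1} \<rho>"
    and eq: "\<And>A. \<lbrakk>A \<in> sets borel; A \<subseteq> {0..1}\<rbrakk> \<Longrightarrow> signed_measure R A = (LBINT u:A. \<rho> u)"
    and \<phi>: "continuous_on {0..1} \<phi>"
  shows "signed_integral R \<phi> = integral {0..1} (\<lambda>u. \<phi> u * \<rho> u)"
proof -
  obtain M1 M3 where RM: "R = (M1, M3)" by (cases R)
  interpret M1: finite_measure M1 using R by (simp add: RM fin_signed_def)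
  interpret M3: finite_measure M3 using R by (simp add: RM fin_signed_def)
  define L where "L = restrict_space lborel {0..1::real}"
  have sM1: "sets M1 = sets L" and sM3: "sets M3 = sets L"
    using R by (simp_all add: RM fin_signed_def L_def sets_restrict_space)
  have spL: "space L = {0..1}" by (simp add: L_def space_restrict_space)
  have sp: "space M1 = {0..1}" "space M3 = {0..1}"
    using sM1 sM3 spL by (auto dest: sets_eq_imp_space_eq)
  have mL: "f \<in> borel_measurable L" if "continuous_on {0..1} f" for f :: "real \<Rightarrow> real"
    using borel_measurable_continuous_on_restrict[OF that]
    by (simp add: L_def measurable_cong_sets[OF sets_restrict_space_cong[OF sets_lborel] refl])
  \<comment> \<open>The measure identity yields integrals of nonnegative functions only. It is
    applied to \<phi> + C and to the constant C, and the two results are subtracted.\<close>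
  obtain C where C: "C > 0" "\<And>u. u \<in> {0..1} \<Longrightarrow> \<bar>\<phi> u\<bar> \<le> C"
    using compact_imp_bounded[OF compact_continuous_image[OF \<phi> compact_Icc]]
    unfolding bounded_pos by auto
  have lint: "integrable L f" "integral\<^sup>L L f = integral {0..1} f" if "continuous_on {0..1} f" for f :: "real \<Rightarrow> real"
    using borel_integrable_atLeastAtMost'[OF that] lbint_eq_integral[OF that]
    by (simp_all add: L_def integrable_restrict_space integral_restrict_space set_integrable_def set_lebesgue_integral_def)
  define h where "h u = max 0 (\<rho> u)" for u
  define g where "g u = max 0 (- \<rho> u)" for u
  have hg: "continuous_on {0..1} h" "continuous_on {0..1} g" "\<And>u. 0 \<le> h u" "\<And>u. 0 \<le> g u" "\<And>u. \<rho> u = h u - g u"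
    unfolding h_def g_def by (auto intro!: continuous_intros \<rho>)
  note [measurable] = mL[OF hg(1)] mL[OF hg(2)]
  let ?D = "\<lambda>k. density L (\<lambda>u. ennreal (k u))"
  have dens: "integral\<^sup>L (?D k) f = integral {0..1} (\<lambda>u. k u * f u)" "integrable (?D k) f"
    if "continuous_on {0..1} k" "\<And>u. 0 \<le> k u" "continuous_on {0..1} f" for k f :: "real \<Rightarrow> real"
    using that by (auto simp: integral_density integrable_density mL lint intro!: lint continuous_intros)
  have eqm: "emeasure M1 A + emeasure (?D g) A = emeasure M3 A + emeasure (?D h) A" if A: "A \<in> sets M1" for A
  proof -
    have AL: "A \<in> sets L" using A sM1 by simp
    then have A': "A \<in> sets borel" "A \<subseteq> {0..1}"
      by (auto simp: L_def sets_restrict_space_iff)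
    have iA: "integrable L (\<lambda>u. indicator A u * k u)" "integral\<^sup>L L (\<lambda>u. indicator A u * k u) = (LBINT u:A. k u)"
       if "continuous_on {0..1} k" for k :: "real \<Rightarrow> real"
    proof -
      show "integrable L (\<lambda>u. indicator A u * k u)"
        using integrable_mult_indicator[OF AL lint(1)[OF that]] by simp
      have e: "(\<lambda>u. indicator {0..1} u *\<^sub>R (indicator A u * k u)) = (\<lambda>u. indicator A u *\<^sub>R k u)"
        using A'(2) by (intro ext) (auto split: split_indicator)
      then show "integral\<^sup>L L (\<lambda>u. indicator A u * k u) = (LBINT u:A. k u)"
        unfolding L_def set_lebesgue_integral_def by (subst integral_restrict_space) (auto simp only: e, simp)
    qed
    have D: "emeasure (?D k) A = ennreal (LBINT u:A. k u)" "0 \<le> (LBINT u:A. k u)" if "continuous_on {0..1} k" "\<And>u. 0 \<le> k u" for k :: "real \<Rightarrow> real"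
    proof -
      have "emeasure (?D k) A = (\<integral>\<^sup>+u. ennreal (k u) * indicator A u \<partial>L)"
        using that AL mL by (simp add: emeasure_density)
      also have "\<dots> = (\<integral>\<^sup>+u. ennreal (indicator A u * k u) \<partial>L)"
        by (intro nn_integral_cong) (auto split: split_indicator)
      also have "\<dots> = ennreal (LBINT u:A. k u)"
        using that iA[OF that(1)] by (subst nn_integral_eq_integral) auto
      finally show "emeasure (?D k) A = ennreal (LBINT u:A. k u)" .
      show "0 \<le> (LBINT u:A. k u)" unfolding iA(2)[OF that(1), symmetric] using that by (intro integral_nonneg_AE) auto
    qed
    have "measure M1 A - measure M3 A = (LBINT u:A. \<rho> u)"
      using eq[OF A'] by (simp add: RM signed_measure_def)
    also have "\<dots> = integral\<^sup>L L (\<lambda>u. indicator A u * h u - indicator A u * g u)"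
      unfolding iA(2)[OF \<rho>, symmetric] by (simp add: hg(5) right_diff_distrib)
    also have "\<dots> = (LBINT u:A. h u) - (LBINT u:A. g u)"
      using iA[OF hg(1)] iA[OF hg(2)] by simp
    finally have "measure M1 A + (LBINT u:A. g u) = measure M3 A + (LBINT u:A. h u)" by simp
    then show ?thesis
      using D(2)[OF hg(1,3)] D(2)[OF hg(2,4)]
      by (simp add: D(1) hg M1.emeasure_eq_measure M3.emeasure_eq_measure ennreal_plus[symmetric] del: ennreal_plus)
  qed
  have main: "integral\<^sup>L M1 f + integral {0..1} (\<lambda>u. g u * f u) = integral\<^sup>L M3 f + integral {0..1} (\<lambda>u. h u * f u)"
    if f: "continuous_on {0..1} f" "\<And>u. u \<in> {0..1} \<Longrightarrow> 0 \<le> f u" "\<And>u. u \<in> {0..1} \<Longrightarrow> f u \<le> B" for f :: "real \<Rightarrow> real" and B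
  proof -
    have i: "integrable M1 f" "integrable M3 f"
      using f sp mL[OF f(1)] sM1 sM3
      by (auto intro!: M1.integrable_const_bound[where B = B] M3.integrable_const_bound[where B = B] simp: measurable_cong_sets[OF sM1 refl] measurable_cong_sets[OF sM3 refl])
    have n: "0 \<le> integral\<^sup>L M' f" "(\<integral>\<^sup>+u. f u \<partial>M') = ennreal (integral\<^sup>L M' f)" if "space M' = {0..1}" "integrable M' f" for M'
      using that f by (auto intro!: integral_nonneg_AE nn_integral_eq_integral)
    have sD: "space (?D k) = {0..1}" for k by (simp add: spL)
    have "(\<integral>\<^sup>+u. f u \<partial>M1) + (\<integral>\<^sup>+u. f u \<partial>?D g) = (\<integral>\<^sup>+u. f u \<partial>M3) + (\<integral>\<^sup>+u. f u \<partial>?D h)"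
      using sM1 sM3 eqm mL[OF f(1)] by (intro nn_integral_sum_measures) (auto simp: measurable_cong_sets[OF sM1 refl])
    then show ?thesis
      using n[OF sp(1) i(1)] n[OF sp(2) i(2)] n[OF sD dens(2)[OF hg(1,3) f(1)]] n[OF sD dens(2)[OF hg(2,4) f(1)]]
      by (simp add: dens hg f(1) ennreal_plus[symmetric] del: ennreal_plus)
  qed
  have i: "integrable M1 \<phi>" "integrable M3 \<phi>"
    using C sp mL[OF \<phi>] sM1 sM3
    by (auto intro!: M1.integrable_const_bound[where B = C] M3.integrable_const_bound[where B = C] simp: measurable_cong_sets[OF sM1 refl] measurable_cong_sets[OF sM3 refl])
  have a: "integral {0..1} (\<lambda>u. k u * (\<phi> u + C)) = integral {0..1} (\<lambda>u. k u * \<phi> u) + integral {0..1} (\<lambda>u. k u * C)"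
    if "continuous_on {0..1} k" for k :: "real \<Rightarrow> real"
    unfolding distrib_left using that
    by (intro Henstock_Kurzweil_Integration.integral_add integrable_continuous_real continuous_intros \<phi>)
  have "integral\<^sup>L M1 (\<lambda>u. \<phi> u + C) + integral {0..1} (\<lambda>u. g u * (\<phi> u + C)) = integral\<^sup>L M3 (\<lambda>u. \<phi> u + C) + integral {0..1} (\<lambda>u. h u * (\<phi> u + C))"
  proof (rule main[where B = "2 * C"])
    show "0 \<le> \<phi> u + C" "\<phi> u + C \<le> 2 * C" if "u \<in> {0..1}" for u
      using C(2)[OF that] by auto
  qed (intro continuous_intros \<phi>)
  moreover have "integral\<^sup>L M1 (\<lambda>u. C) + integral {0..1} (\<lambda>u. g u * C) = integral\<^sup>L M3 (\<lambda>u. C) + integral {0..1} (\<lambda>u. h u * C)"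
    using C by (intro main[where B = "C"] continuous_intros) auto
  ultimately have "integral\<^sup>L M1 \<phi> + integral {0..1} (\<lambda>u. g u * \<phi> u) = integral\<^sup>L M3 \<phi> + integral {0..1} (\<lambda>u. h u * \<phi> u)"
    using i by (simp add: a hg)
  moreover have "integral {0..1} (\<lambda>u. \<phi> u * \<rho> u) = integral {0..1} (\<lambda>u. h u * \<phi> u) - integral {0..1} (\<lambda>u. g u * \<phi> u)"
    unfolding hg(5) using hg(1,2)
    by (subst Henstock_Kurzweil_Integration.integral_diff[symmetric]) (auto intro!: integrable_continuous_real continuous_intros \<phi> simp: algebra_simps)
  ultimately show ?thesis by (simp add: signed_integral_def RM)
qed

text \<open>The eigenvalue of -1/(2\<gamma>) times the second derivative on the mode
  \<open>sine k\<close>.\<close>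

definition rate :: "real \<Rightarrow> nat \<Rightarrow> real" where
  "rate \<gamma> k = (Suc k * pi)\<^sup>2 / (2 * \<gamma>)"

text \<open>An eigenfunction as test function closes the weak equation into y' = c - \<kappa> y. The
  boundary term supplies c, and c/\<kappa> is the k-th coefficient of the stationary profile Fbar u.
  Consequently the difference to this profile decays exponentially.\<close>

lemma stretch_sine_coeff:
  assumes "\<gamma> > 0" and rini: "continuous_on {0..1} rini"
    and sol: "stretch_solution \<gamma> Fbar rini R" and "t \<ge> 0"
  shows "signed_integral (R t) (sine k) = Fbar * ((- 1) ^ k / (Suc k * pi))
    + exp (- rate \<gamma> k * t) * integral {0..1} (\<lambda>u. (rini u - Fbar * u) * sine k u)"
proof -
  let ?c = "Suc k * pi"
  define \<kappa> where "\<kappa> = rate \<gamma> k"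
  note \<kappa>_def = \<kappa>_def[unfolded rate_def]
  have \<kappa>: "\<kappa> > 0" using assms(1) by (simp add: \<kappa>_def)
  have sc: "continuous_on A (sine k)" for A :: "real set"
    by (rule continuous_on_sine) (rule continuous_on_id)
  define y where "y s = signed_integral (R s) (sine k)" for s
  have y_cont: "continuous_on {0..} y"
    using sol sc unfolding stretch_solution_def y_def by blast
  have C2: "C2_with (sine k) (\<lambda>u. ?c * cos (?c * u)) (\<lambda>u. - ?c\<^sup>2 * sine k u)"
    unfolding C2_with_def
    by (auto simp: sine_def[abs_def] power2_eq_square simp del: of_nat_Suc intro!: derivative_eq_intros continuous_intros)
  have s01: "sine k 0 = 0" "sine k 1 = 0"
    using sin_npi[of "Suc k"] by (simp_all add: sine_def del: of_nat_Suc)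
  have c1: "cos (?c * 1) = - ((- 1) ^ k)" using cos_npi[of "Suc k"] by (simp del: of_nat_Suc)
  let ?a0 = "integral {0..1} (\<lambda>u. sine k u * rini u)"
  define c where "c = Fbar * (?c * (- 1) ^ k) / (2 * \<gamma>)"
  have eq: "y s = ?a0 + c * s - \<kappa> * integral {0..s} y" if "s \<ge> 0" for s
  proof -
    have "y s - (LBINT u:{0..1}. sine k u * rini u) =
           1 / (2 * \<gamma>) * (LBINT s:{0..s}. signed_integral (R s) (\<lambda>u. - ?c\<^sup>2 * sine k u))
             - Fbar * s / (2 * \<gamma>) * (?c * cos (?c * 1))"
      using sol C2 s01 that unfolding stretch_solution_def y_def by blast
    moreover have "(LBINT u:{0..1}. sine k u * rini u) = ?a0"
      by (intro lbint_eq_integral continuous_intros rini sc)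
    moreover have "signed_integral (R s) (\<lambda>u. - ?c\<^sup>2 * sine k u) = - ?c\<^sup>2 * y s" for s
      by (simp add: signed_integral_def y_def right_diff_distrib del: of_nat_Suc)
    moreover have "(LBINT s:{0..s}. - ?c\<^sup>2 * y s) = - ?c\<^sup>2 * integral {0..s} y"
    proof -
      have "continuous_on {0..s} y" by (rule continuous_on_subset[OF y_cont]) auto
      then show ?thesis
        by (subst lbint_eq_integral) (auto intro!: continuous_intros Henstock_Kurzweil_Integration.integral_mult_right simp del: of_nat_Suc)
    qed
    ultimately show ?thesis
      unfolding c1 by (simp add: \<kappa>_def c_def field_simps del: of_nat_Suc)
  qed
  \<comment> \<open>Weak continuity in time makes y continuous. The integral equation therefore
    upgrades y to a differentiable function, also at time 0 from the right.\<close>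
  have d: "(y has_real_derivative c + 0 - \<kappa> * y s) (at s within {0..})" if "0 \<le> s" for s
  proof (rule has_field_derivative_transform_within[where d = 1])
    show "((\<lambda>s. ?a0 + c * s - \<kappa> * integral {0..s} y) has_real_derivative c + 0 - \<kappa> * y s) (at s within {0..})"
      by (rule derivative_eq_intros integral_at_0_deriv y_cont that refl | simp)+
  qed (use eq that in auto)
  \<comment> \<open>With error term 0 the relaxation estimate is an equality.\<close>
  have "\<bar>y t - (exp (- \<kappa> * t) * y 0 + (1 - exp (- \<kappa> * t)) * (c / \<kappa>))\<bar> \<le> 0 / \<kappa>"
    by (rule relaxation_bound[OF \<kappa> \<open>t \<ge> 0\<close> d]) auto
  then have "y t = exp (- \<kappa> * t) * (y 0 - c / \<kappa>) + c / \<kappa>"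
    by (simp add: algebra_simps)
  moreover have "c / \<kappa> = Fbar * ((- 1) ^ k / ?c)"
    using assms(1) by (simp add: c_def \<kappa>_def power2_eq_square field_simps del: of_nat_Suc)
  moreover have "y 0 = ?a0" using eq[of 0] by simp
  moreover have "integral {0..1} (\<lambda>u. (rini u - Fbar * u) * sine k u) = ?a0 - Fbar * ((- 1) ^ k / ?c)"
  proof (rule integral_unique)
    have "((\<lambda>u. sine k u * rini u - Fbar * (u * sine k u)) has_integral ?a0 - Fbar * ((- 1) ^ k / ?c)) {0..1}"
      by (intro has_integral_diff has_integral_mult_right identity_sine_coeff integrable_integral integrable_continuous_real continuous_intros rini sc)
    then show "((\<lambda>u. (rini u - Fbar * u) * sine k u) has_integral ?a0 - Fbar * ((- 1) ^ k / ?c)) {0..1}"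
      by (simp add: algebra_simps)
  qed
  ultimately show ?thesis by (simp add: y_def \<kappa>_def rate_def)
qed

text \<open>exp (-x) \<le> 2/x^2 at x of order k^2 s leaves k^(-4). After the factor k of a
  differentiated sine there is still a summable bound, for every fixed s > 0.\<close>

lemma relaxed_coeff_bound:
  assumes "\<gamma> > 0" "s > 0"
  shows "Suc k * pi * exp (- rate \<gamma> k * s) \<le> 8 * \<gamma>\<^sup>2 / s\<^sup>2 * (1 / (real (Suc k))\<^sup>2)"
proof -
  let ?c = "Suc k * pi"
  have c1: "?c \<ge> Suc k" using pi_gt3 by (simp add: mult_le_cancel_left1 del: of_nat_Suc)
  then have c0: "?c \<ge> 1" by linarith
  define x where "x = rate \<gamma> k * s"
  have x: "x > 0" using assms by (simp add: x_def rate_def)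
  have "x\<^sup>2 / 2 \<le> exp x" using exp_lower_Taylor_quadratic[of x] x by simp
  then have "exp (- x) \<le> 2 / x\<^sup>2"
    using x by (simp add: exp_minus field_simps)
  moreover have "2 / x\<^sup>2 = 8 * \<gamma>\<^sup>2 / s\<^sup>2 * (1 / ?c ^ 4)"
    using assms by (simp add: x_def rate_def field_simps eval_nat_numeral del: of_nat_Suc)
  ultimately have "exp (- x) \<le> 8 * \<gamma>\<^sup>2 / s\<^sup>2 * (1 / ?c ^ 4)" by simp
  then have "?c * exp (- x) \<le> ?c * (8 * \<gamma>\<^sup>2 / s\<^sup>2 * (1 / ?c ^ 4))"
    by (intro mult_left_mono) auto
  also have "\<dots> = 8 * \<gamma>\<^sup>2 / s\<^sup>2 * (1 / ?c ^ 3)"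
    by (simp add: eval_nat_numeral field_simps del: of_nat_Suc)
  also have "\<dots> \<le> 8 * \<gamma>\<^sup>2 / s\<^sup>2 * (1 / (real (Suc k))\<^sup>2)"
  proof (intro mult_left_mono divide_left_mono)
    have "(real (Suc k))\<^sup>2 \<le> ?c\<^sup>2" by (intro power_mono c1) auto
    also have "\<dots> \<le> ?c ^ 3" using c0 by (intro power_increasing) auto
    finally show "(real (Suc k))\<^sup>2 \<le> ?c ^ 3" .
  qed (use c0 in auto)
  finally show ?thesis by (simp add: x_def)
qed

lemma summable_inverse_squares: "summable (\<lambda>k. 1 / (real (Suc k))\<^sup>2)"
  using sums_summable[OF inverse_squares_sums] by (simp add: add.commute)

lemma sine_coeff_bounded:
  assumes h: "continuous_on {0..1} h"
    and c: "\<And>k. ((\<lambda>u. h u * sine k u) has_integral c k) {0..1}"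
  shows "\<exists>D. \<forall>k. \<bar>c k\<bar> \<le> D"
proof (intro exI allI)
  fix k
  have "(c k)\<^sup>2 \<le> (\<Sum>k. (c k)\<^sup>2)"
    using sum_le_suminf[OF sine_bessel[OF h c], of "{k}"] by simp
  moreover have "2 * \<bar>c k\<bar> * 1 \<le> \<bar>c k\<bar>\<^sup>2 + 1\<^sup>2" by (rule sum_squares_bound)
  moreover have "0 \<le> \<bar>c k\<bar>\<^sup>2" by simp
  ultimately show "\<bar>c k\<bar> \<le> (\<Sum>k. (c k)\<^sup>2) + 1" unfolding power2_abs by simp
qed

text \<open>At a positive time the coefficients decay fast enough for termwise differentiation up to
  the end point. The resulting function has the same sine coefficients as the density, and
  completeness identifies the two. The sign is the value of cos ((k+1) pi), from the derivative of
  \<open>sine k\<close> at 1.\<close>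

lemma stretch_boundary_slope:
  assumes "\<gamma> > 0" and rini: "continuous_on {0..1} rini"
    and \<rho>: "stretch_density \<gamma> Fbar rini \<rho>" and s: "s > 0"
  defines "d \<equiv> \<lambda>k. integral {0..1} (\<lambda>u. (rini u - Fbar * u) * sine k u)"
  shows "(\<lambda>k. 2 * d k * (Suc k * pi) * (- 1) ^ Suc k * exp (- rate \<gamma> k * s)) sums
     (vector_derivative (\<rho> s) (at 1 within {0..1}) - Fbar)"
proof -
  obtain R where R: "stretch_solution \<gamma> Fbar rini R"
    "\<And>t A. \<lbrakk>t > 0; A \<in> sets borel; A \<subseteq> {0..1}\<rbrakk> \<Longrightarrow> signed_measure (R t) A = (LBINT u:A. \<rho> t u)"
    and \<rho>c: "continuous_on ({0<..} \<times> {0..1}) (\<lambda>(t, u). \<rho> t u)"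
    using \<rho> unfolding stretch_density_def by blast
  have "continuous_on {0..1} (\<lambda>u. (\<lambda>(t, u). \<rho> t u) (s, u))"
    by (rule continuous_on_compose2[OF \<rho>c, of "{0..1}" "\<lambda>u. (s, u)"]) (use s in \<open>auto intro!: continuous_on_Pair continuous_on_const continuous_on_id\<close>)
  then have \<rho>s: "continuous_on {0..1} (\<rho> s)" by simp
  have sc: "continuous_on A (sine k)" for A :: "real set" and k
    by (rule continuous_on_sine) (rule continuous_on_id)
  have hc: "continuous_on {0..1} (\<lambda>u. rini u - Fbar * u)" by (intro continuous_intros rini)
  have d: "((\<lambda>u. (rini u - Fbar * u) * sine k u) has_integral d k) {0..1}" for k
    unfolding d_def by (intro integrable_integral integrable_continuous_real continuous_intros rini sc)
  obtain D where D: "\<And>k. \<bar>d k\<bar> \<le> D" using sine_coeff_bounded[OF hc d] by blast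
  define e where "e k = 2 * d k * exp (- rate \<gamma> k * s)" for k
  define B where "B k = 2 * D * (8 * \<gamma>\<^sup>2 / s\<^sup>2 * (1 / (real (Suc k))\<^sup>2))" for k
  have B: "summable B"
    unfolding B_def by (intro summable_mult summable_inverse_squares)
  have eB: "\<bar>e k\<bar> * (Suc k * pi) \<le> B k" for k
  proof -
    have "\<bar>e k\<bar> * (Suc k * pi) = 2 * \<bar>d k\<bar> * (Suc k * pi * exp (- rate \<gamma> k * s))"
      by (simp add: e_def abs_mult)
    also have "\<dots> \<le> B k"
      unfolding B_def by (rule mult_mono[OF _ relaxed_coeff_bound[OF assms(1) s]]) (use D[of k] in auto)
    finally show ?thesis .
  qed
  have eB': "\<bar>e k\<bar> \<le> B k" for k
  proof -
    have "\<bar>e k\<bar> * 1 \<le> \<bar>e k\<bar> * (Suc k * pi)"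
    proof (intro mult_left_mono)
      have "1 * 1 \<le> real (Suc k) * pi" using pi_gt3 by (intro mult_mono) auto
      then show "1 \<le> real (Suc k) * pi" by simp
    qed simp
    then show ?thesis using eB[of k] by simp
  qed
  \<comment> \<open>Uniform convergence of the derivatives needs pointwise convergence at one point
    only; at 0 every term is 0.\<close>
  have "\<exists>g0. \<forall>u\<in>{0..1}. (\<lambda>k. e k * sine k u) sums g0 u \<and>
      (g0 has_field_derivative (\<Sum>k. e k * (Suc k * pi) * cos (Suc k * pi * u))) (at u within {0..1})"
  proof (rule has_field_derivative_series[where ?x0.0 = 0])
    show "((\<lambda>u. e k * sine k u) has_real_derivative e k * (Suc k * pi) * cos (Suc k * pi * u)) (at u within {0..1})" for k and u :: real
      unfolding sine_def by (auto intro!: derivative_eq_intros simp del: of_nat_Suc)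
    show "uniform_limit {0..1} (\<lambda>n u. \<Sum>k<n. e k * (Suc k * pi) * cos (Suc k * pi * u))
       (\<lambda>u. \<Sum>k. e k * (Suc k * pi) * cos (Suc k * pi * u)) sequentially"
    proof (rule Weierstrass_m_test[OF _ B])
      fix k u
      have "norm (e k * (Suc k * pi) * cos (Suc k * pi * u)) \<le> \<bar>e k\<bar> * (Suc k * pi) * 1"
        unfolding real_norm_def abs_mult by (intro mult_mono) (auto simp del: of_nat_Suc)
      then show "norm (e k * (Suc k * pi) * cos (Suc k * pi * u)) \<le> B k" using eB[of k] by simp
    qed
  qed (auto simp: sine_def)
  then obtain g0 where g0: "\<And>u. u \<in> {0..1} \<Longrightarrow> (\<lambda>k. e k * sine k u) sums g0 u"
    and g0': "\<And>u. u \<in> {0..1} \<Longrightarrow> (g0 has_real_derivative (\<Sum>k. e k * (Suc k * pi) * cos (Suc k * pi * u))) (at u within {0..1})"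
    by blast
  have g0c: "continuous_on {0..1} g0" by (rule DERIV_continuous_on[OF g0'])
  have coeff: "((\<lambda>u. g0 u * sine k u) has_integral e k / 2) {0..1}" for k
  proof -
    have "uniform_limit {0..1} (\<lambda>n u. \<Sum>i<n. e i * sine i u * sine k u) (\<lambda>u. \<Sum>i. e i * sine i u * sine k u) sequentially"
    proof (rule Weierstrass_m_test[OF _ B])
      fix i u
      have "norm (e i * sine i u * sine k u) \<le> \<bar>e i\<bar> * 1 * 1"
        unfolding real_norm_def abs_mult by (intro mult_mono) (auto simp: sine_def)
      then show "norm (e i * sine i u * sine k u) \<le> B i" using eB'[of i] by simp
    qed
    then have ul: "uniform_limit {0..1} (\<lambda>n u. \<Sum>i<n. e i * sine i u * sine k u) (\<lambda>u. g0 u * sine k u) sequentially"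
      by (rule uniform_limit_cong'[THEN iffD1, rotated 2])
        (auto simp: sums_unique[OF sums_mult2[OF g0]])
    obtain I J where IJ: "\<And>n. ((\<lambda>u. \<Sum>i<n. e i * sine i u * sine k u) has_integral I n) {0..1}"
       "((\<lambda>u. g0 u * sine k u) has_integral J) {0..1}" "I \<longlonglongrightarrow> J"
      by (rule uniform_limit_integral[OF ul]) (auto intro!: continuous_intros sc)
    have "((\<lambda>u. \<Sum>i<n. e i * (sine i u * sine k u)) has_integral (\<Sum>i<n. e i * (if i = k then 1 / 2 else 0))) {0..1}" for n
      by (intro has_integral_sum has_integral_mult_right sine_orthogonal) auto
    then have "I n = (\<Sum>i<n. e i * (if i = k then 1 / 2 else 0))" for n
      using IJ(1)[of n] by (auto dest: has_integral_unique simp: mult.assoc)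
    then have "eventually (\<lambda>n. I n = e k / 2) sequentially"
      by (intro eventually_sequentiallyI[of "Suc k"]) (simp add: if_distrib[where f = "\<lambda>x. _ * x"] cong: if_cong)
    then have "I \<longlonglongrightarrow> e k / 2" by (rule tendsto_eventually)
    with IJ show ?thesis using LIMSEQ_unique by blast
  qed
  have \<rho>eq: "\<rho> s u = Fbar * u + g0 u" if u: "u \<in> {0..1}" for u
  proof -
    \<comment> \<open>The density has no prescribed boundary values pointwise. Completeness compares
      continuous functions through their coefficients alone and gives equality on the closed
      interval, which fixes the boundary values as well.\<close>
    have "\<rho> s u - Fbar * u - g0 u = 0"
    proof (rule sine_complete[OF _ _ u])
      show "continuous_on {0..1} (\<lambda>u. \<rho> s u - Fbar * u - g0 u)" by (intro continuous_intros \<rho>s g0c)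
      fix k
      have fs: "fin_signed (R s)" using R(1) s unfolding stretch_solution_def by simp
      have "((\<lambda>u. sine k u * \<rho> s u) has_integral integral {0..1} (\<lambda>u. sine k u * \<rho> s u)) {0..1}"
        by (intro integrable_integral integrable_continuous_real continuous_intros \<rho>s sc)
      also have "integral {0..1} (\<lambda>u. sine k u * \<rho> s u) = Fbar * ((- 1) ^ k / (Suc k * pi)) + e k / 2"
        using signed_integral_density[OF fs \<rho>s R(2)[OF s] sc, of k] stretch_sine_coeff[OF assms(1) rini R(1), of s k] s
        by (simp add: e_def d_def mult.commute)
      finally have "((\<lambda>u. sine k u * \<rho> s u - Fbar * (u * sine k u) - g0 u * sine k u) has_integral
         Fbar * ((- 1) ^ k / (Suc k * pi)) + e k / 2 - Fbar * ((- 1) ^ k / (Suc k * pi)) - e k / 2) {0..1}"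
        by (intro has_integral_diff has_integral_mult_right coeff identity_sine_coeff)
      then show "((\<lambda>u. (\<rho> s u - Fbar * u - g0 u) * sine k u) has_integral 0) {0..1}"
        by (simp add: algebra_simps)
    qed
    then show ?thesis by simp
  qed
  have "((\<lambda>u. Fbar * u + g0 u) has_real_derivative Fbar + (\<Sum>k. e k * (Suc k * pi) * cos (Suc k * pi * 1))) (at 1 within {0..1})"
    by (auto intro!: derivative_eq_intros g0')
  then have "(\<rho> s has_real_derivative Fbar + (\<Sum>k. e k * (Suc k * pi) * cos (Suc k * pi * 1))) (at 1 within {0..1})"
    by (rule has_field_derivative_transform_within[where d = 1]) (auto simp: \<rho>eq)
  then have "vector_derivative (\<rho> s) (at 1 within {0..1}) = Fbar + (\<Sum>k. e k * (Suc k * pi) * cos (Suc k * pi * 1))"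
    by (intro vector_derivative_within_closed_interval) (auto simp: has_real_derivative_iff_has_vector_derivative)
  moreover have "summable (\<lambda>k. e k * (Suc k * pi) * cos (Suc k * pi * 1))"
  proof (rule summable_comparison_test'[OF B])
    fix k :: nat
    have "norm (e k * (Suc k * pi) * cos (Suc k * pi * 1)) \<le> \<bar>e k\<bar> * (Suc k * pi) * 1"
      unfolding real_norm_def abs_mult by (intro mult_mono) (auto simp del: of_nat_Suc)
    then show "norm (e k * (Suc k * pi) * cos (Suc k * pi * 1)) \<le> B k" using eB[of k] by simp
  qed
  moreover have "(\<lambda>k. e k * (Suc k * pi) * cos (Suc k * pi * 1)) =
      (\<lambda>k. 2 * d k * (Suc k * pi) * (- 1) ^ Suc k * exp (- rate \<gamma> k * s))"
  proof
    fix k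
    show "e k * (Suc k * pi) * cos (Suc k * pi * 1) = 2 * d k * (Suc k * pi) * (- 1) ^ Suc k * exp (- rate \<gamma> k * s)"
      using cos_npi[of "Suc k"] by (simp add: e_def mult_ac del: of_nat_Suc)
  qed
  ultimately show ?thesis by (simp only: summable_sums add_diff_cancel_left')
qed

text \<open>The bound on the slope series degenerates as s tends to 0, since the initial profile is
  merely continuous. Integration in time divides each term by \<open>rate\<close>; what is left, of
  size d_k/k, is absolutely summable because d_k and 1/k are both square summable. This justifies
  exchanging sum and integral.\<close>

lemma stretch_flux:
  assumes "\<gamma> > 0" and rini: "continuous_on {0..1} rini"
    and \<rho>: "stretch_density \<gamma> Fbar rini \<rho>" and t: "t > 0"
  defines "d \<equiv> \<lambda>k. integral {0..1} (\<lambda>u. (rini u - Fbar * u) * sine k u)"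
  shows "(\<lambda>k. 4 * \<gamma> * ((- 1) ^ Suc k / (Suc k * pi)) * d k * (1 - exp (- rate \<gamma> k * t))) sums
     ((LBINT s:{0..t}. vector_derivative (\<rho> s) (at 1 within {0..1})) - Fbar * t)"
proof -
  define V where "V s = vector_derivative (\<rho> s) (at 1 within {0..1})" for s
  define C where "C k = 2 * d k * (Suc k * pi) * (- 1) ^ Suc k" for k
  have V: "(\<lambda>k. C k * exp (- rate \<gamma> k * s)) sums (V s - Fbar)" if "s > 0" for s
    using stretch_boundary_slope[OF assms(1) rini \<rho> that] by (simp add: C_def V_def d_def)
  have rpos: "rate \<gamma> k > 0" for k using assms(1) by (simp add: rate_def)
  have ex: "((\<lambda>s. c * exp (- rate \<gamma> k * s)) has_integral c * (1 - exp (- rate \<gamma> k * t)) / rate \<gamma> k) {0..t}" for c k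
  proof -
    have "((\<lambda>s. c * exp (- rate \<gamma> k * s)) has_integral
       (- c * exp (- rate \<gamma> k * t) / rate \<gamma> k) - (- c * exp (- rate \<gamma> k * 0) / rate \<gamma> k)) {0..t}"
      using t rpos[of k] by (intro fundamental_theorem_of_calculus)
        (auto intro!: derivative_eq_intros simp: has_real_derivative_iff_has_vector_derivative[symmetric])
    then show ?thesis by (simp add: algebra_simps diff_divide_distrib)
  qed
  let ?f = "\<lambda>k s. indicator {0..t} s *\<^sub>R (C k * exp (- rate \<gamma> k * s))"
  have fi: "integrable lborel (?f k)" for k
    unfolding set_integrable_def[symmetric]
    by (intro borel_integrable_atLeastAtMost' continuous_intros)
  have int: "(LBINT s:{0..t}. c * exp (- rate \<gamma> k * s)) = c * (1 - exp (- rate \<gamma> k * t)) / rate \<gamma> k" for c k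
    by (subst lbint_eq_integral, intro continuous_intros) (rule integral_unique[OF ex])
  have nf: "norm (?f k s) = indicator {0..t} s *\<^sub>R (\<bar>C k\<bar> * exp (- rate \<gamma> k * s))" for k s
    by (simp add: abs_mult)
  have hc: "continuous_on {0..1} (\<lambda>u. rini u - Fbar * u)" by (intro continuous_intros rini)
  have sc: "continuous_on A (sine k)" for A :: "real set" and k
    by (rule continuous_on_sine) (rule continuous_on_id)
  have "((\<lambda>u. (rini u - Fbar * u) * sine k u) has_integral d k) {0..1}" for k
    unfolding d_def by (intro integrable_integral integrable_continuous_real continuous_intros rini sc)
  note bessel = sine_bessel[OF hc this] and bounded = sine_coeff_bounded[OF hc this]
  obtain D where D: "\<And>k. \<bar>d k\<bar> \<le> D" using bounded by blast
  have quot: "C k / rate \<gamma> k = 4 * \<gamma> * ((- 1) ^ Suc k / (Suc k * pi)) * d k" for k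
    using assms(1) by (simp add: C_def rate_def field_simps power2_eq_square del: of_nat_Suc power_Suc)
  have "summable (\<lambda>k. \<integral>s. norm (?f k s) \<partial>lborel)"
  proof (rule summable_comparison_test'[where N = 0])
    show "summable (\<lambda>k. 4 * \<gamma> * ((d k)\<^sup>2 + 1 / (real (Suc k))\<^sup>2))"
      by (intro summable_mult summable_add bessel summable_inverse_squares)
    fix k :: nat
    have "(\<integral>s. norm (?f k s) \<partial>lborel) = \<bar>C k\<bar> * (1 - exp (- rate \<gamma> k * t)) / rate \<gamma> k"
      unfolding nf by (rule int[unfolded set_lebesgue_integral_def])
    also have "\<dots> = \<bar>C k / rate \<gamma> k\<bar> * (1 - exp (- rate \<gamma> k * t))"
      using rpos[of k] by simp
    also have "\<dots> \<le> \<bar>C k / rate \<gamma> k\<bar> * 1"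
      by (intro mult_left_mono) auto
    finally have 1: "(\<integral>s. norm (?f k s) \<partial>lborel) \<le> \<bar>C k / rate \<gamma> k\<bar>" by simp
    have "\<bar>C k / rate \<gamma> k\<bar> = 4 * \<gamma> * (\<bar>d k\<bar> * (1 / (Suc k * pi)))"
      unfolding quot using assms(1) by (simp add: abs_mult power_abs del: of_nat_Suc power_Suc)
    also have "\<dots> \<le> 4 * \<gamma> * (\<bar>d k\<bar> * (1 / real (Suc k)))"
    proof -
      have "real (Suc k) * 1 \<le> Suc k * pi" using pi_gt3 by (intro mult_left_mono) auto
      then have "1 / (Suc k * pi) \<le> 1 / real (Suc k)" by (intro divide_left_mono) auto
      then show ?thesis using assms(1) by (intro mult_left_mono) auto
    qed
    also have "\<dots> \<le> 4 * \<gamma> * ((d k)\<^sup>2 + 1 / (real (Suc k))\<^sup>2)"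
    proof -
      have "2 * \<bar>d k\<bar> * (1 / real (Suc k)) \<le> \<bar>d k\<bar>\<^sup>2 + (1 / real (Suc k))\<^sup>2" by (rule sum_squares_bound)
      moreover have "0 \<le> \<bar>d k\<bar> * (1 / real (Suc k))" by simp
      ultimately have "\<bar>d k\<bar> * (1 / real (Suc k)) \<le> (d k)\<^sup>2 + 1 / (real (Suc k))\<^sup>2"
        unfolding power2_abs power_one_over by linarith
      then show ?thesis using assms(1) by (intro mult_left_mono) auto
    qed
    finally show "norm (\<integral>s. norm (?f k s) \<partial>lborel) \<le> 4 * \<gamma> * ((d k)\<^sup>2 + 1 / (real (Suc k))\<^sup>2)"
      using 1 by simp
  qed
  moreover have "AE s in lborel. summable (\<lambda>k. norm (?f k s))"
    using AE_lborel_singleton[of 0]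
  proof eventually_elim
    case (elim s)
    show ?case
    proof (cases "s \<in> {0..t}")
      case True
      then have s: "s > 0" using elim by auto
      have "summable (\<lambda>k. \<bar>C k\<bar> * exp (- rate \<gamma> k * s))"
      proof (rule summable_comparison_test'[where N = 0])
        show "summable (\<lambda>k. 2 * D * (8 * \<gamma>\<^sup>2 / s\<^sup>2 * (1 / (real (Suc k))\<^sup>2)))"
          by (intro summable_mult summable_inverse_squares)
        fix k :: nat
        have "\<bar>C k\<bar> * exp (- rate \<gamma> k * s) = 2 * \<bar>d k\<bar> * (Suc k * pi * exp (- rate \<gamma> k * s))"
          by (simp add: C_def abs_mult power_abs del: of_nat_Suc power_Suc)
        also have "\<dots> \<le> 2 * D * (8 * \<gamma>\<^sup>2 / s\<^sup>2 * (1 / (real (Suc k))\<^sup>2))"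
          by (rule mult_mono[OF _ relaxed_coeff_bound[OF assms(1) s]]) (use D[of k] in auto)
        finally show "norm (\<bar>C k\<bar> * exp (- rate \<gamma> k * s)) \<le> 2 * D * (8 * \<gamma>\<^sup>2 / s\<^sup>2 * (1 / (real (Suc k))\<^sup>2))" by simp
      qed
      then show ?thesis using True unfolding nf by simp
    qed simp
  qed
  ultimately have S: "integrable lborel (\<lambda>s. \<Sum>k. ?f k s)" "(\<lambda>k. integral\<^sup>L lborel (?f k)) sums (\<integral>s. (\<Sum>k. ?f k s) \<partial>lborel)"
    using integrable_suminf[of lborel ?f] sums_integral[of lborel ?f] fi by blast+
  \<comment> \<open>The series is identified with the slope only for s > 0; the single time 0 is
    discarded as a null set.\<close>
  have eqS: "(\<Sum>k. ?f k s) = indicator {0..t} s *\<^sub>R (V s - Fbar)" if "s \<notin> {0}" for s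
  proof (cases "s \<in> {0..t}")
    case True
    then show ?thesis using V[of s] that by (simp add: sums_unique[symmetric])
  qed simp
  have "integrable lborel (\<lambda>s. indicator {0..t} s *\<^sub>R (V s - Fbar)) \<and>
    (\<integral>s. (\<Sum>k. ?f k s) \<partial>lborel) = (\<integral>s. indicator {0..t} s *\<^sub>R (V s - Fbar) \<partial>lborel)"
    using S(1) integrable_discrete_difference[of "{0}" lborel "\<lambda>s. \<Sum>k. ?f k s" "\<lambda>s. indicator {0..t} s *\<^sub>R (V s - Fbar)"]
      integral_discrete_difference[of "{0}" lborel "\<lambda>s. \<Sum>k. ?f k s" "\<lambda>s. indicator {0..t} s *\<^sub>R (V s - Fbar)"] eqS
    by auto
  then have VI: "set_integrable lborel {0..t} (\<lambda>s. V s - Fbar)" "(\<integral>s. (\<Sum>k. ?f k s) \<partial>lborel) = (LBINT s:{0..t}. V s - Fbar)"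
    by (auto simp: set_integrable_def set_lebesgue_integral_def)
  have cF: "set_integrable lborel {0..t} (\<lambda>s. Fbar)" by (rule borel_integrable_atLeastAtMost') simp
  have "(LBINT s:{0..t}. V s) = (LBINT s:{0..t}. (V s - Fbar) + Fbar)" by simp
  also have "\<dots> = (LBINT s:{0..t}. V s - Fbar) + (LBINT s:{0..t}. Fbar)"
    by (rule set_integral_add(2)[OF VI(1) cF])
  also have "(LBINT s:{0..t}. Fbar) = Fbar * t"
    using t by (subst lbint_eq_integral) auto
  finally have "(\<integral>s. (\<Sum>k. ?f k s) \<partial>lborel) = (LBINT s:{0..t}. V s) - Fbar * t"
    using VI(2) by simp
  moreover have "integral\<^sup>L lborel (?f k) = 4 * \<gamma> * ((- 1) ^ Suc k / (Suc k * pi)) * d k * (1 - exp (- rate \<gamma> k * t))" for k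
    using int[of "C k" k] unfolding quot[symmetric] set_lebesgue_integral_def by (simp only: times_divide_eq_left)
  ultimately show ?thesis using S(2) by (simp add: V_def)
qed

section \<open>Energy of order n on the diffusive time scale\<close>

context damped_chain
begin

text \<open>Under the constant force the chain has a steady state with linear stretch and one common
  momentum, whose friction balances the stretch gradient Fbar/(n+1). Subtracting it leaves a chain
  driven by the small oscillating part only.\<close>

lemma stationary_shift:
  "damped_chain \<gamma> n (\<lambda>t. G t - Fbar) (\<lambda>x t. R x t - Fbar * x / (n + 1)) (\<lambda>x t. P x t - Fbar / (2 * \<gamma> * (n + 1)))"
proof
  show "continuous_on {0..} (\<lambda>t. G t - Fbar)" by (intro continuous_intros G_cont)
  show "R (Suc n) t - Fbar * real (Suc n) / real (n + 1) = G t - Fbar" if "t \<ge> 0" for t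
    using R_end[OF that] by (simp add: field_simps)
  show "((\<lambda>t. R (Suc x) t - Fbar * real (Suc x) / real (n + 1)) has_real_derivative
      P (Suc x) t - Fbar / (2 * \<gamma> * real (n + 1)) - (P x t - Fbar / (2 * \<gamma> * real (n + 1)))) (at t within {0..})"
    if "x < n" "t \<ge> 0" for x t
    by (auto intro!: derivative_eq_intros R_deriv that)
  show "((\<lambda>t. P x t - Fbar / (2 * \<gamma> * real (n + 1))) has_real_derivative
      R (Suc x) t - Fbar * real (Suc x) / real (n + 1) - (R x t - Fbar * real x / real (n + 1))
        - 2 * \<gamma> * (P x t - Fbar / (2 * \<gamma> * real (n + 1)))) (at t within {0..})"
    if "x \<le> n" "t \<ge> 0" for x t
  proof (rule DERIV_cong)
    show "((\<lambda>t. P x t - Fbar / (2 * \<gamma> * real (n + 1))) has_real_derivative R (Suc x) t - R x t - 2 * \<gamma> * P x t - 0) (at t within {0..})"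
      by (intro derivative_intros P_deriv that)
    have "2 * \<gamma> * (Fbar / (2 * \<gamma> * real (n + 1))) = Fbar * real (Suc x) / real (n + 1) - Fbar * real x / real (n + 1)"
      using damping_pos by (simp add: diff_divide_distrib[symmetric] right_diff_distrib[symmetric])
    then show "R (Suc x) t - R x t - 2 * \<gamma> * P x t - 0 =
      R (Suc x) t - Fbar * real (Suc x) / real (n + 1) - (R x t - Fbar * real x / real (n + 1))
        - 2 * \<gamma> * (P x t - Fbar / (2 * \<gamma> * real (n + 1)))"
      by (simp add: right_diff_distrib)
  qed
qed (use damping_pos R_0 in auto)

end

definition stationary_bound :: "real \<Rightarrow> real \<Rightarrow> real" where
  "stationary_bound \<gamma> Fbar = Fbar\<^sup>2 + (Fbar / (2 * \<gamma>))\<^sup>2"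

text \<open>Energy per site of the shifted chain. The first two terms come from its initial value;
  the last is the energy injected by a force of size K/sqrt n during t n^2, which is K^2 t
  n/(2\<gamma>) in total.\<close>

definition shifted_bound :: "real \<Rightarrow> real \<Rightarrow> real \<Rightarrow> real \<Rightarrow> real \<Rightarrow> real" where
  "shifted_bound \<gamma> Fbar K H t = 2 * H + 2 * stationary_bound \<gamma> Fbar + K\<^sup>2 / (2 * \<gamma>) * t"

text \<open>One constant for two estimates: the first two terms bound the energy after undoing the
  shift, the last two bound the time integral of the squared last momentum.\<close>

definition energy_const :: "real \<Rightarrow> real \<Rightarrow> real \<Rightarrow> real \<Rightarrow> real \<Rightarrow> real" where
  "energy_const \<gamma> Fbar K H t = 2 * shifted_bound \<gamma> Fbar K H t + 2 * stationary_bound \<gamma> Fbar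
     + shifted_bound \<gamma> Fbar K H t / \<gamma> + 2 * stationary_bound \<gamma> Fbar * t"

lemma square_sum_le: "(a + b)\<^sup>2 \<le> 2 * a\<^sup>2 + 2 * (b::real)\<^sup>2"
proof -
  have "0 \<le> (a - b)\<^sup>2" by simp
  then show ?thesis by (simp add: power2_sum power2_diff)
qed

lemma square_diff_le: "(a - b)\<^sup>2 \<le> 2 * a\<^sup>2 + 2 * (b::real)\<^sup>2"
  using square_sum_le[of a "- b"] by simp

context damped_chain
begin

text \<open>A force of order 1 could inject energy of order n^2 during t n^2. Applied to the shifted
  chain, \<open>energy_bound\<close> sees a force of order 1/sqrt n and gives order n. The shift is
  undone by (a+b)^2 \<le> 2a^2 + 2b^2, at a cost of order n again.\<close>

lemma macroscopic_bounds:
  fixes t H K Fbar :: real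
  assumes n: "n \<ge> 1" and K: "\<And>s. s \<ge> 0 \<Longrightarrow> \<bar>G s - Fbar\<bar> \<le> K / sqrt n"
    and H: "energy 0 \<le> H * n" and t: "t \<ge> 0"
  shows "s \<in> {0..t * (real n)\<^sup>2} \<Longrightarrow> energy s \<le> energy_const \<gamma> Fbar K H t * n"
    and "integral {0..t * (real n)\<^sup>2} (\<lambda>s. (P n s)\<^sup>2) \<le> energy_const \<gamma> Fbar K H t * n"
proof -
  let ?R = "\<lambda>x t. R x t - Fbar * x / (n + 1)" and ?P = "\<lambda>x t. P x t - Fbar / (2 * \<gamma> * (n + 1))"
  interpret S: damped_chain \<gamma> n "\<lambda>t. G t - Fbar" ?R ?P
    by (rule stationary_shift)
  define S where "S = stationary_bound \<gamma> Fbar"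
  define C where "C = shifted_bound \<gamma> Fbar K H t"
  define st where "st = (\<Sum>x<n. (Fbar * real (Suc x) / (n + 1))\<^sup>2) + (\<Sum>x\<le>n. (Fbar / (2 * \<gamma> * (n + 1)))\<^sup>2)"
  have S0: "S \<ge> 0" by (simp add: S_def stationary_bound_def)
  have Pst: "(Fbar / (2 * \<gamma> * (n + 1)))\<^sup>2 \<le> S / (real (n + 1))\<^sup>2"
  proof -
    have "(Fbar / (2 * \<gamma> * (n + 1)))\<^sup>2 = (Fbar / (2 * \<gamma>))\<^sup>2 / (real (n + 1))\<^sup>2"
      by (simp add: power_divide power_mult_distrib)
    also have "\<dots> \<le> S / (real (n + 1))\<^sup>2"
      by (intro divide_right_mono) (simp_all add: S_def stationary_bound_def)
    finally show ?thesis .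
  qed
  have st: "st \<le> S * n"
  proof -
    have "(\<Sum>x<n. (Fbar * real (Suc x) / (n + 1))\<^sup>2) \<le> (\<Sum>x<n. Fbar\<^sup>2)"
    proof (rule sum_mono)
      fix x assume "x \<in> {..<n}"
      then have "real (Suc x) / (n + 1) \<le> 1" by simp
      then have "Fbar\<^sup>2 * (real (Suc x) / (n + 1))\<^sup>2 \<le> Fbar\<^sup>2 * 1"
        by (intro mult_left_mono power_le_one) auto
      then show "(Fbar * real (Suc x) / (n + 1))\<^sup>2 \<le> Fbar\<^sup>2"
        by (simp add: power_mult_distrib power_divide)
    qed
    moreover have "(\<Sum>x\<le>n. (Fbar / (2 * \<gamma> * (n + 1)))\<^sup>2) \<le> (Fbar / (2 * \<gamma>))\<^sup>2 * n"
    proof -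
      have "(\<Sum>x\<le>n. (Fbar / (2 * \<gamma> * (n + 1)))\<^sup>2) = (Fbar / (2 * \<gamma>))\<^sup>2 * (1 / (n + 1))"
        by (simp add: power_divide power_mult_distrib power2_eq_square)
      also have "\<dots> \<le> (Fbar / (2 * \<gamma>))\<^sup>2 * n"
      proof (intro mult_left_mono)
        have "1 / (real n + 1) \<le> 1" by simp
        also have "1 \<le> real n" using n by simp
        finally show "1 / real (n + 1) \<le> real n" by (simp add: add.commute)
      qed simp
      finally show ?thesis .
    qed
    ultimately show ?thesis by (simp add: st_def S_def stationary_bound_def algebra_simps)
  qed
  have down: "S.energy s \<le> 2 * energy s + 2 * st" for s
    unfolding S.energy_def energy_def st_def distrib_left sum_distrib_left
    using sum_mono[of "{..<n}" "\<lambda>x. (?R (Suc x) s)\<^sup>2" "\<lambda>x. 2 * (R (Suc x) s)\<^sup>2 + 2 * (Fbar * real (Suc x) / (n + 1))\<^sup>2", OF square_diff_le]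
      sum_mono[of "{..n}" "\<lambda>x. (?P x s)\<^sup>2" "\<lambda>x. 2 * (P x s)\<^sup>2 + 2 * (Fbar / (2 * \<gamma> * (n + 1)))\<^sup>2", OF square_diff_le]
    by (simp only: sum.distrib)
  have up: "energy s \<le> 2 * S.energy s + 2 * st" for s
  proof -
    have A: "(R x s)\<^sup>2 \<le> 2 * (?R x s)\<^sup>2 + 2 * (Fbar * real x / (n + 1))\<^sup>2" for x
      using square_sum_le[of "?R x s" "Fbar * real x / (n + 1)"] by simp
    have B: "(P x s)\<^sup>2 \<le> 2 * (?P x s)\<^sup>2 + 2 * (Fbar / (2 * \<gamma> * (n + 1)))\<^sup>2" for x
      using square_sum_le[of "?P x s" "Fbar / (2 * \<gamma> * (n + 1))"] by simp
    show ?thesis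
      unfolding S.energy_def energy_def st_def distrib_left sum_distrib_left
      using sum_mono[of "{..<n}" "\<lambda>x. (R (Suc x) s)\<^sup>2" "\<lambda>x. 2 * (?R (Suc x) s)\<^sup>2 + 2 * (Fbar * real (Suc x) / (n + 1))\<^sup>2", OF A]
        sum_mono[of "{..n}" "\<lambda>x. (P x s)\<^sup>2" "\<lambda>x. 2 * (?P x s)\<^sup>2 + 2 * (Fbar / (2 * \<gamma> * (n + 1)))\<^sup>2", OF B]
      by (simp only: sum.distrib)
  qed
  have SE: "S.energy s + 2 * \<gamma> * integral {0..s} (\<lambda>s. (?P n s)\<^sup>2) \<le> C * n" if "s \<in> {0..t * (real n)\<^sup>2}" for s
  proof -
    have "S.energy s + 2 * \<gamma> * integral {0..s} (\<lambda>s. (?P n s)\<^sup>2) \<le> S.energy 0 + (K / sqrt n)\<^sup>2 / (2 * \<gamma>) * s"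
      using that K by (intro S.energy_bound) auto
    also have "\<dots> \<le> (2 * (H * n) + 2 * (S * n)) + (K / sqrt n)\<^sup>2 / (2 * \<gamma>) * (t * (real n)\<^sup>2)"
      using down[of 0] H st that damping_pos by (intro add_mono mult_left_mono) auto
    also have "(K / sqrt n)\<^sup>2 / (2 * \<gamma>) * (t * (real n)\<^sup>2) = K\<^sup>2 / (2 * \<gamma>) * t * n"
      using n by (simp add: power_divide power2_eq_square)
    also have "2 * (H * n) + 2 * (S * n) + K\<^sup>2 / (2 * \<gamma>) * t * n = C * n"
      by (simp add: C_def shifted_bound_def S_def algebra_simps)
    finally show ?thesis .
  qed
  have cP: "continuous_on {0..s} (P n)" for s by (rule continuous_on_subset[OF P_cont]) auto
  have I0: "0 \<le> integral {0..s} (\<lambda>s. (?P n s)\<^sup>2)" for s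
    by (intro integral_nonneg integrable_continuous_real continuous_intros cP) auto
  have E0: "0 \<le> S.energy s" for s unfolding S.energy_def by (intro add_nonneg_nonneg sum_nonneg) auto
  have C0: "0 \<le> C * n"
    using SE[of 0] E0[of 0] t n by simp
  then have C0': "0 \<le> C" using n by (simp add: zero_le_mult_iff)
  have EC: "energy_const \<gamma> Fbar K H t * n = 2 * (C * n) + 2 * (S * n) + C * n / \<gamma> + 2 * S * t * n"
    by (simp add: energy_const_def C_def S_def algebra_simps)
  show "energy s \<le> energy_const \<gamma> Fbar K H t * n" if "s \<in> {0..t * (real n)\<^sup>2}"
  proof -
    have "energy s \<le> 2 * (C * n) + 2 * (S * n)"
      using up[of s] SE[OF that] st mult_nonneg_nonneg[OF _ I0[of s], of "2 * \<gamma>"] damping_pos by linarith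
    also have "\<dots> \<le> energy_const \<gamma> Fbar K H t * n"
      unfolding EC using C0 S0 damping_pos t by simp
    finally show ?thesis .
  qed
  let ?T = "t * (real n)\<^sup>2"
  have T: "?T \<in> {0..?T}" using t by simp
  have "integral {0..?T} (\<lambda>s. (P n s)\<^sup>2) \<le> integral {0..?T} (\<lambda>s. 2 * (?P n s)\<^sup>2 + 2 * (S / (real (n + 1))\<^sup>2))"
  proof (intro integral_le integrable_continuous_real continuous_intros cP)
    fix s
    have "(P n s)\<^sup>2 \<le> 2 * (?P n s)\<^sup>2 + 2 * (Fbar / (2 * \<gamma> * (n + 1)))\<^sup>2"
      using square_sum_le[of "?P n s" "Fbar / (2 * \<gamma> * (n + 1))"] by simp
    then show "(P n s)\<^sup>2 \<le> 2 * (?P n s)\<^sup>2 + 2 * (S / (real (n + 1))\<^sup>2)" using Pst by simp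
  qed
  also have "\<dots> = 2 * integral {0..?T} (\<lambda>s. (?P n s)\<^sup>2) + 2 * (S / (real (n + 1))\<^sup>2) * ?T"
  proof (rule integral_unique)
    have "((\<lambda>s. 2 * (S / (real (n + 1))\<^sup>2)) has_integral 2 * (S / (real (n + 1))\<^sup>2) * ?T) {0..?T}"
      using has_integral_const_real[of "2 * (S / (real (n + 1))\<^sup>2)" 0 ?T] t by (simp add: mult.commute)
    then show "((\<lambda>s. 2 * (?P n s)\<^sup>2 + 2 * (S / (real (n + 1))\<^sup>2)) has_integral
       2 * integral {0..?T} (\<lambda>s. (?P n s)\<^sup>2) + 2 * (S / (real (n + 1))\<^sup>2) * ?T) {0..?T}"
      by (intro has_integral_add has_integral_mult_right integrable_integral integrable_continuous_real continuous_intros cP)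
  qed
  also have "\<dots> \<le> C * n / \<gamma> + 2 * S * t * n"
  proof (rule add_mono)
    have "2 * \<gamma> * integral {0..?T} (\<lambda>s. (?P n s)\<^sup>2) \<le> C * n" using SE[OF T] E0[of ?T] by linarith
    then show "2 * integral {0..?T} (\<lambda>s. (?P n s)\<^sup>2) \<le> C * n / \<gamma>"
      using damping_pos by (simp add: field_simps)
    have "(real n)\<^sup>2 / (real (n + 1))\<^sup>2 \<le> 1" by simp
    also have "1 \<le> real n" using n by simp
    finally have "2 * S * t * ((real n)\<^sup>2 / (real (n + 1))\<^sup>2) \<le> 2 * S * t * n"
      using S0 t by (intro mult_left_mono) auto
    then show "2 * (S / (real (n + 1))\<^sup>2) * ?T \<le> 2 * S * t * n" by simp
  qed
  also have "\<dots> \<le> energy_const \<gamma> Fbar K H t * n"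
    unfolding EC using C0 S0 by simp
  finally show "integral {0..?T} (\<lambda>s. (P n s)\<^sup>2) \<le> energy_const \<gamma> Fbar K H t * n" .
qed

text \<open>\<open>\<bar>y\<bar> \<le> 1 + y\<^sup>2\<close> for each of the n stretches and n+1
  momenta. A bound linear in n is all that the boundary terms in time require.\<close>

lemma abs_sum_le_energy:
  "(\<Sum>x<n. \<bar>R (Suc x) s\<bar>) + (\<Sum>x\<le>n. \<bar>P x s\<bar>) \<le> 2 * real n + 1 + energy s"
proof -
  have le: "\<bar>y\<bar> \<le> 1 + y\<^sup>2" for y :: real
    using sum_squares_bound[of "\<bar>y\<bar>" 1] by simp
  have "(\<Sum>x<n. \<bar>R (Suc x) s\<bar>) + (\<Sum>x\<le>n. \<bar>P x s\<bar>) \<le> (\<Sum>x<n. 1 + (R (Suc x) s)\<^sup>2) + (\<Sum>x\<le>n. 1 + (P x s)\<^sup>2)"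
    by (intro add_mono sum_mono le)
  also have "\<dots> = 2 * real n + 1 + energy s" by (simp add: sum.distrib energy_def)
  finally show ?thesis .
qed

lemma norm_pairing_le:
  assumes "\<And>x. x < n \<Longrightarrow> norm (u (Suc x)) \<le> B" "\<And>x. x \<le> n \<Longrightarrow> norm (v x) \<le> B"
  shows "norm (pairing u v s) \<le> B * (2 * real n + 1 + energy s)"
proof -
  have B: "B \<ge> 0" using assms(2)[of 0] norm_ge_zero order_trans by blast
  have "norm (pairing u v s) \<le> (\<Sum>x<n. norm (R (Suc x) s *\<^sub>R u (Suc x))) + (\<Sum>x\<le>n. norm (P x s *\<^sub>R v x))"
    unfolding pairing_def by (intro order_trans[OF norm_triangle_ineq] add_mono norm_sum)
  also have "\<dots> \<le> (\<Sum>x<n. B * \<bar>R (Suc x) s\<bar>) + (\<Sum>x\<le>n. B * \<bar>P x s\<bar>)"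
    using assms by (intro add_mono sum_mono) (auto simp: mult.commute intro!: mult_right_mono)
  also have "\<dots> = B * ((\<Sum>x<n. \<bar>R (Suc x) s\<bar>) + (\<Sum>x\<le>n. \<bar>P x s\<bar>))"
    by (simp add: sum_distrib_left distrib_left)
  also have "\<dots> \<le> B * (2 * real n + 1 + energy s)"
    using abs_sum_le_energy B by (intro mult_left_mono)
  finally show ?thesis .
qed

end

section \<open>The dispersion relation and the boundary wave\<close>

text \<open>Wave profiles z^x of frequency a satisfy z + 1/z = 2 + m, whose two roots are inverse to
  each other. The decaying one is expressed through the square root S of the limit formula by a
  Cayley transform. The last identity follows from (1 - z)/(2\<gamma> + i a) = (a/2)(S - i) and
  links the response at the end to Re S.\<close>

lemma csqrt_resolvent:
  assumes "\<gamma> > 0" "a > 0"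
  defines "S \<equiv> csqrt (4 / ((of_real a)\<^sup>2 - 2 * \<i> * of_real \<gamma> * of_real a) - 1)"
    and "m \<equiv> \<i> * of_real a * (2 * of_real \<gamma> + \<i> * of_real a)"
  obtains z where "norm z < 1" "z \<noteq> 0" "1 + z\<^sup>2 = (2 + m) * z"
    "2 * Re ((1 - z) / (2 * of_real \<gamma> + \<i> * of_real a)) = a * Re S"
proof -
  define q where "q = (of_real a)\<^sup>2 - 2 * \<i> * of_real \<gamma> * of_real a"
  have Imq: "Im q = - (2 * \<gamma> * a)" by (simp add: q_def power2_eq_square)
  then have q0: "q \<noteq> 0" using assms(1,2) by auto
  have mq: "m = - q" by (simp add: m_def q_def power2_eq_square algebra_simps)
  have SS: "S\<^sup>2 = 4 / q - 1" by (simp add: S_def q_def)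
  \<comment> \<open>Since S^2 lies in the upper half plane and the principal root has Re S \<ge> 0,
    both Re S and Im S are positive. The sign of Im S is what makes z decay.\<close>
  have "Im (4 / q) = 4 * (2 * \<gamma> * a) / (cmod q)\<^sup>2"
    by (simp add: Im_divide Imq cmod_power2)
  then have "Im (S\<^sup>2) > 0"
    unfolding SS using assms(1,2) q0 by simp
  then have "Re S * Im S > 0" by (simp add: power2_eq_square mult.commute)
  then have ImS: "Im S > 0" and ReS: "Re S > 0"
    using csqrt_principal[of "4 / q - 1"] by (auto simp: S_def q_def zero_less_mult_iff)
  \<comment> \<open>Solving (1-z)^2 = m z with m = -q and S^2 = 4/q - 1 gives 1 - z = 2/(1 - i S).
    The modulus is below 1 because 1 + i S is shorter than 1 - i S.\<close>
  define z where "z = - ((1 + \<i> * S) / (1 - \<i> * S))"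
  have prod: "(1 + \<i> * S) * (1 - \<i> * S) = 4 / q"
    using SS by (simp add: algebra_simps power2_eq_square)
  then have nz: "1 + \<i> * S \<noteq> 0" "1 - \<i> * S \<noteq> 0" using q0 by auto
  have "(cmod (1 + \<i> * S))\<^sup>2 < (cmod (1 - \<i> * S))\<^sup>2"
    using ImS unfolding cmod_power2 by (simp add: power2_eq_square algebra_simps)
  then have "cmod (1 + \<i> * S) < cmod (1 - \<i> * S)" by (simp add: power2_less_imp_less)
  then have z1: "norm z < 1" using nz by (simp add: z_def norm_divide)
  have z0: "z \<noteq> 0"
    unfolding z_def neg_equal_0_iff_equal divide_eq_0_iff using nz by blast
  have omz: "1 - z = 2 / (1 - \<i> * S)" using nz by (simp add: z_def field_simps)
  have z2: "1 + z\<^sup>2 = (2 + m) * z"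
  proof -
    have "(1 - z)\<^sup>2 = m * z"
    proof -
      have "(1 - z)\<^sup>2 = 4 / (1 - \<i> * S)\<^sup>2" by (simp add: omz power_divide)
      also have "4 = q * ((1 + \<i> * S) * (1 - \<i> * S))" using prod q0 by simp
      also have "\<dots> / (1 - \<i> * S)\<^sup>2 = m * z" using nz by (simp add: mq z_def power2_eq_square)
      finally show ?thesis .
    qed
    then show ?thesis by (simp add: power2_eq_square algebra_simps)
  qed
  have "(1 - z) / (2 * of_real \<gamma> + \<i> * of_real a) = of_real (a / 2) * (S - \<i>)"
  proof -
    have g0: "2 * of_real \<gamma> + \<i> * of_real a \<noteq> (0::complex)" using assms(1) by (auto simp: complex_eq_iff)
    have "(1 - z) * (\<i> * of_real a) = of_real (a / 2) * (S - \<i>) * m"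
    proof -
      have "of_real (a / 2) * (S - \<i>) = - (\<i> * of_real a) * (1 + \<i> * S) / 2"
        by (simp add: algebra_simps)
      then have "of_real (a / 2) * (S - \<i>) * m = \<i> * of_real a * ((1 + \<i> * S) * q) / 2"
        by (simp add: mq)
      also have "(1 + \<i> * S) * q = 4 / (1 - \<i> * S)" using prod q0 nz by (simp add: field_simps)
      also have "4 / (1 - \<i> * S) = 2 * (1 - z)" by (simp add: omz)
      also have "\<i> * of_real a * (2 * (1 - z)) / 2 = (1 - z) * (\<i> * of_real a)" by simp
      finally show ?thesis by (rule sym)
    qed
    then have "(1 - z) * (\<i> * of_real a) = of_real (a / 2) * (S - \<i>) * (2 * of_real \<gamma> + \<i> * of_real a) * (\<i> * of_real a)"
      by (simp add: m_def mult_ac)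
    then have "1 - z = of_real (a / 2) * (S - \<i>) * (2 * of_real \<gamma> + \<i> * of_real a)"
      using assms(2) by simp
    then show ?thesis using g0 by (simp add: field_simps)
  qed
  then have "Re ((1 - z) / (2 * of_real \<gamma> + \<i> * of_real a)) = Re (of_real (a / 2) * (S - \<i>))"
    by (simp only:)
  also have "\<dots> = a / 2 * Re S" by simp
  finally have "2 * Re ((1 - z) / (2 * of_real \<gamma> + \<i> * of_real a)) = a * Re S" by simp
  then show thesis using that z1 z0 z2 by blast
qed

text \<open>The combination of z^x and z^(-x) that vanishes at 0 and equals -1 at n+1, multiplied
  through by a power of z so that no negative exponent remains. The second power is the reflection
  at the left end.\<close>

definition decaying_wave :: "complex \<Rightarrow> nat \<Rightarrow> nat \<Rightarrow> complex" where
  "decaying_wave z n x = - (z ^ (n + 1 - x) - z ^ (n + 1 + x)) / (1 - z ^ (2 * n + 2))"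

text \<open>Only powers with nonnegative exponents occur and the denominator stays above 1 - |z|, so
  the bound is uniform in n and in the site. At the last bond the reflected part is of order z^(2n),
  and the limit is that of a half-infinite chain.\<close>

lemma decaying_wave:
  assumes z: "norm z < 1" and zm: "1 + z\<^sup>2 = (2 + m) * z"
  shows "decaying_wave z n 0 = 0" "decaying_wave z n (Suc n) = - 1"
    and "x < n \<Longrightarrow> decaying_wave z n (Suc (Suc x)) - 2 * decaying_wave z n (Suc x) + decaying_wave z n x
      = m * decaying_wave z n (Suc x)"
    and "norm (decaying_wave z n y) \<le> 2 / (1 - norm z)"
    and "(\<lambda>n. decaying_wave z n n) \<longlonglongrightarrow> - z"
proof -
  have pow_le: "norm z ^ k \<le> 1" for k using z by (intro power_le_one) auto
  have den: "norm (1 - z ^ (2 * n + 2)) \<ge> 1 - norm z" for n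
  proof -
    have "norm z ^ (2 * n + 2) \<le> norm z ^ 1" using z by (intro power_decreasing) auto
    then have "1 - norm z \<le> norm (1::complex) - norm (z ^ (2 * n + 2))"
      unfolding norm_power norm_one power_one_right by linarith
    also have "\<dots> \<le> norm (1 - z ^ (2 * n + 2))" by (rule norm_triangle_ineq2)
    finally show ?thesis .
  qed
  then have den0: "1 - z ^ (2 * n + 2) \<noteq> 0" for n using z by (metis diff_gt_0_iff_gt leD norm_zero)
  show "decaying_wave z n 0 = 0" by (simp add: decaying_wave_def)
  show "decaying_wave z n (Suc n) = - 1"
  proof -
    have e: "n + 1 - Suc n = 0" "n + 1 + Suc n = 2 * n + 2" by auto
    show ?thesis
      unfolding decaying_wave_def e
      by (simp only: power_0 minus_divide_left[symmetric] divide_self[OF den0])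
  qed
  show "norm (decaying_wave z n y) \<le> 2 / (1 - norm z)"
  proof -
    have "norm (z ^ (n + 1 - y) - z ^ (n + 1 + y)) \<le> norm (z ^ (n + 1 - y)) + norm (z ^ (n + 1 + y))"
      by (rule norm_triangle_ineq4)
    also have "\<dots> \<le> 1 + 1" unfolding norm_power by (intro add_mono pow_le)
    finally have "norm (z ^ (n + 1 - y) - z ^ (n + 1 + y)) \<le> 2" by simp
    then have "norm (z ^ (n + 1 - y) - z ^ (n + 1 + y)) / norm (1 - z ^ (2 * n + 2)) \<le> 2 / (1 - norm z)"
      using den[of n] z by (intro frac_le) auto
    then show ?thesis unfolding decaying_wave_def norm_divide norm_minus_cancel .
  qed
  show "decaying_wave z n (Suc (Suc x)) - 2 * decaying_wave z n (Suc x) + decaying_wave z n x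
      = m * decaying_wave z n (Suc x)" if xn: "x < n"
  proof -
    let ?w = "\<lambda>x. z ^ (n + 1 - x) - z ^ (n + 1 + x)"
    obtain j where j: "n = x + Suc j" using less_imp_Suc_add[OF xn] by auto
    have a: "n + 1 - x = Suc (Suc j)" "n + 1 - Suc x = Suc j" "n + 1 - Suc (Suc x) = j"
      "n + 1 + Suc x = Suc (n + 1 + x)" "n + 1 + Suc (Suc x) = Suc (Suc (n + 1 + x))"
      using j by auto
    have "?w (Suc (Suc x)) + ?w x = (1 + z\<^sup>2) * (z ^ j - z ^ (n + 1 + x))"
      unfolding a by (simp add: algebra_simps power2_eq_square)
    also have "\<dots> = (2 + m) * ?w (Suc x)"
      unfolding zm a by (simp add: algebra_simps)
    finally have "?w (Suc (Suc x)) - 2 * ?w (Suc x) + ?w x = m * ?w (Suc x)" by (simp add: algebra_simps)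
    moreover have dw: "decaying_wave z n x = - 1 / (1 - z ^ (2 * n + 2)) * ?w x" for x
      unfolding decaying_wave_def
      by (simp only: minus_divide_left[symmetric] times_divide_eq_left mult_1_left mult_minus_left)
    have "c * A - 2 * (c * B) + c * C = c * (A - 2 * B + C)" for c A B C :: complex
      by (simp add: algebra_simps)
    ultimately show ?thesis unfolding dw by (simp only: mult.left_commute[of m])
  qed
  have "(\<lambda>n. (z\<^sup>2) ^ n) \<longlonglongrightarrow> 0"
    using z by (intro LIMSEQ_power_zero) (simp add: norm_power power_less_one_iff)
  then have L: "(\<lambda>n. z ^ (2 * n)) \<longlonglongrightarrow> 0" by (simp add: power_mult)
  have "(\<lambda>n. - (z - z ^ (2 * n) * z) / (1 - z ^ (2 * n) * z\<^sup>2)) \<longlonglongrightarrow> - (z - 0 * z) / (1 - 0 * z\<^sup>2)"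
    by (intro tendsto_intros L) simp
  then show "(\<lambda>n. decaying_wave z n n) \<longlonglongrightarrow> - z"
    by (simp add: decaying_wave_def mult_2[symmetric] power_add power2_eq_square mult_ac)
qed

section \<open>Time averages of harmonics\<close>

lemma integral_sums:
  fixes F :: "nat \<Rightarrow> real \<Rightarrow> 'a::banach"
  assumes c: "\<And>j. continuous_on {a..b} (F j)"
    and M: "\<And>j s. s \<in> {a..b} \<Longrightarrow> norm (F j s) \<le> M j" "summable M"
  shows "(\<lambda>j. integral {a..b} (F j)) sums integral {a..b} (\<lambda>s. \<Sum>j. F j s)"
proof -
  have ul: "uniform_limit {a..b} (\<lambda>n s. \<Sum>j<n. F j s) (\<lambda>s. \<Sum>j. F j s) sequentially"
    by (rule Weierstrass_m_test[OF M])
  obtain I J where IJ: "\<And>n. ((\<lambda>s. \<Sum>j<n. F j s) has_integral I n) {a..b}"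
    "((\<lambda>s. \<Sum>j. F j s) has_integral J) {a..b}" "I \<longlonglongrightarrow> J"
    by (rule uniform_limit_integral[OF ul]) (auto intro!: continuous_intros c)
  have "((\<lambda>s. \<Sum>j<n. F j s) has_integral (\<Sum>j<n. integral {a..b} (F j))) {a..b}" for n
    by (intro has_integral_sum integrable_integral integrable_continuous_real c) auto
  then have "I n = (\<Sum>j<n. integral {a..b} (F j))" for n
    using IJ(1)[of n] by (auto dest: has_integral_unique)
  then have "I = (\<lambda>n. \<Sum>j<n. integral {a..b} (F j))" by blast
  then show ?thesis using IJ(2,3) by (simp add: sums_def integral_unique)
qed

text \<open>A nonconstant harmonic has a bounded primitive, so its integral does not grow with T.
  This removes both the constant force and the off-resonant harmonics after division by a diverging
  factor.\<close>

lemma exp_i_integral: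
  assumes "b \<noteq> 0"
  shows "norm (integral {0..T} (\<lambda>s. exp (\<i> * of_real (b * s)))) \<le> 2 / \<bar>b\<bar>"
proof (cases "T \<ge> 0")
  case True
  have "((\<lambda>s. exp (\<i> * of_real (b * s))) has_integral
     exp (\<i> * of_real (b * T)) / (\<i> * of_real b) - exp (\<i> * of_real (b * 0)) / (\<i> * of_real b)) {0..T}"
  proof (rule fundamental_theorem_of_calculus[OF True])
    fix s :: real
    have "((\<lambda>s::complex. exp (\<i> * (of_real b * s)) / (\<i> * of_real b)) has_field_derivative exp (\<i> * (of_real b * of_real s))) (at (of_real s))"
      using assms by (auto intro!: derivative_eq_intros simp: field_simps)
    from has_vector_derivative_real_field[OF this]
    show "((\<lambda>s. exp (\<i> * of_real (b * s)) / (\<i> * of_real b)) has_vector_derivative exp (\<i> * of_real (b * s))) (at s within {0..T})"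
      by simp
  qed
  then have "integral {0..T} (\<lambda>s. exp (\<i> * of_real (b * s))) = (exp (\<i> * of_real (b * T)) - 1) / (\<i> * of_real b)"
    by (simp add: integral_unique diff_divide_distrib)
  moreover have "norm (exp (\<i> * of_real (b * T)) - 1) \<le> 2"
    using norm_triangle_ineq4[of "exp (\<i> * of_real (b * T))" 1] by simp
  ultimately show ?thesis using assms by (simp add: norm_divide norm_mult divide_right_mono)
qed simp

lemma exp_i_average:
  assumes "filterlim T at_top sequentially"
  shows "(\<lambda>n. integral {0..T n} (\<lambda>s. exp (\<i> * of_real (b * s))) / of_real (T n)) \<longlonglongrightarrow> (if b = 0 then 1 else 0)"
proof (cases "b = 0")
  case True
  have "eventually (\<lambda>n. T n > 0) sequentially" using assms by (simp add: filterlim_at_top_dense)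
  then have "eventually (\<lambda>n. integral {0..T n} (\<lambda>s. exp (\<i> * of_real (b * s))) / of_real (T n) = 1) sequentially"
    by eventually_elim (use True in \<open>simp add: scaleR_conv_of_real\<close>)
  then show ?thesis using True by (simp add: tendsto_eventually)
next
  case False
  have "eventually (\<lambda>n. T n > 0) sequentially" using assms by (simp add: filterlim_at_top_dense)
  then have "eventually (\<lambda>n. norm (integral {0..T n} (\<lambda>s. exp (\<i> * of_real (b * s))) / of_real (T n)) \<le> 2 / \<bar>b\<bar> / T n) sequentially"
  proof eventually_elim
    case (elim n)
    then show ?case
      using divide_right_mono[OF exp_i_integral[OF False, of "T n"], of "T n"] by (simp only: norm_divide norm_of_real abs_of_pos)
  qed
  moreover have "(\<lambda>n. 2 / \<bar>b\<bar> / T n) \<longlonglongrightarrow> 0"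
    by (rule real_tendsto_divide_at_top[OF tendsto_const assms])
  ultimately show ?thesis using False by (auto intro: Lim_null_comparison)
qed

text \<open>The joint contribution of the Fourier terms of frequencies a and -a with conjugate
  coefficients, as \<open>harmonic_eq\<close> spells out.\<close>

definition harmonic :: "complex \<Rightarrow> real \<Rightarrow> real \<Rightarrow> real" where
  "harmonic c a t = 2 * Re (c * exp (\<i> * of_real (a * t)))"

lemma harmonic_bound: "\<bar>harmonic c a t\<bar> \<le> 2 * norm c"
  using abs_Re_le_cmod[of "c * exp (\<i> * of_real (a * t))"] by (simp add: harmonic_def norm_mult)

lemma harmonic_cont [continuous_intros]: "continuous_on A (harmonic c a)"
  unfolding harmonic_def[abs_def] by (intro continuous_intros)

lemma harmonic_eq:
  "of_real (harmonic c a t) = c * exp (\<i> * of_real (a * t)) + cnj c * exp (- \<i> * of_real (a * t))"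
proof -
  have "cnj (exp (\<i> * of_real (a * t))) = exp (- \<i> * of_real (a * t))" by (simp add: exp_cnj)
  then show ?thesis
    using complex_add_cnj[of "c * exp (\<i> * of_real (a * t))"] by (simp add: harmonic_def)
qed

definition oscillation :: "real \<Rightarrow> (nat \<Rightarrow> complex) \<Rightarrow> real \<Rightarrow> real" where
  "oscillation \<omega> f t = (\<Sum>k. harmonic (f k) (real (Suc k) * \<omega>) t)"

lemma oscillation_sums:
  assumes "summable (\<lambda>k. norm (f k))"
  shows "(\<lambda>k. harmonic (f k) (real (Suc k) * \<omega>) t) sums oscillation \<omega> f t"
  unfolding oscillation_def
  by (rule summable_sums, rule summable_comparison_test'[where N = 0, OF summable_mult[OF assms]])
    (use harmonic_bound in auto)

lemma oscillation_cont:
  assumes "summable (\<lambda>k. norm (f k))"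
  shows "continuous_on A (oscillation \<omega> f)"
proof -
  have "uniform_limit A (\<lambda>n s. \<Sum>k<n. harmonic (f k) (real (Suc k) * \<omega>) s) (oscillation \<omega> f) sequentially"
    unfolding oscillation_def[abs_def]
    by (rule Weierstrass_m_test[where M = "\<lambda>k. 2 * norm (f k)"])
      (use harmonic_bound in \<open>auto intro: summable_mult assms\<close>)
  then show ?thesis
    by (rule uniform_limit_theorem[rotated]) (auto intro!: always_eventually continuous_on_sum harmonic_cont)
qed

lemma oscillation_bound:
  assumes "summable (\<lambda>k. norm (f k))"
  shows "\<bar>oscillation \<omega> f t\<bar> \<le> (\<Sum>k. 2 * norm (f k))"
proof -
  have s: "summable (\<lambda>k. 2 * norm (f k))" by (intro summable_mult assms)
  have s': "summable (\<lambda>k. \<bar>harmonic (f k) (real (Suc k) * \<omega>) t\<bar>)"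
    by (rule summable_comparison_test'[OF s, where N = 0]) (use harmonic_bound in auto)
  have "\<bar>oscillation \<omega> f t\<bar> \<le> (\<Sum>k. \<bar>harmonic (f k) (real (Suc k) * \<omega>) t\<bar>)"
    unfolding oscillation_def by (rule summable_rabs[OF s'])
  also have "\<dots> \<le> (\<Sum>k. 2 * norm (f k))"
    by (rule suminf_le[OF harmonic_bound s' s])
  finally show ?thesis .
qed

text \<open>Averaging against exp (-i (k+1) \<omega> s) extracts the k-th Fourier coefficient. Each
  harmonic averages to its resonant part; the limit is exchanged with the sum over harmonics by
  dominated summation, with the bound 2 |f_j| on each average.\<close>

lemma oscillation_average:
  assumes f: "summable (\<lambda>k. norm (f k))" and \<omega>: "\<omega> > 0" and T: "filterlim T at_top sequentially" "\<And>n. T n \<ge> 0"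
  shows "(\<lambda>n. integral {0..T n} (\<lambda>s. exp (- \<i> * of_real (real (Suc k) * \<omega> * s)) * of_real (oscillation \<omega> f s)) / of_real (T n)) \<longlonglongrightarrow> f k"
proof -
  let ?e = "\<lambda>s. exp (- \<i> * of_real (real (Suc k) * \<omega> * s))"
  let ?h = "\<lambda>j s. of_real (harmonic (f j) (real (Suc j) * \<omega>) s) :: complex"
  have s: "summable (\<lambda>k. 2 * norm (f k))" by (intro summable_mult f)
  have hb: "norm (?e s * ?h j s) \<le> 2 * norm (f j)" for j s
    using harmonic_bound[of "f j" "real (Suc j) * \<omega>" s] by (simp add: norm_mult del: of_nat_Suc)
  have hc: "continuous_on A (\<lambda>s. ?e s * ?h j s)" for A j
    by (intro continuous_intros harmonic_cont)
  have "(\<lambda>n. \<Sum>j. integral {0..T n} (\<lambda>s. ?e s * ?h j s) / of_real (T n)) \<longlonglongrightarrow> (\<Sum>j. if j = k then f k else 0)"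
  proof (rule tannerys_theorem[THEN conjunct2, THEN conjunct2])
    fix j
    \<comment> \<open>The two frequencies are (j-k) \<omega> and -(j+k+2) \<omega>. The second never
      vanishes, so the conjugate half is never resonant.\<close>
    have eq: "?e s * ?h j s = f j * exp (\<i> * of_real ((real j - real k) * \<omega> * s)) + cnj (f j) * exp (\<i> * of_real (- (real j + real k + 2) * \<omega> * s))" for s
    proof -
      have "?e s * ?h j s = f j * (?e s * exp (\<i> * of_real (real (Suc j) * \<omega> * s))) + cnj (f j) * (?e s * exp (- \<i> * of_real (real (Suc j) * \<omega> * s)))"
        unfolding harmonic_eq by (simp only: distrib_left mult.left_commute)
      also have "?e s * exp (\<i> * of_real (real (Suc j) * \<omega> * s)) = exp (\<i> * of_real ((real j - real k) * \<omega> * s))"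
        unfolding exp_add[symmetric] by (rule arg_cong[where f = exp]) (simp add: algebra_simps)
      also have "?e s * exp (- \<i> * of_real (real (Suc j) * \<omega> * s)) = exp (\<i> * of_real (- (real j + real k + 2) * \<omega> * s))"
        unfolding exp_add[symmetric] by (rule arg_cong[where f = exp]) (simp add: algebra_simps)
      finally show ?thesis .
    qed
    have "integral {0..T n} (\<lambda>s. ?e s * ?h j s) / of_real (T n) =
      f j * (integral {0..T n} (\<lambda>s. exp (\<i> * of_real ((real j - real k) * \<omega> * s))) / of_real (T n)) +
      cnj (f j) * (integral {0..T n} (\<lambda>s. exp (\<i> * of_real (- (real j + real k + 2) * \<omega> * s))) / of_real (T n))" for n
    proof -
      have "integral {0..T n} (\<lambda>s. ?e s * ?h j s) =
        f j * integral {0..T n} (\<lambda>s. exp (\<i> * of_real ((real j - real k) * \<omega> * s))) +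
        cnj (f j) * integral {0..T n} (\<lambda>s. exp (\<i> * of_real (- (real j + real k + 2) * \<omega> * s)))"
        unfolding eq
        by (intro integral_unique has_integral_add has_integral_mult_right integrable_integral
            integrable_continuous_real continuous_intros)
      then show ?thesis by (simp only: add_divide_distrib times_divide_eq_right)
    qed
    moreover have "(\<lambda>n. f j * (integral {0..T n} (\<lambda>s. exp (\<i> * of_real ((real j - real k) * \<omega> * s))) / of_real (T n)) +
      cnj (f j) * (integral {0..T n} (\<lambda>s. exp (\<i> * of_real (- (real j + real k + 2) * \<omega> * s))) / of_real (T n)))
      \<longlonglongrightarrow> f j * (if (real j - real k) * \<omega> = 0 then 1 else 0) + cnj (f j) * (if - (real j + real k + 2) * \<omega> = 0 then 1 else 0)"
      by (intro tendsto_intros exp_i_average T)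
    moreover have "f j * (if (real j - real k) * \<omega> = 0 then 1 else 0) + cnj (f j) * (if - (real j + real k + 2) * \<omega> = 0 then 1 else 0) = (if j = k then f k else 0)"
      using \<omega> by auto
    ultimately show "(\<lambda>n. integral {0..T n} (\<lambda>s. ?e s * ?h j s) / of_real (T n)) \<longlonglongrightarrow> (if j = k then f k else 0)"
      by simp
  next
    have "norm (integral {0..T n} (\<lambda>s. ?e s * ?h j s) / of_real (T n)) \<le> 2 * norm (f j)" for j n
    proof (cases "T n = 0")
      case False
      then have Tn: "T n > 0" using T(2)[of n] by simp
      have "norm (integral {0..T n} (\<lambda>s. ?e s * ?h j s)) \<le> 2 * norm (f j) * (T n - 0)"
        using Tn by (intro integral_bound hc hb) auto
      then show ?thesis using Tn by (simp add: norm_divide divide_le_eq)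
    qed simp
    then show "\<forall>\<^sub>F (j, n) in at_top \<times>\<^sub>F sequentially. norm (integral {0..T n} (\<lambda>s. ?e s * ?h j s) / of_real (T n)) \<le> 2 * norm (f j)"
      by (intro always_eventually) auto
  qed (use s in auto)
  moreover have "(\<Sum>j. integral {0..T n} (\<lambda>s. ?e s * ?h j s) / of_real (T n)) =
     integral {0..T n} (\<lambda>s. ?e s * of_real (oscillation \<omega> f s)) / of_real (T n)" for n
  proof -
    have "(\<lambda>j. integral {0..T n} (\<lambda>s. ?e s * ?h j s)) sums integral {0..T n} (\<lambda>s. \<Sum>j. ?e s * ?h j s)"
      by (rule integral_sums[OF hc hb s])
    moreover have "(\<Sum>j. ?e s * ?h j s) = ?e s * of_real (oscillation \<omega> f s)" for s
    proof -
      have "(\<lambda>j. ?h j s) sums of_real (oscillation \<omega> f s)"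
        by (intro sums_of_real oscillation_sums f)
      then show ?thesis by (intro sums_unique[symmetric] sums_mult)
    qed
    ultimately show ?thesis by (simp add: sums_divide sums_unique[symmetric] del: of_nat_Suc)
  qed
  moreover have "(\<Sum>j. if j = k then f k else 0) = f k"
    using sums_unique[OF sums_If_finite[of "\<lambda>j. j = k" "\<lambda>j. f k"]] by simp
  ultimately show ?thesis by simp
qed

section \<open>The work of the oscillating force\<close>

text \<open>All chain lengths at once, reduced to deterministic data: the averaged dynamics,
  summable amplitudes and an energy of order n at time 0. The work limits are derived from these
  data alone.\<close>

locale forced_chains =
  fixes \<gamma> Fbar \<omega> H :: real and f :: "nat \<Rightarrow> complex" and R P :: "nat \<Rightarrow> nat \<Rightarrow> real \<Rightarrow> real"
  assumes \<gamma>_pos: "\<gamma> > 0" and \<omega>_pos: "\<omega> > 0" and f_summable: "summable (\<lambda>k. norm (f k))"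
    and chain: "n \<ge> 1 \<Longrightarrow>
      damped_chain \<gamma> n (\<lambda>t. Fbar + oscillation \<omega> f t / sqrt (real n)) (R n) (P n)"
    and energy_0: "n \<ge> 1 \<Longrightarrow> damped_chain.energy n (R n) (P n) 0 \<le> H * real n"
begin

definition Kosc :: real where "Kosc = (\<Sum>k. 2 * norm (f k))"

definition Cen :: "real \<Rightarrow> real" where "Cen t = energy_const \<gamma> Fbar Kosc H t"

lemma osc_bound: "\<bar>oscillation \<omega> f t\<bar> \<le> Kosc"
  unfolding Kosc_def by (rule oscillation_bound[OF f_summable])

lemma bounds:
  assumes n: "n \<ge> 1" and t: "t \<ge> 0"
  shows "s \<in> {0..t * (real n)\<^sup>2} \<Longrightarrow> damped_chain.energy n (R n) (P n) s \<le> Cen t * real n"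
    and "integral {0..t * (real n)\<^sup>2} (\<lambda>s. (P n n s)\<^sup>2) \<le> Cen t * real n"
proof -
  interpret damped_chain \<gamma> n "\<lambda>t. Fbar + oscillation \<omega> f t / sqrt (real n)" "R n" "P n"
    by (rule chain[OF n])
  have K: "\<bar>Fbar + oscillation \<omega> f s / sqrt (real n) - Fbar\<bar> \<le> Kosc / sqrt (real n)" for s
    using osc_bound[of s] by (simp add: abs_divide divide_right_mono)
  show "energy s \<le> Cen t * real n" if "s \<in> {0..t * (real n)\<^sup>2}"
    unfolding Cen_def by (rule macroscopic_bounds(1)[OF n K energy_0[OF n] t that])
  show "integral {0..t * (real n)\<^sup>2} (\<lambda>s. (P n n s)\<^sup>2) \<le> Cen t * real n"
    unfolding Cen_def by (rule macroscopic_bounds(2)[OF n K energy_0[OF n] t])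
qed

lemma Cen_nonneg: "t \<ge> 0 \<Longrightarrow> 0 \<le> Cen t"
proof -
  assume t: "t \<ge> 0"
  interpret damped_chain \<gamma> 1 "\<lambda>t. Fbar + oscillation \<omega> f t / sqrt (real 1)" "R 1" "P 1"
    by (rule chain) simp
  have "0 \<le> energy 0" unfolding energy_def by (intro add_nonneg_nonneg sum_nonneg) auto
  then show ?thesis using bounds(1)[of 1 t 0] t by simp
qed

lemma pairing_bound:
  assumes n: "n \<ge> 1" and s: "s \<in> {0..t * (real n)\<^sup>2}" and t: "t \<ge> 0"
    and B: "\<And>x. x < n \<Longrightarrow> norm (u (Suc x)) \<le> B" "\<And>x. x \<le> n \<Longrightarrow> norm (v x) \<le> B"
  shows "norm (damped_chain.pairing n (R n) (P n) u v s) \<le> B * (3 + Cen t) * real n"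
proof -
  interpret damped_chain \<gamma> n "\<lambda>t. Fbar + oscillation \<omega> f t / sqrt (real n)" "R n" "P n"
    by (rule chain[OF n])
  have B0: "B \<ge> 0" using B(2)[of 0] norm_ge_zero order_trans by blast
  have "norm (pairing u v s) \<le> B * (2 * real n + 1 + energy s)"
    by (rule norm_pairing_le[where u = u and v = v, OF B])
  also have "\<dots> \<le> B * ((3 + Cen t) * real n)"
    using bounds(1)[OF n t s] n B0 by (intro mult_left_mono) (auto simp: algebra_simps)
  finally show ?thesis by (simp add: mult.assoc)
qed

text \<open>The normalisation n^(3/2) combines the factor 1/n of the work with the amplitude 1/sqrt
  n of the oscillating force.\<close>

definition fourier_work :: "real \<Rightarrow> nat \<Rightarrow> nat \<Rightarrow> complex" where
  "fourier_work t k n = integral {0..t * (real n)\<^sup>2}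
     (\<lambda>s. exp (- \<i> * of_real (real (Suc k) * \<omega> * s)) * of_real (P n n s)) / of_real (real n * sqrt (real n))"

lemma P_cont': "n \<ge> 1 \<Longrightarrow> continuous_on {0..T} (P n n)"
  using damped_chain.P_cont[OF chain, of n n] by (auto elim!: continuous_on_subset)

text \<open>A bound uniform in both n and k, needed to exchange the limit with the sum over
  harmonics. The weighted inequality
  \<open>\<bar>P\<bar> \<le> sqrt n * P\<^sup>2 + 1 / sqrt n\<close> balances the two sides: the
  integral of the square is of order n, the time window is t n^2, and both terms become of order
  n^(3/2).\<close>

lemma fourier_work_bound:
  assumes n: "n \<ge> 1" and t: "t \<ge> 0"
  shows "norm (fourier_work t k n) \<le> Cen t + t"
proof -
  let ?T = "t * (real n)\<^sup>2"
  have np: "sqrt (real n) > 0" using n by simp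
  note c = P_cont'[OF n]
  have "norm (integral {0..?T} (\<lambda>s. exp (- \<i> * of_real (real (Suc k) * \<omega> * s)) * of_real (P n n s)))
     \<le> integral {0..?T} (\<lambda>s. sqrt (real n) * (P n n s)\<^sup>2 + 1 / sqrt (real n))"
  proof (rule integral_norm_bound_integral)
    fix s
    have "2 * (sqrt (sqrt (real n)) * \<bar>P n n s\<bar>) * (1 / sqrt (sqrt (real n))) \<le>
      (sqrt (sqrt (real n)) * \<bar>P n n s\<bar>)\<^sup>2 + (1 / sqrt (sqrt (real n)))\<^sup>2"
      by (rule sum_squares_bound)
    then have "2 * \<bar>P n n s\<bar> \<le> sqrt (real n) * (P n n s)\<^sup>2 + 1 / sqrt (real n)"
      using n by (simp add: power_mult_distrib power_divide)
    moreover have "0 \<le> sqrt (real n) * (P n n s)\<^sup>2 + 1 / sqrt (real n)" by simp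
    ultimately have "\<bar>P n n s\<bar> \<le> sqrt (real n) * (P n n s)\<^sup>2 + 1 / sqrt (real n)" by linarith
    then show "norm (exp (- \<i> * of_real (real (Suc k) * \<omega> * s)) * of_real (P n n s)) \<le> sqrt (real n) * (P n n s)\<^sup>2 + 1 / sqrt (real n)"
      by (simp add: norm_mult)
  qed (intro integrable_continuous_real continuous_intros c; use np in simp)+
  also have "\<dots> = sqrt (real n) * integral {0..?T} (\<lambda>s. (P n n s)\<^sup>2) + 1 / sqrt (real n) * ?T"
  proof (rule integral_unique)
    have "((\<lambda>s. 1 / sqrt (real n)) has_integral 1 / sqrt (real n) * ?T) {0..?T}"
      using has_integral_const_real[of "1 / sqrt (real n)" 0 ?T] t by (simp add: mult.commute)
    then show "((\<lambda>s. sqrt (real n) * (P n n s)\<^sup>2 + 1 / sqrt (real n)) has_integral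
       sqrt (real n) * integral {0..?T} (\<lambda>s. (P n n s)\<^sup>2) + 1 / sqrt (real n) * ?T) {0..?T}"
      by (intro has_integral_add has_integral_mult_right integrable_integral integrable_continuous_real continuous_intros c)
  qed
  also have "\<dots> \<le> sqrt (real n) * (Cen t * real n) + t * (real n * sqrt (real n))"
  proof (rule add_mono)
    have "(real n)\<^sup>2 / sqrt (real n) = real n * sqrt (real n)"
      using n by (simp add: power2_eq_square field_simps)
    then show "1 / sqrt (real n) * ?T \<le> t * (real n * sqrt (real n))"
      by (metis (no_types, opaque_lifting) mult.left_commute mult_1 order_refl times_divide_eq_left)
  qed (intro mult_left_mono bounds(2) n t; simp)
  also have "\<dots> = (Cen t + t) * (real n * sqrt (real n))" by (simp add: algebra_simps)
  finally show ?thesis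
    unfolding fourier_work_def using n by (simp add: norm_divide norm_mult divide_le_eq)
qed

lemma at_top_scaled_squares: "t > 0 \<Longrightarrow> filterlim (\<lambda>n. t * (real n)\<^sup>2) at_top sequentially"
  by real_asymp

text \<open>The dual vector is the boundary wave of the frequency in question, so the momentum
  integral equals v_n times the force integral, up to boundary terms in time. In the limit only the
  resonant coefficient f_k survives, multiplied by the response (1 - z)/(2\<gamma> + i a) of the
  last particle.\<close>

lemma fourier_work_limit:
  assumes t: "t > 0"
  shows "\<exists>V. fourier_work t k \<longlonglongrightarrow> V \<and>
    2 * Re (cnj (f k) * V) = (norm (f k))\<^sup>2 * (real (Suc k) * \<omega>) *
      Re (csqrt (4 / ((of_real (real (Suc k) * \<omega>))\<^sup>2 - 2 * \<i> * of_real \<gamma> * of_real (real (Suc k) * \<omega>)) - 1)) * t"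
proof -
  define a where "a = real (Suc k) * \<omega>"
  have a: "a > 0" using \<omega>_pos by (simp add: a_def)
  define g where "g = 2 * of_real \<gamma> + \<i> * of_real a"
  have g0: "g \<noteq> 0" using \<gamma>_pos by (auto simp: g_def complex_eq_iff)
  obtain z where z: "norm z < 1" "1 + z\<^sup>2 = (2 + \<i> * of_real a * g) * z"
    "2 * Re ((1 - z) / g) = a * Re (csqrt (4 / ((of_real a)\<^sup>2 - 2 * \<i> * of_real \<gamma> * of_real a) - 1))"
    using csqrt_resolvent[OF \<gamma>_pos a] unfolding g_def by metis
  define u where "u n = decaying_wave z n" for n
  \<comment> \<open>Read off from the first adjoint equation; the recursion of the wave is then the
    second one, and u_(n+1) = -1 is the end condition.\<close>
  define v where "v n x = (u n x - u n (Suc x)) / g" for n x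
  note dw = decaying_wave[OF z(1,2), folded u_def]
  define B where "B = 2 / (1 - norm z) + 2 * (2 / (1 - norm z)) / norm g"
  have b0: "0 \<le> 2 / (1 - norm z)" using z(1) by simp
  have uB: "norm (u n x) \<le> B" for n x
    using dw(4)[of n x] b0 by (simp add: B_def add_increasing2)
  have vB: "norm (v n x) \<le> B" for n x
  proof -
    have "norm (u n x - u n (Suc x)) \<le> 2 * (2 / (1 - norm z))"
      using norm_triangle_ineq4[of "u n x" "u n (Suc x)"] dw(4)[of n x] dw(4)[of n "Suc x"] by linarith
    then have "norm (v n x) \<le> 2 * (2 / (1 - norm z)) / norm g"
      unfolding v_def norm_divide by (rule divide_right_mono) simp
    then show ?thesis unfolding B_def using b0 by linarith
  qed
  let ?e = "\<lambda>s. exp (- \<i> * of_real (a * s))"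
  let ?T = "\<lambda>n. t * (real n)\<^sup>2"
  \<comment> \<open>The extra 1/sqrt n in front of the oscillation turns the divisor n^(3/2) into
    n^2. This part is therefore t times a genuine average over the window t n^2.\<close>
  define Dn where "Dn n = integral {0..?T n} (\<lambda>s. ?e s * of_real (oscillation \<omega> f s)) / of_real (?T n) * of_real t" for n
  \<comment> \<open>The constant force against a harmonic: a bounded integral divided by
    n^(3/2).\<close>
  define An where "An n = of_real Fbar * integral {0..?T n} ?e / of_real (real n * sqrt (real n))" for n
  \<comment> \<open>Boundary terms in time: the wave is bounded, so the pairing is of order n and
    the quotient of order 1/sqrt n.\<close>
  define En where "En n = (exp (- \<i> * of_real a * of_real (?T n)) * damped_chain.pairing n (R n) (P n) (u n) (v n) (?T n)
      - damped_chain.pairing n (R n) (P n) (u n) (v n) 0) / of_real (real n * sqrt (real n))" for n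
  have Icon: "(\<lambda>s. ?e s * of_real (h s)) integrable_on {0..T}" if "continuous_on {0..T} h" for h :: "real \<Rightarrow> real" and T
    by (intro integrable_continuous_real continuous_intros that)
  have eq: "fourier_work t k n = v n n * (An n + Dn n) - En n" if n: "n \<ge> 1" for n
  proof -
    interpret damped_chain \<gamma> n "\<lambda>t. Fbar + oscillation \<omega> f t / sqrt (real n)" "R n" "P n"
      by (rule chain[OF n])
    have T0: "?T n \<ge> 0" using t by simp
    have id: "integral {0..?T n} (\<lambda>s. exp (- \<i> * of_real a * of_real s) * of_real (P n n s)) =
      v n n * integral {0..?T n} (\<lambda>s. exp (- \<i> * of_real a * of_real s) * of_real (Fbar + oscillation \<omega> f s / sqrt (real n)))
      - (exp (- \<i> * of_real a * of_real (?T n)) * pairing (u n) (v n) (?T n) - pairing (u n) (v n) 0)"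
    proof (rule boundary_work_identity[OF T0])
      show "u n 0 = 0" by (rule dw(1))
      show "u n x - u n (Suc x) = (of_real (2 * \<gamma>) - - \<i> * of_real a) * v n x" for x
        using g0 by (simp add: v_def g_def)
      show "u n n + 1 = (of_real (2 * \<gamma>) - - \<i> * of_real a) * v n n"
        using g0 dw(2)[of n] by (simp add: v_def g_def)
      show "v n (Suc x) - v n x = - \<i> * of_real a * u n (Suc x)" if "x < n" for x
      proof -
        have "v n (Suc x) - v n x = - (u n (Suc (Suc x)) - 2 * u n (Suc x) + u n x) / g"
          by (simp add: v_def diff_divide_distrib[symmetric])
        also have "\<dots> = - \<i> * of_real a * u n (Suc x)"
          unfolding dw(3)[OF that] using g0 by simp
        finally show ?thesis .
      qed
    qed
    have "integral {0..?T n} (\<lambda>s. exp (- \<i> * of_real a * of_real s) * of_real (Fbar + oscillation \<omega> f s / sqrt (real n))) =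
      of_real Fbar * integral {0..?T n} ?e + integral {0..?T n} (\<lambda>s. ?e s * of_real (oscillation \<omega> f s)) / of_real (sqrt (real n))"
    proof (rule integral_unique)
      have "((\<lambda>s. of_real Fbar * ?e s + ?e s * of_real (oscillation \<omega> f s) / of_real (sqrt (real n))) has_integral
        of_real Fbar * integral {0..?T n} ?e + integral {0..?T n} (\<lambda>s. ?e s * of_real (oscillation \<omega> f s)) / of_real (sqrt (real n))) {0..?T n}"
        by (intro has_integral_add has_integral_mult_right has_integral_divide integrable_integral integrable_continuous_real
            continuous_intros oscillation_cont f_summable)
      then show "((\<lambda>s. exp (- \<i> * of_real a * of_real s) * of_real (Fbar + oscillation \<omega> f s / sqrt (real n))) has_integral
        of_real Fbar * integral {0..?T n} ?e + integral {0..?T n} (\<lambda>s. ?e s * of_real (oscillation \<omega> f s)) / of_real (sqrt (real n))) {0..?T n}"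
        by (simp add: algebra_simps)
    qed
    note id = id[unfolded this]
    have n0: "of_real (real n * sqrt (real n)) \<noteq> (0::complex)" "of_real (?T n) \<noteq> (0::complex)" "of_real t \<noteq> (0::complex)"
      using n t by auto
    have D: "integral {0..?T n} (\<lambda>s. ?e s * of_real (oscillation \<omega> f s)) / of_real (sqrt (real n)) / of_real (real n * sqrt (real n)) = Dn n"
    proof -
      have "of_real (sqrt (real n)) * of_real (sqrt (real n)) = (of_nat n :: complex)"
        using of_real_mult[of "sqrt (real n)" "sqrt (real n)", where 'a = complex] by simp
      then have "of_real (sqrt (real n)) * of_real (real n * sqrt (real n)) = (of_nat n * of_nat n :: complex)"
        by (simp add: mult_ac)
      then show ?thesis using n0(3) unfolding Dn_def divide_divide_eq_left by (simp add: power2_eq_square)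
    qed
    show ?thesis
      unfolding fourier_work_def a_def[symmetric] An_def En_def D[symmetric]
      using id by (simp add: diff_divide_distrib add_divide_distrib distrib_left mult.assoc)
  qed
  have "Dn \<longlonglongrightarrow> f k * of_real t"
    unfolding Dn_def a_def using t
    by (intro tendsto_intros oscillation_average f_summable \<omega>_pos at_top_scaled_squares) auto
  moreover have "An \<longlonglongrightarrow> 0"
  proof (rule Lim_null_comparison)
    show "\<forall>\<^sub>F n in sequentially. norm (An n) \<le> \<bar>Fbar\<bar> * (2 / a) / (real n * sqrt (real n))"
    proof (rule always_eventually, rule allI)
      fix n
      have "norm (integral {0..?T n} ?e) \<le> 2 / a"
        using exp_i_integral[of "- a" "?T n"] a by simp
      then show "norm (An n) \<le> \<bar>Fbar\<bar> * (2 / a) / (real n * sqrt (real n))"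
        unfolding An_def norm_divide norm_mult norm_of_real
        by (subst (2) abs_of_nonneg, simp, intro divide_right_mono mult_left_mono) auto
    qed
    show "(\<lambda>n. \<bar>Fbar\<bar> * (2 / a) / (real n * sqrt (real n))) \<longlonglongrightarrow> 0" by real_asymp
  qed
  moreover have "En \<longlonglongrightarrow> 0"
  proof (rule Lim_null_comparison)
    show "\<forall>\<^sub>F n in sequentially. norm (En n) \<le> 2 * (B * (3 + Cen t)) / sqrt (real n)"
    proof (rule eventually_sequentiallyI[of 1])
      fix n :: nat assume n: "1 \<le> n"
      let ?p = "damped_chain.pairing n (R n) (P n) (u n) (v n)"
      have p: "norm (?p s) \<le> B * (3 + Cen t) * real n" if "s \<in> {0..?T n}" for s
        using t by (intro pairing_bound[OF n that] uB vB) auto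
      have "norm (exp (- \<i> * of_real a * of_real (?T n)) * ?p (?T n) - ?p 0) \<le> norm (exp (- \<i> * of_real a * of_real (?T n)) * ?p (?T n)) + norm (?p 0)"
        by (rule norm_triangle_ineq4)
      also have "norm (exp (- \<i> * of_real a * of_real (?T n)) * ?p (?T n)) = norm (?p (?T n))"
        by (simp add: norm_mult)
      also have "norm (?p (?T n)) + norm (?p 0) \<le> 2 * (B * (3 + Cen t)) * real n"
        using p[of "?T n"] p[of 0] t by simp
      finally show "norm (En n) \<le> 2 * (B * (3 + Cen t)) / sqrt (real n)"
        unfolding En_def using n by (simp add: norm_divide norm_mult field_simps)
    qed
    have "(\<lambda>n. c / sqrt (real n)) \<longlonglongrightarrow> 0" for c :: real by real_asymp
    then show "(\<lambda>n. 2 * (B * (3 + Cen t)) / sqrt (real n)) \<longlonglongrightarrow> 0" .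
  qed
  moreover have "(\<lambda>n. v n n) \<longlonglongrightarrow> (- z - - 1) / g"
    unfolding v_def dw(2) by (intro tendsto_intros dw(5) g0)
  ultimately have "(\<lambda>n. v n n * (An n + Dn n) - En n) \<longlonglongrightarrow> (- z - - 1) / g * (0 + f k * of_real t) - 0"
    by (intro tendsto_intros)
  moreover have "\<forall>\<^sub>F n in sequentially. v n n * (An n + Dn n) - En n = fourier_work t k n"
    by (rule eventually_sequentiallyI[of 1]) (simp add: eq)
  ultimately have "fourier_work t k \<longlonglongrightarrow> (1 - z) / g * (f k * of_real t)"
    by (auto intro: Lim_transform_eventually)
  moreover have "2 * Re (cnj (f k) * ((1 - z) / g * (f k * of_real t))) = (norm (f k))\<^sup>2 * (2 * Re ((1 - z) / g)) * t"
  proof -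
    have "cnj (f k) * ((1 - z) / g * (f k * of_real t)) = of_real ((norm (f k))\<^sup>2 * t) * ((1 - z) / g)"
      using complex_norm_square[of "f k"] by (simp add: mult_ac)
    moreover have "Re (of_real ((norm (f k))\<^sup>2 * t) * w) = (norm (f k))\<^sup>2 * t * Re w" for w
      by (simp add: Re_divide)
    ultimately show ?thesis by (simp only: mult_ac)
  qed
  ultimately show ?thesis unfolding z(3) a_def by (metis mult.assoc)
qed

text \<open>The force is expanded into harmonics, each contributing twice the real part of the
  conjugate amplitude times \<open>fourier_work\<close>. The uniform bound on
  \<open>fourier_work\<close> and summable amplitudes allow the termwise limit.\<close>

lemma oscillating_work_limit:
  assumes t: "t > 0"
  defines "q \<equiv> \<lambda>k. (norm (f k))\<^sup>2 * (real (Suc k) * \<omega>) *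
      Re (csqrt (4 / ((of_real (real (Suc k) * \<omega>))\<^sup>2 - 2 * \<i> * of_real \<gamma> * of_real (real (Suc k) * \<omega>)) - 1))"
  shows "(\<lambda>n. 1 / real n * integral {0..t * (real n)\<^sup>2} (\<lambda>s. oscillation \<omega> f s / sqrt (real n) * P n n s))
     \<longlonglongrightarrow> (\<Sum>k. q k) * t"
    and "summable q"
proof -
  have "\<exists>V. \<forall>k. fourier_work t k \<longlonglongrightarrow> V k \<and> 2 * Re (cnj (f k) * V k) = q k * t"
    using fourier_work_limit[OF t] unfolding q_def by metis
  then obtain V where V: "\<And>k. fourier_work t k \<longlonglongrightarrow> V k" "\<And>k. 2 * Re (cnj (f k) * V k) = q k * t" by blast
  have t0: "t \<ge> 0" using t by simp
  have s: "summable (\<lambda>k. 2 * (norm (f k) * (Cen t + t)))"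
    by (intro summable_mult summable_mult2 f_summable)
  have T: "(\<forall>\<^sub>F n in sequentially. summable (\<lambda>k. norm (2 * Re (cnj (f k) * fourier_work t k n)))) \<and>
    summable (\<lambda>k. norm (q k * t)) \<and>
    (\<lambda>n. \<Sum>k. 2 * Re (cnj (f k) * fourier_work t k n)) \<longlonglongrightarrow> (\<Sum>k. q k * t)"
  proof (rule tannerys_theorem)
    show "(\<lambda>n. 2 * Re (cnj (f k) * fourier_work t k n)) \<longlonglongrightarrow> q k * t" for k
      unfolding V(2)[symmetric] by (intro tendsto_intros V(1))
    have "norm (2 * Re (cnj (f k) * fourier_work t k n)) \<le> 2 * (norm (f k) * (Cen t + t))" if "n \<ge> 1" for k n
    proof -
      have "\<bar>Re (cnj (f k) * fourier_work t k n)\<bar> \<le> norm (f k) * norm (fourier_work t k n)"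
        using abs_Re_le_cmod[of "cnj (f k) * fourier_work t k n"] by (simp add: norm_mult)
      also have "\<dots> \<le> norm (f k) * (Cen t + t)" by (intro mult_left_mono fourier_work_bound that t0) auto
      finally show ?thesis by simp
    qed
    then show "\<forall>\<^sub>F (k, n) in at_top \<times>\<^sub>F sequentially. norm (2 * Re (cnj (f k) * fourier_work t k n)) \<le> 2 * (norm (f k) * (Cen t + t))"
      unfolding eventually_prod_filter
      by (intro exI[of _ "\<lambda>_. True"] exI[of _ "\<lambda>n. n \<ge> 1"] conjI eventually_ge_at_top) auto
  qed (use s in auto)
  have "summable (\<lambda>k. q k * t)" using T by (blast intro: summable_norm_cancel)
  then show sq: "summable q" using t summable_mult2[of "\<lambda>k. q k * t" "1 / t"] by simp
  have eq: "1 / real n * integral {0..t * (real n)\<^sup>2} (\<lambda>s. oscillation \<omega> f s / sqrt (real n) * P n n s) =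
     (\<Sum>k. 2 * Re (cnj (f k) * fourier_work t k n))" if n: "n \<ge> 1" for n
  proof -
    let ?T = "t * (real n)\<^sup>2" and ?c = "1 / (real n * sqrt (real n))"
    note c = P_cont'[OF n]
    \<comment> \<open>For a fixed n this serves only to integrate the series over a fixed window
      term by term; the bound may depend on n.\<close>
    have "bounded (P n n ` {0..?T})"
      by (intro compact_imp_bounded compact_continuous_image c compact_Icc)
    then obtain Pm where Pm: "\<And>s. s \<in> {0..?T} \<Longrightarrow> \<bar>P n n s\<bar> \<le> Pm"
      unfolding bounded_iff real_norm_def by blast
    have "(\<lambda>k. integral {0..?T} (\<lambda>s. harmonic (f k) (real (Suc k) * \<omega>) s * P n n s)) sums
       integral {0..?T} (\<lambda>s. \<Sum>k. harmonic (f k) (real (Suc k) * \<omega>) s * P n n s)"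
    proof (rule integral_sums)
      show "continuous_on {0..?T} (\<lambda>s. harmonic (f k) (real (Suc k) * \<omega>) s * P n n s)" for k
        by (intro continuous_intros harmonic_cont c)
      show "summable (\<lambda>k. 2 * norm (f k) * Pm)" by (intro summable_mult summable_mult2 f_summable)
      show "norm (harmonic (f k) (real (Suc k) * \<omega>) s * P n n s) \<le> 2 * norm (f k) * Pm" if "s \<in> {0..?T}" for k s
        unfolding real_norm_def abs_mult by (intro mult_mono harmonic_bound Pm that) auto
    qed
    moreover have "(\<Sum>k. harmonic (f k) (real (Suc k) * \<omega>) s * P n n s) = oscillation \<omega> f s * P n n s" for s
      by (intro sums_unique[symmetric] sums_mult2 oscillation_sums f_summable)
    moreover have "integral {0..?T} (\<lambda>s. harmonic (f k) (real (Suc k) * \<omega>) s * P n n s) =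
      2 * Re (cnj (f k) * fourier_work t k n) * (real n * sqrt (real n))" for k
    proof -
      let ?g = "\<lambda>s. exp (- \<i> * of_real (real (Suc k) * \<omega> * s)) * of_real (P n n s)"
      have "((\<lambda>s. 2 * Re (cnj (f k) * ?g s)) has_integral 2 * Re (cnj (f k) * integral {0..?T} ?g)) {0..?T}"
        by (intro has_integral_mult_right has_integral_linear[OF _ bounded_linear_Re, unfolded o_def] integrable_integral
           integrable_continuous_real continuous_intros c)
      moreover have "2 * Re (cnj (f k) * ?g s) = harmonic (f k) (real (Suc k) * \<omega>) s * P n n s" for s
      proof -
        have "cnj (f k) * ?g s = cnj (f k * exp (\<i> * of_real (real (Suc k) * \<omega> * s))) * of_real (P n n s)"
          by (simp add: exp_cnj)
        moreover have "2 * Re (cnj w * of_real x) = 2 * Re w * x" for w x by simp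
        ultimately show ?thesis unfolding harmonic_def by (simp only:)
      qed
      ultimately have "integral {0..?T} (\<lambda>s. harmonic (f k) (real (Suc k) * \<omega>) s * P n n s) = 2 * Re (cnj (f k) * integral {0..?T} ?g)"
        by (simp add: integral_unique)
      also have "integral {0..?T} ?g = fourier_work t k n * of_real (real n * sqrt (real n))"
        unfolding fourier_work_def using n by simp
      also have "2 * Re (cnj (f k) * (fourier_work t k n * of_real (real n * sqrt (real n)))) = 2 * Re (cnj (f k) * fourier_work t k n) * (real n * sqrt (real n))"
      proof -
        have "Re (x * of_real y) = Re x * y" for x y by simp
        from this[of "cnj (f k) * fourier_work t k n" "real n * sqrt (real n)"]
        show ?thesis by (simp only: mult.assoc)
      qed
      finally show ?thesis .
    qed
    ultimately have "(\<lambda>k. 2 * Re (cnj (f k) * fourier_work t k n) * (real n * sqrt (real n))) sums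
       integral {0..?T} (\<lambda>s. oscillation \<omega> f s * P n n s)" by simp
    from sums_divide[OF this, of "real n * sqrt (real n)"]
    have S: "(\<lambda>k. 2 * Re (cnj (f k) * fourier_work t k n)) sums (integral {0..?T} (\<lambda>s. oscillation \<omega> f s * P n n s) / (real n * sqrt (real n)))"
      using n by simp
    have "integral {0..?T} (\<lambda>s. oscillation \<omega> f s / sqrt (real n) * P n n s) = integral {0..?T} (\<lambda>s. oscillation \<omega> f s * P n n s) / sqrt (real n)"
      by (simp only: times_divide_eq_left integral_divide)
    then have "1 / real n * integral {0..?T} (\<lambda>s. oscillation \<omega> f s / sqrt (real n) * P n n s) =
      integral {0..?T} (\<lambda>s. oscillation \<omega> f s * P n n s) / (real n * sqrt (real n))"
      by simp
    also have "\<dots> = (\<Sum>k. 2 * Re (cnj (f k) * fourier_work t k n))" by (rule sums_unique[OF S])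
    finally show ?thesis .
  qed
  have "(\<lambda>n. \<Sum>k. 2 * Re (cnj (f k) * fourier_work t k n)) \<longlonglongrightarrow> (\<Sum>k. q k) * t"
    using T suminf_mult2[OF sq, of t] by simp
  then show "(\<lambda>n. 1 / real n * integral {0..t * (real n)\<^sup>2} (\<lambda>s. oscillation \<omega> f s / sqrt (real n) * P n n s))
     \<longlonglongrightarrow> (\<Sum>k. q k) * t"
    by (rule Lim_transform_eventually) (rule eventually_sequentiallyI[of 1], rule eq[symmetric])
qed

end

section \<open>Macroscopic modes and the work of the constant force\<close>

text \<open>The truncation level K is fixed before n grows, so the truncation error may depend on n
  as long as its limit in n tends to 0 with K.\<close>

lemma double_limit:
  fixes X :: "nat \<Rightarrow> real"
  assumes XK: "\<And>K. XK K \<longlonglongrightarrow> L K" and L: "L \<longlonglongrightarrow> l"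
    and le: "\<And>K. \<forall>\<^sub>F n in sequentially. \<bar>X n - XK K n\<bar> \<le> E K n"
    and E: "\<And>K. E K \<longlonglongrightarrow> e K" and e: "e \<longlonglongrightarrow> 0"
  shows "X \<longlonglongrightarrow> l"
proof (rule LIMSEQ_I)
  fix r :: real assume r: "r > 0"
  have "\<forall>\<^sub>F K in sequentially. \<bar>L K - l\<bar> < r / 3 \<and> \<bar>e K\<bar> < r / 6"
    using tendstoD[OF L, of "r / 3"] tendstoD[OF e, of "r / 6"] r
    by (auto simp: dist_real_def elim: eventually_elim2)
  then obtain K where K: "\<bar>L K - l\<bar> < r / 3" "\<bar>e K\<bar> < r / 6"
    by (auto simp: eventually_sequentially)
  have "\<forall>\<^sub>F n in sequentially. \<bar>XK K n - L K\<bar> < r / 3" "\<forall>\<^sub>F n in sequentially. \<bar>E K n - e K\<bar> < r / 6"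
    using tendstoD[OF XK, of "r / 3" K] tendstoD[OF E, of "r / 6" K] r by (auto simp: dist_real_def)
  then have "\<forall>\<^sub>F n in sequentially. norm (X n - l) < r"
    using le[of K]
  proof eventually_elim
    case (elim n)
    then show ?case using K unfolding real_norm_def by linarith
  qed
  then show "\<exists>n0. \<forall>n\<ge>n0. norm (X n - l) < r" by (simp add: eventually_sequentially)
qed

lemma mean_product_le:
  fixes a b :: "nat \<Rightarrow> real"
  shows "\<bar>1 / real n * (\<Sum>x<n. a x * b x)\<bar> \<le> sqrt (1 / real n * (\<Sum>x<n. (a x)\<^sup>2)) * sqrt (1 / real n * (\<Sum>x<n. (b x)\<^sup>2))"
proof -
  have "(1 / real n * (\<Sum>x<n. a x * b x))\<^sup>2 \<le> (1 / real n)\<^sup>2 * ((\<Sum>x<n. (a x)\<^sup>2) * (\<Sum>x<n. (b x)\<^sup>2))"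
    unfolding power_mult_distrib by (intro mult_left_mono Cauchy_Schwarz_ineq_sum) simp
  then have "sqrt ((1 / real n * (\<Sum>x<n. a x * b x))\<^sup>2) \<le> sqrt ((1 / real n * (\<Sum>x<n. (a x)\<^sup>2)) * (1 / real n * (\<Sum>x<n. (b x)\<^sup>2)))"
    by (intro real_sqrt_le_mono) (simp add: power2_eq_square mult_ac)
  then show ?thesis by (simp only: real_sqrt_mult real_sqrt_abs)
qed

lemma abs_sin_diff_le: "\<bar>sin x - sin y\<bar> \<le> \<bar>x - y :: real\<bar>"
proof -
  have "\<bar>sin x - sin y\<bar> = 2 * (\<bar>sin ((x - y) / 2)\<bar> * \<bar>cos ((x + y) / 2)\<bar>)"
    by (simp add: sin_diff_sin abs_mult)
  also have "\<dots> \<le> 2 * (\<bar>(x - y) / 2\<bar> * 1)"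
    by (intro mult_left_mono mult_mono abs_sin_x_le_abs_x) auto
  finally show ?thesis by simp
qed

text \<open>With n+1 in the denominator the fictitious bond carrying the force sits at 1. The
  sampled sines then vanish at both ends, as \<open>pairing_deriv\<close> requires.\<close>

definition site :: "nat \<Rightarrow> nat \<Rightarrow> real" where
  "site n x = real x / real (n + 1)"

lemma site_tags: "x < n \<Longrightarrow> site n (Suc x) \<in> {real x / real n..real (Suc x) / real n}"
  "x < n \<Longrightarrow> real (Suc x) / real n \<in> {real x / real n..real (Suc x) / real n}"
  by (auto simp: site_def field_simps)

lemma site_Suc: "site n (Suc x) = site n x + 1 / real (n + 1)"
  by (simp add: site_def add_divide_distrib)

text \<open>The sampled sines are exact eigenvectors of the discrete Laplacian, with eigenvalue 2
  cos - 2, so no discretisation error arises in the mode equations.\<close>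

lemma sine_site_sum:
  "sine k (site n x) + sine k (site n (Suc (Suc x))) = 2 * cos (Suc k * pi / real (n + 1)) * sine k (site n (Suc x))"
proof -
  let ?c = "Suc k * pi / real (n + 1)" and ?a = "Suc k * pi * site n (Suc x)"
  have "sine k (site n x) = sin (?a - ?c)" "sine k (site n (Suc (Suc x))) = sin (?a + ?c)"
    unfolding sine_def by (rule arg_cong[where f = sin], simp add: site_Suc distrib_left del: of_nat_Suc of_nat_add)+
  then show ?thesis by (simp add: sin_add sin_diff sine_def)
qed

lemma sine_site_end: "sine k (site n (Suc n)) = 0" "sine k (site n n) = (- 1) ^ k * sin (Suc k * pi / real (n + 1))"
proof -
  have "site n (Suc n) = 1" by (simp add: site_def)
  then show "sine k (site n (Suc n)) = 0" using sin_npi[of "Suc k"] by (simp add: sine_def del: of_nat_Suc)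
  have "sine k (site n n) = sin (Suc k * pi - Suc k * pi / real (n + 1))"
    unfolding sine_def site_def by (rule arg_cong[where f = sin]) (simp add: field_simps)
  also have "\<dots> = (- 1) ^ k * sin (Suc k * pi / real (n + 1))"
    using sin_npi[of "Suc k"] cos_npi[of "Suc k"] by (simp add: sin_diff del: of_nat_Suc)
  finally show "sine k (site n n) = (- 1) ^ k * sin (Suc k * pi / real (n + 1))" .
qed

context forced_chains
begin

definition profile_mode :: "nat \<Rightarrow> nat \<Rightarrow> real \<Rightarrow> real" where
  "profile_mode k n s = 1 / real n * (\<Sum>x<n. R n (Suc x) s * sine k (site n (Suc x)))"

text \<open>The eigenvalue of the sampled mode divided by 2\<gamma>, in units of diffusive time; the
  factor n^2 is the change of time.\<close>

definition discrete_rate :: "nat \<Rightarrow> nat \<Rightarrow> real" where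
  "discrete_rate k n = (real n)\<^sup>2 * (2 - 2 * cos (Suc k * pi / real (n + 1))) / (2 * \<gamma>)"

lemma discrete_rate_limit: "discrete_rate k \<longlonglongrightarrow> rate \<gamma> k"
proof -
  have "(\<lambda>n. (real n)\<^sup>2 * (2 - 2 * cos (c / real (n + 1)))) \<longlonglongrightarrow> c * c" for c :: real
    by real_asymp
  from tendsto_divide[OF this tendsto_const, of "2 * \<gamma>" "Suc k * pi"] show ?thesis
    using \<gamma>_pos unfolding discrete_rate_def[abs_def] rate_def power2_eq_square by simp
qed

text \<open>The mode is corrected by a momentum part so that the pairing closes on itself. In
  diffusive time it then solves a relaxation equation whose perturbations, the momentum part and the
  oscillating force, tend to 0. The limit has the relaxation form found for the stretch
  equation.\<close>

lemma profile_mode_limit: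
  assumes t: "t > 0"
    and init: "(\<lambda>n. profile_mode k n 0) \<longlonglongrightarrow> rk"
  shows "(\<lambda>n. profile_mode k n (t * (real n)\<^sup>2)) \<longlonglongrightarrow>
    exp (- rate \<gamma> k * t) * rk + (1 - exp (- rate \<gamma> k * t)) * (Fbar * ((- 1) ^ k / (Suc k * pi)))"
proof -
  let ?c = "Suc k * pi"
  define u where "u n x = sine k (site n x)" for n x
  \<comment> \<open>The choice that cancels every momentum coefficient in
    \<open>pairing_deriv\<close>: the momenta follow the stretch gradient adiabatically.\<close>
  define v where "v n x = (u n x - u n (Suc x)) / (2 * \<gamma>)" for n x
  define \<beta> where "\<beta> n s = (\<Sum>x\<le>n. P n x s * v n x)" for n s
  define Y where "Y n s = damped_chain.pairing n (R n) (P n) (u n) (v n) s" for n s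
  define y where "y n \<tau> = Y n ((real n)\<^sup>2 * \<tau>) / real n" for n \<tau>
  \<comment> \<open>v is of order 1/n and the momenta sum to order n, so \<beta> stays bounded and
    disappears after division by n.\<close>
  define b0 where "b0 = ?c / (2 * \<gamma>) * (3 + Cen t)"
  define c where "c n = real n * v n n * Fbar" for n
  \<comment> \<open>The first term is the momentum part divided by n, the second the oscillating
    force of size 1/sqrt n acting through n v_n, which converges.\<close>
  define \<epsilon> where "\<epsilon> n = \<bar>discrete_rate k n\<bar> * (b0 / real n) + \<bar>real n * v n n\<bar> * (Kosc / sqrt (real n))" for n
  have Cen0: "Cen t \<ge> 0" using Cen_nonneg t by simp
  have Yeq: "Y n s = real n * profile_mode k n s + \<beta> n s" if n: "n \<ge> 1" for n s
  proof -
    interpret damped_chain \<gamma> n "\<lambda>t. Fbar + oscillation \<omega> f t / sqrt (real n)" "R n" "P n"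
      by (rule chain[OF n])
    show ?thesis unfolding Y_def pairing_def profile_mode_def \<beta>_def u_def using n by simp
  qed
  have \<beta>b: "\<bar>\<beta> n s\<bar> \<le> b0" if n: "n \<ge> 1" and s: "s \<in> {0..t * (real n)\<^sup>2}" for n s
  proof -
    interpret damped_chain \<gamma> n "\<lambda>t. Fbar + oscillation \<omega> f t / sqrt (real n)" "R n" "P n"
      by (rule chain[OF n])
    have vb: "\<bar>v n x\<bar> \<le> ?c / real n / (2 * \<gamma>)" for x
    proof -
      have "\<bar>u n x - u n (Suc x)\<bar> \<le> \<bar>?c * site n x - ?c * site n (Suc x)\<bar>"
        unfolding u_def sine_def by (rule abs_sin_diff_le)
      also have "?c * site n x - ?c * site n (Suc x) = - (?c / real (n + 1))"
        by (simp add: site_Suc distrib_left del: of_nat_Suc of_nat_add)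
      also have "\<bar>- (?c / real (n + 1))\<bar> \<le> ?c / real n"
        using n by (simp del: of_nat_Suc of_nat_add) (intro divide_left_mono, auto)
      finally show ?thesis
        unfolding v_def abs_divide using \<gamma>_pos by (subst (2) abs_of_pos, simp, intro divide_right_mono) auto
    qed
    have "\<bar>\<beta> n s\<bar> \<le> (\<Sum>x\<le>n. \<bar>P n x s\<bar> * (?c / real n / (2 * \<gamma>)))"
      unfolding \<beta>_def
      by (rule order_trans[OF sum_abs], rule sum_mono, unfold abs_mult, rule mult_left_mono[OF vb]) simp
    also have "\<dots> = (\<Sum>x\<le>n. \<bar>P n x s\<bar>) * (?c / real n / (2 * \<gamma>))" by (rule sum_distrib_right[symmetric])
    also have "\<dots> \<le> ((3 + Cen t) * real n) * (?c / real n / (2 * \<gamma>))"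
    proof (rule mult_right_mono)
      have "0 \<le> (\<Sum>x<n. \<bar>R n (Suc x) s\<bar>)" by (intro sum_nonneg) auto
      then have "(\<Sum>x\<le>n. \<bar>P n x s\<bar>) \<le> 2 * real n + 1 + energy s"
        using abs_sum_le_energy[of s] by linarith
      also have "\<dots> \<le> (3 + Cen t) * real n"
        using bounds(1)[OF n _ s] t n by (simp add: algebra_simps)
      finally show "(\<Sum>x\<le>n. \<bar>P n x s\<bar>) \<le> (3 + Cen t) * real n" .
    qed (use \<gamma>_pos in auto)
    also have "\<dots> = b0"
    proof -
      have "(a * x) * (e / x / g) = e / g * a" if "x \<noteq> 0" for a x e g :: real
        using that by simp
      then show ?thesis unfolding b0_def using n by simp
    qed
    finally show ?thesis .
  qed
  have vn: "v n n = (- 1) ^ k * sin (?c / real (n + 1)) / (2 * \<gamma>)" for n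
    by (simp add: v_def u_def sine_site_end)
  have nv: "(\<lambda>n. real n * v n n) \<longlonglongrightarrow> (- 1) ^ k * ?c / (2 * \<gamma>)"
  proof -
    have "(\<lambda>n. real n * sin (a / real (n + 1))) \<longlonglongrightarrow> a" for a :: real by real_asymp
    from tendsto_mult[OF tendsto_const[of "(- 1) ^ k / (2 * \<gamma>)"] this[of ?c]] show ?thesis
      unfolding vn by (simp add: mult_ac del: of_nat_Suc of_nat_add)
  qed
  have rpos: "rate \<gamma> k > 0" using \<gamma>_pos by (simp add: rate_def)
  have ev: "\<forall>\<^sub>F n in sequentially. \<bar>y n t - (exp (- discrete_rate k n * t) * y n 0 + (1 - exp (- discrete_rate k n * t)) * (c n / discrete_rate k n))\<bar>
      \<le> \<epsilon> n / discrete_rate k n"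
    using order_tendstoD(1)[OF discrete_rate_limit rpos] eventually_ge_at_top[of 1]
  proof eventually_elim
    case (elim n)
    let ?r = "discrete_rate k n"
    interpret damped_chain \<gamma> n "\<lambda>t. Fbar + oscillation \<omega> f t / sqrt (real n)" "R n" "P n"
      by (rule chain[OF elim(2)])
    have n0: "real n > 0" using elim by simp
    define \<mu> where "\<mu> = 2 - 2 * cos (?c / real (n + 1))"
    have r: "?r = (real n)\<^sup>2 * (\<mu> / (2 * \<gamma>))" by (simp add: discrete_rate_def \<mu>_def)
    have vv: "v n x - v n (Suc x) = - (\<mu> / (2 * \<gamma>)) * u n (Suc x)" for x
    proof -
      have "v n x - v n (Suc x) = ((u n x + u n (Suc (Suc x))) - 2 * u n (Suc x)) / (2 * \<gamma>)"
        by (simp add: v_def diff_divide_distrib[symmetric])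
      also have "u n x + u n (Suc (Suc x)) = 2 * cos (?c / real (n + 1)) * u n (Suc x)"
        unfolding u_def by (rule sine_site_sum)
      moreover have "(2 * a * w - 2 * w) / g = - ((2 - 2 * a) / g) * w" for a w g :: real
        by (cases "g = 0") (simp_all add: field_simps)
      ultimately show ?thesis unfolding \<mu>_def by simp
    qed
    have Yd: "(Y n has_real_derivative - (\<mu> / (2 * \<gamma>)) * (Y n s - \<beta> n s) + (Fbar + oscillation \<omega> f s / sqrt (real n)) * v n n) (at s within {0..})"
      if s: "s \<ge> 0" for s
    proof -
      have "(pairing (u n) (v n) has_vector_derivative
        (\<Sum>x\<le>n. P n x s *\<^sub>R (u n x - u n (Suc x) - (2 * \<gamma>) *\<^sub>R v n x))
        + (\<Sum>x<n. R n (Suc x) s *\<^sub>R (v n x - v n (Suc x))) + (Fbar + oscillation \<omega> f s / sqrt (real n)) *\<^sub>R v n n) (at s within {0..})"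
        using s by (intro pairing_deriv) (simp_all add: u_def sine_site_end, simp add: sine_def site_def)
      moreover have "(\<Sum>x\<le>n. P n x s *\<^sub>R (u n x - u n (Suc x) - (2 * \<gamma>) *\<^sub>R v n x)) = 0"
        using \<gamma>_pos by (simp add: v_def)
      moreover have "(\<Sum>x<n. R n (Suc x) s *\<^sub>R (v n x - v n (Suc x))) = - (\<mu> / (2 * \<gamma>)) * (Y n s - \<beta> n s)"
        unfolding vv Y_def pairing_def \<beta>_def by (simp add: sum_distrib_left mult_ac)
      ultimately show ?thesis
        by (simp add: has_real_derivative_iff_has_vector_derivative Y_def[abs_def])
    qed
    have yd: "(y n has_real_derivative c n + (?r * (\<beta> n ((real n)\<^sup>2 * \<tau>) / real n) + real n * v n n * (oscillation \<omega> f ((real n)\<^sup>2 * \<tau>) / sqrt (real n))) - ?r * y n \<tau>) (at \<tau> within {0..})"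
      if \<tau>: "\<tau> \<ge> 0" for \<tau>
    proof -
      let ?s = "(real n)\<^sup>2 * \<tau>"
      have g: "((\<lambda>\<tau>. (real n)\<^sup>2 * \<tau>) has_real_derivative (real n)\<^sup>2) (at \<tau> within {0..})"
        by (auto intro!: derivative_eq_intros)
      have "(Y n has_real_derivative - (\<mu> / (2 * \<gamma>)) * (Y n ?s - \<beta> n ?s) + (Fbar + oscillation \<omega> f ?s / sqrt (real n)) * v n n) (at ?s within (\<lambda>\<tau>. (real n)\<^sup>2 * \<tau>) ` {0..})"
        by (rule DERIV_subset[OF Yd]) (use \<tau> in auto)
      from DERIV_cdivide[OF DERIV_image_chain[OF this g], of "real n"]
      show ?thesis
        unfolding y_def[abs_def] o_def
      proof (rule DERIV_cong)
        show "(- (\<mu> / (2 * \<gamma>)) * (Y n ?s - \<beta> n ?s) + (Fbar + oscillation \<omega> f ?s / sqrt (real n)) * v n n) * (real n)\<^sup>2 / real n =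
          c n + (?r * (\<beta> n ?s / real n) + real n * v n n * (oscillation \<omega> f ?s / sqrt (real n))) - ?r * (Y n ?s / real n)"
        proof -
          have "(- m * (a - b) + (F + p) * w) * N\<^sup>2 / N = N * w * F + (N\<^sup>2 * m * (b / N) + N * w * p) - N\<^sup>2 * m * (a / N)"
            if "N > 0" for m a b F p w N :: real
            using that by (simp add: power2_eq_square field_simps)
          then show ?thesis unfolding r c_def using n0 by blast
        qed
      qed
    qed
    show ?case
    proof (rule relaxation_bound[OF elim(1) _ yd])
      fix s assume s: "0 \<le> s" "s \<le> t"
      have "(real n)\<^sup>2 * s \<in> {0..t * (real n)\<^sup>2}" using s by (simp add: mult.commute[of t] mult_left_mono)
      then have "\<bar>\<beta> n ((real n)\<^sup>2 * s)\<bar> / real n \<le> b0 / real n"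
        using \<beta>b[OF elim(2)] by (intro divide_right_mono) auto
      then have "\<bar>?r * (\<beta> n ((real n)\<^sup>2 * s) / real n)\<bar> \<le> \<bar>?r\<bar> * (b0 / real n)"
        unfolding abs_mult abs_divide by (intro mult_left_mono) auto
      moreover have "\<bar>real n * v n n * (oscillation \<omega> f ((real n)\<^sup>2 * s) / sqrt (real n))\<bar> \<le> \<bar>real n * v n n\<bar> * (Kosc / sqrt (real n))"
        unfolding abs_mult[of "real n * v n n"] abs_divide using osc_bound by (intro mult_left_mono) (auto intro: divide_right_mono)
      ultimately show "\<bar>?r * (\<beta> n ((real n)\<^sup>2 * s) / real n) + real n * v n n * (oscillation \<omega> f ((real n)\<^sup>2 * s) / sqrt (real n))\<bar> \<le> \<epsilon> n"
        unfolding \<epsilon>_def by linarith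
    qed (use t in auto)
  qed
  have inv0: "(\<lambda>n. a / real n) \<longlonglongrightarrow> 0" "(\<lambda>n. a / sqrt (real n)) \<longlonglongrightarrow> 0" for a :: real by real_asymp+
  have "\<epsilon> \<longlonglongrightarrow> \<bar>rate \<gamma> k\<bar> * 0 + \<bar>(- 1) ^ k * ?c / (2 * \<gamma>)\<bar> * 0"
    unfolding \<epsilon>_def[abs_def] by (intro tendsto_intros discrete_rate_limit nv inv0)
  then have "(\<lambda>n. \<epsilon> n / discrete_rate k n) \<longlonglongrightarrow> 0 / rate \<gamma> k"
    using rpos by (intro tendsto_divide discrete_rate_limit) auto
  then have \<epsilon>0: "(\<lambda>n. \<epsilon> n / discrete_rate k n) \<longlonglongrightarrow> 0" by simp
  have A: "(\<lambda>n. y n t - (exp (- discrete_rate k n * t) * y n 0 + (1 - exp (- discrete_rate k n * t)) * (c n / discrete_rate k n))) \<longlonglongrightarrow> 0"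
    by (rule Lim_null_comparison[OF _ \<epsilon>0]) (unfold real_norm_def, rule ev)
  have \<beta>0: "(\<lambda>n. \<beta> n (\<tau> * (real n)\<^sup>2) / real n) \<longlonglongrightarrow> 0" if "\<tau> \<in> {0..t}" for \<tau>
  proof (rule Lim_null_comparison)
    show "\<forall>\<^sub>F n in sequentially. norm (\<beta> n (\<tau> * (real n)\<^sup>2) / real n) \<le> b0 / real n"
    proof (rule eventually_sequentiallyI[of 1])
      fix n :: nat assume n: "1 \<le> n"
      have "\<tau> * (real n)\<^sup>2 \<in> {0..t * (real n)\<^sup>2}" using that by (simp add: mult_right_mono)
      from \<beta>b[OF n this] show "norm (\<beta> n (\<tau> * (real n)\<^sup>2) / real n) \<le> b0 / real n"
        by (simp add: divide_right_mono)
    qed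
  qed (rule inv0(1))
  have yM: "\<forall>\<^sub>F n in sequentially. y n \<tau> = profile_mode k n (\<tau> * (real n)\<^sup>2) + \<beta> n (\<tau> * (real n)\<^sup>2) / real n" for \<tau>
    by (rule eventually_sequentiallyI[of 1]) (simp add: y_def Yeq mult.commute add_divide_distrib)
  have "(\<lambda>n. profile_mode k n (0 * (real n)\<^sup>2) + \<beta> n (0 * (real n)\<^sup>2) / real n) \<longlonglongrightarrow> rk + 0"
    using t by (intro tendsto_add \<beta>0) (auto simp: init)
  then have "(\<lambda>n. y n 0) \<longlonglongrightarrow> rk + 0"
    by (rule Lim_transform_eventually) (use yM[of 0] in \<open>auto elim: eventually_mono\<close>)
  then have y0: "(\<lambda>n. y n 0) \<longlonglongrightarrow> rk" by simp
  have "(\<lambda>n. (y n t - (exp (- discrete_rate k n * t) * y n 0 + (1 - exp (- discrete_rate k n * t)) * (c n / discrete_rate k n))) +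
      (exp (- discrete_rate k n * t) * y n 0 + (1 - exp (- discrete_rate k n * t)) * (c n / discrete_rate k n)) - \<beta> n (t * (real n)\<^sup>2) / real n)
      \<longlonglongrightarrow> 0 + (exp (- rate \<gamma> k * t) * rk + (1 - exp (- rate \<gamma> k * t)) * ((- 1) ^ k * ?c / (2 * \<gamma>) * Fbar / rate \<gamma> k)) - 0"
    unfolding c_def using t rpos by (intro tendsto_intros A[unfolded c_def] y0 nv discrete_rate_limit \<beta>0) auto
  moreover have "(- 1) ^ k * ?c / (2 * \<gamma>) * Fbar / rate \<gamma> k = Fbar * ((- 1) ^ k / ?c)"
    using \<gamma>_pos by (simp add: rate_def power2_eq_square field_simps del: of_nat_Suc)
  ultimately have "(\<lambda>n. y n t - \<beta> n (t * (real n)\<^sup>2) / real n) \<longlonglongrightarrow> exp (- rate \<gamma> k * t) * rk + (1 - exp (- rate \<gamma> k * t)) * (Fbar * ((- 1) ^ k / ?c))"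
    by (simp only: diff_add_cancel add_0_left diff_0_right)
  then show ?thesis
    by (rule Lim_transform_eventually) (use yM[of t] in \<open>auto elim: eventually_mono\<close>)
qed

end

context forced_chains
begin

text \<open>At frequency zero the dual vector is the linear profile. The mean momentum integral
  splits into a force term A, the change X of the first moment of the stretch, and a negligible
  momentum term B. The weight u in X is expanded in sines: each mode is known in the limit, and the
  remainder is small in L2 while the stretches are bounded in L2 by the energy. The resulting series
  is that of the flux at the right end.\<close>

lemma mean_work_limit:
  assumes t: "t > 0" and rini: "continuous_on {0..1} rini"
    and init: "(\<lambda>n. 1 / real n * (\<Sum>x<n. (R n (Suc x) 0 - rini (real (Suc x) / real n))\<^sup>2)) \<longlonglongrightarrow> 0"
    and \<rho>: "stretch_density \<gamma> Fbar rini \<rho>"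
  shows "(\<lambda>n. 1 / real n * integral {0..t * (real n)\<^sup>2} (P n n)) \<longlonglongrightarrow>
    1 / (2 * \<gamma>) * (LBINT s:{0..t}. vector_derivative (\<rho> s) (at 1 within {0..1}))"
proof -
  define W where "W = (LBINT s:{0..t}. vector_derivative (\<rho> s) (at 1 within {0..1}))"
  define d where "d k = integral {0..1} (\<lambda>u. (rini u - Fbar * u) * sine k u)" for k
  define b where "b k = (- 1) ^ k / (Suc k * pi)" for k
  define r where "r k = integral {0..1} (\<lambda>u. rini u * sine k u)" for k
  have sc: "continuous_on A (sine k)" for A :: "real set" and k
    by (rule continuous_on_sine) (rule continuous_on_id)
  have dr: "d k = r k - Fbar * b k" for k
  proof -
    have "((\<lambda>u. rini u * sine k u - Fbar * (u * sine k u)) has_integral r k - Fbar * b k) {0..1}"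
      unfolding r_def b_def
      by (intro has_integral_diff has_integral_mult_right identity_sine_coeff integrable_integral integrable_continuous_real continuous_intros rini sc)
    then show ?thesis unfolding d_def by (simp add: integral_unique algebra_simps)
  qed
  define \<xi> where "\<xi> n x = site n (Suc x)" for n x
  define \<Delta> where "\<Delta> n x = R n (Suc x) (t * (real n)\<^sup>2) - R n (Suc x) 0" for n x
  define X where "X n = 1 / real n * (\<Sum>x<n. \<xi> n x * \<Delta> n x)" for n
  define A where "A n = 1 / (2 * \<gamma> * real n * real (n + 1)) * (Fbar * (t * (real n)\<^sup>2) + integral {0..t * (real n)\<^sup>2} (oscillation \<omega> f) / sqrt (real n))" for n
  define B where "B n = 1 / (2 * \<gamma> * real n * real (n + 1)) * ((\<Sum>x\<le>n. P n x (t * (real n)\<^sup>2)) - (\<Sum>x\<le>n. P n x 0))" for n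
  \<comment> \<open>Here b = 0, u = -x/(n+1) and v is the constant 1/(2\<gamma>(n+1)); then u_n + 1
    = 1/(n+1) is the end condition.\<close>
  have id: "1 / real n * integral {0..t * (real n)\<^sup>2} (P n n) = A n + X n - B n" if n: "n \<ge> 1" for n
  proof -
    interpret damped_chain \<gamma> n "\<lambda>t. Fbar + oscillation \<omega> f t / sqrt (real n)" "R n" "P n"
      by (rule chain[OF n])
    let ?T = "t * (real n)\<^sup>2" and ?v = "1 / (2 * \<gamma> * real (n + 1))"
    have T0: "?T \<ge> 0" using t by simp
    have "integral {0..?T} (\<lambda>s. exp (0 * of_real s) * of_real (P n n s)) =
      ?v * integral {0..?T} (\<lambda>s. exp (0 * of_real s) * of_real (Fbar + oscillation \<omega> f s / sqrt (real n)))
      - (exp (0 * of_real ?T) * pairing (\<lambda>x. - site n x) (\<lambda>_. ?v) ?T - pairing (\<lambda>x. - site n x) (\<lambda>_. ?v) 0)"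
    proof (rule boundary_work_identity[OF T0])
      show "- site n x - - site n (Suc x) = (of_real (2 * \<gamma>) - 0) * ?v" for x
        using \<gamma>_pos by (simp add: site_Suc del: of_nat_Suc of_nat_add)
      show "- site n n + 1 = (of_real (2 * \<gamma>) - 0) * ?v"
      proof -
        have "site n n + 1 / real (n + 1) = 1"
          unfolding site_Suc[symmetric] by (simp add: site_def)
        then have "- site n n + 1 = 1 / real (n + 1)" by linarith
        then show ?thesis using \<gamma>_pos by (simp del: of_nat_add)
      qed
    qed (simp_all add: site_def)
    then have "integral {0..?T} (P n n) = ?v * integral {0..?T} (\<lambda>s. Fbar + oscillation \<omega> f s / sqrt (real n))
      - (pairing (\<lambda>x. - site n x) (\<lambda>_. ?v) ?T - pairing (\<lambda>x. - site n x) (\<lambda>_. ?v) 0)"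
      by simp
    also have "integral {0..?T} (\<lambda>s. Fbar + oscillation \<omega> f s / sqrt (real n)) = Fbar * ?T + integral {0..?T} (oscillation \<omega> f) / sqrt (real n)"
    proof (rule integral_unique)
      have "((\<lambda>s. Fbar) has_integral Fbar * ?T) {0..?T}"
        using has_integral_const_real[of Fbar 0 ?T] T0 by (simp add: mult.commute)
      then show "((\<lambda>s. Fbar + oscillation \<omega> f s / sqrt (real n)) has_integral Fbar * ?T + integral {0..?T} (oscillation \<omega> f) / sqrt (real n)) {0..?T}"
        by (intro has_integral_add has_integral_divide integrable_integral integrable_continuous_real oscillation_cont f_summable)
    qed
    finally have I: "integral {0..?T} (P n n) = ?v * (Fbar * ?T + integral {0..?T} (oscillation \<omega> f) / sqrt (real n))
      - (pairing (\<lambda>x. - site n x) (\<lambda>_. ?v) ?T - pairing (\<lambda>x. - site n x) (\<lambda>_. ?v) 0)" .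
    have pr: "pairing (\<lambda>x. - site n x) (\<lambda>_. ?v) s = ?v * (\<Sum>x\<le>n. P n x s) - (\<Sum>x<n. \<xi> n x * R n (Suc x) s)" for s
      by (simp add: pairing_def \<xi>_def sum_distrib_left sum_divide_distrib sum_negf mult_ac)
    have s\<Delta>: "(\<Sum>x<n. \<xi> n x * \<Delta> n x) = (\<Sum>x<n. \<xi> n x * R n (Suc x) ?T) - (\<Sum>x<n. \<xi> n x * R n (Suc x) 0)"
      unfolding \<Delta>_def right_diff_distrib sum_subtractf ..
    have "1 / N * (1 / (2 * g * M) * a - (1 / (2 * g * M) * p - x - (1 / (2 * g * M) * p' - x'))) =
      1 / (2 * g * N * M) * a + 1 / N * (x - x') - 1 / (2 * g * N * M) * (p - p')" for N g M a p x p' x' :: real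
      by (simp add: algebra_simps diff_divide_distrib)
    then show ?thesis unfolding I pr A_def B_def X_def s\<Delta> by blast
  qed
  have "A \<longlonglongrightarrow> Fbar * t / (2 * \<gamma>)"
  proof -
    define A1 where "A1 n = integral {0..t * (real n)\<^sup>2} (oscillation \<omega> f) / ((real n)\<^sup>2)" for n
    have A1: "\<bar>A1 n\<bar> \<le> Kosc * t" for n
    proof -
      have "norm (integral {0..t * (real n)\<^sup>2} (oscillation \<omega> f)) \<le> Kosc * (t * (real n)\<^sup>2 - 0)"
        using t osc_bound by (intro integral_bound oscillation_cont f_summable) auto
      moreover have "0 \<le> Kosc * t" using osc_bound[of 0] t by (intro mult_nonneg_nonneg) auto
      ultimately show ?thesis unfolding A1_def by (cases "n = 0") (auto simp: divide_le_eq abs_divide)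
    qed
    have "A n = 1 / (2 * \<gamma>) * (real n / real (n + 1)) * (Fbar * t + A1 n / sqrt (real n))" if "n \<ge> 1" for n
    proof -
      have "1 / (2 * g * N * M) * (F * (t * N\<^sup>2) + I / q) = 1 / (2 * g) * (N / M) * (F * t + I / N\<^sup>2 / q)"
        if "g > 0" "N > 0" "M > 0" "q > 0" for g N M F I q :: real
        using that by (simp add: power2_eq_square field_simps)
      then show ?thesis using that \<gamma>_pos unfolding A_def A1_def by simp
    qed
    then have ev: "\<forall>\<^sub>F n in sequentially. 1 / (2 * \<gamma>) * (real n / real (n + 1)) * (Fbar * t + A1 n / sqrt (real n)) = A n"
      by (intro eventually_sequentiallyI[of 1]) simp
    have "(\<lambda>n. A1 n / sqrt (real n)) \<longlonglongrightarrow> 0"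
    proof (rule Lim_null_comparison)
      show "\<forall>\<^sub>F n in sequentially. norm (A1 n / sqrt (real n)) \<le> Kosc * t / sqrt (real n)"
        using A1 by (intro always_eventually) (simp add: divide_right_mono abs_divide)
      have "(\<lambda>n. c / sqrt (real n)) \<longlonglongrightarrow> 0" for c :: real by real_asymp
      then show "(\<lambda>n. Kosc * t / sqrt (real n)) \<longlonglongrightarrow> 0" .
    qed
    moreover have "(\<lambda>n. real n / real (n + 1)) \<longlonglongrightarrow> 1" by real_asymp
    ultimately have "(\<lambda>n. 1 / (2 * \<gamma>) * (real n / real (n + 1)) * (Fbar * t + A1 n / sqrt (real n))) \<longlonglongrightarrow> 1 / (2 * \<gamma>) * 1 * (Fbar * t + 0)"
      by (intro tendsto_intros)
    then have "A \<longlonglongrightarrow> 1 / (2 * \<gamma>) * 1 * (Fbar * t + 0)" by (rule Lim_transform_eventually[OF _ ev])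
    then show ?thesis by simp
  qed
  moreover have "B \<longlonglongrightarrow> 0"
  proof (rule Lim_null_comparison)
    show "\<forall>\<^sub>F n in sequentially. norm (B n) \<le> ((3 + Cen t) / \<gamma>) / real (n + 1)"
    proof (rule eventually_sequentiallyI[of 1])
    fix n :: nat assume n: "1 \<le> n"
    interpret damped_chain \<gamma> n "\<lambda>t. Fbar + oscillation \<omega> f t / sqrt (real n)" "R n" "P n"
      by (rule chain[OF n])
    have S: "\<bar>\<Sum>x\<le>n. P n x s\<bar> \<le> (3 + Cen t) * real n" if "s \<in> {0..t * (real n)\<^sup>2}" for s
    proof -
      have "0 \<le> (\<Sum>x<n. \<bar>R n (Suc x) s\<bar>)" by (intro sum_nonneg) auto
      then have "\<bar>\<Sum>x\<le>n. P n x s\<bar> \<le> 2 * real n + 1 + energy s"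
        using abs_sum_le_energy[of s] sum_abs[of "\<lambda>x. P n x s" "{..n}"] by linarith
      also have "\<dots> \<le> (3 + Cen t) * real n"
        using bounds(1)[OF n _ that] t n by (simp add: algebra_simps)
      finally show ?thesis .
    qed
    have "\<bar>(\<Sum>x\<le>n. P n x (t * (real n)\<^sup>2)) - (\<Sum>x\<le>n. P n x 0)\<bar> \<le> 2 * ((3 + Cen t) * real n)"
      using S[of "t * (real n)\<^sup>2"] S[of 0] t by simp
    then have "norm (B n) \<le> 1 / (2 * \<gamma> * real n * real (n + 1)) * (2 * ((3 + Cen t) * real n))"
      unfolding B_def real_norm_def abs_mult using \<gamma>_pos by (intro mult_mono) auto
    also have "\<dots> = ((3 + Cen t) / \<gamma>) / real (n + 1)"
    proof -
      have "1 / (2 * g * N * M) * (2 * (a * N)) = a / g / M" if "N > 0" for g N M a :: real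
        using that by simp
      then show ?thesis using n by simp
    qed
    finally show "norm (B n) \<le> ((3 + Cen t) / \<gamma>) / real (n + 1)" .
    qed
    have "(\<lambda>n. c / real (n + 1)) \<longlonglongrightarrow> 0" for c :: real by real_asymp
    then show "(\<lambda>n. ((3 + Cen t) / \<gamma>) / real (n + 1)) \<longlonglongrightarrow> 0" .
  qed
  moreover have "X \<longlonglongrightarrow> (W - Fbar * t) / (2 * \<gamma>)"
  proof (rule double_limit)
    let ?S = "\<lambda>K u. \<Sum>k<K. 2 * b k * sine k u"
    define XK where "XK K n = 1 / real n * (\<Sum>x<n. ?S K (\<xi> n x) * \<Delta> n x)" for K n
    define l where "l k = 2 * b k * (- (1 - exp (- rate \<gamma> k * t)) * d k)" for k
    \<comment> \<open>The hypothesis compares stretches with the profile at x/n, the modes live at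
      x/(n+1). Cauchy-Schwarz removes the mean square error, and the two-tag Riemann sum treats the
      rest.\<close>
    have init_mode: "(\<lambda>n. profile_mode k n 0) \<longlonglongrightarrow> r k" for k
    proof -
      let ?\<delta> = "\<lambda>n x. R n (Suc x) 0 - rini (real (Suc x) / real n)"
      have "(\<lambda>n. 1 / real n * (\<Sum>x<n. ?\<delta> n x * sine k (\<xi> n x))) \<longlonglongrightarrow> 0"
      proof (rule Lim_null_comparison)
        show "\<forall>\<^sub>F n in sequentially. norm (1 / real n * (\<Sum>x<n. ?\<delta> n x * sine k (\<xi> n x))) \<le> sqrt (1 / real n * (\<Sum>x<n. (?\<delta> n x)\<^sup>2))"
        proof (rule always_eventually, rule allI)
          fix n
          have "(\<Sum>x<n. (sine k (\<xi> n x))\<^sup>2) \<le> (\<Sum>x<n. 1)"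
            by (intro sum_mono) (simp add: sine_def abs_square_le_1)
          then have "sqrt (1 / real n * (\<Sum>x<n. (sine k (\<xi> n x))\<^sup>2)) \<le> 1"
            by (cases "n = 0") (auto simp: divide_le_eq)
          then have "sqrt (1 / real n * (\<Sum>x<n. (?\<delta> n x)\<^sup>2)) * sqrt (1 / real n * (\<Sum>x<n. (sine k (\<xi> n x))\<^sup>2)) \<le> sqrt (1 / real n * (\<Sum>x<n. (?\<delta> n x)\<^sup>2)) * 1"
            by (intro mult_left_mono) (auto intro!: real_sqrt_ge_zero divide_nonneg_nonneg sum_nonneg)
          then show "norm (1 / real n * (\<Sum>x<n. ?\<delta> n x * sine k (\<xi> n x))) \<le> sqrt (1 / real n * (\<Sum>x<n. (?\<delta> n x)\<^sup>2))"
            using mean_product_le[of n "?\<delta> n" "\<lambda>x. sine k (\<xi> n x)"] unfolding real_norm_def by linarith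
        qed
        show "(\<lambda>n. sqrt (1 / real n * (\<Sum>x<n. (?\<delta> n x)\<^sup>2))) \<longlonglongrightarrow> 0"
          using tendsto_real_sqrt[OF init] by simp
      qed
      moreover have "(\<lambda>n. 1 / real n * (\<Sum>x<n. (\<lambda>(a, c). rini a * sine k c) (real (Suc x) / real n, \<xi> n x))) \<longlonglongrightarrow> integral {0..1} (\<lambda>u. (\<lambda>(a, c). rini a * sine k c) (u, u))"
        unfolding \<xi>_def
      proof (intro tagged_riemann_sum site_tags)
        have "continuous_on ({0..1} \<times> {0..1}) (\<lambda>p. rini (fst p) * sine k (snd p))"
          by (intro continuous_intros continuous_on_compose2[OF rini]) auto
        then show "continuous_on ({0..1} \<times> {0..1}) (\<lambda>(a, c). rini a * sine k c)" by (simp add: case_prod_beta)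
      qed
      ultimately have "(\<lambda>n. 1 / real n * (\<Sum>x<n. ?\<delta> n x * sine k (\<xi> n x)) + 1 / real n * (\<Sum>x<n. rini (real (Suc x) / real n) * sine k (\<xi> n x))) \<longlonglongrightarrow> 0 + r k"
        unfolding r_def by (intro tendsto_add) simp_all
      moreover have "1 / real n * (\<Sum>x<n. ?\<delta> n x * sine k (\<xi> n x)) + 1 / real n * (\<Sum>x<n. rini (real (Suc x) / real n) * sine k (\<xi> n x)) = profile_mode k n 0" for n
        by (simp add: profile_mode_def \<xi>_def sum.distrib[symmetric] left_diff_distrib add_divide_distrib[symmetric] del: of_nat_Suc)
      ultimately show ?thesis by simp
    qed
    show "XK K \<longlonglongrightarrow> (\<Sum>k<K. l k)" for K
    proof -
      have "XK K = (\<lambda>n. \<Sum>k<K. 2 * b k * (profile_mode k n (t * (real n)\<^sup>2) - profile_mode k n 0))"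
      proof
        fix n
        have "XK K n = 1 / real n * (\<Sum>k<K. \<Sum>x<n. 2 * b k * sine k (\<xi> n x) * \<Delta> n x)"
          unfolding XK_def sum_distrib_right by (subst sum.swap) simp
        also have "\<dots> = (\<Sum>k<K. 2 * b k * (profile_mode k n (t * (real n)\<^sup>2) - profile_mode k n 0))"
          unfolding sum_distrib_left[of "1 / real n"] profile_mode_def \<Delta>_def \<xi>_def
          by (intro sum.cong refl)
            (simp add: right_diff_distrib sum_subtractf sum_distrib_left sum_divide_distrib mult_ac)
        finally show "XK K n = (\<Sum>k<K. 2 * b k * (profile_mode k n (t * (real n)\<^sup>2) - profile_mode k n 0))" .
      qed
      moreover have "(\<lambda>n. \<Sum>k<K. 2 * b k * (profile_mode k n (t * (real n)\<^sup>2) - profile_mode k n 0)) \<longlonglongrightarrow>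
        (\<Sum>k<K. 2 * b k * (exp (- rate \<gamma> k * t) * r k + (1 - exp (- rate \<gamma> k * t)) * (Fbar * ((- 1) ^ k / (Suc k * pi))) - r k))"
        by (intro tendsto_intros profile_mode_limit t init_mode)
      moreover have "exp (- rate \<gamma> k * t) * r k + (1 - exp (- rate \<gamma> k * t)) * (Fbar * ((- 1) ^ k / (Suc k * pi))) - r k
        = - (1 - exp (- rate \<gamma> k * t)) * d k" for k
      proof -
        have "e * x + (1 - e) * y - x = - (1 - e) * (x - y)" for e x y :: real by (simp add: algebra_simps)
        then show ?thesis unfolding dr b_def .
      qed
      ultimately show ?thesis by (simp only: l_def)
    qed
    show "(\<lambda>K. \<Sum>k<K. l k) \<longlonglongrightarrow> (W - Fbar * t) / (2 * \<gamma>)"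
    proof -
      have "(\<lambda>k. 4 * \<gamma> * ((- 1) ^ Suc k / (Suc k * pi)) * d k * (1 - exp (- rate \<gamma> k * t)) / (2 * \<gamma>)) sums ((W - Fbar * t) / (2 * \<gamma>))"
        unfolding W_def d_def by (intro sums_divide stretch_flux \<gamma>_pos rini \<rho> t)
      moreover have "4 * \<gamma> * ((- 1) ^ Suc k / (Suc k * pi)) * d k * (1 - exp (- rate \<gamma> k * t)) / (2 * \<gamma>) = l k" for k
        using \<gamma>_pos by (simp add: l_def b_def field_simps del: of_nat_Suc)
      ultimately show ?thesis by (simp only: sums_def)
    qed
    \<comment> \<open>From (a-b)^2 \<le> 2a^2 + 2b^2 and the energy bound at the two times t n^2 and
      0.\<close>
    let ?C = "4 * Cen t"
    let ?q = "\<lambda>K n. 1 / real n * (\<Sum>x<n. (\<xi> n x - ?S K (\<xi> n x))\<^sup>2)"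
    show "\<forall>\<^sub>F n in sequentially. \<bar>X n - XK K n\<bar> \<le> sqrt (?q K n) * sqrt ?C" for K
    proof (rule eventually_sequentiallyI[of 1])
      fix n :: nat assume n: "1 \<le> n"
      interpret damped_chain \<gamma> n "\<lambda>t. Fbar + oscillation \<omega> f t / sqrt (real n)" "R n" "P n"
        by (rule chain[OF n])
      have RE: "(\<Sum>x<n. (R n (Suc x) s)\<^sup>2) \<le> energy s" for s
        unfolding energy_def by (simp add: sum_nonneg)
      have "(\<Sum>x<n. (\<Delta> n x)\<^sup>2) \<le> (\<Sum>x<n. 2 * (R n (Suc x) (t * (real n)\<^sup>2))\<^sup>2 + 2 * (R n (Suc x) 0)\<^sup>2)"
        unfolding \<Delta>_def by (intro sum_mono square_diff_le)
      also have "\<dots> \<le> 2 * energy (t * (real n)\<^sup>2) + 2 * energy 0"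
        using RE[of "t * (real n)\<^sup>2"] RE[of 0] by (simp add: sum.distrib sum_distrib_left[symmetric])
      also have "\<dots> \<le> ?C * real n"
        using bounds(1)[OF n, of t "t * (real n)\<^sup>2"] bounds(1)[OF n, of t 0] t by simp
      finally have "1 / real n * (\<Sum>x<n. (\<Delta> n x)\<^sup>2) \<le> ?C"
        using n by (simp add: divide_le_eq)
      then have le: "sqrt (?q K n) * sqrt (1 / real n * (\<Sum>x<n. (\<Delta> n x)\<^sup>2)) \<le> sqrt (?q K n) * sqrt ?C"
        by (intro mult_left_mono real_sqrt_le_mono) (auto intro!: real_sqrt_ge_zero divide_nonneg_nonneg sum_nonneg)
      have "X n - XK K n = 1 / real n * (\<Sum>x<n. (\<xi> n x - ?S K (\<xi> n x)) * \<Delta> n x)"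
        unfolding X_def XK_def by (simp only: left_diff_distrib sum_subtractf right_diff_distrib)
      with mean_product_le[of n "\<lambda>x. \<xi> n x - ?S K (\<xi> n x)" "\<Delta> n"] le
      show "\<bar>X n - XK K n\<bar> \<le> sqrt (?q K n) * sqrt ?C" by linarith
    qed
    show "(\<lambda>n. sqrt (?q K n) * sqrt ?C) \<longlonglongrightarrow> sqrt (integral {0..1} (\<lambda>u. (u - ?S K u)\<^sup>2)) * sqrt ?C" for K
    proof (intro tendsto_intros)
      have "(\<lambda>n. 1 / real n * (\<Sum>x<n. (\<lambda>p. (fst p - ?S K (fst p))\<^sup>2) (\<xi> n x, \<xi> n x))) \<longlonglongrightarrow> integral {0..1} (\<lambda>u. (\<lambda>p. (fst p - ?S K (fst p))\<^sup>2) (u, u))"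
        unfolding \<xi>_def by (intro tagged_riemann_sum site_tags continuous_intros)
      then show "?q K \<longlonglongrightarrow> integral {0..1} (\<lambda>u. (u - ?S K u)\<^sup>2)" by simp
    qed
    have "(\<lambda>K. sqrt (integral {0..1} (\<lambda>u. (u - ?S K u)\<^sup>2)) * sqrt ?C) \<longlonglongrightarrow> sqrt 0 * sqrt ?C"
      unfolding b_def by (intro tendsto_intros identity_sine_expansion)
    then show "(\<lambda>K. sqrt (integral {0..1} (\<lambda>u. (u - ?S K u)\<^sup>2)) * sqrt ?C) \<longlonglongrightarrow> 0" by simp
  qed
  ultimately have "(\<lambda>n. A n + X n - B n) \<longlonglongrightarrow> Fbar * t / (2 * \<gamma>) + (W - Fbar * t) / (2 * \<gamma>) - 0"
    by (intro tendsto_intros)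
  then have "(\<lambda>n. 1 / real n * integral {0..t * (real n)\<^sup>2} (P n n)) \<longlonglongrightarrow> Fbar * t / (2 * \<gamma>) + (W - Fbar * t) / (2 * \<gamma>) - 0"
    by (rule Lim_transform_eventually) (rule eventually_sequentiallyI[of 1], rule id[symmetric])
  then show ?thesis by (simp add: W_def add_divide_distrib[symmetric])
qed

lemma total_work_limit:
  assumes t: "t > 0" and rini: "continuous_on {0..1} rini"
    and init: "(\<lambda>n. 1 / real n * (\<Sum>x<n. (R n (Suc x) 0 - rini (real (Suc x) / real n))\<^sup>2)) \<longlonglongrightarrow> 0"
    and \<rho>: "stretch_density \<gamma> Fbar rini \<rho>"
  shows "(\<lambda>n. 1 / real n * integral {0..t * (real n)\<^sup>2} (\<lambda>s. (Fbar + oscillation \<omega> f s / sqrt (real n)) * P n n s)) \<longlonglongrightarrow>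
    Fbar / (2 * \<gamma>) * (LBINT s:{0..t}. vector_derivative (\<rho> s) (at 1 within {0..1}))
    + (\<Sum>k. (norm (f k))\<^sup>2 * (real (Suc k) * \<omega>) *
      Re (csqrt (4 / ((of_real (real (Suc k) * \<omega>))\<^sup>2 - 2 * \<i> * of_real \<gamma> * of_real (real (Suc k) * \<omega>)) - 1))) * t"
    (is "_ \<longlonglongrightarrow> ?L")
proof -
  have "(\<lambda>n. Fbar * (1 / real n * integral {0..t * (real n)\<^sup>2} (P n n)) +
      1 / real n * integral {0..t * (real n)\<^sup>2} (\<lambda>s. oscillation \<omega> f s / sqrt (real n) * P n n s)) \<longlonglongrightarrow>
    Fbar * (1 / (2 * \<gamma>) * (LBINT s:{0..t}. vector_derivative (\<rho> s) (at 1 within {0..1})))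
    + (\<Sum>k. (norm (f k))\<^sup>2 * (real (Suc k) * \<omega>) *
      Re (csqrt (4 / ((of_real (real (Suc k) * \<omega>))\<^sup>2 - 2 * \<i> * of_real \<gamma> * of_real (real (Suc k) * \<omega>)) - 1))) * t"
    by (intro tendsto_add tendsto_mult_left mean_work_limit[OF assms] oscillating_work_limit(1)[OF t])
  also have "Fbar * (1 / (2 * \<gamma>) * (LBINT s:{0..t}. vector_derivative (\<rho> s) (at 1 within {0..1}))) =
    Fbar / (2 * \<gamma>) * (LBINT s:{0..t}. vector_derivative (\<rho> s) (at 1 within {0..1}))" by simp
  finally show ?thesis
  proof (rule Lim_transform_eventually)
    show "\<forall>\<^sub>F n in sequentially. Fbar * (1 / real n * integral {0..t * (real n)\<^sup>2} (P n n)) +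
      1 / real n * integral {0..t * (real n)\<^sup>2} (\<lambda>s. oscillation \<omega> f s / sqrt (real n) * P n n s) =
      1 / real n * integral {0..t * (real n)\<^sup>2} (\<lambda>s. (Fbar + oscillation \<omega> f s / sqrt (real n)) * P n n s)"
    proof (rule eventually_sequentiallyI[of 1])
      fix n :: nat assume n: "1 \<le> n"
      have "((\<lambda>s. Fbar * P n n s + oscillation \<omega> f s / sqrt (real n) * P n n s) has_integral
        Fbar * integral {0..t * (real n)\<^sup>2} (P n n) + integral {0..t * (real n)\<^sup>2} (\<lambda>s. oscillation \<omega> f s / sqrt (real n) * P n n s)) {0..t * (real n)\<^sup>2}"
        using n by (intro has_integral_add has_integral_mult_right integrable_integral integrable_continuous_real continuous_intros
          P_cont' oscillation_cont f_summable) auto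
      from integral_unique[OF this] show "Fbar * (1 / real n * integral {0..t * (real n)\<^sup>2} (P n n)) +
        1 / real n * integral {0..t * (real n)\<^sup>2} (\<lambda>s. oscillation \<omega> f s / sqrt (real n) * P n n s) =
        1 / real n * integral {0..t * (real n)\<^sup>2} (\<lambda>s. (Fbar + oscillation \<omega> f s / sqrt (real n)) * P n n s)"
        by (simp only: distrib_right) (simp add: distrib_left)
    qed
  qed
qed

end

section \<open>Paths with left limits and their Riemann sums\<close>

text \<open>The integrand of \<open>jump_integral\<close> under a name. Where no left limit exists
  the value is arbitrary, so it is used through \<open>cadlag\<close> at positive times.\<close>

definition left_lim :: "(real \<Rightarrow> real) \<Rightarrow> real \<Rightarrow> real" where
  "left_lim f s = Lim (at_left s) f"

lemma tendsto_left_lim: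
  assumes "cadlag f" "s > 0"
  shows "(f \<longlongrightarrow> left_lim f s) (at_left s)"
proof -
  obtain l where l: "(f \<longlongrightarrow> l) (at_left s)" using assms unfolding cadlag_def by blast
  then have "left_lim f s = l" unfolding left_lim_def by (intro tendsto_Lim) auto
  with l show ?thesis by simp
qed

text \<open>Bisection: near every time the path is bounded, on the right by right continuity and on
  the left by the left limit, and boundedness passes to adjacent intervals.\<close>

lemma cadlag_bounded:
  assumes f: "cadlag f"
  shows "\<exists>B. \<forall>s\<in>{0..T}. \<bar>f s\<bar> \<le> B"
proof (cases "0 \<le> T")
  case True
  define Q where "Q a b \<longleftrightarrow> (\<exists>B. \<forall>s\<in>{a..b} \<inter> {0..}. \<bar>f s\<bar> \<le> B)" for a b
  have "Q 0 T"
    using True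
  proof (induction rule: Bolzano)
    case (trans a b c)
    obtain B1 where B1: "\<And>s. s \<in> {a..b} \<inter> {0..} \<Longrightarrow> \<bar>f s\<bar> \<le> B1" using trans(1) unfolding Q_def by blast
    obtain B2 where B2: "\<And>s. s \<in> {b..c} \<inter> {0..} \<Longrightarrow> \<bar>f s\<bar> \<le> B2" using trans(2) unfolding Q_def by blast
    have "\<bar>f s\<bar> \<le> max B1 B2" if "s \<in> {a..c} \<inter> {0..}" for s
      using B1[of s] B2[of s] that by (cases "s \<le> b") auto
    then show ?case unfolding Q_def by blast
  next
    case (local x)
    have "(f \<longlongrightarrow> f x) (at_right x)" using f local(1) unfolding cadlag_def continuous_within by blast
    then have "eventually (\<lambda>s. dist (f s) (f x) < 1) (at_right x)" by (rule tendstoD) simp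
    then obtain d1 where d1: "d1 > x" "\<And>s. x < s \<Longrightarrow> s < d1 \<Longrightarrow> \<bar>f s - f x\<bar> < 1"
      unfolding eventually_at_right_field by (auto simp: dist_real_def)
    \<comment> \<open>At x = 0 the left neighbourhood contains no admissible time, so the bound 0 is
      vacuous there.\<close>
    obtain d2 B where d2: "d2 < x" "\<And>s. d2 < s \<Longrightarrow> s < x \<Longrightarrow> s \<ge> 0 \<Longrightarrow> \<bar>f s\<bar> \<le> B"
    proof (cases "x > 0")
      case True
      have "eventually (\<lambda>s. dist (f s) (left_lim f x) < 1) (at_left x)"
        by (rule tendstoD[OF tendsto_left_lim[OF f True]]) simp
      then obtain d where "d < x" "\<And>s. d < s \<Longrightarrow> s < x \<Longrightarrow> \<bar>f s - left_lim f x\<bar> < 1"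
        unfolding eventually_at_left_field by (auto simp: dist_real_def)
      then show ?thesis by (intro that[of d "\<bar>left_lim f x\<bar> + 1"]) force+
    next
      case False
      then show ?thesis using local(1) by (intro that[of "x - 1" 0]) auto
    qed
    have "Q a b" if "a \<le> x" "x \<le> b" "b - a < min (d1 - x) (x - d2)" for a b
    proof -
      have "\<bar>f s\<bar> \<le> max (\<bar>f x\<bar> + 1) B" if "s \<in> {a..b} \<inter> {0..}" for s
      proof -
        consider "s = x" | "x < s" | "s < x" by linarith
        then show ?thesis
        proof cases
          case 2
          then have "\<bar>f s - f x\<bar> < 1" using that \<open>b - a < _\<close> \<open>a \<le> x\<close> by (intro d1(2)) auto
          then show ?thesis by linarith
        next
          case 3
          then have "\<bar>f s\<bar> \<le> B" using that \<open>b - a < _\<close> \<open>x \<le> b\<close> by (intro d2(2)) auto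
          then show ?thesis by linarith
        qed auto
      qed
      then show ?thesis unfolding Q_def by blast
    qed
    then show ?case using d1(1) d2(1) by (intro exI[of _ "min (d1 - x) (x - d2)"]) auto
  qed
  then show ?thesis unfolding Q_def by (auto simp: Int_absorb2)
qed auto

lemma left_lim_bounded:
  assumes f: "cadlag f" and B: "\<And>s. s \<in> {0..T} \<Longrightarrow> \<bar>f s\<bar> \<le> B" and s: "s \<in> {0<..T}"
  shows "\<bar>left_lim f s\<bar> \<le> B"
proof (rule tendsto_upperbound[OF tendsto_rabs[OF tendsto_left_lim[OF f]]])
  show "\<forall>\<^sub>F i in at_left s. \<bar>f i\<bar> \<le> B"
    unfolding eventually_at_left_field using s B by (intro exI[of _ 0]) auto
qed (use s in auto)

text \<open>The last grid point strictly before s, also when s is itself a grid point. Hence the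
  ceiling minus 1 instead of the floor: sampled values must approach the left limit and not the
  value after a jump.\<close>

definition grid_before :: "real \<Rightarrow> nat \<Rightarrow> real \<Rightarrow> real" where
  "grid_before T K s = (real_of_int \<lceil>s * K / T\<rceil> - 1) * T / K"

lemma grid_before:
  assumes "T > 0" "K > 0"
  shows "grid_before T K s < s" "s \<le> grid_before T K s + T / K" "s > 0 \<Longrightarrow> 0 \<le> grid_before T K s"
proof -
  have c: "real_of_int \<lceil>s * K / T\<rceil> - 1 < s * K / T" "s * K / T \<le> real_of_int \<lceil>s * K / T\<rceil>"
    using ceiling_correct[of "s * K / T"] by auto
  show "grid_before T K s < s"
    using assms c(1) by (simp add: grid_before_def field_simps)
  have "s = s * K / T * (T / K)" using assms by simp
  also have "\<dots> \<le> real_of_int \<lceil>s * K / T\<rceil> * (T / K)" using assms c(2) by (intro mult_right_mono) auto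
  finally show "s \<le> grid_before T K s + T / K"
    using assms by (simp add: grid_before_def left_diff_distrib diff_divide_distrib)
  assume "s > 0"
  then have "s * K / T > 0" using assms by simp
  then have "\<lceil>s * K / T\<rceil> \<ge> 1" by (simp add: less_ceiling_iff)
  then show "0 \<le> grid_before T K s" using assms by (simp add: grid_before_def)
qed

lemma grid_before_cell:
  fixes s T :: real
  assumes T: "T > 0" "K > 0" and s: "s \<in> {real i * T / real K<..real (Suc i) * T / real K}"
  shows "\<lceil>s * real K / T\<rceil> = int (Suc i)" "grid_before T K s = real i * T / real K"
proof -
  have "real i < s * real K / T" "s * real K / T \<le> real (Suc i)"
    using s T by (auto simp: field_simps)
  then show *: "\<lceil>s * K / T\<rceil> = int (Suc i)" by (intro ceiling_unique) auto
  show "grid_before T K s = real i * T / real K" unfolding grid_before_def * by simp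
qed

lemma grid_before_tendsto:
  assumes "T > 0" "(f \<longlongrightarrow> l) (at_left s)"
  shows "(\<lambda>K. f (grid_before T (Suc K) s)) \<longlonglongrightarrow> l"
proof (rule filterlim_compose[OF assms(2)])
  have "(\<lambda>K. grid_before T (Suc K) s) \<longlonglongrightarrow> s"
  proof (rule tendsto_sandwich[OF always_eventually always_eventually])
    show "\<forall>K. s - T / Suc K \<le> grid_before T (Suc K) s"
    proof
      fix K show "s - T / Suc K \<le> grid_before T (Suc K) s"
        using grid_before(2)[OF assms(1), of "Suc K" s] by simp
    qed
    show "\<forall>K. grid_before T (Suc K) s \<le> s" using grid_before(1)[OF assms(1)] by (auto intro: less_imp_le)
    have "(\<lambda>K. s - T * inverse (real (Suc K))) \<longlonglongrightarrow> s - T * 0"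
      by (intro tendsto_intros LIMSEQ_inverse_real_of_nat)
    then show "(\<lambda>K. s - T / Suc K) \<longlonglongrightarrow> s" by (simp add: divide_inverse)
  qed simp
  then show "filterlim (\<lambda>K. grid_before T (Suc K) s) (at_left s) sequentially"
    using grid_before(1)[OF assms(1)] by (intro filterlim_at_withinI) auto
qed

text \<open>The function factors through a countable set of grid points, so an arbitrary f is
  allowed.\<close>

lemma measurable_grid_before [measurable]: "(\<lambda>s. f (grid_before T K s) :: real) \<in> borel_measurable borel"
proof -
  have "(\<lambda>s::real. (\<lambda>z::int. f ((real_of_int z - 1) * T / real K)) \<lceil>s * real K / T\<rceil>) \<in> borel_measurable borel"
    by (rule measurable_compose_countable[where f = "\<lambda>z s. f ((real_of_int z - 1) * T / K)"]) auto
  then show ?thesis by (simp add: grid_before_def)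
qed

lemma measurable_left_lim:
  assumes f: "cadlag f" and T: "T > 0"
  shows "(\<lambda>s. indicator {0<..T} s * left_lim f s) \<in> borel_measurable borel"
proof (rule borel_measurable_LIMSEQ_real)
  show "(\<lambda>K. indicator {0<..T} s * f (grid_before T (Suc K) s)) \<longlonglongrightarrow> indicator {0<..T} s * left_lim f s" for s
    using grid_before_tendsto[OF T tendsto_left_lim[OF f]] by (cases "s \<in> {0<..T}") auto
qed measurable

text \<open>The approximating points lie strictly to the right of s, where right continuity applies;
  floor plus 1 ensures the strictness.\<close>

lemma measurable_cadlag:
  assumes f: "cadlag f"
  shows "(\<lambda>s. indicator {0..T} s * f s) \<in> borel_measurable borel"
proof (rule borel_measurable_LIMSEQ_real)
  let ?g = "\<lambda>K s. (real_of_int \<lfloor>s * real (Suc K)\<rfloor> + 1) / real (Suc K)"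
  have g: "s < ?g K s" "?g K s \<le> s + inverse (real (Suc K))" for K s
  proof -
    have fl: "real_of_int \<lfloor>s * real (Suc K)\<rfloor> \<le> s * real (Suc K)" "s * real (Suc K) < real_of_int \<lfloor>s * real (Suc K)\<rfloor> + 1"
      using floor_correct[of "s * real (Suc K)"] by auto
    show "s < ?g K s" using fl(2) by (simp add: less_divide_eq)
    show "?g K s \<le> s + inverse (real (Suc K))" using fl(1) by (simp add: divide_le_eq distrib_right)
  qed
  show "(\<lambda>K. indicator {0..T} s * f (?g K s)) \<longlonglongrightarrow> indicator {0..T} s * f s" for s
  proof (cases "s \<in> {0..T}")
    case True
    have "(\<lambda>K. ?g K s) \<longlonglongrightarrow> s"
    proof (rule tendsto_sandwich[OF always_eventually always_eventually])
      show "\<forall>K. s \<le> ?g K s" using g(1) by (auto intro: less_imp_le)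
      show "\<forall>K. ?g K s \<le> s + inverse (real (Suc K))" using g(2) by auto
      have "(\<lambda>K. s + inverse (real (Suc K))) \<longlonglongrightarrow> s + 0" by (intro tendsto_intros LIMSEQ_inverse_real_of_nat)
      then show "(\<lambda>K. s + inverse (real (Suc K))) \<longlonglongrightarrow> s" by simp
    qed simp
    then have "filterlim (\<lambda>K. ?g K s) (at_right s) sequentially"
      using g(1)[of s] by (intro filterlim_at_withinI) (auto simp: less_imp_neq[symmetric])
    moreover have "(f \<longlongrightarrow> f s) (at_right s)" using f True unfolding cadlag_def continuous_within by simp
    ultimately have "(\<lambda>K. f (?g K s)) \<longlonglongrightarrow> f s" by (rule filterlim_compose[rotated])
    then show ?thesis using True by simp
  qed simp
  show "(\<lambda>s. indicator {0..T} s * f (?g K s)) \<in> borel_measurable borel" for K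
  proof -
    have "(\<lambda>s. (\<lambda>z::int. f ((real_of_int z + 1) / real (Suc K))) \<lfloor>s * real (Suc K)\<rfloor>) \<in> borel_measurable borel"
      by (rule measurable_compose_countable[where f = "\<lambda>z s. f ((real_of_int z + 1) / real (Suc K))"]) auto
    then show ?thesis by (intro borel_measurable_times) auto
  qed
qed

lemma integrable_cadlag:
  assumes f: "cadlag f" and uv: "0 \<le> u"
  shows "set_integrable lborel {u..v} f" "set_integrable lborel {u<..v} f"
proof -
  obtain B where B: "\<And>s. s \<in> {0..v} \<Longrightarrow> \<bar>f s\<bar> \<le> B" using cadlag_bounded[OF f, of v] by blast
  have "set_integrable lborel A f" if A: "A \<subseteq> {0..v}" "A \<in> sets borel" for A
    unfolding set_integrable_def
  proof (rule integrableI_bounded_set[where A = "{0..v}" and B = "\<bar>B\<bar>"])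
    have "(\<lambda>s. indicator A s * (indicator {0..v} s * f s)) \<in> borel_measurable borel"
      using A measurable_cadlag[OF f, of v] by measurable
    moreover have "(\<lambda>s. indicator A s * (indicator {0..v} s * f s)) = (\<lambda>s. indicator A s *\<^sub>R f s)"
      using A by (intro ext) (auto split: split_indicator)
    ultimately show "(\<lambda>s. indicator A s *\<^sub>R f s) \<in> borel_measurable lborel" by simp
    show "AE s in lborel. s \<in> {0..v} \<longrightarrow> norm (indicator A s *\<^sub>R f s) \<le> \<bar>B\<bar>"
      using B by (intro AE_I2) (force split: split_indicator)
    show "AE s in lborel. s \<notin> {0..v} \<longrightarrow> indicator A s *\<^sub>R f s = 0"
      using A by (intro AE_I2) (auto split: split_indicator)
  qed (simp_all add: emeasure_lborel_Icc_eq)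
  moreover have "{u..v} \<subseteq> {0..v}" "{u<..v} \<subseteq> {0..v}" using uv by auto
  ultimately show "set_integrable lborel {u..v} f" "set_integrable lborel {u<..v} f" by simp_all
qed

lemma integrable_left_lim:
  assumes f: "cadlag f" and uv: "0 \<le> u" and \<nu>: "sets \<nu> = sets borel" "emeasure \<nu> {0<..v} < \<infinity>"
  shows "set_integrable \<nu> {u<..v} (left_lim f)"
proof (cases "v > 0")
  case True
  obtain B where B: "\<And>s. s \<in> {0..v} \<Longrightarrow> \<bar>f s\<bar> \<le> B" using cadlag_bounded[OF f, of v] by blast
  note [measurable_cong] = \<nu>(1)
  show ?thesis
    unfolding set_integrable_def
  proof (rule integrableI_bounded_set[where A = "{0<..v}" and B = "\<bar>B\<bar>"])
    have "(\<lambda>s. indicator {u<..v} s * (indicator {0<..v} s * left_lim f s)) \<in> borel_measurable \<nu>"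
      using measurable_left_lim[OF f True] by measurable
    moreover have "(\<lambda>s. indicator {u<..v} s * (indicator {0<..v} s * left_lim f s)) = (\<lambda>s. indicator {u<..v} s *\<^sub>R left_lim f s)"
      using uv by (auto split: split_indicator)
    ultimately show "(\<lambda>s. indicator {u<..v} s *\<^sub>R left_lim f s) \<in> borel_measurable \<nu>" by simp
    show "AE s in \<nu>. s \<in> {0<..v} \<longrightarrow> norm (indicator {u<..v} s *\<^sub>R left_lim f s) \<le> \<bar>B\<bar>"
      using left_lim_bounded[OF f B] by (intro AE_I2) (force split: split_indicator)
  qed (use \<nu> uv in \<open>auto split: split_indicator\<close>)
next
  case False
  then have "{u<..v} = {}" using uv by auto
  then show ?thesis by (simp add: set_integrable_def)
qed

text \<open>The left limits are the pointwise limit of the translates \<open>f (s - 1/n)\<close>, so translation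
  invariance replaces the countability of the set of discontinuities.\<close>

lemma integral_left_lim:
  assumes f: "cadlag f" and uv: "0 \<le> u" "u \<le> v"
  shows "(LBINT s:{u<..v}. left_lim f s) = (LBINT s:{u<..v}. f s)"
proof -
  \<comment> \<open>Freezing f at negative times makes the translates meaningful near 0; the later
    cutoff at v keeps them bounded.\<close>
  define g where "g s = f (max 0 s)" for s
  obtain B where B: "\<And>s. s \<in> {0..v} \<Longrightarrow> \<bar>f s\<bar> \<le> B" using cadlag_bounded[OF f, of v] by blast
  have gB: "\<bar>g s\<bar> \<le> \<bar>B\<bar>" if "s \<le> v" for s using B[of "max 0 s"] that uv by (auto simp: g_def)
  have gm: "(\<lambda>s. indicator {..v} s * g s) \<in> borel_measurable borel"
  proof -
    have "(\<lambda>s. indicator {..v} s * ((\<lambda>s. indicator {0..v} s * f s) (max 0 s))) \<in> borel_measurable borel"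
      by (intro borel_measurable_times borel_measurable_indicator measurable_compose[OF _ measurable_cadlag[OF f]]) auto
    moreover have "(\<lambda>s. indicator {..v} s * ((\<lambda>s. indicator {0..v} s * f s) (max 0 s))) = (\<lambda>s. indicator {..v} s * g s)"
      using uv by (auto simp: g_def split: split_indicator)
    ultimately show ?thesis by simp
  qed
  define \<delta> where "\<delta> n = inverse (real (Suc n))" for n
  have \<delta>: "\<delta> n > 0" "\<delta> n \<le> 1" for n by (auto simp: \<delta>_def inverse_le_1_iff)
  have \<delta>0: "\<delta> \<longlonglongrightarrow> 0" unfolding \<delta>_def[abs_def] by (rule LIMSEQ_inverse_real_of_nat)
  let ?h = "\<lambda>s. indicator {..v} s * g s"
  have shift: "(\<integral>s. indicator {u<..v} s * ?h (s - \<delta> n) \<partial>lborel) = (\<integral>s. indicator {u - \<delta> n<..v - \<delta> n} s * ?h s \<partial>lborel)" for n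
    using lborel_integral_real_affine[of 1 "\<lambda>s. indicator {u - \<delta> n<..v - \<delta> n} s * ?h s" "- \<delta> n"]
    by (simp add: indicator_def algebra_simps)
  have dom: "integrable lborel (\<lambda>s. indicator {u - 1..v} s * \<bar>B\<bar>)"
    by (intro integrable_mult_left integrable_real_indicator) (auto simp: emeasure_lborel_Icc_eq)
  have hB: "\<bar>?h s\<bar> \<le> \<bar>B\<bar>" for s using gB by (auto split: split_indicator)
  have L1: "(\<lambda>n. \<integral>s. indicator {u<..v} s * ?h (s - \<delta> n) \<partial>lborel) \<longlonglongrightarrow> (\<integral>s. indicator {u<..v} s * left_lim f s \<partial>lborel)"
  proof (rule integral_dominated_convergence[OF _ _ dom])
    show "(\<lambda>s. indicator {u<..v} s * left_lim f s) \<in> borel_measurable lborel"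
      using borel_measurable_integrable[OF integrable_left_lim[OF f uv(1), of lborel v, unfolded set_integrable_def]]
      using uv by (simp add: emeasure_lborel_Ioc)
    have hm: "(\<lambda>s. ?h (s - \<delta> n)) \<in> borel_measurable lborel" for n
      by (rule measurable_compose[OF _ gm]) simp
    show "(\<lambda>s. indicator {u<..v} s * ?h (s - \<delta> n)) \<in> borel_measurable lborel" for n
      by (rule borel_measurable_times[OF _ hm]) simp
    show "AE s in lborel. norm (indicator {u<..v} s * ?h (s - \<delta> n)) \<le> indicator {u - 1..v} s * \<bar>B\<bar>" for n
    proof (intro AE_I2)
      fix s
      have "\<bar>indicator {u<..v} s\<bar> * \<bar>?h (s - \<delta> n)\<bar> \<le> indicator {u - 1..v} s * \<bar>B\<bar>"
        by (intro mult_mono hB) (auto split: split_indicator)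
      then show "norm (indicator {u<..v} s * ?h (s - \<delta> n)) \<le> indicator {u - 1..v} s * \<bar>B\<bar>"
        by (simp only: real_norm_def abs_mult)
    qed
    show "AE s in lborel. (\<lambda>n. indicator {u<..v} s * ?h (s - \<delta> n)) \<longlonglongrightarrow> indicator {u<..v} s * left_lim f s"
    proof (intro AE_I2)
      fix s
      show "(\<lambda>n. indicator {u<..v} s * ?h (s - \<delta> n)) \<longlonglongrightarrow> indicator {u<..v} s * left_lim f s"
      proof (cases "s \<in> {u<..v}")
        case True
        then have s: "s > 0" "s \<le> v" using uv by auto
        have "(\<lambda>n. s - \<delta> n) \<longlonglongrightarrow> s - 0" by (intro tendsto_intros \<delta>0)
        then have "filterlim (\<lambda>n. s - \<delta> n) (at_left s) sequentially"
          using \<delta>(1) by (intro filterlim_at_withinI) (auto simp: less_imp_neq)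
        then have "(\<lambda>n. f (s - \<delta> n)) \<longlonglongrightarrow> left_lim f s"
          by (rule filterlim_compose[OF tendsto_left_lim[OF f s(1)]])
        moreover have "eventually (\<lambda>n. \<delta> n < s) sequentially" using order_tendstoD(2)[OF \<delta>0 s(1)] .
        then have "eventually (\<lambda>n. f (s - \<delta> n) = ?h (s - \<delta> n)) sequentially"
        proof eventually_elim
          case (elim n)
          then show ?case using s \<delta>(1)[of n] by (auto simp: g_def split: split_indicator)
        qed
        ultimately have "(\<lambda>n. ?h (s - \<delta> n)) \<longlonglongrightarrow> left_lim f s" by (rule Lim_transform_eventually)
        then show ?thesis using True by simp
      qed simp
    qed
  qed
  \<comment> \<open>Translating the domain instead of the function turns (u, v] into [u, v) in the
    limit; the two differ only in end points.\<close>
  have L2: "(\<lambda>n. \<integral>s. indicator {u - \<delta> n<..v - \<delta> n} s * ?h s \<partial>lborel) \<longlonglongrightarrow> (\<integral>s. indicator {u..<v} s * ?h s \<partial>lborel)"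
  proof (rule integral_dominated_convergence[OF _ _ dom])
    show "(\<lambda>s. indicator {u..<v} s * ?h s) \<in> borel_measurable lborel" "(\<lambda>s. indicator {u - \<delta> n<..v - \<delta> n} s * ?h s) \<in> borel_measurable lborel" for n
      using gm by auto
    show "AE s in lborel. norm (indicator {u - \<delta> n<..v - \<delta> n} s * ?h s) \<le> indicator {u - 1..v} s * \<bar>B\<bar>" for n
    proof (intro AE_I2)
      fix s
      have "\<bar>indicator {u - \<delta> n<..v - \<delta> n} s\<bar> * \<bar>?h s\<bar> \<le> indicator {u - 1..v} s * \<bar>B\<bar>"
        using \<delta>[of n] by (intro mult_mono hB) (auto simp: indicator_def)
      then show "norm (indicator {u - \<delta> n<..v - \<delta> n} s * ?h s) \<le> indicator {u - 1..v} s * \<bar>B\<bar>"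
        by (simp only: real_norm_def abs_mult)
    qed
    show "AE s in lborel. (\<lambda>n. indicator {u - \<delta> n<..v - \<delta> n} s * ?h s) \<longlonglongrightarrow> indicator {u..<v} s * ?h s"
    proof (intro AE_I2 tendsto_mult tendsto_const)
      fix s
      have "eventually (\<lambda>n. indicator {u - \<delta> n<..v - \<delta> n} s = (indicator {u..<v} s :: real)) sequentially"
      proof -
        have "eventually (\<lambda>n. s < u \<longrightarrow> \<delta> n < u - s) sequentially" "eventually (\<lambda>n. s < v \<longrightarrow> \<delta> n < v - s) sequentially"
          using order_tendstoD(2)[OF \<delta>0, of "u - s"] order_tendstoD(2)[OF \<delta>0, of "v - s"]
          by (cases "s < u"; cases "s < v"; auto)+
        then show ?thesis
        proof eventually_elim
          case (elim n)
          then show ?case using \<delta>(1)[of n] by (auto simp: indicator_def)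
        qed
      qed
      then show "(\<lambda>n. indicator {u - \<delta> n<..v - \<delta> n} s) \<longlonglongrightarrow> (indicator {u..<v} s :: real)"
        by (rule tendsto_eventually)
    qed
  qed
  have "(\<integral>s. indicator {u<..v} s * left_lim f s \<partial>lborel) = (\<integral>s. indicator {u..<v} s * ?h s \<partial>lborel)"
    using LIMSEQ_unique[OF L1[unfolded shift] L2] .
  also have "\<dots> = (\<integral>s. indicator {u<..v} s * f s \<partial>lborel)"
    by (rule integral_discrete_difference[where X = "{u, v}"]) (use uv in \<open>auto simp: g_def split: split_indicator\<close>)
  finally show ?thesis by (simp add: set_lebesgue_integral_def)
qed

lemma cell_union: "(\<Union>i<K. {real i * T / real K<..real (Suc i) * T / real K}) = {0<..T}" if "T > 0" "K > 0"
proof -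
  have "(\<Union>i<m. {real i * T / real K<..real (Suc i) * T / real K}) = {0<..real m * T / real K}" for m
  proof (induction m)
    case (Suc m)
    have "0 \<le> real m * T / real K" "real m * T / real K \<le> real (Suc m) * T / real K"
      using that by (auto simp: divide_right_mono mult_right_mono)
    then show ?case unfolding lessThan_Suc UN_insert Suc by auto
  qed simp
  from this[of K] show ?thesis using that by simp
qed

text \<open>On each cell the sampled value is f at the last grid point before s, which tends to the
  left limit at s. Dominated convergence applies to any measure finite on (0, T], in particular to
  Lebesgue measure and to the jump measure of a path.\<close>

lemma left_riemann_error:
  fixes \<nu> :: "real measure" and T :: real
  assumes f: "cadlag f" and \<nu>: "sets \<nu> = sets borel" "emeasure \<nu> {0<..T} < \<infinity>" and T: "T > 0"
  shows "(\<lambda>K. \<Sum>i<Suc K. \<bar>LINT s:{real i * T / real (Suc K)<..real (Suc i) * T / real (Suc K)}|\<nu>. left_lim f s - f (real i * T / real (Suc K))\<bar>) \<longlonglongrightarrow> 0"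
proof -
  obtain B where B: "\<And>s. s \<in> {0..T} \<Longrightarrow> \<bar>f s\<bar> \<le> B" using cadlag_bounded[OF f, of T] by blast
  note [measurable_cong] = \<nu>(1)
  note m = measurable_left_lim[OF f T]
  let ?e = "\<lambda>K s. indicator {0<..T} s * \<bar>left_lim f s - f (grid_before T (Suc K) s)\<bar>"
  have em: "?e K \<in> borel_measurable \<nu>" for K
  proof -
    have "(\<lambda>s. indicator {0<..T} s * \<bar>indicator {0<..T} s * left_lim f s - f (grid_before T (Suc K) s)\<bar>) \<in> borel_measurable \<nu>"
      using m by measurable
    moreover have "(\<lambda>s. indicator {0<..T} s * \<bar>indicator {0<..T} s * left_lim f s - f (grid_before T (Suc K) s)\<bar>) = ?e K"
      by (auto split: split_indicator)
    ultimately show ?thesis by simp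
  qed
  have eb: "?e K s \<le> indicator {0<..T} s * (2 * \<bar>B\<bar>)" for K s
  proof (cases "s \<in> {0<..T}")
    case True
    have "grid_before T (Suc K) s \<in> {0..T}" using grid_before[OF T, of "Suc K" s] True by auto
    then show ?thesis using B[of "grid_before T (Suc K) s"] left_lim_bounded[OF f B True] True by auto
  qed simp
  have dom: "integrable \<nu> (\<lambda>s. indicator {0<..T} s * (2 * \<bar>B\<bar>))"
    using \<nu> by (intro integrable_mult_left integrable_real_indicator) auto
  have ei: "integrable \<nu> (?e K)" for K
    by (rule Bochner_Integration.integrable_bound[OF dom em]) (use eb in \<open>auto intro!: AE_I2 simp: abs_mult\<close>)
  have lim: "(\<lambda>K. integral\<^sup>L \<nu> (?e K)) \<longlonglongrightarrow> (\<integral>s. 0 \<partial>\<nu>)"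
  proof (rule integral_dominated_convergence[OF _ em dom])
    show "AE s in \<nu>. (\<lambda>K. ?e K s) \<longlonglongrightarrow> 0"
    proof (intro AE_I2)
      fix s show "(\<lambda>K. ?e K s) \<longlonglongrightarrow> 0"
      proof (cases "s \<in> {0<..T}")
        case True
        then have "(\<lambda>K. \<bar>left_lim f s - f (grid_before T (Suc K) s)\<bar>) \<longlonglongrightarrow> \<bar>left_lim f s - left_lim f s\<bar>"
          by (intro tendsto_intros grid_before_tendsto[OF T] tendsto_left_lim f) auto
        then show ?thesis using True by simp
      qed simp
    qed
  qed (use eb in \<open>auto intro!: AE_I2 simp: abs_mult\<close>)
  have le: "(\<Sum>i<Suc K. \<bar>LINT s:{real i * T / real (Suc K)<..real (Suc i) * T / real (Suc K)}|\<nu>. left_lim f s - f (real i * T / real (Suc K))\<bar>) \<le> integral\<^sup>L \<nu> (?e K)" for K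
  proof -
    let ?A = "\<lambda>i. {real i * T / real (Suc K)<..real (Suc i) * T / real (Suc K)}"
    have AU: "(\<Union>i<Suc K. ?A i) = {0<..T}" by (rule cell_union[OF T]) simp
    have disj: "disjoint_family_on ?A {..<Suc K}"
    proof (unfold disjoint_family_on_def, intro ballI impI)
      fix i j :: nat assume ij: "i \<noteq> j"
      show "?A i \<inter> ?A j = {}"
      proof (rule ccontr)
        assume "?A i \<inter> ?A j \<noteq> {}"
        then obtain s where "s \<in> ?A i" "s \<in> ?A j" by blast
        then have "int (Suc i) = int (Suc j)"
          using grid_before_cell(1)[OF T, of "Suc K" s i] grid_before_cell(1)[OF T, of "Suc K" s j] by simp
        then show False using ij by simp
      qed
    qed
    have "\<bar>LINT s:?A i|\<nu>. left_lim f s - f (real i * T / real (Suc K))\<bar> \<le> (LINT s:?A i|\<nu>. ?e K s)" if i: "i < Suc K" for i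
    proof -
      have "?A i \<subseteq> {0<..T}" using AU i by blast
      then have cell: "grid_before T (Suc K) s = real i * T / real (Suc K)" "s \<in> {0<..T}" if "s \<in> ?A i" for s
        using grid_before_cell(2)[OF T _ that] that by auto
      define X where "X s = indicator (?A i) s *\<^sub>R (left_lim f s - f (grid_before T (Suc K) s))" for s
      have e1: "(LINT s:?A i|\<nu>. left_lim f s - f (real i * T / real (Suc K))) = integral\<^sup>L \<nu> X"
        unfolding set_lebesgue_integral_def X_def
        by (intro Bochner_Integration.integral_cong refl) (use cell in \<open>simp add: indicator_def\<close>)
      have e2: "(LINT s:?A i|\<nu>. ?e K s) = (\<integral>s. norm (X s) \<partial>\<nu>)"
        unfolding set_lebesgue_integral_def X_def
        by (intro Bochner_Integration.integral_cong refl) (use cell in \<open>simp add: indicator_def\<close>)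
      show ?thesis unfolding e1 e2 using integral_norm_bound[of \<nu> X] by simp
    qed
    then have "(\<Sum>i<Suc K. \<bar>LINT s:?A i|\<nu>. left_lim f s - f (real i * T / real (Suc K))\<bar>) \<le> (\<Sum>i<Suc K. LINT s:?A i|\<nu>. ?e K s)"
      by (intro sum_mono) auto
    also have "\<dots> = (LINT s:(\<Union>i<Suc K. ?A i)|\<nu>. ?e K s)"
    proof (rule set_integral_finite_Union[symmetric])
      show "set_integrable \<nu> (?A i) (?e K)" for i
        unfolding set_integrable_def by (rule integrable_mult_indicator[OF _ ei]) (simp add: \<nu>(1))
    qed (use disj \<nu>(1) in auto)
    also have "\<dots> = integral\<^sup>L \<nu> (?e K)"
      unfolding AU set_lebesgue_integral_def by (intro Bochner_Integration.integral_cong) (auto split: split_indicator)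
    finally show ?thesis .
  qed
  show ?thesis
    by (rule tendsto_sandwich[OF always_eventually always_eventually tendsto_const lim[simplified]])
       (use le in \<open>auto intro: sum_nonneg\<close>)
qed

section \<open>The Euler scheme along a single path\<close>

text \<open>The growth factors vary with the step, because the number of jumps per step does; 1 +
  \<alpha> \<le> exp \<alpha> collects them into an exponential of their sum.\<close>

lemma discrete_gronwall:
  fixes x \<alpha> \<beta> :: "nat \<Rightarrow> real"
  assumes "\<And>i. i < n \<Longrightarrow> x (Suc i) \<le> (1 + \<alpha> i) * x i + \<beta> i"
    and "\<And>i. i < n \<Longrightarrow> 0 \<le> \<alpha> i" "\<And>i. i < n \<Longrightarrow> 0 \<le> \<beta> i" "0 \<le> x 0"
  shows "x n \<le> (x 0 + (\<Sum>i<n. \<beta> i)) * exp (\<Sum>i<n. \<alpha> i)"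
  using assms
proof (induction n)
  case (Suc n)
  let ?S = "x 0 + (\<Sum>i<n. \<beta> i)" and ?E = "exp (\<Sum>i<n. \<alpha> i)"
  have S0: "0 \<le> ?S" using Suc.prems by (intro add_nonneg_nonneg sum_nonneg) auto
  have E1: "1 \<le> ?E * exp (\<alpha> n)"
    using Suc.prems(2) by (auto simp: exp_add[symmetric] intro!: add_nonneg_nonneg sum_nonneg)
  have "x (Suc n) \<le> (1 + \<alpha> n) * x n + \<beta> n" using Suc.prems(1) by simp
  also have "\<dots> \<le> exp (\<alpha> n) * (?S * ?E) + \<beta> n * (?E * exp (\<alpha> n))"
  proof (rule add_mono)
    have "(1 + \<alpha> n) * x n \<le> (1 + \<alpha> n) * (?S * ?E)"
      using Suc by (intro mult_left_mono Suc.IH) (auto intro: add_nonneg_nonneg)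
    also have "\<dots> \<le> exp (\<alpha> n) * (?S * ?E)"
      using S0 exp_ge_add_one_self[of "\<alpha> n"] by (intro mult_right_mono) (auto intro!: mult_nonneg_nonneg)
    finally show "(1 + \<alpha> n) * x n \<le> exp (\<alpha> n) * (?S * ?E)" .
    show "\<beta> n \<le> \<beta> n * (?E * exp (\<alpha> n))"
      using E1 Suc.prems(3)[of n] by (simp add: mult_le_cancel_left1)
  qed
  also have "\<dots> = (x 0 + (\<Sum>i<Suc n. \<beta> i)) * exp (\<Sum>i<Suc n. \<alpha> i)"
    by (simp add: exp_add algebra_simps)
  finally show ?case .
qed simp

definition drift_norm :: "nat \<Rightarrow> (nat \<Rightarrow> nat \<Rightarrow> real) \<Rightarrow> real" where
  "drift_norm m a = (\<Sum>j\<le>m. \<Sum>k\<le>m. \<bar>a j k\<bar>)"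

lemma drift_norm_nonneg: "0 \<le> drift_norm m a"
  by (simp add: drift_norm_def sum_nonneg)

lemma drift_bound: "(\<Sum>j\<le>m. \<bar>\<Sum>k\<le>m. a j k * y k\<bar>) \<le> drift_norm m a * (\<Sum>k\<le>m. \<bar>y k\<bar>)"
proof -
  have "\<bar>\<Sum>k\<le>m. a j k * y k\<bar> \<le> (\<Sum>k\<le>m. \<bar>a j k\<bar> * (\<Sum>k\<le>m. \<bar>y k\<bar>))" for j
  proof (rule order_trans[OF sum_abs], rule sum_mono)
    fix k assume "k \<in> {..m}"
    then have "\<bar>y k\<bar> \<le> (\<Sum>k\<le>m. \<bar>y k\<bar>)" by (intro member_le_sum) auto
    then show "\<bar>a j k * y k\<bar> \<le> \<bar>a j k\<bar> * (\<Sum>k\<le>m. \<bar>y k\<bar>)"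
      unfolding abs_mult by (intro mult_left_mono) auto
  qed
  then show ?thesis unfolding drift_norm_def sum_distrib_right by (intro sum_mono)
qed

text \<open>Stated for an arbitrary inhomogeneity \<rho> so as to serve twice: for the scheme
  itself, with \<rho> the increment of the additive input, and for its error, with \<rho> the local
  error. The bound 2 on \<open>c\<close> is the size of a flip p to -p.\<close>

lemma linear_step_bound:
  fixes e e' \<rho> D c :: "nat \<Rightarrow> real"
  assumes e': "\<And>j. j \<le> m \<Longrightarrow> e' j = e j + h * (\<Sum>k\<le>m. a j k * e k) + \<rho> j + c j * e j * D j"
    and D: "\<And>j. j \<le> m \<Longrightarrow> 0 \<le> D j" and c: "\<And>j. j \<le> m \<Longrightarrow> \<bar>c j\<bar> \<le> 2" and h: "0 \<le> h"
  shows "(\<Sum>j\<le>m. \<bar>e' j\<bar>) \<le> (1 + (h * drift_norm m a + 2 * (\<Sum>j\<le>m. D j))) * (\<Sum>j\<le>m. \<bar>e j\<bar>) + (\<Sum>j\<le>m. \<bar>\<rho> j\<bar>)"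
proof -
  have "\<bar>e' j\<bar> \<le> \<bar>e j\<bar> + h * \<bar>\<Sum>k\<le>m. a j k * e k\<bar> + \<bar>\<rho> j\<bar> + 2 * (\<Sum>j\<le>m. D j) * \<bar>e j\<bar>" if j: "j \<le> m" for j
  proof -
    have "\<bar>c j * e j * D j\<bar> \<le> 2 * \<bar>e j\<bar> * (\<Sum>j\<le>m. D j)"
    proof -
      have "D j \<le> (\<Sum>j\<le>m. D j)" using j D by (intro member_le_sum) auto
      then show ?thesis unfolding abs_mult using c[OF j] D[OF j] by (intro mult_mono) auto
    qed
    moreover have "\<bar>h * (\<Sum>k\<le>m. a j k * e k)\<bar> = h * \<bar>\<Sum>k\<le>m. a j k * e k\<bar>" using h by (simp add: abs_mult)
    moreover have "2 * \<bar>e j\<bar> * (\<Sum>j\<le>m. D j) = 2 * (\<Sum>j\<le>m. D j) * \<bar>e j\<bar>" by simp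
    ultimately show ?thesis unfolding e'[OF j] by linarith
  qed
  then have "(\<Sum>j\<le>m. \<bar>e' j\<bar>) \<le> (\<Sum>j\<le>m. \<bar>e j\<bar> + h * \<bar>\<Sum>k\<le>m. a j k * e k\<bar> + \<bar>\<rho> j\<bar> + 2 * (\<Sum>j\<le>m. D j) * \<bar>e j\<bar>)"
    by (intro sum_mono) auto
  also have "\<dots> = (\<Sum>j\<le>m. \<bar>e j\<bar>) + h * (\<Sum>j\<le>m. \<bar>\<Sum>k\<le>m. a j k * e k\<bar>) + (\<Sum>j\<le>m. \<bar>\<rho> j\<bar>) + 2 * (\<Sum>j\<le>m. D j) * (\<Sum>j\<le>m. \<bar>e j\<bar>)"
    by (simp only: sum.distrib sum_distrib_left)
  also have "\<dots> \<le> (\<Sum>j\<le>m. \<bar>e j\<bar>) + h * (drift_norm m a * (\<Sum>j\<le>m. \<bar>e j\<bar>)) + (\<Sum>j\<le>m. \<bar>\<rho> j\<bar>) + 2 * (\<Sum>j\<le>m. D j) * (\<Sum>j\<le>m. \<bar>e j\<bar>)"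
    using mult_left_mono[OF drift_bound h] by simp
  also have "\<dots> = (1 + (h * drift_norm m a + 2 * (\<Sum>j\<le>m. D j))) * (\<Sum>j\<le>m. \<bar>e j\<bar>) + (\<Sum>j\<le>m. \<bar>\<rho> j\<bar>)"
    by (simp add: algebra_simps)
  finally show ?thesis .
qed

definition node :: "real \<Rightarrow> nat \<Rightarrow> nat \<Rightarrow> real" where
  "node T K i = real i * T / real K"

lemma node_mono: "T \<ge> 0 \<Longrightarrow> i \<le> i' \<Longrightarrow> node T K i \<le> node T K i'"
  by (simp add: node_def divide_right_mono mult_right_mono)

lemma node_0: "node T K 0 = 0" by (simp add: node_def)

lemma node_le: "T \<ge> 0 \<Longrightarrow> K > 0 \<Longrightarrow> i \<le> K \<Longrightarrow> node T K i \<in> {0..T}"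
  using node_mono[of T 0 i K] node_mono[of T i K K] by (simp add: node_def)

lemma node_step: "node T K (Suc i) = node T K i + T / real K"
  by (simp add: node_def add_divide_distrib distrib_right)

text \<open>Here \<open>a\<close> is the linear drift, \<open>H\<close> an additive input,
  \<open>F\<close> the counting integrators and \<open>c\<close> the relative jump sizes. The jump
  term is evaluated at the left node, so that it can be independent of the coming increment of
  \<open>F\<close>. The increments of \<open>H\<close> are taken exactly.\<close>

primrec euler ::
  "nat \<Rightarrow> (nat \<Rightarrow> nat \<Rightarrow> real) \<Rightarrow> (nat \<Rightarrow> real) \<Rightarrow> (nat \<Rightarrow> real \<Rightarrow> real) \<Rightarrow> (nat \<Rightarrow> real \<Rightarrow> real)
     \<Rightarrow> (nat \<Rightarrow> real) \<Rightarrow> real \<Rightarrow> nat \<Rightarrow> nat \<Rightarrow> nat \<Rightarrow> real" where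
  "euler m a c F H z0 T K 0 = z0"
| "euler m a c F H z0 T K (Suc i) = (\<lambda>j. euler m a c F H z0 T K i j
     + T / real K * (\<Sum>k\<le>m. a j k * euler m a c F H z0 T K i k)
     + (H j (node T K (Suc i)) - H j (node T K i))
     + c j * euler m a c F H z0 T K i j * (F j (node T K (Suc i)) - F j (node T K i)))"

text \<open>The Gronwall factor of a path: it depends on the path only through the number of jumps
  up to T, and not on the mesh.\<close>

definition jump_factor :: "nat \<Rightarrow> (nat \<Rightarrow> nat \<Rightarrow> real) \<Rightarrow> (nat \<Rightarrow> real \<Rightarrow> real) \<Rightarrow> real \<Rightarrow> real" where
  "jump_factor m a F T = exp (drift_norm m a * T + 2 * (\<Sum>j\<le>m. F j T - F j 0))"

lemma euler_gronwall:
  assumes T: "T \<ge> 0" "K > 0" and i: "i \<le> K"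
    and F: "\<And>j s t. \<lbrakk>j \<le> m; 0 \<le> s; s \<le> t\<rbrakk> \<Longrightarrow> F j s \<le> F j t"
    and x: "\<And>l. l < i \<Longrightarrow> x (Suc l) \<le> (1 + (T / real K * drift_norm m a + 2 * (\<Sum>j\<le>m. F j (node T K (Suc l)) - F j (node T K l)))) * x l + \<beta> l"
    and \<beta>: "\<And>l. l < i \<Longrightarrow> 0 \<le> \<beta> l" and x0: "0 \<le> x 0"
  shows "x i \<le> (x 0 + (\<Sum>l<i. \<beta> l)) * jump_factor m a F T"
proof -
  let ?\<alpha> = "\<lambda>l. T / real K * drift_norm m a + 2 * (\<Sum>j\<le>m. F j (node T K (Suc l)) - F j (node T K l))"
  have n0: "0 \<le> node T K l" for l using T by (simp add: node_def)
  have \<alpha>0: "0 \<le> ?\<alpha> l" for l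
    using T drift_norm_nonneg[of m a] n0 node_mono[OF T(1), of l "Suc l" K] by (intro add_nonneg_nonneg mult_nonneg_nonneg sum_nonneg) (auto intro: F)
  have "x i \<le> (x 0 + (\<Sum>l<i. \<beta> l)) * exp (\<Sum>l<i. ?\<alpha> l)"
    by (rule discrete_gronwall[OF x \<alpha>0 \<beta> x0])
  also have "\<dots> \<le> (x 0 + (\<Sum>l<i. \<beta> l)) * jump_factor m a F T"
  proof (rule mult_left_mono)
    have "(\<Sum>l<i. \<Sum>j\<le>m. F j (node T K (Suc l)) - F j (node T K l)) = (\<Sum>j\<le>m. F j (node T K i) - F j 0)"
    proof (subst sum.swap, intro sum.cong refl)
      fix j show "(\<Sum>l<i. F j (node T K (Suc l)) - F j (node T K l)) = F j (node T K i) - F j 0"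
        using sum_lessThan_telescope[of "\<lambda>l. F j (node T K l)" i] by (simp add: node_0)
    qed
    also have "\<dots> \<le> (\<Sum>j\<le>m. F j T - F j 0)"
      using node_le[OF T i] by (intro sum_mono diff_right_mono F) auto
    moreover have "real i * (T / real K * drift_norm m a) \<le> drift_norm m a * T"
    proof -
      have "node T K i * drift_norm m a \<le> T * drift_norm m a"
        using node_le[OF T i] drift_norm_nonneg by (intro mult_right_mono) auto
      then show ?thesis by (simp add: node_def mult_ac)
    qed
    ultimately have "(\<Sum>l<i. ?\<alpha> l) \<le> drift_norm m a * T + 2 * (\<Sum>j\<le>m. F j T - F j 0)"
      by (simp add: sum.distrib sum_distrib_left[symmetric])
    then show "exp (\<Sum>l<i. ?\<alpha> l) \<le> jump_factor m a F T" by (simp add: jump_factor_def)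
  qed (use x0 \<beta> in \<open>auto intro!: add_nonneg_nonneg sum_nonneg\<close>)
  finally show ?thesis .
qed

text \<open>The right side is free of K and i, so its average can dominate all schemes at once.
  \<open>V\<close> controls the variation of the inputs.\<close>

lemma euler_bound:
  assumes T: "T \<ge> 0" "K > 0" and i: "i \<le> K"
    and F: "\<And>j s t. \<lbrakk>j \<le> m; 0 \<le> s; s \<le> t\<rbrakk> \<Longrightarrow> F j s \<le> F j t"
    and c: "\<And>j. j \<le> m \<Longrightarrow> \<bar>c j\<bar> \<le> 2"
    and V: "\<And>s t. \<lbrakk>0 \<le> s; s \<le> t\<rbrakk> \<Longrightarrow> (\<Sum>j\<le>m. \<bar>H j t - H j s\<bar>) \<le> V t - V s"
  shows "(\<Sum>j\<le>m. \<bar>euler m a c F H z0 T K i j\<bar>) \<le> ((\<Sum>j\<le>m. \<bar>z0 j\<bar>) + (V T - V 0)) * jump_factor m a F T"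
proof -
  let ?x = "\<lambda>i. \<Sum>j\<le>m. \<bar>euler m a c F H z0 T K i j\<bar>"
  let ?\<beta> = "\<lambda>l. \<Sum>j\<le>m. \<bar>H j (node T K (Suc l)) - H j (node T K l)\<bar>"
  have n0: "0 \<le> node T K l" "node T K l \<le> node T K (Suc l)" for l using T node_mono[of T l "Suc l" K] by (auto simp: node_def)
  have "?x i \<le> (?x 0 + (\<Sum>l<i. ?\<beta> l)) * jump_factor m a F T"
  proof (rule euler_gronwall[OF T i F])
    fix l
    show "?x (Suc l) \<le> (1 + (T / real K * drift_norm m a + 2 * (\<Sum>j\<le>m. F j (node T K (Suc l)) - F j (node T K l)))) * ?x l + ?\<beta> l"
      using T n0 by (intro linear_step_bound) (auto intro: F c)
  qed (auto intro: sum_nonneg)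
  also have "\<dots> \<le> ((\<Sum>j\<le>m. \<bar>z0 j\<bar>) + (V T - V 0)) * jump_factor m a F T"
  proof (rule mult_right_mono)
    have "(\<Sum>l<i. ?\<beta> l) \<le> (\<Sum>l<i. V (node T K (Suc l)) - V (node T K l))"
      by (intro sum_mono V n0)
    also have "\<dots> = V (node T K i) - V 0"
      using sum_lessThan_telescope[of "\<lambda>l. V (node T K l)" i] by (simp add: node_0)
    also have "\<dots> \<le> V T - V 0"
    proof -
      have "0 \<le> (\<Sum>j\<le>m. \<bar>H j T - H j (node T K i)\<bar>)" by (simp add: sum_nonneg)
      also have "\<dots> \<le> V T - V (node T K i)" using node_le[OF T i] by (intro V) auto
      finally show ?thesis by simp
    qed
    finally show "?x 0 + (\<Sum>l<i. ?\<beta> l) \<le> (\<Sum>j\<le>m. \<bar>z0 j\<bar>) + (V T - V 0)" by simp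
  qed (simp add: jump_factor_def)
  finally show ?thesis .
qed

lemma lbint_singleton: "(LBINT s:{x}. g s) = 0" for x :: real and g :: "real \<Rightarrow> real"
  unfolding set_lebesgue_integral_def
  by (rule integral_eq_zero_AE) (use AE_lborel_singleton[of x] in \<open>auto elim!: eventually_mono\<close>)

text \<open>The local errors are left Riemann errors for Lebesgue measure and for the jump measures;
  their sums over all steps tend to 0, and the Gronwall estimate carries this to the global error,
  uniformly over the nodes.\<close>

lemma euler_converges:
  assumes T: "T > 0"
    and z: "\<And>j. j \<le> m \<Longrightarrow> cadlag (z j)"
    and F: "\<And>j s t. j \<le> m \<Longrightarrow> s \<le> t \<Longrightarrow> F j s \<le> F j t"
    and Fr: "\<And>j s. j \<le> m \<Longrightarrow> continuous (at_right s) (F j)"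
    and c: "\<And>j. j \<le> m \<Longrightarrow> \<bar>c j\<bar> \<le> 2" and H0: "\<And>j. j \<le> m \<Longrightarrow> H j 0 = 0"
    and eq: "\<And>j t. \<lbrakk>j \<le> m; 0 \<le> t\<rbrakk> \<Longrightarrow> z j t = z0 j + (LBINT s:{0..t}. \<Sum>k\<le>m. a j k * z k s) + H j t
       + c j * (LINT s:{0<..t}|interval_measure (F j). left_lim (z j) s)"
  shows "\<exists>\<delta>. \<delta> \<longlonglongrightarrow> 0 \<and> (\<forall>K i j. i \<le> Suc K \<longrightarrow> j \<le> m \<longrightarrow>
    \<bar>euler m a c F H z0 T (Suc K) i j - z j (node T (Suc K) i)\<bar> \<le> \<delta> K)"
proof -
  let ?\<nu> = "\<lambda>j. interval_measure (F j)"
  let ?A = "\<lambda>K i. {node T K i<..node T K (Suc i)}"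
  define Q where "Q \<nu> j K = (\<Sum>i<Suc K. \<bar>LINT s:?A (Suc K) i|\<nu>. left_lim (z j) s - z j (node T (Suc K) i)\<bar>)" for \<nu> j K
  have \<nu>fin: "emeasure (?\<nu> j) {u<..v} = ennreal (F j v - F j u)" "measure (?\<nu> j) {u<..v} = F j v - F j u"
    if "j \<le> m" "u \<le> v" for j u v
  proof -
    show e: "emeasure (?\<nu> j) {u<..v} = ennreal (F j v - F j u)"
      using that by (subst emeasure_interval_measure_Ioc) (auto intro: F Fr)
    show "measure (?\<nu> j) {u<..v} = F j v - F j u"
      using F[OF that] by (simp add: measure_def e)
  qed
  have QL: "Q lborel j \<longlonglongrightarrow> 0" if "j \<le> m" for j
    unfolding Q_def node_def using T by (intro left_riemann_error z that) (auto simp: emeasure_lborel_Ioc)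
  have Q\<nu>: "Q (?\<nu> j) j \<longlonglongrightarrow> 0" if "j \<le> m" for j
    unfolding Q_def node_def using T \<nu>fin(1)[OF that, of 0 T] by (intro left_riemann_error z that) auto
  define \<delta> where "\<delta> K = (\<Sum>j\<le>m. (\<Sum>k\<le>m. \<bar>a j k\<bar> * Q lborel k K) + 2 * Q (?\<nu> j) j K) * jump_factor m a F T" for K
  have "\<delta> \<longlonglongrightarrow> (\<Sum>j\<le>m. (\<Sum>k\<le>m. \<bar>a j k\<bar> * 0) + 2 * 0) * jump_factor m a F T"
    unfolding \<delta>_def[abs_def] by (intro tendsto_intros QL Q\<nu>) auto
  then have "\<delta> \<longlonglongrightarrow> 0" by simp
  moreover have "\<bar>euler m a c F H z0 T (Suc K) i j - z j (node T (Suc K) i)\<bar> \<le> \<delta> K" if i: "i \<le> Suc K" and j: "j \<le> m" for K i j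
  proof -
    let ?n = "node T (Suc K)" and ?h = "T / real (Suc K)"
    have n0: "0 \<le> ?n l" "?n l \<le> ?n (Suc l)" for l using T node_mono[of T l "Suc l" "Suc K"] by (auto simp: node_def)
    define e where "e l j = euler m a c F H z0 T (Suc K) l j - z j (?n l)" for l j
    \<comment> \<open>What the exact path does beyond an Euler step: the drift integral and the jump
      integral, each minus its value with the integrand frozen at the left node.\<close>
    define r where "r l j = (\<Sum>k\<le>m. a j k * (LINT s:?A (Suc K) l|lborel. left_lim (z k) s - z k (?n l)))
       + c j * (LINT s:?A (Suc K) l|?\<nu> j. left_lim (z j) s - z j (?n l))" for l j
    have step: "z j (?n (Suc l)) = z j (?n l) + ?h * (\<Sum>k\<le>m. a j k * z k (?n l)) + (H j (?n (Suc l)) - H j (?n l))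
       + c j * z j (?n l) * (F j (?n (Suc l)) - F j (?n l)) + r l j" if j: "j \<le> m" for l j
    proof -
      let ?g = "?n l" and ?g' = "?n (Suc l)"
      have fin: "emeasure lborel {0<..?g'} < \<infinity>" "emeasure (?\<nu> j) {0<..?g'} < \<infinity>"
        using n0 \<nu>fin(1)[OF j, of 0 ?g'] n0(1)[of "Suc l"] by (auto simp: emeasure_lborel_Ioc)
      have i1: "set_integrable lborel {u..v} (\<lambda>s. \<Sum>k\<le>m. a j k * z k s)" "set_integrable lborel {u<..v} (\<lambda>s. \<Sum>k\<le>m. a j k * z k s)" if "0 \<le> u" for u v
        using integrable_cadlag[OF z that] unfolding set_integrable_def by (auto simp: sum_distrib_left mult.left_commute[of "indicator _ _"])
      have i2: "set_integrable (?\<nu> j) {u<..?g'} (left_lim (z j))" if "0 \<le> u" for u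
        by (rule integrable_left_lim[OF z[OF j] that _ fin(2)]) simp
      have i2': "set_integrable (?\<nu> j) {0<..?g} (left_lim (z j))"
        by (rule set_integrable_subset[OF i2[of 0]]) (use n0(2)[of l] in auto)
      have "(LBINT s:{0..?g'}. \<Sum>k\<le>m. a j k * z k s) = (LBINT s:{0..?g} \<union> {?g<..?g'}. \<Sum>k\<le>m. a j k * z k s)"
        using n0 by (simp add: ivl_disj_un)
      also have "\<dots> = (LBINT s:{0..?g}. \<Sum>k\<le>m. a j k * z k s) + (LBINT s:{?g<..?g'}. \<Sum>k\<le>m. a j k * z k s)"
        by (rule set_integral_Un) (use i1 n0 in auto)
      also have "(LBINT s:{?g<..?g'}. \<Sum>k\<le>m. a j k * z k s) = (\<Sum>k\<le>m. a j k * (LBINT s:{?g<..?g'}. z k s))"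
      proof -
        have "(LBINT s:{?g<..?g'}. \<Sum>k\<le>m. a j k * z k s) = (\<Sum>k\<le>m. LBINT s:{?g<..?g'}. a j k * z k s)"
          unfolding set_lebesgue_integral_def scaleR_sum_right
          by (rule Bochner_Integration.integral_sum) (use integrable_cadlag(2)[OF z n0(1), unfolded set_integrable_def] in \<open>auto simp: mult.left_commute[of "indicator _ _"]\<close>)
        then show ?thesis by simp
      qed
      also have "(\<Sum>k\<le>m. a j k * (LBINT s:{?g<..?g'}. z k s)) =
         ?h * (\<Sum>k\<le>m. a j k * z k ?g) + (\<Sum>k\<le>m. a j k * (LINT s:?A (Suc K) l|lborel. left_lim (z k) s - z k ?g))"
      proof -
        have "(LBINT s:{?g<..?g'}. z k s) = ?h * z k ?g + (LINT s:?A (Suc K) l|lborel. left_lim (z k) s - z k ?g)" if k: "k \<le> m" for k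
        proof -
          have "(LINT s:?A (Suc K) l|lborel. left_lim (z k) s - z k ?g) = (LBINT s:{?g<..?g'}. left_lim (z k) s) - (LBINT s:{?g<..?g'}. z k ?g)"
            by (rule set_integral_diff(2)[OF integrable_left_lim[OF z[OF k] n0(1) _ fin(1)]])
              (simp_all add: set_integrable_def emeasure_lborel_Ioc n0)
          \<comment> \<open>For Lebesgue measure the path may be exchanged with its left limits, so
            drift and jumps are covered by the same Riemann estimate.\<close>
          also have "(LBINT s:{?g<..?g'}. left_lim (z k) s) = (LBINT s:{?g<..?g'}. z k s)"
            by (rule integral_left_lim[OF z[OF k] n0])
          also have "(LBINT s:{?g<..?g'}. z k ?g) = ?h * z k ?g"
            using n0(2)[of l] by (simp add: set_lebesgue_integral_def measure_def emeasure_lborel_Ioc node_step)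
          finally show ?thesis by simp
        qed
        then have "(\<Sum>k\<le>m. a j k * (LBINT s:{?g<..?g'}. z k s)) = (\<Sum>k\<le>m. ?h * (a j k * z k ?g) + a j k * (LINT s:?A (Suc K) l|lborel. left_lim (z k) s - z k ?g))"
          by (intro sum.cong) (auto simp: algebra_simps)
        then show ?thesis by (simp only: sum.distrib sum_distrib_left)
      qed
      finally have I: "(LBINT s:{0..?g'}. \<Sum>k\<le>m. a j k * z k s) = (LBINT s:{0..?g}. \<Sum>k\<le>m. a j k * z k s) +
         (?h * (\<Sum>k\<le>m. a j k * z k ?g) + (\<Sum>k\<le>m. a j k * (LINT s:?A (Suc K) l|lborel. left_lim (z k) s - z k ?g)))" .
      have "(LINT s:{0<..?g'}|?\<nu> j. left_lim (z j) s) = (LINT s:{0<..?g} \<union> {?g<..?g'}|?\<nu> j. left_lim (z j) s)"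
        using n0 by (simp add: ivl_disj_un)
      also have "\<dots> = (LINT s:{0<..?g}|?\<nu> j. left_lim (z j) s) + (LINT s:{?g<..?g'}|?\<nu> j. left_lim (z j) s)"
        by (rule set_integral_Un) (use i2 i2' n0 in auto)
      also have "(LINT s:{?g<..?g'}|?\<nu> j. left_lim (z j) s) = z j ?g * (F j ?g' - F j ?g) + (LINT s:?A (Suc K) l|?\<nu> j. left_lim (z j) s - z j ?g)"
      proof -
        have "(LINT s:?A (Suc K) l|?\<nu> j. left_lim (z j) s - z j ?g) = (LINT s:{?g<..?g'}|?\<nu> j. left_lim (z j) s) - (LINT s:{?g<..?g'}|?\<nu> j. z j ?g)"
          by (rule set_integral_diff(2)[OF i2[OF n0(1)]]) (simp add: set_integrable_def \<nu>fin(1)[OF j n0(2)])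
        also have "(LINT s:{?g<..?g'}|?\<nu> j. z j ?g) = z j ?g * (F j ?g' - F j ?g)"
          by (simp add: set_lebesgue_integral_def \<nu>fin(2)[OF j n0(2)])
        finally show ?thesis by simp
      qed
      finally have J: "(LINT s:{0<..?g'}|?\<nu> j. left_lim (z j) s) = (LINT s:{0<..?g}|?\<nu> j. left_lim (z j) s) +
        (z j ?g * (F j ?g' - F j ?g) + (LINT s:?A (Suc K) l|?\<nu> j. left_lim (z j) s - z j ?g))" .
      show ?thesis
        unfolding eq[OF j n0(1)[of "Suc l"]] eq[OF j n0(1)[of l], symmetric] I J r_def
        by (simp only: distrib_left eq[OF j n0(1)[of l], symmetric] add.assoc[symmetric])
          (use eq[OF j n0(1)[of l]] in \<open>simp add: algebra_simps\<close>)
    qed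
    have e_step: "(\<Sum>j\<le>m. \<bar>e (Suc l) j\<bar>) \<le> (1 + (T / real (Suc K) * drift_norm m a + 2 * (\<Sum>j\<le>m. F j (?n (Suc l)) - F j (?n l)))) * (\<Sum>j\<le>m. \<bar>e l j\<bar>) + (\<Sum>j\<le>m. \<bar>- r l j\<bar>)" for l
    proof (rule linear_step_bound[OF _ _ c])
      fix j assume j: "j \<le> m"
      have "(\<Sum>k\<le>m. a j k * e l k) = (\<Sum>k\<le>m. a j k * euler m a c F H z0 T (Suc K) l k) - (\<Sum>k\<le>m. a j k * z k (?n l))"
        by (simp add: e_def right_diff_distrib sum_subtractf)
      then show "e (Suc l) j = e l j + T / real (Suc K) * (\<Sum>k\<le>m. a j k * e l k) + - r l j + c j * e l j * (F j (?n (Suc l)) - F j (?n l))"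
      proof -
        assume eq: "(\<Sum>k\<le>m. a j k * e l k) = (\<Sum>k\<le>m. a j k * euler m a c F H z0 T (Suc K) l k) - (\<Sum>k\<le>m. a j k * z k (?n l))"
        have "(y + h * A + dH + w * y * D) - (x + h * B + dH + w * x * D + p) = y - x + h * (A - B) + - p + w * (y - x) * D"
          for y h A dH w D x B p :: real by (simp add: algebra_simps)
        then show ?thesis unfolding eq unfolding e_def step[OF j] euler.simps .
      qed
      show "0 \<le> F j (?n (Suc l)) - F j (?n l)" using F[OF j n0(2)] by simp
    qed (use T in auto)
    have "\<bar>e i j\<bar> \<le> (\<Sum>j\<le>m. \<bar>e i j\<bar>)" using j by (intro member_le_sum) auto
    also have "\<dots> \<le> ((\<Sum>j\<le>m. \<bar>e 0 j\<bar>) + (\<Sum>l<i. \<Sum>j\<le>m. \<bar>- r l j\<bar>)) * jump_factor m a F T"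
      by (rule euler_gronwall[OF _ _ i _ e_step]) (use T F in \<open>auto intro: sum_nonneg\<close>)
    also have "\<dots> \<le> \<delta> K"
      unfolding \<delta>_def
    proof (rule mult_right_mono)
      have "e 0 j = 0" if "j \<le> m" for j
        using eq[OF that, of 0] H0[OF that] by (simp add: e_def node_0 lbint_singleton) (simp add: set_lebesgue_integral_def)
      then have "(\<Sum>j\<le>m. \<bar>e 0 j\<bar>) = 0" by simp
      moreover have "(\<Sum>l<i. \<Sum>j\<le>m. \<bar>- r l j\<bar>) \<le> (\<Sum>l<Suc K. \<Sum>j\<le>m. \<bar>- r l j\<bar>)"
        using i by (intro sum_mono2) (auto intro: sum_nonneg)
      moreover have "(\<Sum>l<Suc K. \<Sum>j\<le>m. \<bar>- r l j\<bar>) \<le> (\<Sum>j\<le>m. (\<Sum>k\<le>m. \<bar>a j k\<bar> * Q lborel k K) + 2 * Q (?\<nu> j) j K)"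
      proof -
        let ?I = "\<lambda>\<nu> k l. \<bar>LINT s:?A (Suc K) l|\<nu>. left_lim (z k) s - z k (?n l)\<bar>"
        have "\<bar>- r l j\<bar> \<le> (\<Sum>k\<le>m. \<bar>a j k\<bar> * ?I lborel k l) + 2 * ?I (?\<nu> j) j l" if "j \<le> m" for l j
        proof -
          have "\<bar>\<Sum>k\<le>m. a j k * (LINT s:?A (Suc K) l|lborel. left_lim (z k) s - z k (?n l))\<bar> \<le> (\<Sum>k\<le>m. \<bar>a j k\<bar> * ?I lborel k l)"
            by (rule order_trans[OF sum_abs]) (simp add: abs_mult)
          moreover have "\<bar>c j * (LINT s:?A (Suc K) l|?\<nu> j. left_lim (z j) s - z j (?n l))\<bar> \<le> 2 * ?I (?\<nu> j) j l"
            unfolding abs_mult by (intro mult_right_mono c that) auto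
          ultimately show ?thesis unfolding r_def abs_minus_cancel by linarith
        qed
        then have "(\<Sum>l<Suc K. \<Sum>j\<le>m. \<bar>- r l j\<bar>) \<le> (\<Sum>l<Suc K. \<Sum>j\<le>m. (\<Sum>k\<le>m. \<bar>a j k\<bar> * ?I lborel k l) + 2 * ?I (?\<nu> j) j l)"
          by (intro sum_mono) auto
        also have "\<dots> = (\<Sum>j\<le>m. \<Sum>l<Suc K. (\<Sum>k\<le>m. \<bar>a j k\<bar> * ?I lborel k l) + 2 * ?I (?\<nu> j) j l)"
          by (rule sum.swap)
        also have "\<dots> = (\<Sum>j\<le>m. (\<Sum>k\<le>m. \<bar>a j k\<bar> * Q lborel k K) + 2 * Q (?\<nu> j) j K)"
        proof (intro sum.cong refl)
          fix j
          have "(\<Sum>l<Suc K. \<Sum>k\<le>m. \<bar>a j k\<bar> * ?I lborel k l) = (\<Sum>k\<le>m. \<Sum>l<Suc K. \<bar>a j k\<bar> * ?I lborel k l)"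
            by (rule sum.swap)
          then show "(\<Sum>l<Suc K. (\<Sum>k\<le>m. \<bar>a j k\<bar> * ?I lborel k l) + 2 * ?I (?\<nu> j) j l) = (\<Sum>k\<le>m. \<bar>a j k\<bar> * Q lborel k K) + 2 * Q (?\<nu> j) j K"
            unfolding Q_def sum.distrib by (simp only: sum_distrib_left)
        qed
        finally show ?thesis .
      qed
      ultimately show "(\<Sum>j\<le>m. \<bar>e 0 j\<bar>) + (\<Sum>l<i. \<Sum>j\<le>m. \<bar>- r l j\<bar>) \<le> (\<Sum>j\<le>m. (\<Sum>k\<le>m. \<bar>a j k\<bar> * Q lborel k K) + 2 * Q (?\<nu> j) j K)"
        by linarith
    qed (simp add: jump_factor_def)
    finally show ?thesis by (simp add: e_def)
  qed
  ultimately show ?thesis by blast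
qed

definition cell_index :: "real \<Rightarrow> nat \<Rightarrow> real \<Rightarrow> nat" where
  "cell_index T K s = nat (\<lceil>s * real K / T\<rceil> - 1)"

lemma cell_index:
  assumes "T > 0" "K > 0" "s \<in> {0<..T}"
  shows "node T K (cell_index T K s) = grid_before T K s" "cell_index T K s < K"
proof -
  have "s * real K / T > 0" using assms by simp
  then have c1: "\<lceil>s * real K / T\<rceil> \<ge> 1" by (simp add: less_ceiling_iff)
  then show "node T K (cell_index T K s) = grid_before T K s"
    by (simp add: node_def cell_index_def grid_before_def)
  have "s * real K / T \<le> real K" using assms by (simp add: divide_le_eq mult.commute[of s])
  then have "\<lceil>s * real K / T\<rceil> \<le> int K" by (simp add: ceiling_le_iff)
  then show "cell_index T K s < K" using c1 assms(2) unfolding cell_index_def by linarith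
qed

lemma measurable_cell_index [measurable]: "(\<lambda>s. \<psi> (cell_index T K s) :: real) \<in> borel_measurable borel"
proof -
  have "(\<lambda>s::real. (\<lambda>x::int. \<psi> (nat (x - 1))) \<lceil>s * real K / T\<rceil>) \<in> borel_measurable borel"
    by (rule measurable_compose_countable[where f = "\<lambda>z s. \<psi> (nat (z - 1))"]) auto
  then show ?thesis by (simp add: cell_index_def)
qed

text \<open>Turns the accumulated Euler steps into an integral over the fixed interval (0, T], to
  which dominated convergence in time applies.\<close>

lemma integral_step:
  fixes \<psi> :: "nat \<Rightarrow> real"
  assumes T: "T > 0" "K > 0"
  shows "(LBINT s:{0<..T}. \<psi> (cell_index T K s)) = (\<Sum>i<K. T / real K * \<psi> i)"
proof -
  let ?A = "\<lambda>i. {real i * T / real K<..real (Suc i) * T / real K}"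
  have cell: "cell_index T K s = i" if "s \<in> ?A i" for i s
    using grid_before_cell(1)[OF T that] by (simp add: cell_index_def)
  have A: "indicator (?A i) s *\<^sub>R \<psi> (cell_index T K s) = indicator (?A i) s *\<^sub>R \<psi> i" for i s
    using cell[of s i] by (simp add: indicator_def)
  have len: "emeasure lborel (?A i) = ennreal (T / real K)" for i
    using T by (subst emeasure_lborel_Ioc) (auto simp: divide_right_mono mult_right_mono diff_divide_distrib[symmetric] left_diff_distrib[symmetric])
  have "(LBINT s:(\<Union>i<K. ?A i). \<psi> (cell_index T K s)) = (\<Sum>i<K. LBINT s:?A i. \<psi> (cell_index T K s))"
  proof (rule set_integral_finite_Union)
    show "disjoint_family_on ?A {..<K}"
      using cell unfolding disjoint_family_on_def by (metis disjoint_iff)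
    show "set_integrable lborel (?A i) (\<lambda>s. \<psi> (cell_index T K s))" for i
      unfolding set_integrable_def A
      by (intro integrable_scaleR_left integrable_real_indicator) (simp_all add: len del: of_nat_Suc)
  qed auto
  also have "\<dots> = (\<Sum>i<K. T / real K * \<psi> i)"
    unfolding set_lebesgue_integral_def A using T by (simp add: measure_def len del: of_nat_Suc)
  finally show ?thesis unfolding cell_union[OF T] .
qed

section \<open>Averaging a linear system driven by jumps\<close>

text \<open>The scheme \<open>Y\<close> and its dominating variable \<open>G\<close> are parameters
  tied by equations, so that the assumptions can speak about them. Independence is condensed into
  \<open>jump_mean\<close>: on average, the next increment of F_j may be replaced by its
  mean.\<close>

locale jump_system = prob_space M for M :: "'a measure" +
  fixes m :: nat and a :: "nat \<Rightarrow> nat \<Rightarrow> real" and c rt :: "nat \<Rightarrow> real"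
    and F H z :: "nat \<Rightarrow> real \<Rightarrow> 'a \<Rightarrow> real" and z0 :: "nat \<Rightarrow> 'a \<Rightarrow> real"
    and V :: "real \<Rightarrow> 'a \<Rightarrow> real" and h :: "nat \<Rightarrow> real \<Rightarrow> real"
    and Y :: "real \<Rightarrow> nat \<Rightarrow> nat \<Rightarrow> nat \<Rightarrow> 'a \<Rightarrow> real" and G :: "real \<Rightarrow> 'a \<Rightarrow> real"
  assumes c_le: "\<And>j. j \<le> m \<Longrightarrow> \<bar>c j\<bar> \<le> 2"
    and Y_def: "\<And>T K i j \<omega>. Y T K i j \<omega> = euler m a c (\<lambda>j s. F j s \<omega>) (\<lambda>j s. H j s \<omega>) (\<lambda>j. z0 j \<omega>) T K i j"
    and G_def: "\<And>T \<omega>. G T \<omega> = ((\<Sum>j\<le>m. \<bar>z0 j \<omega>\<bar>) + (V T \<omega> - V 0 \<omega>)) * jump_factor m a (\<lambda>j s. F j s \<omega>) T"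
    and z_cadlag: "AE \<omega> in M. \<forall>j\<le>m. cadlag (\<lambda>t. z j t \<omega>)"
    and F_mono: "AE \<omega> in M. \<forall>j\<le>m. \<forall>s t. s \<le> t \<longrightarrow> F j s \<omega> \<le> F j t \<omega>"
    and F_right: "AE \<omega> in M. \<forall>j\<le>m. \<forall>s. continuous (at_right s) (\<lambda>s. F j s \<omega>)"
    and H_0: "AE \<omega> in M. \<forall>j\<le>m. H j 0 \<omega> = 0"
    and H_V: "AE \<omega> in M. \<forall>s t. 0 \<le> s \<longrightarrow> s \<le> t \<longrightarrow> (\<Sum>j\<le>m. \<bar>H j t \<omega> - H j s \<omega>\<bar>) \<le> V t \<omega> - V s \<omega>"
    and z_eq: "AE \<omega> in M. \<forall>j\<le>m. \<forall>t\<ge>0. z j t \<omega> = z0 j \<omega> + (LBINT s:{0..t}. \<Sum>k\<le>m. a j k * z k s \<omega>) + H j t \<omega>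
       + c j * (LINT s:{0<..t}|interval_measure (\<lambda>s. F j s \<omega>). left_lim (\<lambda>s. z j s \<omega>) s)"
    and G_integrable: "\<And>T. T \<ge> 0 \<Longrightarrow> integrable M (G T)"
    and Y_measurable: "\<And>T K i j. \<lbrakk>T > 0; K > 0; i \<le> K; j \<le> m\<rbrakk> \<Longrightarrow> Y T K i j \<in> borel_measurable M"
    and z_measurable: "\<And>j t. \<lbrakk>j \<le> m; t \<ge> 0\<rbrakk> \<Longrightarrow> z j t \<in> borel_measurable M"
    and jump_mean: "\<And>T K i j. \<lbrakk>T > 0; K > 0; i < K; j \<le> m; integrable M (Y T K i j)\<rbrakk> \<Longrightarrow>
       integrable M (\<lambda>\<omega>. c j * Y T K i j \<omega> * (F j (node T K (Suc i)) \<omega> - F j (node T K i) \<omega>)) \<and>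
       (\<integral>\<omega>. c j * Y T K i j \<omega> * (F j (node T K (Suc i)) \<omega> - F j (node T K i) \<omega>) \<partial>M) = T / real K * (c j * rt j * (\<integral>\<omega>. Y T K i j \<omega> \<partial>M))"
    and H_mean: "\<And>j t. \<lbrakk>j \<le> m; t \<ge> 0\<rbrakk> \<Longrightarrow> integrable M (H j t) \<and> (\<integral>\<omega>. H j t \<omega> \<partial>M) = h j t"
    and h_cont: "\<And>j. j \<le> m \<Longrightarrow> continuous_on {0..} (h j)"
begin

lemma Y_le_G:
  assumes "T > 0" "K > 0"
  shows "AE \<omega> in M. \<forall>i\<le>K. \<forall>j\<le>m. \<bar>Y T K i j \<omega>\<bar> \<le> G T \<omega>"
  using F_mono H_V
proof eventually_elim
  case (elim \<omega>)
  show ?case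
  proof (intro allI impI)
    fix i j assume ij: "i \<le> K" "j \<le> m"
    have "\<bar>Y T K i j \<omega>\<bar> \<le> (\<Sum>j\<le>m. \<bar>Y T K i j \<omega>\<bar>)" using ij by (intro member_le_sum) auto
    also have "\<dots> \<le> G T \<omega>"
      unfolding Y_def G_def using assms ij elim by (intro euler_bound c_le) auto
    finally show "\<bar>Y T K i j \<omega>\<bar> \<le> G T \<omega>" .
  qed
qed


lemma Y_integrable:
  assumes "T > 0" "K > 0" "i \<le> K" "j \<le> m"
  shows "integrable M (Y T K i j)"
  by (rule Bochner_Integration.integrable_bound[OF G_integrable[of T] Y_measurable[OF assms]])
    (use Y_le_G[OF assms(1,2)] assms in \<open>auto elim!: eventually_mono intro: order_trans[OF _ abs_ge_self]\<close>)

definition mY :: "real \<Rightarrow> nat \<Rightarrow> nat \<Rightarrow> nat \<Rightarrow> real" where "mY T K i j = (\<integral>\<omega>. Y T K i j \<omega> \<partial>M)"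

text \<open>The drift of the averages: the linear drift together with the jumps, each replaced by
  its size times its rate.\<close>

definition field :: "(nat \<Rightarrow> real) \<Rightarrow> nat \<Rightarrow> real" where
  "field x j = (\<Sum>k\<le>m. a j k * x k) + c j * rt j * x j"

lemma mY_bound:
  assumes "T > 0" "K > 0" "i \<le> K" "j \<le> m"
  shows "\<bar>mY T K i j\<bar> \<le> (\<integral>\<omega>. G T \<omega> \<partial>M)"
proof -
  have "\<bar>mY T K i j\<bar> \<le> (\<integral>\<omega>. \<bar>Y T K i j \<omega>\<bar> \<partial>M)" unfolding mY_def by (rule integral_abs_bound)
  also have "\<dots> \<le> (\<integral>\<omega>. G T \<omega> \<partial>M)"
    using assms Y_le_G[OF assms(1,2)] by (intro integral_mono_AE integrable_abs Y_integrable G_integrable) (auto elim!: eventually_mono)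
  finally show ?thesis .
qed

text \<open>By \<open>jump_mean\<close> the averaged scheme is again an Euler scheme, now for a
  deterministic linear equation with the field \<open>field\<close>.\<close>

lemma mY_step:
  assumes T: "T > 0" "K > 0" and i: "i < K" and j: "j \<le> m"
  shows "mY T K (Suc i) j = mY T K i j + T / real K * field (mY T K i) j + (h j (node T K (Suc i)) - h j (node T K i))"
proof -
  have n: "0 \<le> node T K l" for l using T by (simp add: node_def)
  have Yi: "integrable M (Y T K i k)" if "k \<le> m" for k using T i that by (intro Y_integrable) auto
  note jm = jump_mean[OF T i j Yi[OF j]]
  have S: "integrable M (\<lambda>\<omega>. T / real K * (\<Sum>k\<le>m. a j k * Y T K i k \<omega>))"
    by (intro integrable_mult_right Bochner_Integration.integrable_sum Yi) auto
  have "mY T K (Suc i) j = (\<integral>\<omega>. Y T K i j \<omega> + T / real K * (\<Sum>k\<le>m. a j k * Y T K i k \<omega>) + (H j (node T K (Suc i)) \<omega> - H j (node T K i) \<omega>)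
     + c j * Y T K i j \<omega> * (F j (node T K (Suc i)) \<omega> - F j (node T K i) \<omega>) \<partial>M)"
    unfolding mY_def Y_def by simp
  also have "\<dots> = mY T K i j + T / real K * (\<Sum>k\<le>m. a j k * mY T K i k) + (h j (node T K (Suc i)) - h j (node T K i)) + T / real K * (c j * rt j * mY T K i j)"
    using jm Yi[OF j] S H_mean[OF j n] Yi by (simp add: mY_def)
  finally show ?thesis by (simp add: field_def distrib_left)
qed

lemma mY_sum:
  assumes T: "T > 0" "K > 0" and i: "i \<le> K" and j: "j \<le> m"
  shows "mY T K i j = (\<integral>\<omega>. z0 j \<omega> \<partial>M) + (\<Sum>l<i. T / real K * field (mY T K l) j) + (h j (node T K i) - h j 0)"
  using i
proof (induction i)
  case 0
  have "Y T K 0 j = z0 j" by (rule ext) (simp add: Y_def)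
  then show ?case by (simp add: mY_def node_0)
next
  case (Suc i)
  then show ?case using mY_step[OF T, of i j] j by simp
qed

definition mean :: "nat \<Rightarrow> real \<Rightarrow> real" where "mean j t = (\<integral>\<omega>. z j t \<omega> \<partial>M)"

lemma Y_converges:
  assumes T: "T > 0"
  shows "AE \<omega> in M. \<exists>\<delta>. \<delta> \<longlonglongrightarrow> 0 \<and> (\<forall>K i j. i \<le> Suc K \<longrightarrow> j \<le> m \<longrightarrow>
    \<bar>Y T (Suc K) i j \<omega> - z j (node T (Suc K) i) \<omega>\<bar> \<le> \<delta> K)"
  using z_cadlag F_mono F_right H_0 z_eq
proof eventually_elim
  case (elim \<omega>)
  then show ?case unfolding Y_def by (intro euler_converges[OF T] c_le) auto
qed

lemma Y_end_converges:
  assumes T: "T > 0" and j: "j \<le> m"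
  shows "AE \<omega> in M. (\<lambda>K. Y T (Suc K) (Suc K) j \<omega>) \<longlonglongrightarrow> z j T \<omega>"
  using Y_converges[OF T]
proof eventually_elim
  case (elim \<omega>)
  then obtain \<delta> where \<delta>: "\<delta> \<longlonglongrightarrow> 0" "\<And>K. \<bar>Y T (Suc K) (Suc K) j \<omega> - z j (node T (Suc K) (Suc K)) \<omega>\<bar> \<le> \<delta> K"
    using j by blast
  have "node T (Suc K) (Suc K) = T" for K by (simp add: node_def del: of_nat_Suc)
  then have "(\<lambda>K. Y T (Suc K) (Suc K) j \<omega> - z j T \<omega>) \<longlonglongrightarrow> 0"
    using \<delta> by (intro Lim_null_comparison[OF _ \<delta>(1)] always_eventually) simp
  then show ?case by (simp add: LIM_zero_iff)
qed

text \<open>The node attached to s lies strictly before s, hence the limit is the left limit of the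
  path.\<close>

lemma Y_cell_converges:
  assumes T: "T > 0" and j: "j \<le> m" and s: "s \<in> {0<..T}"
  shows "AE \<omega> in M. (\<lambda>K. Y T (Suc K) (cell_index T (Suc K) s) j \<omega>) \<longlonglongrightarrow> left_lim (\<lambda>s. z j s \<omega>) s"
  using Y_converges[OF T] z_cadlag
proof eventually_elim
  case (elim \<omega>)
  obtain \<delta> where \<delta>: "\<delta> \<longlonglongrightarrow> 0" "\<And>K i. i \<le> Suc K \<Longrightarrow> \<bar>Y T (Suc K) i j \<omega> - z j (node T (Suc K) i) \<omega>\<bar> \<le> \<delta> K"
    using elim(1) j by blast
  have ci: "node T (Suc K) (cell_index T (Suc K) s) = grid_before T (Suc K) s" "cell_index T (Suc K) s \<le> Suc K" for K
    using cell_index[OF T _ s, of "Suc K"] by auto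
  have "(\<lambda>K. Y T (Suc K) (cell_index T (Suc K) s) j \<omega> - z j (grid_before T (Suc K) s) \<omega>) \<longlonglongrightarrow> 0"
  proof (rule Lim_null_comparison[OF _ \<delta>(1)], rule always_eventually, rule allI)
    fix K show "norm (Y T (Suc K) (cell_index T (Suc K) s) j \<omega> - z j (grid_before T (Suc K) s) \<omega>) \<le> \<delta> K"
      using \<delta>(2)[OF ci(2), of K] unfolding ci(1) by simp
  qed
  moreover have "(\<lambda>K. z j (grid_before T (Suc K) s) \<omega>) \<longlonglongrightarrow> left_lim (\<lambda>s. z j s \<omega>) s"
    using elim(2) j s by (intro grid_before_tendsto[OF T, where f = "\<lambda>s. z j s \<omega>"] tendsto_left_lim) auto
  ultimately show ?case using tendsto_add by fastforce
qed

lemma limit_bound: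
  assumes T: "T > 0"
    and l: "AE \<omega> in M. (\<lambda>K. Y T (Suc K) (\<iota> K) j \<omega>) \<longlonglongrightarrow> x \<omega>" and \<iota>: "\<And>K. \<iota> K \<le> Suc K" and j: "j \<le> m"
  shows "AE \<omega> in M. \<bar>x \<omega>\<bar> \<le> G T \<omega>"
proof -
  have "AE \<omega> in M. \<forall>K. \<forall>i\<le>Suc K. \<forall>j\<le>m. \<bar>Y T (Suc K) i j \<omega>\<bar> \<le> G T \<omega>"
    by (intro AE_all_countable[THEN iffD2] allI Y_le_G T) auto
  with l show ?thesis
  proof eventually_elim
    case (elim \<omega>)
    show ?case by (rule Lim_bounded[OF tendsto_rabs[OF elim(1)], of 0]) (use elim(2) \<iota> j in blast)
  qed
qed

lemma expectation_limit:
  assumes T: "T > 0"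
    and l: "AE \<omega> in M. (\<lambda>K. Y T (Suc K) (\<iota> K) j \<omega>) \<longlonglongrightarrow> x \<omega>" and \<iota>: "\<And>K. \<iota> K \<le> Suc K" and j: "j \<le> m"
    and x: "x \<in> borel_measurable M"
  shows "(\<lambda>K. mY T (Suc K) (\<iota> K) j) \<longlonglongrightarrow> (\<integral>\<omega>. x \<omega> \<partial>M)"
  unfolding mY_def
proof (rule integral_dominated_convergence[OF x _ G_integrable[of T] l])
  show "Y T (Suc K) (\<iota> K) j \<in> borel_measurable M" for K using T \<iota> j by (intro Y_measurable) auto
  show "AE \<omega> in M. norm (Y T (Suc K) (\<iota> K) j \<omega>) \<le> G T \<omega>" for K
    using Y_le_G[OF T, of "Suc K"] by (auto elim!: eventually_mono simp: \<iota> j)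
qed (use T in auto)

text \<open>The left limit need not be measurable in \<open>\<omega>\<close> on the exceptional null set, hence the
  detour through \<open>lim\<close>.\<close>

lemma mean_cell_converges:
  assumes T: "T > 0" and j: "j \<le> m" and s: "s \<in> {0<..T}"
  defines "x \<equiv> \<lambda>\<omega>. lim (\<lambda>K. Y T (Suc K) (cell_index T (Suc K) s) j \<omega>)"
  shows "x \<in> borel_measurable M" "AE \<omega> in M. x \<omega> = left_lim (\<lambda>s. z j s \<omega>) s"
    "(\<lambda>K. mY T (Suc K) (cell_index T (Suc K) s) j) \<longlonglongrightarrow> (\<integral>\<omega>. x \<omega> \<partial>M)"
proof -
  have ci: "cell_index T (Suc K) s \<le> Suc K" for K using cell_index(2)[OF T _ s, of "Suc K"] by simp
  show xm: "x \<in> borel_measurable M"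
    unfolding x_def using T ci j by (intro borel_measurable_lim_metric Y_measurable) auto
  show xe: "AE \<omega> in M. x \<omega> = left_lim (\<lambda>s. z j s \<omega>) s"
    using Y_cell_converges[OF T j s] by eventually_elim (simp add: x_def limI)
  have "AE \<omega> in M. (\<lambda>K. Y T (Suc K) (cell_index T (Suc K) s) j \<omega>) \<longlonglongrightarrow> x \<omega>"
    using Y_cell_converges[OF T j s] xe by eventually_elim simp
  then show "(\<lambda>K. mY T (Suc K) (cell_index T (Suc K) s) j) \<longlonglongrightarrow> (\<integral>\<omega>. x \<omega> \<partial>M)"
    by (rule expectation_limit[OF T _ ci j xm])
qed

lemma z_bound:
  assumes T: "T > 0" and j: "j \<le> m" and u: "u \<in> {0..T}"
  shows "AE \<omega> in M. \<bar>z j u \<omega>\<bar> \<le> G T \<omega>"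
proof -
  have GG: "AE \<omega> in M. G u \<omega> \<le> G T \<omega>" 
    using F_mono H_V
  proof eventually_elim
    case (elim \<omega>)
    have "0 \<le> (\<Sum>j\<le>m. \<bar>H j u \<omega> - H j 0 \<omega>\<bar>)" "0 \<le> (\<Sum>j\<le>m. \<bar>H j T \<omega> - H j u \<omega>\<bar>)" by (simp_all add: sum_nonneg)
    moreover have "(\<Sum>j\<le>m. \<bar>H j u \<omega> - H j 0 \<omega>\<bar>) \<le> V u \<omega> - V 0 \<omega>"
      "(\<Sum>j\<le>m. \<bar>H j T \<omega> - H j u \<omega>\<bar>) \<le> V T \<omega> - V u \<omega>"
      using elim(2)[rule_format, of 0 u] elim(2)[rule_format, of u T] u by simp_all
    ultimately have V: "V 0 \<omega> \<le> V u \<omega>" "V u \<omega> \<le> V T \<omega>" by linarith+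
    show ?case unfolding G_def
    proof (intro mult_mono add_mono order_refl diff_right_mono V)
      have "(\<Sum>j\<le>m. F j u \<omega> - F j 0 \<omega>) \<le> (\<Sum>j\<le>m. F j T \<omega> - F j 0 \<omega>)"
        using u by (intro sum_mono diff_right_mono elim(1)[rule_format]) auto
      moreover have "drift_norm m a * u \<le> drift_norm m a * T" using u drift_norm_nonneg by (intro mult_left_mono) auto
      ultimately show "jump_factor m a (\<lambda>j s. F j s \<omega>) u \<le> jump_factor m a (\<lambda>j s. F j s \<omega>) T"
        by (simp add: jump_factor_def)
    qed (use V in \<open>auto simp: jump_factor_def intro!: add_nonneg_nonneg sum_nonneg\<close>)
  qed
  show ?thesis
  \<comment> \<open>At a positive time the bound passes to the limit of the schemes on [0, u]. Time
    0 allows no grid, and the path starts at the initial value of the scheme.\<close>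
  proof (cases "u = 0")
    case False
    then have u0: "u > 0" using u by simp
    show ?thesis using limit_bound[OF u0 Y_end_converges[OF u0 j] _ j] GG by auto
  next
    case True
    have "AE \<omega> in M. z j 0 \<omega> = z0 j \<omega>" using z_eq H_0
    proof eventually_elim
      case (elim \<omega>)
      have "z j 0 \<omega> = z0 j \<omega> + (LBINT s:{0..0}. \<Sum>k\<le>m. a j k * z k s \<omega>) + H j 0 \<omega>
       + c j * (LINT s:{0<..0}|interval_measure (\<lambda>s. F j s \<omega>). left_lim (\<lambda>s. z j s \<omega>) s)"
        using elim(1) j by blast
      then show ?case using elim(2) j by (simp add: lbint_singleton) (simp add: set_lebesgue_integral_def)
    qed
    moreover have "AE \<omega> in M. \<bar>z0 j \<omega>\<bar> \<le> G T \<omega>"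
      using Y_le_G[OF T zero_less_one]
    proof eventually_elim
      case (elim \<omega>)
      then have "\<bar>Y T 1 0 j \<omega>\<bar> \<le> G T \<omega>" using j by blast
      then show ?case by (simp add: Y_def)
    qed
    ultimately show ?thesis unfolding True by eventually_elim simp
  qed
qed

lemma z_integrable:
  assumes "j \<le> m" "t \<ge> 0"
  shows "integrable M (z j t)"
  by (rule Bochner_Integration.integrable_bound[OF G_integrable[of "t + 1"] z_measurable[OF assms]])
    (use assms z_bound[of "t + 1" j t] in \<open>auto elim!: eventually_mono intro: order_trans[OF _ abs_ge_self]\<close>)

lemma mean_0:
  assumes j: "j \<le> m"
  shows "mean j 0 = (\<integral>\<omega>. z0 j \<omega> \<partial>M)"
proof -
  have "AE \<omega> in M. z j 0 \<omega> = z0 j \<omega>" using z_eq H_0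
  proof eventually_elim
    case (elim \<omega>)
    have "z j 0 \<omega> = z0 j \<omega> + (LBINT s:{0..0}. \<Sum>k\<le>m. a j k * z k s \<omega>) + H j 0 \<omega>
     + c j * (LINT s:{0<..0}|interval_measure (\<lambda>s. F j s \<omega>). left_lim (\<lambda>s. z j s \<omega>) s)"
      using elim(1) j by blast
    then show ?case using elim(2) j by (simp add: lbint_singleton) (simp add: set_lebesgue_integral_def)
  qed
  moreover have "z0 j \<in> borel_measurable M"
    using Y_measurable[of 1 1 0 j] j by (simp add: Y_def[abs_def])
  ultimately show ?thesis unfolding mean_def using j by (intro integral_cong_AE z_measurable) auto
qed

text \<open>The expectation of the left limit at s, written through the schemes on [0, T] in order
  to integrate a measurable variable.\<close>

definition lmean :: "real \<Rightarrow> nat \<Rightarrow> real \<Rightarrow> real" where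
  "lmean T j s = (\<integral>\<omega>. lim (\<lambda>K. Y T (Suc K) (cell_index T (Suc K) s) j \<omega>) \<partial>M)"

text \<open>The grids of different horizons differ, but along almost every path both limits are the
  left limit at s.\<close>

lemma lmean_cong:
  assumes "T > 0" "T' > 0" "j \<le> m" "s \<in> {0<..T}" "s \<in> {0<..T'}"
  shows "lmean T j s = lmean T' j s"
  unfolding lmean_def
proof (rule integral_cong_AE)
  show "AE \<omega> in M. lim (\<lambda>K. Y T (Suc K) (cell_index T (Suc K) s) j \<omega>) = lim (\<lambda>K. Y T' (Suc K) (cell_index T' (Suc K) s) j \<omega>)"
    using mean_cell_converges(2)[OF assms(1,3,4)] mean_cell_converges(2)[OF assms(2,3,5)] by eventually_elim simp
qed (use mean_cell_converges(1) assms in auto)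

lemma field_bound:
  assumes "\<And>k. k \<le> m \<Longrightarrow> \<bar>x k\<bar> \<le> B" "j \<le> m"
  shows "\<bar>field x j\<bar> \<le> (\<Sum>k\<le>m. \<bar>a j k\<bar> * B) + \<bar>c j * rt j\<bar> * B"
  unfolding field_def
proof (rule order_trans[OF abs_triangle_ineq], rule add_mono)
  show "\<bar>\<Sum>k\<le>m. a j k * x k\<bar> \<le> (\<Sum>k\<le>m. \<bar>a j k\<bar> * B)"
    by (rule order_trans[OF sum_abs], rule sum_mono) (auto simp: abs_mult intro!: mult_left_mono assms)
  show "\<bar>c j * rt j * x j\<bar> \<le> \<bar>c j * rt j\<bar> * B"
    unfolding abs_mult[of "c j * rt j"] by (intro mult_left_mono assms) auto
qed

lemma field_tendsto:
  "(\<And>k. k \<le> m \<Longrightarrow> ((\<lambda>n. x n k) \<longlongrightarrow> y k) A) \<Longrightarrow> j \<le> m \<Longrightarrow> ((\<lambda>n. field (x n) j) \<longlongrightarrow> field y j) A"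
  unfolding field_def by (intro tendsto_intros) auto

definition lfield :: "real \<Rightarrow> nat \<Rightarrow> real \<Rightarrow> real" where
  "lfield T j s = indicator {0<..T} s * field (\<lambda>k. lmean T k s) j"

text \<open>Two dominated convergences: in the probability space with \<open>G\<close>, and in time
  with the constant obtained from its expectation. What results is an integral equation containing
  the means of the left limits.\<close>

lemma mean_raw:
  assumes T: "T > 0" and j: "j \<le> m"
  shows "integrable lborel (lfield T j)" "mean j T = (\<integral>\<omega>. z0 j \<omega> \<partial>M) + (\<integral>s. lfield T j s \<partial>lborel) + (h j T - h j 0)"
proof -
  define B where "B = (\<integral>\<omega>. G T \<omega> \<partial>M)"
  define C where "C = (\<Sum>k\<le>m. \<bar>a j k\<bar> * B) + \<bar>c j * rt j\<bar> * B"
  let ?f = "\<lambda>K s. indicator {0<..T} s * field (mY T (Suc K) (cell_index T (Suc K) s)) j"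
  have ci: "cell_index T (Suc K) s \<le> Suc K" if "s \<in> {0<..T}" for K s
    using cell_index(2)[OF T _ that, of "Suc K"] by simp
  have fm: "?f K \<in> borel_measurable borel" for K
    using measurable_cell_index[of "\<lambda>i. field (mY T (Suc K) i) j" T "Suc K"] by measurable
  have lim: "(\<lambda>K. ?f K s) \<longlonglongrightarrow> lfield T j s" for s
    unfolding lfield_def
  proof (cases "s \<in> {0<..T}")
    case True
    show "(\<lambda>K. ?f K s) \<longlonglongrightarrow> indicator {0<..T} s * field (\<lambda>k. lmean T k s) j"
      unfolding lmean_def using mean_cell_converges(3)[OF T _ True] by (intro tendsto_mult_left field_tendsto j)
  qed simp
  have bd: "norm (?f K s) \<le> indicator {0<..T} s * C" for K s
  proof (cases "s \<in> {0<..T}")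
    case True
    then show ?thesis unfolding C_def B_def using field_bound[of "mY T (Suc K) (cell_index T (Suc K) s)" B j] mY_bound[OF T _ ci[OF True]] j
      by (simp add: B_def)
  qed simp
  have Ci: "integrable lborel (\<lambda>s. indicator {0<..T} s * C)"
    by (intro integrable_mult_left integrable_real_indicator) (use T in auto)
  have lm: "lfield T j \<in> borel_measurable lborel" using borel_measurable_LIMSEQ_real[OF lim fm] by simp
  have fm': "?f K \<in> borel_measurable lborel" for K using fm[of K] by simp
  show "integrable lborel (lfield T j)"
    by (rule integrable_dominated_convergence[OF lm, where s = ?f, OF fm' Ci]) (use lim bd in auto)
  have L: "(\<lambda>K. \<integral>s. ?f K s \<partial>lborel) \<longlonglongrightarrow> (\<integral>s. lfield T j s \<partial>lborel)"
    by (rule integral_dominated_convergence[OF lm, where s = ?f, OF fm' Ci]) (use lim bd in auto)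
  have nT: "node T (Suc K) (Suc K) = T" for K by (simp add: node_def del: of_nat_Suc)
  have e: "mY T (Suc K) (Suc K) j = (\<integral>\<omega>. z0 j \<omega> \<partial>M) + (\<integral>s. ?f K s \<partial>lborel) + (h j T - h j 0)" for K
    using mY_sum[OF T, of "Suc K" "Suc K" j] integral_step[OF T, of "Suc K" "\<lambda>l. field (mY T (Suc K) l) j"] j
    by (simp only: nT set_lebesgue_integral_def real_scaleR_def zero_less_Suc order_refl)
  have "(\<lambda>K. mY T (Suc K) (Suc K) j) \<longlonglongrightarrow> mean j T"
    unfolding mean_def using T by (intro expectation_limit[OF T Y_end_converges[OF T j] _ j] z_measurable j) auto
  moreover have "(\<lambda>K. mY T (Suc K) (Suc K) j) \<longlonglongrightarrow> (\<integral>\<omega>. z0 j \<omega> \<partial>M) + (\<integral>s. lfield T j s \<partial>lborel) + (h j T - h j 0)"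
    unfolding e by (intro tendsto_intros L)
  ultimately show "mean j T = (\<integral>\<omega>. z0 j \<omega> \<partial>M) + (\<integral>s. lfield T j s \<partial>lborel) + (h j T - h j 0)"
    by (rule LIMSEQ_unique)
qed

lemma mean_integral:
  assumes T: "T > 0" and t: "t \<in> {0..T}" and j: "j \<le> m"
  shows "mean j t = mean j 0 + integral {0..t} (lfield T j) + (h j t - h j 0)"
proof (cases "t = 0")
  case False
  then have t0: "t > 0" using t by simp
  have si: "set_integrable lborel {0..t} (lfield T j)"
    unfolding set_integrable_def using integrable_mult_indicator[OF _ mean_raw(1)[OF T j], of "{0..t}"] by simp
  have "indicator {0..t} s *\<^sub>R lfield T j s = lfield t j s" for s
  proof (cases "s \<in> {0<..t}")
    case True
    then have "lmean T k s = lmean t k s" if "k \<le> m" for k using lmean_cong[OF T t0 that] t by auto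
    then have "field (\<lambda>k. lmean T k s) j = field (\<lambda>k. lmean t k s) j" unfolding field_def using j by auto
    then show ?thesis using True t by (simp add: lfield_def)
  next
    case False
    then show ?thesis by (auto simp: lfield_def indicator_def)
  qed
  then have "integral {0..t} (lfield T j) = (\<integral>s. lfield t j s \<partial>lborel)"
    unfolding set_borel_integral_eq_integral(2)[OF si, symmetric] set_lebesgue_integral_def by simp
  then show ?thesis using mean_raw(2)[OF t0 j] mean_0[OF j] by simp
qed simp

text \<open>The paths jump, but the averages equal a primitive of an integrable function plus the
  continuous \<open>h\<close>.\<close>

lemma mean_continuous:
  assumes j: "j \<le> m"
  shows "continuous_on {0..} (mean j)"
  unfolding continuous_on_eq_continuous_within
proof
  fix t :: real assume t: "t \<in> {0..}"
  then have T: "t + 1 > 0" by simp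
  have "set_integrable lborel {0..t+1} (lfield (t + 1) j)"
    unfolding set_integrable_def using integrable_mult_indicator[OF _ mean_raw(1)[OF T j], of "{0..t+1}"] by simp
  then have "continuous_on {0..t + 1} (\<lambda>x. integral {0..x} (lfield (t + 1) j))"
    by (intro indefinite_integral_continuous_1 set_borel_integral_eq_integral(1))
  then have "continuous_on {0..t + 1} (\<lambda>x. mean j 0 + integral {0..x} (lfield (t + 1) j) + (h j x - h j 0))"
    by (intro continuous_intros continuous_on_subset[OF h_cont[OF j]]) auto
  then have "continuous_on {0..t + 1} (mean j)"
    by (rule continuous_on_eq) (rule mean_integral[OF T _ j, symmetric])
  then have "continuous (at t within {0..t + 1}) (mean j)"
    using t by (auto simp: continuous_on_eq_continuous_within)
  moreover have "at t within {0..t + 1} = at t within {0..}"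
    by (rule at_within_nhd[of t "{..<t + 1}"]) auto
  ultimately show "continuous (at t within {0..}) (mean j)" by simp
qed

text \<open>Continuity of the average removes the left limit: along grid points increasing to s the
  averages converge both to \<open>lmean\<close>, by domination, and to the average at s.\<close>

lemma lmean_eq:
  assumes T: "T > 0" and j: "j \<le> m" and s: "s \<in> {0<..T}"
  shows "lmean T j s = mean j s"
proof (rule LIMSEQ_unique)
  let ?u = "\<lambda>K. grid_before T (Suc K) s"
  have u: "?u K \<in> {0..T}" for K using grid_before(1,3)[OF T, of "Suc K" s] s by (auto intro: less_imp_le order_trans)
  note mc = mean_cell_converges[OF T j s]
  show "(\<lambda>K. mean j (?u K)) \<longlonglongrightarrow> lmean T j s"
    unfolding mean_def lmean_def
  proof (rule integral_dominated_convergence[OF mc(1) _ G_integrable[of T]])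
    show "z j (?u K) \<in> borel_measurable M" for K using z_measurable[OF j] u by simp
    show "AE \<omega> in M. (\<lambda>K. z j (?u K) \<omega>) \<longlonglongrightarrow> lim (\<lambda>K. Y T (Suc K) (cell_index T (Suc K) s) j \<omega>)"
      using mc(2) z_cadlag
    proof eventually_elim
      case (elim \<omega>)
      show ?case unfolding elim(1) using elim(2) j s by (intro grid_before_tendsto[OF T, where f = "\<lambda>s. z j s \<omega>"] tendsto_left_lim) auto
    qed
    show "AE \<omega> in M. norm (z j (?u K) \<omega>) \<le> G T \<omega>" for K using z_bound[OF T j u] by simp
  qed (use T in simp)
  have "?u \<longlonglongrightarrow> s" using grid_before_tendsto[OF T, of "\<lambda>x. x" s s] by (simp add: tendsto_ident_at)
  then show "(\<lambda>K. mean j (?u K)) \<longlonglongrightarrow> mean j s"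
    using u s by (intro continuous_on_tendsto_compose[OF mean_continuous[OF j]]) auto
qed

theorem mean_equation:
  assumes T: "T \<ge> 0" and j: "j \<le> m"
  shows "mean j T = mean j 0 + integral {0..T} (\<lambda>s. field (\<lambda>k. mean k s) j) + (h j T - h j 0)"
proof (cases "T = 0")
  case False
  then have T: "T > 0" using T by simp
  have "integral {0..T} (lfield T j) = integral {0..T} (\<lambda>s. field (\<lambda>k. mean k s) j)"
  proof (rule integral_spike[of "{0}"])
    fix s assume s: "s \<in> {0..T} - {0}"
    have "field (\<lambda>k. lmean T k s) j = field (\<lambda>k. mean k s) j"
      unfolding field_def using lmean_eq[OF T] s j by auto
    then show "field (\<lambda>k. mean k s) j = lfield T j s" using s by (simp add: lfield_def)
  qed auto
  then show ?thesis using mean_integral[OF T _ j, of T] T by simp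
qed simp

end

section \<open>Independence, Poisson increments and the Wiener process\<close>

text \<open>Independence of the groups and independence inside each group combine to joint
  independence. Here a group is a noise source and its members are the increments of one Poisson
  process.\<close>

lemma (in prob_space) indep_sets_nested:
  assumes S: "indep_sets S I" and E: "\<And>i l. \<lbrakk>i \<in> I; l \<in> L i\<rbrakk> \<Longrightarrow> E (i, l) \<subseteq> S i"
    and S_Int: "\<And>i A B. \<lbrakk>i \<in> I; A \<in> S i; B \<in> S i\<rbrakk> \<Longrightarrow> A \<inter> B \<in> S i"
    and inner: "\<And>i. i \<in> I \<Longrightarrow> indep_sets (\<lambda>l. E (i, l)) (L i)"
  shows "indep_sets E (Sigma I L)"
proof (rule indep_setsI)
  fix q assume q: "q \<in> Sigma I L"
  then have "fst q \<in> I" "snd q \<in> L (fst q)" by auto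
  moreover have "\<And>i. i \<in> I \<Longrightarrow> S i \<subseteq> events" using S unfolding indep_sets_def by blast
  ultimately show "E q \<subseteq> events" using order_trans[OF E[of "fst q" "snd q"]] by simp
next
  fix A J assume J: "J \<noteq> {}" "J \<subseteq> Sigma I L" "finite J" "\<forall>j\<in>J. A j \<in> E j"
  let ?I = "fst ` J" and ?L = "\<lambda>i. {l. (i, l) \<in> J}"
  have fin: "finite (?L i)" for i by (rule finite_subset[of _ "snd ` J"]) (use J in force)+
  have ne: "?L i \<noteq> {}" if "i \<in> ?I" for i using that by force
  have I: "?I \<subseteq> I" using J(2) by auto
  \<comment> \<open>The events of one group are intersected first; the intersection still lies in
    the system of that group, so the product rule applies first across the groups and then within
    each.\<close>
  define B where "B i = (\<Inter>l\<in>?L i. A (i, l))" for i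
  have B: "B i \<in> S i" if i: "i \<in> ?I" for i
  proof -
    have "(\<Inter>l\<in>K. A (i, l)) \<in> S i" if "finite K" "K \<noteq> {}" "K \<subseteq> ?L i" for K
      using that
    proof (induction rule: finite_ne_induct)
      case (singleton l)
      then have "A (i, l) \<in> E (i, l)" "i \<in> I" "l \<in> L i" using J by auto
      then show ?case using E by auto
    next
      case (insert l K)
      then have "A (i, l) \<in> E (i, l)" "i \<in> I" "l \<in> L i" using J by auto
      then have "A (i, l) \<in> S i" using E by auto
      then show ?case using insert \<open>i \<in> I\<close> S_Int by auto
    qed
    from this[OF fin ne[OF i]] show ?thesis by (simp add: B_def)
  qed
  have "x \<in> (\<Inter>j\<in>J. A j) \<longleftrightarrow> x \<in> (\<Inter>i\<in>?I. B i)" for x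
    unfolding B_def by simp (metis prod.collapse)
  then have "(\<Inter>j\<in>J. A j) = (\<Inter>i\<in>?I. B i)" by blast
  then have "prob (\<Inter>j\<in>J. A j) = prob (\<Inter>i\<in>?I. B i)" by simp
  also have "\<dots> = (\<Prod>i\<in>?I. prob (B i))"
    using J I B by (intro indep_setsD[OF S]) auto
  also have "\<dots> = (\<Prod>i\<in>?I. \<Prod>l\<in>?L i. prob (A (i, l)))"
  proof (rule prod.cong[OF refl])
    fix i assume i: "i \<in> ?I"
    then have "i \<in> I" using I by auto
    then show "prob (B i) = (\<Prod>l\<in>?L i. prob (A (i, l)))"
      unfolding B_def using J fin ne[OF i] by (intro indep_setsD[OF inner]) auto
  qed
  also have "\<dots> = (\<Prod>(i, l)\<in>Sigma ?I ?L. prob (A (i, l)))"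
    using J(3) fin by (intro prod.Sigma) auto
  also have "Sigma ?I ?L = J" by force
  finally show "prob (\<Inter>j\<in>J. A j) = (\<Prod>j\<in>J. prob (A j))" by (simp add: case_prod_beta')
qed

text \<open>Independence survives changes on null sets. This is needed because differences of
  natural numbers agree with real differences only on the almost sure event of nondecreasing
  paths.\<close>

lemma (in prob_space) indep_vars_AE:
  assumes X: "indep_vars (\<lambda>_. borel) X I" and Y: "\<And>i. i \<in> I \<Longrightarrow> Y i \<in> borel_measurable M"
    and eq: "\<And>i. i \<in> I \<Longrightarrow> AE \<omega> in M. X i \<omega> = Y i \<omega>"
  shows "indep_vars (\<lambda>_. borel) Y I"
  unfolding indep_vars_def2
proof (intro conjI ballI Y indep_setsI)
  have Xm: "X i \<in> borel_measurable M" if "i \<in> I" for i using X that unfolding indep_vars_def2 by auto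
  show "{Y i -` A \<inter> space M |A. A \<in> sets borel} \<subseteq> events" if "i \<in> I" for i
    using Y[OF that] by (auto intro: measurable_sets)
  fix A J assume J: "J \<noteq> {}" "J \<subseteq> I" "finite J" "\<forall>j\<in>J. A j \<in> {Y j -` A \<inter> space M |A. A \<in> sets borel}"
  then have "\<forall>j\<in>J. \<exists>B. B \<in> sets borel \<and> A j = Y j -` B \<inter> space M" by auto
  then obtain B where B: "\<And>j. j \<in> J \<Longrightarrow> B j \<in> sets borel" "\<And>j. j \<in> J \<Longrightarrow> A j = Y j -` B j \<inter> space M"
    by metis
  let ?A = "\<lambda>j. X j -` B j \<inter> space M"
  have ev: "A j \<in> events" "?A j \<in> events" if "j \<in> J" for j
    using B[OF that] Y Xm that J(2) by (auto intro!: measurable_sets)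
  have AE_j: "AE \<omega> in M. \<omega> \<in> A j \<longleftrightarrow> \<omega> \<in> ?A j" if "j \<in> J" for j
  proof -
    have "AE \<omega> in M. X j \<omega> = Y j \<omega>" using eq that J(2) by auto
    then show ?thesis unfolding B(2)[OF that] by eventually_elim simp
  qed
  have "AE \<omega> in M. \<forall>j\<in>J. \<omega> \<in> A j \<longleftrightarrow> \<omega> \<in> ?A j"
    using AE_j J(3) by (intro AE_finite_allI) auto
  then have "prob (\<Inter>j\<in>J. A j) = prob (\<Inter>j\<in>J. ?A j)"
    using J(1,3) ev by (intro finite_measure_eq_AE sets.finite_INT) (auto elim!: eventually_mono)
  also have "\<dots> = (\<Prod>j\<in>J. prob (?A j))"
  proof -
    have "indep_sets (\<lambda>i. {X i -` A \<inter> space M |A. A \<in> sets borel}) I"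
      using X unfolding indep_vars_def2 by (rule conjunct2)
    from indep_setsD[OF this J(2,1,3), of ?A] show ?thesis using B(1) by blast
  qed
  also have "\<dots> = (\<Prod>j\<in>J. prob (A j))"
  proof (rule prod.cong[OF refl])
    fix j assume j: "j \<in> J"
    show "prob (?A j) = prob (A j)"
      by (rule finite_measure_eq_AE[OF _ ev(2,1)[OF j]]) (use AE_j[OF j] in \<open>eventually_elim, simp\<close>)
  qed
  finally show "prob (\<Inter>j\<in>J. A j) = (\<Prod>j\<in>J. prob (A j))" .
qed

text \<open>Variables built from disjoint parts of an independent family are independent: later the
  past of the scheme against the next increment, and the initial and Wiener part of
  \<open>GG\<close> against its Poisson part.\<close>

lemma (in prob_space) indep_var_two_groups:
  fixes X Y :: "'a \<Rightarrow> real"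
  assumes E: "indep_sets E K" "\<And>q. q \<in> K \<Longrightarrow> Int_stable (E q)" and PQ: "P \<subseteq> K" "Q \<subseteq> K" "P \<inter> Q = {}"
    and X: "X \<in> borel_measurable (sigma (space M) (\<Union>q\<in>P. E q))"
    and Y: "Y \<in> borel_measurable (sigma (space M) (\<Union>q\<in>Q. E q))"
  shows "indep_var borel X borel Y"
proof -
  have "\<forall>q\<in>K. E q \<subseteq> events" using E(1) unfolding indep_sets_def by blast
  then have Ev: "(\<Union>q\<in>P. E q) \<subseteq> events" "(\<Union>q\<in>Q. E q) \<subseteq> events" using PQ by blast+
  then have Pw: "(\<Union>q\<in>P. E q) \<subseteq> Pow (space M)" "(\<Union>q\<in>Q. E q) \<subseteq> Pow (space M)"
    using sets.sets_into_space by blast+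
  have mX: "X -` A \<inter> space M \<in> sigma_sets (space M) (\<Union>q\<in>P. E q)" if "A \<in> sets borel" for A
    using measurable_sets[OF X that] Pw by simp
  have mY: "Y -` A \<inter> space M \<in> sigma_sets (space M) (\<Union>q\<in>Q. E q)" if "A \<in> sets borel" for A
    using measurable_sets[OF Y that] Pw by simp
  have sub: "sigma_sets (space M) (\<Union>q\<in>P. E q) \<subseteq> events" "sigma_sets (space M) (\<Union>q\<in>Q. E q) \<subseteq> events"
    using Ev by (auto intro!: sets.sigma_sets_subset del: subsetI)
  have "indep_sets (\<lambda>j. sigma_sets (space M) (\<Union>q\<in>case_bool P Q j. E q)) UNIV"
  proof (rule indep_sets_collect_sigma)
    have "(\<Union>j. case_bool P Q j) \<subseteq> K" using PQ by (auto split: bool.splits)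
    then show "indep_sets E (\<Union>j. case_bool P Q j)" by (rule indep_sets_mono_index[OF _ E(1)])
    show "disjoint_family (case_bool P Q)" using PQ(3) by (auto simp: disjoint_family_on_def split: bool.splits)
    show "Int_stable (E i)" if "i \<in> case_bool P Q j" for i j using that E(2) PQ by (auto split: bool.splits)
  qed
  then have "indep_sets (case_bool (sigma_sets (space M) {X -` A \<inter> space M |A. A \<in> sets borel})
      (sigma_sets (space M) {Y -` A \<inter> space M |A. A \<in> sets borel})) UNIV"
  proof (rule indep_sets_mono_sets)
    fix j :: bool
    have "sigma_sets (space M) {X -` A \<inter> space M |A. A \<in> sets borel} \<subseteq> sigma_sets (space M) (\<Union>q\<in>P. E q)"
      using mX by (intro sigma_sets_mono) auto
    moreover have "sigma_sets (space M) {Y -` A \<inter> space M |A. A \<in> sets borel} \<subseteq> sigma_sets (space M) (\<Union>q\<in>Q. E q)"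
      using mY by (intro sigma_sets_mono) auto
    ultimately show "(case j of True \<Rightarrow> sigma_sets (space M) {X -` A \<inter> space M |A. A \<in> sets borel}
       | False \<Rightarrow> sigma_sets (space M) {Y -` A \<inter> space M |A. A \<in> sets borel}) \<subseteq> sigma_sets (space M) (\<Union>q\<in>case_bool P Q j. E q)"
      by (cases j) auto
  qed
  moreover have "X \<in> borel_measurable M" "Y \<in> borel_measurable M"
    using mX mY sub by (auto simp: measurable_def)
  ultimately show ?thesis unfolding indep_var_eq indep_set_def by blast
qed

text \<open>The factorial beats every exponential weight. This is the source of integrability for
  \<open>jump_factor\<close>.\<close>

lemma poisson_exp_integrable:
  assumes r: "r > 0"
  shows "integrable (measure_pmf (poisson_pmf r)) (\<lambda>k. exp (b * real k))"
proof -
  have e: "exp (b * real k) = exp b ^ k" for k by (metis exp_of_nat_mult mult.commute)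
  have "norm (pmf (poisson_pmf r) k * exp (b * real k)) = exp (- r) * (inverse (fact k) * (exp b * r) ^ k)" for k
    using r by (simp add: e power_mult_distrib abs_mult divide_inverse)
  moreover have "summable (\<lambda>k. exp (- r) * (inverse (fact k) * (exp b * r) ^ k))"
    by (intro summable_mult summable_exp)
  ultimately have "summable (\<lambda>k. norm (pmf (poisson_pmf r) k * exp (b * real k)))" by (simp only:)
  then show ?thesis unfolding measure_pmf_eq_density
    by (subst integrable_density) (auto simp: integrable_count_space_nat_iff simp del: pmf_poisson)
qed

text \<open>k p_k = r p_(k-1), so the mean is r times the total mass.\<close>

lemma poisson_mean:
  assumes r: "r > 0"
  shows "integrable (measure_pmf (poisson_pmf r)) real" "(\<integral>k. real k \<partial>measure_pmf (poisson_pmf r)) = r"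
proof -
  have "(\<lambda>k. r * exp (- r) * (r ^ k /\<^sub>R fact k)) sums (r * exp (- r) * exp r)"
    by (intro sums_mult exp_converges)
  moreover have "pmf (poisson_pmf r) (Suc k) * real (Suc k) = r * exp (- r) * (r ^ k /\<^sub>R fact k)" for k
    using r by (simp add: field_simps del: of_nat_Suc)
  ultimately have "(\<lambda>k. pmf (poisson_pmf r) (Suc k) * real (Suc k)) sums r"
    by (simp add: exp_minus_inverse mult.assoc exp_minus)
  then have s: "(\<lambda>k. pmf (poisson_pmf r) k * real k) sums r" by (subst (asm) sums_Suc_iff) simp
  then have i: "integrable (count_space UNIV) (\<lambda>k. pmf (poisson_pmf r) k * real k)"
    by (auto simp: integrable_count_space_nat_iff abs_mult dest: sums_summable)
  then show "integrable (measure_pmf (poisson_pmf r)) real"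
    unfolding measure_pmf_eq_density by (subst integrable_density) auto
  show "(\<integral>k. real k \<partial>measure_pmf (poisson_pmf r)) = r"
    unfolding measure_pmf_eq_density
    using s i by (subst integral_density) (auto simp: integral_count_space_nat sums_unique[symmetric])
qed

context poisson_process
begin

lemma increment_AE:
  assumes "0 \<le> s" "s \<le> t"
  shows "AE \<omega> in M. real (N t \<omega> - N s \<omega>) = real (N t \<omega>) - real (N s \<omega>)"
  using paths_mono
proof eventually_elim
  case (elim \<omega>)
  then have "N s \<omega> \<le> N t \<omega>" using assms by (intro mono_onD[OF elim]) auto
  then show ?case by simp
qed

lemma real_N_measurable: "0 \<le> t \<Longrightarrow> (\<lambda>\<omega>. real (N t \<omega>)) \<in> borel_measurable M"
  by (rule measurable_compose[OF measurable_N]) auto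

lemma increment_integrable:
  fixes \<phi> :: "real \<Rightarrow> real"
  assumes "0 \<le> s" "s < t" "integrable (measure_pmf (poisson_pmf (t - s))) (\<lambda>k. \<phi> (real k))"
    and [measurable]: "\<phi> \<in> borel_measurable borel"
  shows "integrable M (\<lambda>\<omega>. \<phi> (real (N t \<omega>) - real (N s \<omega>)))"
    "(\<integral>\<omega>. \<phi> (real (N t \<omega>) - real (N s \<omega>)) \<partial>M) = (\<integral>k. \<phi> (real k) \<partial>measure_pmf (poisson_pmf (t - s)))"
proof -
  have [measurable]: "N s \<in> M \<rightarrow>\<^sub>M count_space UNIV" "N t \<in> M \<rightarrow>\<^sub>M count_space UNIV"
    by (rule measurable_N, use assms in simp)+
  have D: "(\<lambda>\<omega>. N t \<omega> - N s \<omega>) \<in> M \<rightarrow>\<^sub>M count_space UNIV" by measurable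
  have ae: "AE \<omega> in M. \<phi> (real (N t \<omega> - N s \<omega>)) = \<phi> (real (N t \<omega>) - real (N s \<omega>))"
    using increment_AE[OF assms(1) less_imp_le[OF assms(2)]] by eventually_elim simp
  have i: "integrable M (\<lambda>\<omega>. \<phi> (real (N t \<omega> - N s \<omega>)))"
  proof -
    have "integrable (distr M (count_space UNIV) (\<lambda>\<omega>. N t \<omega> - N s \<omega>)) (\<lambda>k. \<phi> (real k))"
      unfolding increment_law[OF assms(1,2)] by (rule assms(3))
    then show ?thesis by (subst (asm) integrable_distr_eq[OF D]) auto
  qed
  have m: "(\<lambda>\<omega>. \<phi> (real (N t \<omega>) - real (N s \<omega>))) \<in> borel_measurable M"
    using assms(1,2) by (intro measurable_compose[OF _ assms(4)] borel_measurable_diff real_N_measurable) auto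
  then show "integrable M (\<lambda>\<omega>. \<phi> (real (N t \<omega>) - real (N s \<omega>)))"
    by (rule integrable_cong_AE_imp[OF i]) (use ae in \<open>eventually_elim, simp\<close>)
  have "(\<integral>\<omega>. \<phi> (real (N t \<omega>) - real (N s \<omega>)) \<partial>M) = (\<integral>\<omega>. \<phi> (real (N t \<omega> - N s \<omega>)) \<partial>M)"
    by (rule integral_cong_AE[OF m borel_measurable_integrable[OF i]]) (use ae in \<open>eventually_elim, simp\<close>)
  also have "\<dots> = (\<integral>k. \<phi> (real k) \<partial>measure_pmf (poisson_pmf (t - s)))"
    unfolding increment_law[OF assms(1,2), symmetric] by (subst integral_distr[OF D]) auto
  finally show "(\<integral>\<omega>. \<phi> (real (N t \<omega>) - real (N s \<omega>)) \<partial>M) = (\<integral>k. \<phi> (real k) \<partial>measure_pmf (poisson_pmf (t - s)))" .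
qed

lemma indep_real_increments:
  assumes \<tau>: "0 \<le> \<tau> 0" "mono \<tau>"
  shows "indep_vars (\<lambda>_. borel) (\<lambda>i \<omega>. real (N (\<tau> (Suc i)) \<omega>) - real (N (\<tau> i) \<omega>)) {..<k::nat}"
proof (rule indep_vars_AE)
  have \<tau>0: "0 \<le> \<tau> i" for i using monoD[OF \<tau>(2), of 0 i] \<tau>(1) by simp
  have "indep_vars (\<lambda>_. count_space UNIV) (\<lambda>i \<omega>. N (\<tau> (Suc i)) \<omega> - N (\<tau> i) \<omega>) {..<k}"
    using increments \<tau> unfolding indep_increments_def by blast
  then show "indep_vars (\<lambda>_. borel) (\<lambda>i \<omega>. real (N (\<tau> (Suc i)) \<omega> - N (\<tau> i) \<omega>)) {..<k}"
    by (rule indep_vars_compose2) auto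
  show "(\<lambda>\<omega>. real (N (\<tau> (Suc i)) \<omega>) - real (N (\<tau> i) \<omega>)) \<in> borel_measurable M" for i
    using \<tau>0 by (intro borel_measurable_diff real_N_measurable)
  show "AE \<omega> in M. real (N (\<tau> (Suc i)) \<omega> - N (\<tau> i) \<omega>) = real (N (\<tau> (Suc i)) \<omega>) - real (N (\<tau> i) \<omega>)" for i
    by (rule increment_AE[OF \<tau>0]) (simp add: monoD[OF \<tau>(2)])
qed

end

text \<open>Written as a limit of sums, the integral of a path is measurable for every sigma-algebra
  that makes the path values measurable, with no condition on exceptional paths. This is what
  relates it to the Wiener source alone.\<close>

definition riemann :: "(real \<Rightarrow> real) \<Rightarrow> real \<Rightarrow> real" where
  "riemann u t = lim (\<lambda>K. \<Sum>i<Suc K. t / real (Suc K) * u (node t (Suc K) i))"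

lemma riemann_eq:
  assumes u: "continuous_on {0..} u" and t: "t \<ge> 0"
  shows "riemann u t = (LBINT s:{0..t}. u s)" "riemann u t = integral {0..t} u"
proof -
  have c: "continuous_on {0..t} u" by (rule continuous_on_subset[OF u]) auto
  show l: "riemann u t = (LBINT s:{0..t}. u s)"
  proof (cases "t = 0")
    case True
    then show ?thesis by (simp add: riemann_def lbint_singleton)
  next
    case False
    then have T: "t > 0" using t by simp
    have "bounded (u ` {0..t})" by (intro compact_imp_bounded compact_continuous_image c) auto
    then obtain B where "\<forall>y\<in>u ` {0..t}. norm y \<le> B" unfolding bounded_iff by blast
    then have B: "\<And>s. s \<in> {0..t} \<Longrightarrow> \<bar>u s\<bar> \<le> B" by simp
    let ?f = "\<lambda>K s. indicator {0<..t} s * u (grid_before t (Suc K) s)"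
    have fm: "?f K \<in> borel_measurable lborel" for K by measurable
    have lim: "(\<lambda>K. ?f K s) \<longlonglongrightarrow> indicator {0<..t} s * u s" for s
    proof (cases "s \<in> {0<..t}")
      case True
      have "(u \<longlongrightarrow> u s) (at s within {0..})" using u True by (auto simp: continuous_on_def)
      then have "(u \<longlongrightarrow> u s) (at s)" using True by (subst (asm) at_within_interior) (auto simp: interior_real_atLeast)
      then have "(u \<longlongrightarrow> u s) (at_left s)" by (rule tendsto_mono[OF at_le, rotated]) auto
      from grid_before_tendsto[OF T this] show ?thesis using True by simp
    qed simp
    have bd: "norm (?f K s) \<le> indicator {0<..t} s * B" for K s
      using B[of "grid_before t (Suc K) s"] grid_before(1,3)[OF T, of "Suc K" s] by (auto simp: indicator_def)
    have Bi: "integrable lborel (\<lambda>s. indicator {0<..t} s * B)"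
      by (intro integrable_mult_left integrable_real_indicator) (use T in auto)
    have lm: "(\<lambda>s. indicator {0<..t} s * u s) \<in> borel_measurable lborel"
      using borel_measurable_LIMSEQ_real[OF lim fm] .
    have L: "(\<lambda>K. \<integral>s. ?f K s \<partial>lborel) \<longlonglongrightarrow> (\<integral>s. indicator {0<..t} s * u s \<partial>lborel)"
      by (rule integral_dominated_convergence[OF lm, where s = ?f, OF fm Bi]) (use lim bd in auto)
    have "(\<integral>s. ?f K s \<partial>lborel) = (\<integral>s. indicator {0<..t} s * u (node t (Suc K) (cell_index t (Suc K) s)) \<partial>lborel)" for K
      by (rule Bochner_Integration.integral_cong[OF refl]) (simp add: indicator_def cell_index(1)[OF T] del: of_nat_Suc)
    then have e: "(\<integral>s. ?f K s \<partial>lborel) = (\<Sum>i<Suc K. t / real (Suc K) * u (node t (Suc K) i))" for K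
      using integral_step[OF T, of "Suc K" "\<lambda>i. u (node t (Suc K) i)"] by (simp add: set_lebesgue_integral_def del: of_nat_Suc)
    have "riemann u t = (\<integral>s. indicator {0<..t} s * u s \<partial>lborel)"
      unfolding riemann_def using L unfolding e by (rule limI)
    also have "\<dots> = (\<integral>s. indicator {0..t} s * u s \<partial>lborel)"
    proof (rule integral_cong_AE[OF lm])
      show "(\<lambda>s. indicator {0..t} s * u s) \<in> borel_measurable lborel"
        using borel_integrable_atLeastAtMost'[OF c] unfolding set_integrable_def by (auto dest: borel_measurable_integrable)
      show "AE s in lborel. indicat_real {0<..t} s * u s = indicat_real {0..t} s * u s"
        using AE_lborel_singleton[of "0::real"] by eventually_elim (auto simp: indicator_def)
    qed
    finally show ?thesis by (simp add: set_lebesgue_integral_def)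
  \<comment> \<open>A continuous path is integrable on compacts, so the same value is also a gauge
    integral.\<close>
  qed
  then show "riemann u t = integral {0..t} u" using lbint_eq_integral[OF c] by simp
qed

lemma riemann_measurable:
  assumes "\<And>s. 0 \<le> s \<Longrightarrow> X s \<in> borel_measurable A" and t: "0 \<le> t"
  shows "(\<lambda>\<omega>. riemann (\<lambda>s. X s \<omega>) t) \<in> borel_measurable A"
  unfolding riemann_def
  by (intro borel_measurable_lim_metric borel_measurable_sum borel_measurable_times borel_measurable_const assms)
    (use t in \<open>auto simp: node_def\<close>)

context wiener_process
begin

lemma w_moments:
  assumes t: "0 \<le> t"
  shows "integrable M (w t)" "(\<integral>\<omega>. w t \<omega> \<partial>M) = 0" "(\<integral>\<omega>. \<bar>w t \<omega>\<bar> \<partial>M) \<le> sqrt t"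
proof -
  have "integrable M (w t) \<and> (\<integral>\<omega>. w t \<omega> \<partial>M) = 0 \<and> (\<integral>\<omega>. \<bar>w t \<omega>\<bar> \<partial>M) \<le> sqrt t"
  proof (cases "t = 0")
    case True
    have m: "w t \<in> borel_measurable M" using measurable_w[OF t] .
    have z: "AE \<omega> in M. w t \<omega> = 0" using start True by simp
    have "integrable M (w t)" by (rule integrable_cong_AE_imp[of M "\<lambda>_. 0"]) (use m z in auto)
    moreover have "(\<integral>\<omega>. w t \<omega> \<partial>M) = 0" by (rule integral_eq_zero_AE[OF z])
    moreover have "(\<integral>\<omega>. \<bar>w t \<omega>\<bar> \<partial>M) = 0" by (rule integral_eq_zero_AE) (use z in auto)
    ultimately show ?thesis using t by simp
  next
    case False
    then have t: "t > 0" using t by simp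
    then have s: "sqrt t > 0" by simp
    let ?D = "\<lambda>\<omega>. w t \<omega> - w 0 \<omega>"
    have D: "distributed M lborel ?D (normal_density 0 (sqrt t))" using increment_law[of 0 t] t by simp
    have e: "AE \<omega> in M. ?D \<omega> = w t \<omega>" using start by eventually_elim simp
    have m: "w t \<in> borel_measurable M" "?D \<in> borel_measurable M" using measurable_w t by auto
    have i: "integrable M ?D"
      using distributed_integrable[OF D, of "\<lambda>x. x"] integrable_normal_moment_nz_1[OF s, of 0] by simp
    have i': "integrable M (w t)" by (rule integrable_cong_AE_imp[OF i m(1)]) (use e in \<open>eventually_elim, simp\<close>)
    have "(\<integral>\<omega>. w t \<omega> \<partial>M) = (\<integral>\<omega>. ?D \<omega> \<partial>M)" by (rule integral_cong_AE[OF m]) (use e in \<open>eventually_elim, simp\<close>)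
    then have "(\<integral>\<omega>. w t \<omega> \<partial>M) = 0" using normal_distributed_expectation[OF s D] by simp
    moreover have "(\<integral>\<omega>. \<bar>w t \<omega>\<bar> \<partial>M) = (\<integral>\<omega>. \<bar>?D \<omega>\<bar> \<partial>M)"
      by (rule integral_cong_AE) (use e m in \<open>auto elim!: eventually_mono\<close>)
    moreover have "(\<integral>\<omega>. \<bar>?D \<omega>\<bar> \<partial>M) = sqrt t * sqrt (2 / pi)"
      using distributed_integral[OF D, of abs] integral_normal_moment_abs_odd[OF s, of 0 0] by simp
    moreover have "sqrt t * sqrt (2 / pi) \<le> sqrt t * 1"
      using t pi_ge_two by (intro mult_left_mono) auto
    ultimately show ?thesis using i' by simp
  qed
  then show "integrable M (w t)" "(\<integral>\<omega>. w t \<omega> \<partial>M) = 0" "(\<integral>\<omega>. \<bar>w t \<omega>\<bar> \<partial>M) \<le> sqrt t" by auto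
qed

text \<open>Fubini needs a jointly measurable version of the paths, so the paths are set to \<open>0\<close> on a null
  set containing all the discontinuous ones.\<close>

lemma riemann_w:
  assumes t: "0 \<le> t" and \<phi>: "continuous_on UNIV \<phi>" "\<And>x. \<bar>\<phi> x\<bar> \<le> \<bar>x\<bar>"
  shows "integrable M (\<lambda>\<omega>. riemann (\<lambda>s. \<phi> (w s \<omega>)) t)"
    "(\<integral>\<omega>. riemann (\<lambda>s. \<phi> (w s \<omega>)) t \<partial>M) = (\<integral>s. indicator {0..t} s * (\<integral>\<omega>. \<phi> (w s \<omega>) \<partial>M) \<partial>lborel)"
proof -
  interpret P: pair_sigma_finite lborel M ..
  obtain N0 where N0: "{\<omega>\<in>space M. \<not> continuous_on {0..} (\<lambda>t. w t \<omega>)} \<subseteq> N0" "N0 \<in> null_sets M"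
    using AE_E[OF paths_cont] by (metis (no_types, lifting) null_setsI)
  \<comment> \<open>The jointly measurable version; \<open>max 0\<close> continues it constantly to
    negative times, which keeps it continuous on the whole line. The function \<phi> will be the
    identity for the mean and the modulus for the variation.\<close>
  define v where "v s \<omega> = indicator (space M - N0) \<omega> * \<phi> (w (max 0 s) \<omega>)" for s \<omega>
  have \<phi>m[measurable]: "\<phi> \<in> borel_measurable borel" using \<phi>(1) by (rule borel_measurable_continuous_onI)
  have vm: "v s \<in> borel_measurable M" for s
    unfolding v_def using N0(2)
    by (intro borel_measurable_times borel_measurable_indicator sets.Diff sets.top null_setsD2
        measurable_compose[OF measurable_w \<phi>m]) simp_all
  have vc: "continuous_on UNIV (\<lambda>s. v s \<omega>)" if "\<omega> \<in> space M" for \<omega>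
  proof (cases "\<omega> \<in> N0")
    case False
    then have "continuous_on {0..} (\<lambda>t. w t \<omega>)" using N0 that by auto
    then have "continuous_on UNIV (\<lambda>s. w (max 0 s) \<omega>)"
      by (rule continuous_on_compose2) (auto intro!: continuous_intros)
    then have "continuous_on UNIV (\<lambda>s. \<phi> (w (max 0 s) \<omega>))"
      by (rule continuous_on_compose2[OF \<phi>(1)]) auto
    then show ?thesis unfolding v_def by (intro continuous_intros)
  qed (simp add: v_def)
  \<comment> \<open>Rounding time down to a multiple of 1/(K+1) leaves countably many times, so each
    approximation is jointly measurable; continuity gives the limit.\<close>
  have vj: "(\<lambda>x. v (fst x) (snd x)) \<in> borel_measurable (borel \<Otimes>\<^sub>M M)"
  proof (rule borel_measurable_LIMSEQ_real)
    let ?g = "\<lambda>K s. real_of_int \<lfloor>s * real (Suc K)\<rfloor> / real (Suc K)"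
    show "(\<lambda>K. v (?g K (fst x)) (snd x)) \<longlonglongrightarrow> v (fst x) (snd x)" if "x \<in> space (borel \<Otimes>\<^sub>M M)" for x
    proof -
      have "isCont (\<lambda>s. v s (snd x)) (fst x)"
        using vc[of "snd x"] that by (auto simp: space_pair_measure continuous_on_eq_continuous_at)
      moreover have "(\<lambda>K. ?g K (fst x)) \<longlonglongrightarrow> fst x"
      proof (rule tendsto_sandwich[OF always_eventually always_eventually])
        show "\<forall>K. fst x - inverse (real (Suc K)) \<le> ?g K (fst x)"
        proof
          fix K
          have "fst x * real (Suc K) - 1 \<le> real_of_int \<lfloor>fst x * real (Suc K)\<rfloor>" by linarith
          then have "(fst x * real (Suc K) - 1) / real (Suc K) \<le> ?g K (fst x)" by (rule divide_right_mono) simp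
          then show "fst x - inverse (real (Suc K)) \<le> ?g K (fst x)" by (simp add: diff_divide_distrib inverse_eq_divide del: of_nat_Suc)
        qed
        show "\<forall>K. ?g K (fst x) \<le> fst x" by (auto simp: divide_le_eq simp del: of_nat_Suc)
        show "(\<lambda>K. fst x - inverse (real (Suc K))) \<longlonglongrightarrow> fst x"
          using tendsto_diff[OF tendsto_const LIMSEQ_inverse_real_of_nat, of "fst x"] by simp
      qed simp
      ultimately show ?thesis by (rule isCont_tendsto_compose)
    qed
    show "(\<lambda>x. v (?g K (fst x)) (snd x)) \<in> borel_measurable (borel \<Otimes>\<^sub>M M)" for K
    proof (rule measurable_compose_countable[where f = "\<lambda>z x. v (real_of_int z / real (Suc K)) (snd x)" and g = "\<lambda>x. \<lfloor>fst x * real (Suc K)\<rfloor>"])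
      show "(\<lambda>x. v (real_of_int z / real (Suc K)) (snd x)) \<in> borel_measurable (borel \<Otimes>\<^sub>M M)" for z
        by (rule measurable_compose[OF measurable_snd vm])
    qed measurable
  qed
  let ?f = "\<lambda>s \<omega>. indicat_real {0..t} s * v s \<omega>"
  have vAE: "AE \<omega> in M. v s \<omega> = \<phi> (w s \<omega>)" if "0 \<le> s" for s
    using AE_not_in[OF N0(2)] AE_space by eventually_elim (use that in \<open>simp add: v_def\<close>)
  have wi: "integrable M (\<lambda>\<omega>. \<phi> (w s \<omega>))" if "0 \<le> s" for s
    by (rule Bochner_Integration.integrable_bound[OF w_moments(1)[OF that]]) (use \<phi>(2) measurable_w[OF that] in auto)
  have vi: "integrable M (v s)" if "0 \<le> s" for s
    by (rule integrable_cong_AE_imp[OF wi[OF that] vm]) (use vAE[OF that] in \<open>eventually_elim, simp\<close>)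
  have vE: "(\<integral>\<omega>. v s \<omega> \<partial>M) = (\<integral>\<omega>. \<phi> (w s \<omega>) \<partial>M)" if "0 \<le> s" for s
    by (rule integral_cong_AE[OF vm borel_measurable_integrable[OF wi[OF that]] vAE[OF that]])
  have vb: "(\<integral>\<omega>. norm (v s \<omega>) \<partial>M) \<le> sqrt t" if "s \<in> {0..t}" for s
  proof -
    have s: "0 \<le> s" using that by simp
    have "(\<integral>\<omega>. norm (v s \<omega>) \<partial>M) \<le> (\<integral>\<omega>. \<bar>w s \<omega>\<bar> \<partial>M)"
    proof (rule integral_mono_AE)
      show "integrable M (\<lambda>\<omega>. norm (v s \<omega>))" "integrable M (\<lambda>\<omega>. \<bar>w s \<omega>\<bar>)"
        using vi[OF s] w_moments(1)[OF s] by auto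
      show "AE \<omega> in M. norm (v s \<omega>) \<le> \<bar>w s \<omega>\<bar>"
        using vAE[OF s] by eventually_elim (use \<phi>(2) in simp)
    qed
    also have "\<dots> \<le> sqrt s" by (rule w_moments(3)[OF s])
    also have "\<dots> \<le> sqrt t" using that by simp
    finally show ?thesis .
  qed
  have fm: "(\<lambda>(s, \<omega>). ?f s \<omega>) \<in> borel_measurable (lborel \<Otimes>\<^sub>M M)"
  proof -
    have "(\<lambda>x. indicat_real {0..t} (fst x) * v (fst x) (snd x)) \<in> borel_measurable (borel \<Otimes>\<^sub>M M)"
      by (intro borel_measurable_times vj measurable_compose[OF measurable_fst]) auto
    moreover have "sets (lborel \<Otimes>\<^sub>M M) = sets (borel \<Otimes>\<^sub>M M)" by (intro sets_pair_measure_cong) auto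
    ultimately show ?thesis by (simp add: case_prod_beta' cong: measurable_cong_sets)
  qed
  have F: "integrable (lborel \<Otimes>\<^sub>M M) (\<lambda>(s, \<omega>). ?f s \<omega>)"
  proof (rule P.Fubini_integrable[OF fm])
    have nm: "(\<lambda>s. \<integral>\<omega>. norm (case (s, \<omega>) of (s, \<omega>) \<Rightarrow> ?f s \<omega>) \<partial>M) \<in> borel_measurable lborel"
      using fm by measurable
    show "integrable lborel (\<lambda>s. \<integral>\<omega>. norm (case (s, \<omega>) of (s, \<omega>) \<Rightarrow> ?f s \<omega>) \<partial>M)"
    proof (rule Bochner_Integration.integrable_bound[OF _ nm])
      show "integrable lborel (\<lambda>s. indicat_real {0..t} s * sqrt t)"
        by (intro integrable_mult_left integrable_real_indicator) (use t in auto)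
      show "AE s in lborel. norm (\<integral>\<omega>. norm (case (s, \<omega>) of (s, \<omega>) \<Rightarrow> ?f s \<omega>) \<partial>M) \<le> norm (indicat_real {0..t} s * sqrt t)"
      proof (intro always_eventually allI)
        fix s show "norm (\<integral>\<omega>. norm (case (s, \<omega>) of (s, \<omega>) \<Rightarrow> ?f s \<omega>) \<partial>M) \<le> norm (indicat_real {0..t} s * sqrt t)"
          using vb[of s] t by (cases "s \<in> {0..t}") auto
      qed
    qed
    show "AE s in lborel. integrable M (\<lambda>\<omega>. case (s, \<omega>) of (s, \<omega>) \<Rightarrow> ?f s \<omega>)"
    proof (intro always_eventually allI)
      fix s show "integrable M (\<lambda>\<omega>. case (s, \<omega>) of (s, \<omega>) \<Rightarrow> ?f s \<omega>)"
        using vi[of s] by (cases "s \<in> {0..t}") auto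
    qed
  qed
  have rm: "(\<lambda>\<omega>. riemann (\<lambda>s. \<phi> (w s \<omega>)) t) \<in> borel_measurable M"
    by (rule riemann_measurable[OF _ t]) (rule measurable_compose[OF measurable_w], auto)
  have r: "AE \<omega> in M. (\<integral>s. ?f s \<omega> \<partial>lborel) = riemann (\<lambda>s. \<phi> (w s \<omega>)) t"
    using AE_not_in[OF N0(2)] AE_space
  proof eventually_elim
    case (elim \<omega>)
    then have "continuous_on {0..} (\<lambda>t. w t \<omega>)" using N0 by auto
    then have c: "continuous_on {0..} (\<lambda>s. \<phi> (w s \<omega>))"
      by (rule continuous_on_compose2[OF \<phi>(1)]) auto
    have "?f s \<omega> = indicator {0..t} s *\<^sub>R \<phi> (w s \<omega>)" for s using elim by (auto simp: v_def indicator_def)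
    then show ?case unfolding riemann_eq(1)[OF c t] set_lebesgue_integral_def by (simp only:)
  qed
  have i: "integrable M (\<lambda>\<omega>. \<integral>s. ?f s \<omega> \<partial>lborel)" using P.integrable_snd[OF F] .
  show "integrable M (\<lambda>\<omega>. riemann (\<lambda>s. \<phi> (w s \<omega>)) t)"
    by (rule integrable_cong_AE_imp[OF i rm r])
  have "(\<integral>\<omega>. riemann (\<lambda>s. \<phi> (w s \<omega>)) t \<partial>M) = (\<integral>\<omega>. \<integral>s. ?f s \<omega> \<partial>lborel \<partial>M)"
    by (rule integral_cong_AE[OF rm borel_measurable_integrable[OF i]]) (use r in \<open>eventually_elim, simp\<close>)
  also have "\<dots> = (\<integral>s. \<integral>\<omega>. ?f s \<omega> \<partial>M \<partial>lborel)" by (rule P.Fubini_integral[OF F])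
  also have "\<dots> = (\<integral>s. indicator {0..t} s * (\<integral>\<omega>. \<phi> (w s \<omega>) \<partial>M) \<partial>lborel)"
  proof (rule Bochner_Integration.integral_cong[OF refl])
    fix s show "(\<integral>\<omega>. ?f s \<omega> \<partial>M) = indicator {0..t} s * (\<integral>\<omega>. \<phi> (w s \<omega>) \<partial>M)"
      using vE[of s] by (cases "s \<in> {0..t}") auto
  qed
  finally show "(\<integral>\<omega>. riemann (\<lambda>s. \<phi> (w s \<omega>)) t \<partial>M) = (\<integral>s. indicator {0..t} s * (\<integral>\<omega>. \<phi> (w s \<omega>) \<partial>M) \<partial>lborel)" .
qed

end

section \<open>The open chain as a jump system\<close>

lemma cadlag_minus_continuous:
  assumes f: "cadlag f" and g: "continuous_on {0..} g"
  shows "cadlag (\<lambda>t. f t - b * g t)"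
  unfolding cadlag_def
proof (intro conjI allI impI)
  fix t :: real assume t: "t \<ge> 0"
  have "continuous (at t within {0..}) g" using g t by (auto simp: continuous_on_eq_continuous_within)
  then have "continuous (at_right t) g" by (rule continuous_within_subset) (use t in auto)
  then show "continuous (at_right t) (\<lambda>t. f t - b * g t)"
    using f t by (intro continuous_intros) (auto simp: cadlag_def)
next
  fix t :: real assume t: "t > 0"
  have "(g \<longlongrightarrow> g t) (at t within {0..})" using g t by (auto simp: continuous_on_def)
  then have "(g \<longlongrightarrow> g t) (at t)" using t by (subst (asm) at_within_interior) (auto simp: interior_real_atLeast)
  then have "(g \<longlongrightarrow> g t) (at_left t)" by (rule tendsto_mono[OF at_le, rotated]) auto
  then show "\<exists>l. ((\<lambda>t. f t - b * g t) \<longlongrightarrow> l) (at_left t)"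
    using tendsto_diff[OF tendsto_left_lim[OF f t] tendsto_mult_left] by blast
qed

text \<open>The primitive of the modulus controls the variation of the primitive; this supplies the
  function \<open>V\<close> required by \<open>jump_system\<close>.\<close>

lemma integral_increment_bound:
  fixes u :: "real \<Rightarrow> real"
  assumes u: "continuous_on {0..} u" and st: "0 \<le> s" "s \<le> t"
  shows "\<bar>integral {0..t} u - integral {0..s} u\<bar> \<le> integral {0..t} (\<lambda>x. \<bar>u x\<bar>) - integral {0..s} (\<lambda>x. \<bar>u x\<bar>)"
proof -
  have i: "g integrable_on {a..b}" if "continuous_on {0..} g" "0 \<le> a" for g :: "real \<Rightarrow> real" and a b
    by (rule integrable_continuous_real, rule continuous_on_subset[OF that(1)]) (use that(2) in auto)
  have ua: "continuous_on {0..} (\<lambda>x. \<bar>u x\<bar>)" by (intro continuous_intros u)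
  have c: "integral {0..s} g + integral {s..t} g = integral {0..t} g" if "continuous_on {0..} g" for g :: "real \<Rightarrow> real"
    by (rule Henstock_Kurzweil_Integration.integral_combine[OF st i[OF that]]) simp
  have "\<bar>integral {s..t} u\<bar> \<le> integral {s..t} (\<lambda>x. \<bar>u x\<bar>)"
    using integral_norm_bound_integral[OF i[OF u st(1)] i[OF ua st(1)]] by simp
  then show ?thesis using c[OF u] c[OF ua] by linarith
qed

lemma measurable_sigma_generator:
  assumes "U \<subseteq> Pow \<Omega>" "\<And>B. B \<in> sets borel \<Longrightarrow> f -` B \<inter> \<Omega> \<in> U"
  shows "f \<in> borel_measurable (sigma \<Omega> U)"
  using assms by (intro measurableI) (auto simp: sets_measure_of)

lemma path_measurable:
  assumes t: "0 \<le> t"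
  shows "X t \<in> borel_measurable (vimage_algebra (space M) (\<lambda>\<omega>. \<lambda>t\<in>{0..}. X t \<omega>) (\<Pi>\<^sub>M t\<in>{0..}. borel))"
proof -
  let ?V = "vimage_algebra (space M) (\<lambda>\<omega>. \<lambda>t\<in>{0..}. X t \<omega>) (\<Pi>\<^sub>M t\<in>{0..}. borel)"
  have "(\<lambda>\<omega>. \<lambda>t\<in>{0..}. X t \<omega>) \<in> ?V \<rightarrow>\<^sub>M (\<Pi>\<^sub>M t\<in>{0..}. borel)"
    by (rule measurable_vimage_algebra1) (auto simp: space_PiM)
  then have "(\<lambda>\<omega>. (\<lambda>t\<in>{0..}. X t \<omega>) t) \<in> borel_measurable ?V"
    by (rule measurable_compose[OF _ measurable_component_singleton]) (use t in auto)
  then show ?thesis using t by simp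
qed

lemma config_measurable:
  "x \<in> {1..n} \<Longrightarrow> r x t \<in> borel_measurable (vimage_algebra (space M) (config n r p t) (config_space n))"
  "x \<in> {0..n} \<Longrightarrow> p x t \<in> borel_measurable (vimage_algebra (space M) (config n r p t) (config_space n))"
proof -
  let ?V = "vimage_algebra (space M) (config n r p t) (config_space n)"
  have c: "config n r p t \<in> ?V \<rightarrow>\<^sub>M config_space n"
    by (rule measurable_vimage_algebra1) (auto simp: config_def config_space_def space_pair_measure space_PiM)
  show "r x t \<in> borel_measurable ?V" if x: "x \<in> {1..n}"
  proof -
    have "(\<lambda>\<omega>. fst (config n r p t \<omega>) x) \<in> borel_measurable ?V"
      by (rule measurable_compose[OF c], unfold config_space_def)
        (rule measurable_compose[OF measurable_fst measurable_component_singleton[OF x]])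
    then show ?thesis using x by (simp add: config_def)
  qed
  show "p x t \<in> borel_measurable ?V" if x: "x \<in> {0..n}"
  proof -
    have "(\<lambda>\<omega>. snd (config n r p t \<omega>) x) \<in> borel_measurable ?V"
      by (rule measurable_compose[OF c], unfold config_space_def)
        (rule measurable_compose[OF measurable_snd measurable_component_singleton[OF x]])
    then show ?thesis using x by (simp add: config_def)
  qed
qed

text \<open>In the interlaced numbering the sites with a Poisson process are the even positive
  indices.\<close>

lemma sum_even_positive: "(\<Sum>j\<le>2 * n. if even j \<and> 0 < j then g (j div 2) else 0) = (\<Sum>x=1..n. g x)"
  for g :: "nat \<Rightarrow> real"
proof (induction n)
  case (Suc n)
  have "2 * Suc n = Suc (Suc (2 * n))" by simp
  then show ?case using Suc by simp
qed simp

locale open_chain = chain M \<gamma> Tminus \<theta> Fbar Fhat n \<mu> w N r p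
  for M :: "'a measure" and \<gamma> Tminus \<theta> Fbar Fhat n \<mu> w N r p +
  assumes \<gamma>_pos: "\<gamma> > 0" and n_pos: "n \<ge> 1" and force_cont: "continuous_on UNIV (force \<theta> Fbar Fhat n)"
begin

sublocale W: wiener_process M w by (rule wiener)

definition "sg = sqrt (4 * \<gamma> * Tminus)"

definition jmp :: "nat \<Rightarrow> bool" where "jmp j \<longleftrightarrow> even j \<and> 0 < j"

text \<open>Each component is driven by its right neighbour minus its left neighbour in the
  interlaced order. The only friction in the drift is at index 0; elsewhere the damping comes from
  averaging the jumps.\<close>

definition coef :: "nat \<Rightarrow> nat \<Rightarrow> real" where
  "coef j k = (if k = Suc j then 1 else 0) - (if Suc k = j then 1 else 0) - (if k = 0 \<and> j = 0 then 2 * \<gamma> else 0)"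

definition cc :: "nat \<Rightarrow> real" where "cc j = (if jmp j then - 2 else 0)"

text \<open>\<open>max 0\<close> matches the integrator of \<open>jump_integral\<close>: constant
  for negative times, hence monotone on the whole line.\<close>

definition FF :: "nat \<Rightarrow> real \<Rightarrow> 'a \<Rightarrow> real" where
  "FF j s \<omega> = (if jmp j then real (N (j div 2) (\<gamma> * max 0 s) \<omega>) else 0)"

text \<open>Writing p_0 as the shifted component plus \<open>sg * w\<close> leaves -2\<gamma>
  \<open>sg * w\<close> in the equation of index 0 and -\<open>sg * w\<close> in that of index 1;
  their integrals appear here. The force acts on the last index, which differs from 0 and 1 as n is
  at least 1.\<close>

definition HH :: "nat \<Rightarrow> real \<Rightarrow> 'a \<Rightarrow> real" where
  "HH j t \<omega> = (if j = 0 then - 2 * \<gamma> * sg * riemann (\<lambda>s. w s \<omega>) t else if j = 1 then - sg * riemann (\<lambda>s. w s \<omega>) t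
     else if j = 2 * n then integral {0..t} (force \<theta> Fbar Fhat n) else 0)"

text \<open>The factor 2\<gamma> + 1 adds up the Wiener inputs of the indices 0 and 1.\<close>

definition VV :: "real \<Rightarrow> 'a \<Rightarrow> real" where
  "VV t \<omega> = (2 * \<gamma> + 1) * \<bar>sg\<bar> * riemann (\<lambda>s. \<bar>w s \<omega>\<bar>) t + integral {0..t} (\<lambda>s. \<bar>force \<theta> Fbar Fhat n s\<bar>)"

definition hh :: "nat \<Rightarrow> real \<Rightarrow> real" where
  "hh j t = (if j = 2 * n then integral {0..t} (force \<theta> Fbar Fhat n) else 0)"

text \<open>The sites are interlaced as \<open>p\<^sub>0, r\<^sub>1, p\<^sub>1, r\<^sub>2, \<dots>, r\<^sub>n, p\<^sub>n\<close>. Subtracting the Wiener process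
  from \<open>p\<^sub>0\<close> leaves only terms of bounded variation in the equations.\<close>

definition zz :: "nat \<Rightarrow> real \<Rightarrow> 'a \<Rightarrow> real" where
  "zz j t \<omega> = (if j = 0 then p 0 t \<omega> - sg * w t \<omega> else if even j then p (j div 2) t \<omega> else r (Suc (j div 2)) t \<omega>)"

definition zi :: "nat \<Rightarrow> 'a \<Rightarrow> real" where
  "zi j \<omega> = (if even j then p (j div 2) 0 \<omega> else r (Suc (j div 2)) 0 \<omega>)"

definition YY :: "real \<Rightarrow> nat \<Rightarrow> nat \<Rightarrow> nat \<Rightarrow> 'a \<Rightarrow> real" where
  "YY T K i j \<omega> = euler (2 * n) coef cc (\<lambda>j s. FF j s \<omega>) (\<lambda>j s. HH j s \<omega>) (\<lambda>j. zi j \<omega>) T K i j"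

definition GG :: "real \<Rightarrow> 'a \<Rightarrow> real" where
  "GG T \<omega> = ((\<Sum>j\<le>2 * n. \<bar>zi j \<omega>\<bar>) + (VV T \<omega> - VV 0 \<omega>)) * jump_factor (2 * n) coef (\<lambda>j s. FF j s \<omega>) T"

lemma coef_sum:
  assumes "j \<le> 2 * n"
  shows "(\<Sum>k\<le>2 * n. coef j k * y k) =
    (if j < 2 * n then y (Suc j) else 0) - (if j = 0 then 2 * \<gamma> * y 0 else y (j - 1))"
proof (cases j)
  case 0
  have "coef j k * y k = (if k = Suc j then y k else 0) - (if k = 0 then 2 * \<gamma> * y k else 0)" for k
    using 0 by (simp add: coef_def)
  then show ?thesis using 0 n_pos by (simp add: sum_subtractf)
next
  case (Suc i)
  have "coef j k * y k = (if k = Suc j then y k else 0) - (if k = i then y k else 0)" for k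
    using Suc by (simp add: coef_def)
  then show ?thesis using Suc assms by (simp add: sum_subtractf)
qed

lemma odd_site: "j \<le> 2 * n \<Longrightarrow> odd j \<Longrightarrow> Suc (j div 2) \<in> {1..n}" by (auto elim!: oddE)

lemma even_site: "j \<le> 2 * n \<Longrightarrow> j div 2 \<in> {0..n}" by auto

lemma jmp_site: "j \<le> 2 * n \<Longrightarrow> jmp j \<Longrightarrow> j div 2 \<in> {1..n}" by (auto simp: jmp_def elim!: evenE)

lemma zz_cadlag: "AE \<omega> in M. \<forall>j\<le>2 * n. cadlag (\<lambda>t. zz j t \<omega>)"
  using r_paths p_paths W.paths_cont
proof eventually_elim
  case (elim \<omega>)
  show ?case
  proof (intro allI impI)
    fix j assume j: "j \<le> 2 * n"
    consider "j = 0" | "j \<noteq> 0" "even j" | "j \<noteq> 0" "odd j" by blast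
    then show "cadlag (\<lambda>t. zz j t \<omega>)"
    proof cases
      case 1
      have "cadlag (\<lambda>t. p 0 t \<omega>)" using elim(2) by simp
      then show ?thesis unfolding zz_def using 1 elim(3) by (simp add: cadlag_minus_continuous)
    next
      case 2
      then show ?thesis unfolding zz_def using elim(2) even_site[OF j] by simp
    next
      case 3
      then show ?thesis unfolding zz_def using elim(1) odd_site[OF j] by simp
    qed
  qed
qed

lemma N_paths: "AE \<omega> in M. \<forall>x\<in>{1..n}. mono_on {0..} (\<lambda>t. N x t \<omega>) \<and> (\<forall>t\<ge>0. continuous (at_right t) (\<lambda>s. real (N x s \<omega>)))"
proof (rule AE_finite_allI)
  fix x assume "x \<in> {1..n}"
  then interpret P: poisson_process M "N x" by (rule poisson)
  show "AE \<omega> in M. mono_on {0..} (\<lambda>t. N x t \<omega>) \<and> (\<forall>t\<ge>0. continuous (at_right t) (\<lambda>s. real (N x s \<omega>)))"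
    using P.paths_mono P.paths_right_cont by eventually_elim blast
qed simp

lemma FF_mono: "AE \<omega> in M. \<forall>j\<le>2 * n. \<forall>s t. s \<le> t \<longrightarrow> FF j s \<omega> \<le> FF j t \<omega>"
  using N_paths
proof eventually_elim
  case (elim \<omega>)
  show ?case
  proof (intro allI impI)
    fix j and s t :: real assume j: "j \<le> 2 * n" and st: "s \<le> t"
    show "FF j s \<omega> \<le> FF j t \<omega>"
    proof (cases "jmp j")
      case True
      have "mono_on {0..} (\<lambda>t. N (j div 2) t \<omega>)" using elim jmp_site[OF j True] by blast
      from mono_onD[OF this, of "\<gamma> * max 0 s" "\<gamma> * max 0 t"] show ?thesis
        using True st \<gamma>_pos by (simp add: FF_def mult_left_mono)
    qed (simp add: FF_def)
  qed
qed

lemma FF_right: "AE \<omega> in M. \<forall>j\<le>2 * n. \<forall>s. continuous (at_right s) (\<lambda>s. FF j s \<omega>)"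
  using N_paths
proof eventually_elim
  case (elim \<omega>)
  show ?case
  proof (intro allI impI)
    fix j and s :: real assume j: "j \<le> 2 * n"
    show "continuous (at_right s) (\<lambda>s. FF j s \<omega>)"
    proof (cases "jmp j")
      case True
      let ?g = "\<lambda>u. real (N (j div 2) u \<omega>)"
      have "((\<lambda>u. ?g (\<gamma> * max 0 u)) \<longlongrightarrow> ?g (\<gamma> * max 0 s)) (at_right s)"
      proof (cases "s \<ge> 0")
        case s: True
        have "\<forall>t\<ge>0. continuous (at_right t) ?g" using elim jmp_site[OF j True] by blast
        then have "(?g \<longlongrightarrow> ?g (\<gamma> * s)) (at_right (\<gamma> * s))" using s \<gamma>_pos by (simp add: continuous_within)
        \<comment> \<open>The time change is strictly increasing on nonnegative times, so right
          neighbourhoods are mapped into right neighbourhoods.\<close>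
        moreover have "filterlim (\<lambda>u. \<gamma> * max 0 u) (at_right (\<gamma> * s)) (at_right s)"
          unfolding filterlim_at
        proof
          show "\<forall>\<^sub>F u in at_right s. \<gamma> * max 0 u \<in> {\<gamma> * s<..} \<and> \<gamma> * max 0 u \<noteq> \<gamma> * s"
            unfolding eventually_at_right_field using s \<gamma>_pos by (intro exI[of _ "s + 1"]) auto
          have "((\<lambda>u. \<gamma> * max 0 u) \<longlongrightarrow> \<gamma> * max 0 s) (at_right s)" by (intro tendsto_intros)
          then show "((\<lambda>u. \<gamma> * max 0 u) \<longlongrightarrow> \<gamma> * s) (at_right s)" using s by simp
        qed
        ultimately show ?thesis using s filterlim_compose by fastforce
      next
        case False
        show ?thesis
        proof (rule tendsto_eventually)
          show "\<forall>\<^sub>F u in at_right s. ?g (\<gamma> * max 0 u) = ?g (\<gamma> * max 0 s)"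
            unfolding eventually_at_right_field using False by (intro exI[of _ 0]) auto
        qed
      qed
      then show ?thesis using True by (simp add: FF_def continuous_within)
    qed (simp add: FF_def)
  qed
qed

lemma force_cont': "continuous_on A (force \<theta> Fbar Fhat n)"
  by (rule continuous_on_subset[OF force_cont]) simp

lemma HH_0: "HH j 0 \<omega> = 0"
  by (simp add: HH_def riemann_def)

lemma HH_VV: "AE \<omega> in M. \<forall>s t. 0 \<le> s \<longrightarrow> s \<le> t \<longrightarrow> (\<Sum>j\<le>2 * n. \<bar>HH j t \<omega> - HH j s \<omega>\<bar>) \<le> VV t \<omega> - VV s \<omega>"
  using W.paths_cont
proof eventually_elim
  case (elim \<omega>)
  have a: "continuous_on {0..} (\<lambda>s. \<bar>w s \<omega>\<bar>)" by (intro continuous_intros elim)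
  show ?case
  proof (intro allI impI)
    fix s t :: real assume st: "0 \<le> s" "s \<le> t"
    let ?d = "riemann (\<lambda>s. w s \<omega>) t - riemann (\<lambda>s. w s \<omega>) s"
    let ?f = "integral {0..t} (force \<theta> Fbar Fhat n) - integral {0..s} (force \<theta> Fbar Fhat n)"
    let ?A = "riemann (\<lambda>s. \<bar>w s \<omega>\<bar>) t - riemann (\<lambda>s. \<bar>w s \<omega>\<bar>) s"
    have "\<bar>HH j t \<omega> - HH j s \<omega>\<bar> = (if j = 0 then 2 * \<gamma> * \<bar>sg\<bar> * \<bar>?d\<bar> else 0) + (if j = 1 then \<bar>sg\<bar> * \<bar>?d\<bar> else 0) + (if j = 2 * n then \<bar>?f\<bar> else 0)" for j
    proof -
      have "\<bar>- 2 * \<gamma> * sg * x - - 2 * \<gamma> * sg * y\<bar> = 2 * \<gamma> * \<bar>sg\<bar> * \<bar>x - y\<bar>" for x y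
      proof -
        have "- 2 * \<gamma> * sg * x - - 2 * \<gamma> * sg * y = - (2 * \<gamma>) * sg * (x - y)" by (simp add: algebra_simps)
        then show ?thesis using \<gamma>_pos by (simp add: abs_mult)
      qed
      moreover have "\<bar>- sg * x - - sg * y\<bar> = \<bar>sg\<bar> * \<bar>x - y\<bar>" for x y
      proof -
        have "- sg * x - - sg * y = - sg * (x - y)" by (simp add: algebra_simps)
        then show ?thesis by (simp add: abs_mult)
      qed
      ultimately show ?thesis using n_pos by (simp only: HH_def) auto
    qed
    then have "(\<Sum>j\<le>2 * n. \<bar>HH j t \<omega> - HH j s \<omega>\<bar>) = (2 * \<gamma> + 1) * \<bar>sg\<bar> * \<bar>?d\<bar> + \<bar>?f\<bar>"
      using n_pos by (simp add: sum.distrib distrib_right)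
    also have "\<dots> \<le> (2 * \<gamma> + 1) * \<bar>sg\<bar> * ?A + (integral {0..t} (\<lambda>s. \<bar>force \<theta> Fbar Fhat n s\<bar>) - integral {0..s} (\<lambda>s. \<bar>force \<theta> Fbar Fhat n s\<bar>))"
    proof (rule add_mono)
      have "\<bar>?d\<bar> \<le> ?A" using integral_increment_bound[OF elim st] riemann_eq(2)[OF elim] riemann_eq(2)[OF a] st by simp
      then show "(2 * \<gamma> + 1) * \<bar>sg\<bar> * \<bar>?d\<bar> \<le> (2 * \<gamma> + 1) * \<bar>sg\<bar> * ?A" using \<gamma>_pos by (intro mult_left_mono) auto
    qed (rule integral_increment_bound[OF force_cont' st])
    also have "\<dots> = VV t \<omega> - VV s \<omega>" by (simp add: VV_def right_diff_distrib)
    finally show "(\<Sum>j\<le>2 * n. \<bar>HH j t \<omega> - HH j s \<omega>\<bar>) \<le> VV t \<omega> - VV s \<omega>" .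
  qed
qed

text \<open>The integral equations of the chain, rearranged. Cases 1 and 2 carry the correction for
  the subtracted Wiener process, and the last moves the force out of the drift integral.\<close>

lemma zz_eq: "AE \<omega> in M. \<forall>j\<le>2 * n. \<forall>t\<ge>0. zz j t \<omega> = zi j \<omega> + (LBINT s:{0..t}. \<Sum>k\<le>2 * n. coef j k * zz k s \<omega>) + HH j t \<omega>
       + cc j * (LINT s:{0<..t}|interval_measure (\<lambda>s. FF j s \<omega>). left_lim (\<lambda>s. zz j s \<omega>) s)"
  using r_paths p_paths W.paths_cont r_eq p_left_eq p_bulk_eq p_right_eq
proof eventually_elim
  case (elim \<omega>)
  show ?case
  proof (intro allI impI)
    fix j and t :: real assume j: "j \<le> 2 * n" and t: "0 \<le> t"
    have ri: "set_integrable lborel {0..t} (\<lambda>s. r x s \<omega>)" if "x \<in> {1..n}" for x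
      using elim(1) that by (intro integrable_cadlag) auto
    have pi: "set_integrable lborel {0..t} (\<lambda>s. p x s \<omega>)" if "x \<in> {0..n}" for x
      using elim(2) that by (intro integrable_cadlag) auto
    have wi: "set_integrable lborel {0..t} (\<lambda>s. w s \<omega>)"
      by (intro borel_integrable_atLeastAtMost' continuous_on_subset[OF elim(3)]) auto
    have fi: "set_integrable lborel {0..t} (force \<theta> Fbar Fhat n)"
      by (intro borel_integrable_atLeastAtMost' force_cont')
    have IW: "riemann (\<lambda>s. w s \<omega>) t = (LBINT s:{0..t}. w s \<omega>)" by (rule riemann_eq(1)[OF elim(3) t])
    have \<Phi>: "integral {0..t} (force \<theta> Fbar Fhat n) = (LBINT s:{0..t}. force \<theta> Fbar Fhat n s)"
      by (rule lbint_eq_integral[symmetric, OF force_cont'])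
    have jump: "(LINT s:{0<..t}|interval_measure (\<lambda>s. FF j s \<omega>). left_lim (\<lambda>s. zz j s \<omega>) s) = jump_integral \<gamma> (\<lambda>s. N y s \<omega>) (\<lambda>s. p y s \<omega>) t"
      if "j = 2 * y" "y > 0" for y
      using that by (simp add: jump_integral_def FF_def jmp_def zz_def left_lim_def)
    consider "j = 0" | "j = 1" | y where "j = Suc (2 * y)" "y > 0" | y where "j = 2 * y" "y > 0" "y < n" | "j = 2 * n"
      using j n_pos by (cases "even j") (auto elim!: evenE oddE, force+)
    then show "zz j t \<omega> = zi j \<omega> + (LBINT s:{0..t}. \<Sum>k\<le>2 * n. coef j k * zz k s \<omega>) + HH j t \<omega>
       + cc j * (LINT s:{0<..t}|interval_measure (\<lambda>s. FF j s \<omega>). left_lim (\<lambda>s. zz j s \<omega>) s)"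
    proof cases
      case 1
      have "(\<Sum>k\<le>2 * n. coef j k * zz k s \<omega>) = (r 1 s \<omega> - 2 * \<gamma> * p 0 s \<omega>) + 2 * \<gamma> * sg * w s \<omega>" for s
        unfolding coef_sum[OF j] using 1 n_pos by (simp add: zz_def algebra_simps)
      moreover have "(LBINT s:{0..t}. (r 1 s \<omega> - 2 * \<gamma> * p 0 s \<omega>) + 2 * \<gamma> * sg * w s \<omega>) =
        (LBINT s:{0..t}. r 1 s \<omega> - 2 * \<gamma> * p 0 s \<omega>) + (LBINT s:{0..t}. 2 * \<gamma> * sg * w s \<omega>)"
        using ri[of 1] pi[of 0] wi n_pos by (intro set_integral_add set_integral_diff set_integrable_mult_right) auto
      moreover have "p 0 t \<omega> = p 0 0 \<omega> + (LBINT s:{0..t}. r 1 s \<omega> - 2 * \<gamma> * p 0 s \<omega>) + sg * w t \<omega>"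
        unfolding sg_def by (rule elim(5)[rule_format, OF t])
      ultimately show ?thesis using 1 by (simp add: zz_def zi_def HH_def IW cc_def jmp_def)
    next
      case 2
      have "(\<Sum>k\<le>2 * n. coef j k * zz k s \<omega>) = (p 1 s \<omega> - p 0 s \<omega>) + sg * w s \<omega>" for s
        unfolding coef_sum[OF j] using 2 n_pos by (simp add: zz_def)
      moreover have "(LBINT s:{0..t}. (p 1 s \<omega> - p 0 s \<omega>) + sg * w s \<omega>) =
        (LBINT s:{0..t}. p 1 s \<omega> - p 0 s \<omega>) + (LBINT s:{0..t}. sg * w s \<omega>)"
        using pi[of 1] pi[of 0] wi n_pos by (intro set_integral_add set_integral_diff set_integrable_mult_right) auto
      moreover have "r 1 t \<omega> = r 1 0 \<omega> + (LBINT s:{0..t}. p 1 s \<omega> - p (1 - 1) s \<omega>)"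
        by (rule elim(4)[rule_format, OF t]) (use n_pos in auto)
      ultimately show ?thesis using 2 by (simp add: zz_def zi_def HH_def IW cc_def jmp_def)
    next
      case (3 y)
      have jn: "j < 2 * n" using 3 j by presburger
      have "(\<Sum>k\<le>2 * n. coef j k * zz k s \<omega>) = p (Suc y) s \<omega> - p y s \<omega>" for s
        unfolding coef_sum[OF j] using 3 jn by (simp add: zz_def)
      moreover have "r (Suc y) t \<omega> = r (Suc y) 0 \<omega> + (LBINT s:{0..t}. p (Suc y) s \<omega> - p (Suc y - 1) s \<omega>)"
        by (rule elim(4)[rule_format, OF t]) (use 3 j in auto)
      ultimately show ?thesis using 3 jn by (simp add: zz_def zi_def HH_def cc_def jmp_def)
    next
      case (4 y)
      have d: "Suc ((2 * y - 1) div 2) = y" "odd (2 * y - 1)" "2 * y - 1 \<noteq> 0" using 4 by auto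
      have "(\<Sum>k\<le>2 * n. coef j k * zz k s \<omega>) = r (y + 1) s \<omega> - r y s \<omega>" for s
        unfolding coef_sum[OF j] using 4 j d by (simp add: zz_def)
      moreover have "p y t \<omega> = p y 0 \<omega> + (LBINT s:{0..t}. r (y + 1) s \<omega> - r y s \<omega>) - 2 * jump_integral \<gamma> (\<lambda>s. N y s \<omega>) (\<lambda>s. p y s \<omega>) t"
        by (rule elim(6)[rule_format, OF t]) (use 4 in auto)
      ultimately show ?thesis unfolding jump[OF 4(1,2)] using 4 by (simp add: zz_def zi_def HH_def cc_def jmp_def)
    next
      case 5
      have d: "Suc ((2 * n - 1) div 2) = n" "odd (2 * n - 1)" "2 * n - 1 \<noteq> 0" using n_pos by auto
      have "(\<Sum>k\<le>2 * n. coef j k * zz k s \<omega>) = - r n s \<omega>" for s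
        unfolding coef_sum[OF j] using 5 j d n_pos by (simp add: zz_def)
      moreover have "p n t \<omega> = p n 0 \<omega> + (LBINT s:{0..t}. force \<theta> Fbar Fhat n s - r n s \<omega>) - 2 * jump_integral \<gamma> (\<lambda>s. N n s \<omega>) (\<lambda>s. p n s \<omega>) t"
        by (rule elim(7)[rule_format, OF t])
      moreover have "(LBINT s:{0..t}. force \<theta> Fbar Fhat n s - r n s \<omega>) = (LBINT s:{0..t}. force \<theta> Fbar Fhat n s) - (LBINT s:{0..t}. r n s \<omega>)"
        using fi ri[of n] n_pos by (intro set_integral_diff) auto
      moreover have "(LBINT s:{0..t}. - r n s \<omega>) = - (LBINT s:{0..t}. r n s \<omega>)"
        by (simp add: set_lebesgue_integral_def)
      ultimately show ?thesis unfolding jump[OF 5 n_pos[THEN less_le_trans[OF zero_less_one]]] using 5 n_pos by (simp add: zz_def zi_def HH_def cc_def jmp_def \<Phi>)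
    qed
  qed
qed

lemma HH_measurable:
  assumes "\<And>s. 0 \<le> s \<Longrightarrow> w s \<in> borel_measurable A" and t: "0 \<le> t"
  shows "HH j t \<in> borel_measurable A"
proof -
  have "(\<lambda>\<omega>. riemann (\<lambda>s. w s \<omega>) t) \<in> borel_measurable A" by (rule riemann_measurable[OF assms])
  then have "(\<lambda>\<omega>. HH j t \<omega>) \<in> borel_measurable A" unfolding HH_def by measurable
  then show ?thesis .
qed

lemma VV_measurable:
  assumes "\<And>s. 0 \<le> s \<Longrightarrow> w s \<in> borel_measurable A" and t: "0 \<le> t"
  shows "VV t \<in> borel_measurable A"
proof -
  have "(\<lambda>\<omega>. riemann (\<lambda>s. \<bar>w s \<omega>\<bar>) t) \<in> borel_measurable A"
    by (rule riemann_measurable[OF borel_measurable_abs[OF assms(1)] t])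
  then have "(\<lambda>\<omega>. VV t \<omega>) \<in> borel_measurable A" unfolding VV_def by measurable
  then show ?thesis .
qed

text \<open>The sigma-algebra is left open: with the whole space it gives measurability, and with
  the one generated by the noise before step i it gives independence of the next increment.\<close>

lemma YY_measurable_gen:
  assumes zi: "\<And>j. j \<le> 2 * n \<Longrightarrow> zi j \<in> borel_measurable A"
    and w: "\<And>s. 0 \<le> s \<Longrightarrow> w s \<in> borel_measurable A"
    and F: "\<And>l j. l < i \<Longrightarrow> j \<le> 2 * n \<Longrightarrow> (\<lambda>\<omega>. FF j (node T K (Suc l)) \<omega> - FF j (node T K l) \<omega>) \<in> borel_measurable A"
    and T: "T \<ge> 0"
  shows "j \<le> 2 * n \<Longrightarrow> YY T K i j \<in> borel_measurable A"
proof -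
  have n0: "0 \<le> node T K l" for l using T by (simp add: node_def)
  have "\<forall>j\<le>2 * n. (\<lambda>\<omega>. YY T K i' j \<omega>) \<in> borel_measurable A" if "i' \<le> i" for i'
    using that
  proof (induction i')
    case 0
    have "(\<lambda>\<omega>. YY T K 0 j \<omega>) = zi j" for j by (rule ext) (simp add: YY_def)
    then show ?case using zi by simp
  next
    case (Suc l)
    show ?case
    proof (intro allI impI)
      fix j assume j: "j \<le> 2 * n"
      have Y: "(\<lambda>\<omega>. YY T K l k \<omega>) \<in> borel_measurable A" if "k \<le> 2 * n" for k using Suc that by simp
      have eq: "YY T K (Suc l) j = (\<lambda>\<omega>. YY T K l j \<omega> + T / real K * (\<Sum>k\<le>2 * n. coef j k * YY T K l k \<omega>)
        + (HH j (node T K (Suc l)) \<omega> - HH j (node T K l) \<omega>) + cc j * YY T K l j \<omega> * (FF j (node T K (Suc l)) \<omega> - FF j (node T K l) \<omega>))"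
        unfolding YY_def euler.simps by (rule refl)
      show "(\<lambda>\<omega>. YY T K (Suc l) j \<omega>) \<in> borel_measurable A"
        unfolding eq
      proof (intro borel_measurable_add)
        show "(\<lambda>\<omega>. YY T K l j \<omega>) \<in> borel_measurable A" by (rule Y[OF j])
        show "(\<lambda>\<omega>. T / real K * (\<Sum>k\<le>2 * n. coef j k * YY T K l k \<omega>)) \<in> borel_measurable A"
          by (intro borel_measurable_times borel_measurable_const borel_measurable_sum Y) simp
        show "(\<lambda>\<omega>. HH j (node T K (Suc l)) \<omega> - HH j (node T K l) \<omega>) \<in> borel_measurable A"
          by (rule borel_measurable_diff; rule HH_measurable[OF w n0])
        have "(\<lambda>\<omega>. FF j (node T K (Suc l)) \<omega> - FF j (node T K l) \<omega>) \<in> borel_measurable A"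
          using Suc.prems by (intro F j) simp
        then show "(\<lambda>\<omega>. cc j * YY T K l j \<omega> * (FF j (node T K (Suc l)) \<omega> - FF j (node T K l) \<omega>)) \<in> borel_measurable A"
          by (rule borel_measurable_times[OF borel_measurable_times[OF borel_measurable_const Y[OF j]]])
      qed
    qed
  qed
  from this[OF order_refl] show "YY T K i j \<in> borel_measurable A" if "j \<le> 2 * n" using that by simp
qed

lemma FF_measurable:
  assumes j: "j \<le> 2 * n"
  shows "FF j s \<in> borel_measurable M"
proof (cases "jmp j")
  case True
  interpret P: poisson_process M "N (j div 2)" by (rule poisson[OF jmp_site[OF j True]])
  have "0 \<le> \<gamma> * max 0 s" using \<gamma>_pos by simp
  moreover have "FF j s = (\<lambda>\<omega>. real (N (j div 2) (\<gamma> * max 0 s) \<omega>))" by (rule ext) (simp add: FF_def True)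
  ultimately show ?thesis using P.real_N_measurable by metis
next
  case False
  then have "FF j s = (\<lambda>\<omega>. 0)" by (intro ext) (simp add: FF_def)
  then show ?thesis by simp
qed

lemma zi_integrable: "j \<le> 2 * n \<Longrightarrow> integrable M (zi j)"
proof (cases "even j")
  case True
  assume j: "j \<le> 2 * n"
  have "zi j = p (j div 2) 0" using True by (auto simp: zi_def)
  then show ?thesis using p_initial_integrable[OF even_site[OF j]] by simp
next
  case False
  assume j: "j \<le> 2 * n"
  have "zi j = r (Suc (j div 2)) 0" using False by (auto simp: zi_def)
  then show ?thesis using r_initial_integrable[OF odd_site[OF j False]] by simp
qed

lemma YY_measurable:
  assumes "T > 0" "j \<le> 2 * n"
  shows "YY T K i j \<in> borel_measurable M"
proof (rule YY_measurable_gen[OF _ W.measurable_w _ _ assms(2)])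
  show "zi j \<in> borel_measurable M" if "j \<le> 2 * n" for j using zi_integrable[OF that] by (rule borel_measurable_integrable)
  show "(\<lambda>\<omega>. FF j (node T K (Suc l)) \<omega> - FF j (node T K l) \<omega>) \<in> borel_measurable M" if "j \<le> 2 * n" for j l
    by (intro borel_measurable_diff FF_measurable that)
  show "0 \<le> T" by (rule less_imp_le[OF assms(1)])
qed

lemma zz_measurable:
  assumes j: "j \<le> 2 * n" and t: "t \<ge> 0"
  shows "zz j t \<in> borel_measurable M"
proof -
  consider "j = 0" | "j \<noteq> 0" "even j" | "j \<noteq> 0" "odd j" by blast
  then show ?thesis
  proof cases
    case 1
    have "zz j t = (\<lambda>\<omega>. p 0 t \<omega> - sg * w t \<omega>)" by (rule ext) (simp add: zz_def 1)
    moreover have "(\<lambda>\<omega>. p 0 t \<omega> - sg * w t \<omega>) \<in> borel_measurable M"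
      by (rule borel_measurable_diff[OF p_measurable[OF _ t] borel_measurable_times[OF borel_measurable_const W.measurable_w[OF t]]]) simp
    ultimately show ?thesis by (simp only:)
  next
    case 2
    then have "zz j t = p (j div 2) t" by (intro ext) (simp add: zz_def)
    then show ?thesis using p_measurable[OF even_site[OF j] t] by (simp only:)
  next
    case 3
    then have "zz j t = r (Suc (j div 2)) t" by (intro ext) (simp add: zz_def)
    then show ?thesis using r_measurable[OF odd_site[OF j 3(2)] t] by (simp only:)
  qed
qed

lemma HH_mean:
  assumes t: "t \<ge> 0"
  shows "integrable M (HH j t) \<and> (\<integral>\<omega>. HH j t \<omega> \<partial>M) = hh j t"
proof -
  have i: "integrable M (\<lambda>\<omega>. riemann (\<lambda>s. w s \<omega>) t)" and e: "(\<integral>\<omega>. riemann (\<lambda>s. w s \<omega>) t \<partial>M) = 0"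
  proof -
    note R = W.riemann_w[OF t, of "\<lambda>x. x", simplified]
    show "integrable M (\<lambda>\<omega>. riemann (\<lambda>s. w s \<omega>) t)" using R(1) by simp
    have z: "indicat_real {0..t} s * (\<integral>\<omega>. w s \<omega> \<partial>M) = 0" for s
      using W.w_moments(2)[of s] by (cases "s \<in> {0..t}") auto
    show "(\<integral>\<omega>. riemann (\<lambda>s. w s \<omega>) t \<partial>M) = 0" unfolding R(2) z by simp
  qed
  have "integrable M (\<lambda>\<omega>. HH j t \<omega>) \<and> (\<integral>\<omega>. HH j t \<omega> \<partial>M) = hh j t"
    unfolding HH_def hh_def using i e n_pos by (cases "j = 0"; cases "j = 1"; cases "j = 2 * n") (auto simp: prob_space)
  then show ?thesis by simp
qed

lemma hh_cont: "continuous_on {0..} (hh j)"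
proof (cases "j = 2 * n")
  case True
  have "hh j = (\<lambda>t. integral {0..t} (force \<theta> Fbar Fhat n))" using True by (auto simp: hh_def)
  moreover have "continuous_on {0..} (\<lambda>t. integral {0..t} (force \<theta> Fbar Fhat n))"
    by (rule DERIV_continuous_on[OF integral_at_0_deriv[OF force_cont']]) auto
  ultimately show ?thesis by simp
next
  case False
  have "hh j = (\<lambda>t. 0)" using False by (auto simp: hh_def)
  then show ?thesis by simp
qed

end

context open_chain
begin

text \<open>The sigma-algebras of the independence hypothesis as measures, so that measurability of
  functions can be stated for a single source.\<close>

definition VA :: "source \<Rightarrow> 'a measure" where
  "VA i = (case i of Initial \<Rightarrow> vimage_algebra (space M) (config n r p 0) (config_space n)
     | Wiener \<Rightarrow> vimage_algebra (space M) (\<lambda>\<omega>. \<lambda>t\<in>{0..}. w t \<omega>) (\<Pi>\<^sub>M t\<in>{0..}. borel)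
     | Poisson x \<Rightarrow> vimage_algebra (space M) (\<lambda>\<omega>. \<lambda>t\<in>{0..}. real (N x t \<omega>)) (\<Pi>\<^sub>M t\<in>{0..}. borel))"

definition sources :: "source set" where "sources = {Initial, Wiener} \<union> Poisson ` {1..n}"

lemma space_VA: "space (VA i) = space M"
  by (cases i) (simp_all add: VA_def)

lemma sources_indep: "indep_sets (\<lambda>i. sets (VA i)) sources"
proof -
  have "(\<lambda>i. sets (VA i)) = (\<lambda>i. case i of
                Initial \<Rightarrow> sets (vimage_algebra (space M) (config n r p 0) (config_space n))
              | Wiener \<Rightarrow> path_sigma M w
              | Poisson x \<Rightarrow> path_sigma M (\<lambda>t \<omega>. real (N x t \<omega>)))"
    by (rule ext) (simp add: VA_def path_sigma_def split: source.split)
  then show ?thesis unfolding sources_def using independence by simp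
qed

lemma VA_events: "i \<in> sources \<Longrightarrow> sets (VA i) \<subseteq> events"
  using sources_indep[unfolded indep_sets_def, THEN conjunct1] by blast

lemma VA_preimage: "f \<in> borel_measurable (VA i) \<Longrightarrow> B \<in> sets borel \<Longrightarrow> f -` B \<inter> space M \<in> sets (VA i)"
  using measurable_sets[of f "VA i" borel B] by (simp add: space_VA)

lemma VA_sigma:
  assumes "f \<in> borel_measurable (VA i)" "sets (VA i) \<subseteq> U" "U \<subseteq> Pow (space M)"
  shows "f \<in> borel_measurable (sigma (space M) U)"
  by (rule measurable_sigma_generator[OF assms(3)]) (use VA_preimage[OF assms(1)] assms(2) in blast)

lemma zi_VA:
  assumes j: "j \<le> 2 * n"
  shows "zi j \<in> borel_measurable (VA Initial)"
proof (cases "even j")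
  case True
  then have "zi j = p (j div 2) 0" by (auto simp: zi_def)
  then show ?thesis using config_measurable(2)[OF even_site[OF j], of p 0 M r] by (simp add: VA_def)
next
  case False
  then have "zi j = r (Suc (j div 2)) 0" by (auto simp: zi_def)
  then show ?thesis using config_measurable(1)[OF odd_site[OF j False], of r 0 M p] by (simp add: VA_def)
qed

lemma w_VA:
  assumes "0 \<le> s"
  shows "w s \<in> borel_measurable (VA Wiener)"
  unfolding VA_def source.case by (rule path_measurable[OF assms])

lemma N_VA:
  assumes "0 \<le> s"
  shows "(\<lambda>\<omega>. real (N x s \<omega>)) \<in> borel_measurable (VA (Poisson x))"
  unfolding VA_def source.case by (rule path_measurable[OF assms, of "\<lambda>t \<omega>. real (N x t \<omega>)"])

text \<open>The step \<open>i\<close> of the scheme depends on the initial condition, on the Wiener process and on the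
  Poisson increments of the previous steps only.\<close>

lemma jump_mean:
  assumes T: "T > 0" "K > 0" and i: "i < K" and j: "j \<le> 2 * n" and Yi: "integrable M (YY T K i j)"
  shows "integrable M (\<lambda>\<omega>. cc j * YY T K i j \<omega> * (FF j (node T K (Suc i)) \<omega> - FF j (node T K i) \<omega>)) \<and>
    (\<integral>\<omega>. cc j * YY T K i j \<omega> * (FF j (node T K (Suc i)) \<omega> - FF j (node T K i) \<omega>) \<partial>M) = T / real K * (cc j * \<gamma> * (\<integral>\<omega>. YY T K i j \<omega> \<partial>M))"
proof (cases "jmp j")
  case False
  then show ?thesis by (simp add: cc_def)
next
  case True
  define x0 where "x0 = j div 2"
  have x0: "x0 \<in> {1..n}" unfolding x0_def by (rule jmp_site[OF j True])
  define \<tau> where "\<tau> l = \<gamma> * node T K l" for l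
  define D where "D x l \<omega> = real (N x (\<tau> (Suc l)) \<omega>) - real (N x (\<tau> l) \<omega>)" for x l \<omega>
  \<comment> \<open>Poisson sources are cut into the increments 0 to i, of which the last is the
    coming one; the other sources stay whole, under the single label 0.\<close>
  define L where "L s = (case s of Poisson x \<Rightarrow> {..<Suc i} | _ \<Rightarrow> {0})" for s
  define E where "E q = (case fst q of Poisson x \<Rightarrow> {D x (snd q) -` B \<inter> space M |B. B \<in> sets borel} | _ \<Rightarrow> sets (VA (fst q)))" for q :: "source \<times> nat"
  have n0: "0 \<le> node T K l" for l using T by (simp add: node_def)
  have \<tau>0: "0 \<le> \<tau> l" for l unfolding \<tau>_def using n0 \<gamma>_pos by simp
  have \<tau>m: "mono \<tau>" unfolding \<tau>_def using node_mono[of T _ _ K] T \<gamma>_pos by (intro monoI mult_left_mono) auto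
  have FD: "(\<lambda>\<omega>. FF j' (node T K (Suc l)) \<omega> - FF j' (node T K l) \<omega>) = D (j' div 2) l" if "jmp j'" for j' l
    by (rule ext) (simp add: FF_def D_def \<tau>_def that max_absorb2[OF n0])
  have DV: "D x l \<in> borel_measurable (VA (Poisson x))" for x l
    unfolding D_def[abs_def] by (intro borel_measurable_diff N_VA \<tau>0)
  have EV: "E (s, l) \<subseteq> sets (VA s)" for s l
    by (cases s) (auto simp: E_def intro: VA_preimage[OF DV])
  have indep: "indep_sets E (Sigma sources L)"
  proof (rule indep_sets_nested[OF sources_indep EV])
    show "A \<inter> B \<in> sets (VA s)" if "A \<in> sets (VA s)" "B \<in> sets (VA s)" for s A B using that by (rule sets.Int)
    fix s assume s: "s \<in> sources"
    have single: "indep_sets (\<lambda>l. E (s, l)) {0}"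
    proof (rule indep_setsI)
      show "E (s, l) \<subseteq> events" for l using EV VA_events[OF s] by blast
      fix A J assume "J \<noteq> {}" "J \<subseteq> {0::nat}"
      then have "J = {0}" by auto
      then show "prob (\<Inter>j\<in>J. A j) = (\<Prod>j\<in>J. prob (A j))" by simp
    qed
    show "indep_sets (\<lambda>l. E (s, l)) (L s)"
    proof (cases s)
      case (Poisson x)
      then have "x \<in> {1..n}" using s by (auto simp: sources_def)
      then interpret P: poisson_process M "N x" by (rule poisson)
      have "indep_vars (\<lambda>_. borel) (\<lambda>l. D x l) {..<Suc i}"
        unfolding D_def[abs_def] by (rule P.indep_real_increments[OF \<tau>0 \<tau>m])
      then have "indep_sets (\<lambda>l. {D x l -` A \<inter> space M |A. A \<in> sets borel}) {..<Suc i}"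
        unfolding indep_vars_def2 by (rule conjunct2)
      then show ?thesis by (simp add: Poisson E_def L_def)
    qed (use single in \<open>simp_all add: L_def\<close>)
  qed
  have stable: "Int_stable (E q)" for q
  proof -
    have "Int_stable {D x l -` B \<inter> space M |B. B \<in> sets borel}" for x l
    proof (rule Int_stableI)
      fix a b assume "a \<in> {D x l -` B \<inter> space M |B. B \<in> sets borel}" "b \<in> {D x l -` B \<inter> space M |B. B \<in> sets borel}"
      then obtain A B where "A \<in> sets borel" "B \<in> sets borel" "a = D x l -` A \<inter> space M" "b = D x l -` B \<inter> space M" by blast
      then have "A \<inter> B \<in> sets borel" "a \<inter> b = D x l -` (A \<inter> B) \<inter> space M" by auto
      then show "a \<inter> b \<in> {D x l -` B \<inter> space M |B. B \<in> sets borel}" by blast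
    qed
    moreover have "Int_stable (sets (VA s))" for s by (rule sets.Int_stable)
    ultimately show ?thesis by (simp add: E_def split: source.split)
  qed
  let ?q = "(Poisson x0, i)"
  \<comment> \<open>Everything except the coming increment at this site. Increments at other sites
    over the same step may remain, being independent as well.\<close>
  let ?P = "Sigma sources L - {?q}"
  have q: "?q \<in> Sigma sources L" using x0 by (auto simp: sources_def L_def)
  have Pow: "(\<Union>q\<in>?P. E q) \<subseteq> Pow (space M)"
  proof
    fix a assume "a \<in> (\<Union>q\<in>?P. E q)"
    then obtain s l where "a \<in> E (s, l)" by auto
    then have "a \<in> sets (VA s)" using EV by blast
    then show "a \<in> Pow (space M)" using sets.sets_into_space[of a "VA s"] by (simp add: space_VA)
  qed
  have qPow: "E ?q \<subseteq> Pow (space M)"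
    by (auto simp: E_def)
  have Ym: "YY T K i j \<in> borel_measurable (sigma (space M) (\<Union>q\<in>?P. E q))"
  proof (rule YY_measurable_gen[OF _ _ _ _ j])
    have "sets (VA Initial) \<subseteq> (\<Union>q\<in>?P. E q)"
      by (rule UN_upper[of "(Initial, 0)" ?P E, THEN subset_trans[rotated]]) (auto simp: E_def sources_def L_def)
    then show "zi j \<in> borel_measurable (sigma (space M) (\<Union>q\<in>?P. E q))" if "j \<le> 2 * n" for j
      using VA_sigma[OF zi_VA[OF that] _ Pow] by blast
    have "sets (VA Wiener) \<subseteq> (\<Union>q\<in>?P. E q)"
      by (rule UN_upper[of "(Wiener, 0)" ?P E, THEN subset_trans[rotated]]) (auto simp: E_def sources_def L_def)
    then show "w s \<in> borel_measurable (sigma (space M) (\<Union>q\<in>?P. E q))" if "0 \<le> s" for s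
      using VA_sigma[OF w_VA[OF that] _ Pow] by blast
    fix l j' assume l: "l < i" and j': "j' \<le> 2 * n"
    show "(\<lambda>\<omega>. FF j' (node T K (Suc l)) \<omega> - FF j' (node T K l) \<omega>) \<in> borel_measurable (sigma (space M) (\<Union>q\<in>?P. E q))"
    proof (cases "jmp j'")
      case True
      have "(Poisson (j' div 2), l) \<in> ?P" using jmp_site[OF j' True] l by (auto simp: sources_def L_def)
      then have "D (j' div 2) l -` B \<inter> space M \<in> (\<Union>q\<in>?P. E q)" if "B \<in> sets borel" for B
        by (rule UN_I) (use that in \<open>auto simp: E_def\<close>)
      then show ?thesis unfolding FD[OF True] by (rule measurable_sigma_generator[OF Pow])
    next
      case False
      then show ?thesis by (simp add: FF_def)
    qed
  qed (use T in simp)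
  have Dm: "D x0 i \<in> borel_measurable (sigma (space M) (\<Union>q\<in>{?q}. E q))"
    by (rule measurable_sigma_generator) (use qPow in \<open>auto simp: E_def\<close>)
  have iv: "indep_var borel (YY T K i j) borel (D x0 i)"
    by (rule indep_var_two_groups[OF indep stable _ _ _ Ym Dm]) (use q in auto)
  interpret P: poisson_process M "N x0" by (rule poisson[OF x0])
  have \<tau>d: "\<tau> (Suc i) - \<tau> i = \<gamma> * (T / real K)" by (simp add: \<tau>_def node_step algebra_simps)
  have \<tau>l: "\<tau> i < \<tau> (Suc i)"
  proof -
    have "0 < \<gamma> * (T / real K)" using T \<gamma>_pos by simp
    then show ?thesis using \<tau>d by linarith
  qed
  have r0: "\<gamma> * (T / real K) > 0" using T \<gamma>_pos by simp
  have Di: "integrable M (D x0 i)" "(\<integral>\<omega>. D x0 i \<omega> \<partial>M) = \<gamma> * (T / real K)"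
    using P.increment_integrable[OF \<tau>0 \<tau>l, of "\<lambda>x. x"] poisson_mean[OF r0] unfolding \<tau>d D_def[abs_def] by auto
  have I: "integrable M (\<lambda>\<omega>. YY T K i j \<omega> * D x0 i \<omega>)" by (rule indep_var_integrable[OF iv Yi Di(1)])
  have e: "(\<integral>\<omega>. YY T K i j \<omega> * D x0 i \<omega> \<partial>M) = (\<integral>\<omega>. YY T K i j \<omega> \<partial>M) * (\<gamma> * (T / real K))"
    unfolding Di(2)[symmetric] by (rule indep_var_lebesgue_integral[OF iv Yi Di(1)])
  have f: "cc j * YY T K i j \<omega> * (FF j (node T K (Suc i)) \<omega> - FF j (node T K i) \<omega>) = cc j * (YY T K i j \<omega> * D x0 i \<omega>)" for \<omega>
    using fun_cong[OF FD[OF True, of i], of \<omega>] by (simp add: x0_def)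
  have "integrable M (\<lambda>\<omega>. cc j * (YY T K i j \<omega> * D x0 i \<omega>))" by (rule integrable_mult_right) (rule I)
  moreover have "(\<integral>\<omega>. cc j * (YY T K i j \<omega> * D x0 i \<omega>) \<partial>M) = T / real K * (cc j * \<gamma> * (\<integral>\<omega>. YY T K i j \<omega> \<partial>M))"
    unfolding integral_mult_right_zero e by (simp only: ac_simps)
  ultimately show ?thesis unfolding f by (rule conjI)
qed

lemma VV_integrable: "0 \<le> t \<Longrightarrow> integrable M (VV t)"
proof -
  assume t: "0 \<le> t"
  have "integrable M (\<lambda>\<omega>. riemann (\<lambda>s. \<bar>w s \<omega>\<bar>) t)"
    by (rule W.riemann_w(1)[OF t]) (auto intro!: continuous_intros)
  then have "integrable M (\<lambda>\<omega>. VV t \<omega>)" unfolding VV_def by simp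
  then show ?thesis .
qed

text \<open>The variable factors into a constant, a part \<open>X1\<close> depending on the initial
  condition and the Wiener process, and the product \<open>X2\<close> of exponentials of the jump
  counts. Both parts are integrable and they are independent, so the product is integrable without
  any second moment of the initial data.\<close>

lemma GG_integrable:
  assumes T: "T \<ge> 0"
  shows "integrable M (GG T)"
proof -
  define X1 where "X1 \<omega> = (\<Sum>j\<le>2 * n. \<bar>zi j \<omega>\<bar>) + (VV T \<omega> - VV 0 \<omega>)" for \<omega>
  define g where "g x \<omega> = real (N x (\<gamma> * T) \<omega>) - real (N x 0 \<omega>)" for x \<omega>
  define X where "X s \<omega> = (case s of Poisson x \<Rightarrow> exp (2 * g x \<omega>) | _ \<Rightarrow> 1)" for s \<omega>
  let ?Q = "Poisson ` {1..n}"
  define X2 where "X2 \<omega> = (\<Prod>s\<in>?Q. X s \<omega>)" for \<omega>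
  have T0: "0 \<le> \<gamma> * T" using T \<gamma>_pos by simp
  have G: "GG T \<omega> = exp (drift_norm (2 * n) coef * T) * (X1 \<omega> * X2 \<omega>)" for \<omega>
  proof -
    have "(\<Sum>j\<le>2 * n. FF j T \<omega> - FF j 0 \<omega>) = (\<Sum>j\<le>2 * n. if even j \<and> 0 < j then g (j div 2) \<omega> else 0)"
      using T by (intro sum.cong refl) (simp add: FF_def jmp_def g_def)
    also have "\<dots> = (\<Sum>x=1..n. g x \<omega>)" by (rule sum_even_positive)
    finally have e: "(\<Sum>j\<le>2 * n. FF j T \<omega> - FF j 0 \<omega>) = (\<Sum>x=1..n. g x \<omega>)" .
    have "jump_factor (2 * n) coef (\<lambda>j s. FF j s \<omega>) T = exp (drift_norm (2 * n) coef * T + 2 * (\<Sum>x=1..n. g x \<omega>))"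
      unfolding jump_factor_def e by (rule refl)
    also have "\<dots> = exp (drift_norm (2 * n) coef * T) * exp (\<Sum>x=1..n. 2 * g x \<omega>)"
      by (simp only: exp_add sum_distrib_left)
    also have "exp (\<Sum>x=1..n. 2 * g x \<omega>) = (\<Prod>x=1..n. exp (2 * g x \<omega>))" by (rule exp_sum) simp
    also have "(\<Prod>x=1..n. exp (2 * g x \<omega>)) = X2 \<omega>"
      \<comment> \<open>The product is indexed by sources instead of sites, to match the independent
        family; the value 1 of \<open>X\<close> at the other sources is a filler.\<close>
      unfolding X2_def by (subst prod.reindex) (auto simp: inj_on_def X_def)
    finally have j: "jump_factor (2 * n) coef (\<lambda>j s. FF j s \<omega>) T = exp (drift_norm (2 * n) coef * T) * X2 \<omega>" .
    show ?thesis unfolding GG_def j X1_def by (simp only: ac_simps)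
  qed
  have gV: "g x \<in> borel_measurable (VA (Poisson x))" for x
    unfolding g_def[abs_def] by (intro borel_measurable_diff N_VA T0 order_refl)
  have XP: "X (Poisson x) = (\<lambda>\<omega>. exp (2 * g x \<omega>))" for x by (rule ext) (simp add: X_def)
  have XV: "X s \<in> borel_measurable (VA s)" for s
  proof (cases s)
    case Initial
    have "X Initial = (\<lambda>\<omega>. 1)" by (rule ext) (simp add: X_def)
    then show ?thesis unfolding Initial by simp
  next
    case Wiener
    have "X Wiener = (\<lambda>\<omega>. 1)" by (rule ext) (simp add: X_def)
    then show ?thesis unfolding Wiener by simp
  next
    case (Poisson x)
    have "(\<lambda>y::real. exp (2 * y)) \<in> borel_measurable borel" by measurable
    from measurable_compose[OF gV this] show ?thesis unfolding Poisson XP .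
  qed
  have Qs: "?Q \<subseteq> sources" unfolding sources_def by (rule Un_upper2)
  have Xpre: "{X s -` A \<inter> space M |A. A \<in> sets borel} \<subseteq> sets (VA s)" for s
  proof
    fix a assume "a \<in> {X s -` A \<inter> space M |A. A \<in> sets borel}"
    then obtain A where "A \<in> sets borel" "a = X s -` A \<inter> space M" by blast
    then show "a \<in> sets (VA s)" using VA_preimage[OF XV] by simp
  qed
  have Xm: "X s \<in> borel_measurable M" if "s \<in> ?Q" for s
  proof (rule measurableI)
    fix A :: "real set" assume "A \<in> sets borel"
    from VA_preimage[OF XV this] show "X s -` A \<inter> space M \<in> events"
      by (rule subsetD[OF VA_events[OF subsetD[OF Qs that]]])
  qed simp
  have "indep_sets (\<lambda>s. {X s -` A \<inter> space M |A. A \<in> sets borel}) ?Q"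
    by (rule indep_sets_mono_sets[OF indep_sets_mono_index[OF Qs sources_indep] Xpre])
  then have Xiv: "indep_vars (\<lambda>_. borel) X ?Q"
    unfolding indep_vars_def2 using Xm by (intro conjI ballI)
  have Xi: "integrable M (X s)" if s: "s \<in> ?Q" for s
  proof -
    obtain x where x: "s = Poisson x" "x \<in> {1..n}" using s by auto
    interpret P: poisson_process M "N x" by (rule poisson[OF x(2)])
    have "integrable M (\<lambda>\<omega>. exp (2 * (real (N x (\<gamma> * T) \<omega>) - real (N x 0 \<omega>))))"
    proof (cases "T = 0")
      case False
      then have T1: "0 < \<gamma> * T" using T \<gamma>_pos by simp
      show ?thesis
        by (rule P.increment_integrable(1)[OF order_refl T1, of "\<lambda>y. exp (2 * y)"])
          (use poisson_exp_integrable[OF T1, of 2] in simp_all)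
    qed simp
    then show ?thesis unfolding x(1) XP g_def .
  qed
  have X2i: "integrable M X2" unfolding X2_def[abs_def] by (rule indep_vars_integrable[OF _ Xiv Xi]) auto
  have X1i: "integrable M X1"
    unfolding X1_def[abs_def]
    by (intro Bochner_Integration.integrable_add Bochner_Integration.integrable_diff Bochner_Integration.integrable_sum integrable_abs zi_integrable VV_integrable T order_refl) simp
  let ?P = "{Initial, Wiener}"
  have Pow: "(\<Union>s\<in>S. sets (VA s)) \<subseteq> Pow (space M)" for S
  proof
    fix a assume "a \<in> (\<Union>s\<in>S. sets (VA s))"
    then obtain s where "a \<in> sets (VA s)" by blast
    then show "a \<in> Pow (space M)" using sets.sets_into_space[of a "VA s"] by (simp add: space_VA)
  qed
  have X1m: "X1 \<in> borel_measurable (sigma (space M) (\<Union>s\<in>?P. sets (VA s)))"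
  proof -
    have "zi j \<in> borel_measurable (sigma (space M) (\<Union>s\<in>?P. sets (VA s)))" if "j \<le> 2 * n" for j
      by (rule VA_sigma[OF zi_VA[OF that] _ Pow]) auto
    moreover have "VV t \<in> borel_measurable (sigma (space M) (\<Union>s\<in>?P. sets (VA s)))" if "0 \<le> t" for t
      by (rule VV_measurable[OF _ that], rule VA_sigma[OF w_VA _ Pow]) auto
    ultimately show ?thesis unfolding X1_def[abs_def] using T
      by (intro borel_measurable_add borel_measurable_diff borel_measurable_sum borel_measurable_abs) auto
  qed
  have X2m: "X2 \<in> borel_measurable (sigma (space M) (\<Union>s\<in>?Q. sets (VA s)))"
    unfolding X2_def[abs_def]
  proof (rule borel_measurable_prod)
    show "X s \<in> borel_measurable (sigma (space M) (\<Union>s\<in>?Q. sets (VA s)))" if "s \<in> ?Q" for s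
      by (rule VA_sigma[OF XV UN_upper[OF that] Pow])
  qed
  have "indep_var borel X1 borel X2"
    by (rule indep_var_two_groups[OF sources_indep _ _ Qs _ X1m X2m]) (auto simp: sources_def sets.Int_stable)
  from indep_var_integrable[OF this X1i X2i] have "integrable M (\<lambda>\<omega>. GG T \<omega>)"
    unfolding G by (rule integrable_mult_right)
  then show ?thesis .
qed

text \<open>The rate enters only in the product \<open>cc j * \<gamma>\<close>, which vanishes at
  indices without jumps, so one constant rate fits every index.\<close>

sublocale J: jump_system M "2 * n" coef cc "\<lambda>_. \<gamma>" FF HH zz zi VV hh YY GG
proof
  show "\<bar>cc j\<bar> \<le> 2" for j by (simp add: cc_def)
  show "YY T K i j \<omega> = euler (2 * n) coef cc (\<lambda>j s. FF j s \<omega>) (\<lambda>j s. HH j s \<omega>) (\<lambda>j. zi j \<omega>) T K i j" for T K i j \<omega>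
    by (rule YY_def)
  show "GG T \<omega> = ((\<Sum>j\<le>2 * n. \<bar>zi j \<omega>\<bar>) + (VV T \<omega> - VV 0 \<omega>)) * jump_factor (2 * n) coef (\<lambda>j s. FF j s \<omega>) T" for T \<omega>
    by (rule GG_def)
  show "AE \<omega> in M. \<forall>j\<le>2 * n. HH j 0 \<omega> = 0" by (simp add: HH_0)
  show "integrable M (GG T)" if "T \<ge> 0" for T by (rule GG_integrable[OF that])
  show "YY T K i j \<in> borel_measurable M" if "T > 0" "K > 0" "i \<le> K" "j \<le> 2 * n" for T K i j
    by (rule YY_measurable[OF that(1,4)])
  show "zz j t \<in> borel_measurable M" if "j \<le> 2 * n" "t \<ge> 0" for j t by (rule zz_measurable[OF that])
  show "integrable M (HH j t) \<and> (\<integral>\<omega>. HH j t \<omega> \<partial>M) = hh j t" if "j \<le> 2 * n" "t \<ge> 0" for j t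
    by (rule HH_mean[OF that(2)])
  show "continuous_on {0..} (hh j)" for j by (rule hh_cont)
qed (rule zz_cadlag FF_mono FF_right HH_VV zz_eq jump_mean; assumption)+

text \<open>At positive even indices the averaged jumps contribute -2\<gamma>, at index 0 the drift
  does: the damping is the same at all momenta. Continuity of the averages turns the integral
  equation into a differential one.\<close>

lemma mean_deriv:
  assumes j: "j \<le> 2 * n" and t: "0 \<le> t"
  shows "(J.mean j has_real_derivative (if j < 2 * n then J.mean (Suc j) t else force \<theta> Fbar Fhat n t)
     - (if j = 0 then 0 else J.mean (j - 1) t) - (if even j then 2 * \<gamma> * J.mean j t else 0)) (at t within {0..})"
proof -
  let ?g = "\<lambda>s. J.field (\<lambda>k. J.mean k s) j"
  have c: "continuous_on {0..} ?g"
    unfolding J.field_def by (intro continuous_intros J.mean_continuous j) auto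
  have fg: "?g s = (if j < 2 * n then J.mean (Suc j) s else 0) - (if j = 0 then 0 else J.mean (j - 1) s) - (if even j then 2 * \<gamma> * J.mean j s else 0)" for s
    unfolding J.field_def coef_sum[OF j] by (simp add: cc_def jmp_def)
  have h: "(hh j has_real_derivative (if j < 2 * n then 0 else force \<theta> Fbar Fhat n t)) (at t within {0..})"
  proof (cases "j < 2 * n")
    case True
    then have "hh j = (\<lambda>t. 0)" by (auto simp: hh_def)
    then show ?thesis using True by simp
  next
    case False
    then have "hh j = (\<lambda>t. integral {0..t} (force \<theta> Fbar Fhat n))" using j by (auto simp: hh_def)
    then show ?thesis using False integral_at_0_deriv[OF force_cont' t] by simp
  qed
  have d: "((\<lambda>x. J.mean j 0 + integral {0..x} ?g + (hh j x - hh j 0)) has_real_derivative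
     0 + ?g t + ((if j < 2 * n then 0 else force \<theta> Fbar Fhat n t) - 0)) (at t within {0..})"
    by (intro DERIV_add DERIV_diff DERIV_const h integral_at_0_deriv[OF c t])
  have e: "0 + ?g t + ((if j < 2 * n then 0 else force \<theta> Fbar Fhat n t) - 0) = (if j < 2 * n then J.mean (Suc j) t else force \<theta> Fbar Fhat n t)
     - (if j = 0 then 0 else J.mean (j - 1) t) - (if even j then 2 * \<gamma> * J.mean j t else 0)"
    unfolding fg by (cases "j < 2 * n") simp_all
  show ?thesis
  proof (rule has_field_derivative_transform_within[where d = 1, OF d[unfolded e]])
    show "J.mean j 0 + integral {0..x} ?g + (hh j x - hh j 0) = J.mean j x" if "x \<in> {0..}" for x
      by (rule J.mean_equation[OF _ j, symmetric]) (use that in simp)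
  qed (use t in auto)
qed

text \<open>At site 0 the shifted component differs from the momentum by a multiple of the Wiener
  process, which has mean zero.\<close>

lemma avg_p: "x \<le> n \<Longrightarrow> 0 \<le> t \<Longrightarrow> avg M p x t = J.mean (2 * x) t"
proof (cases "x = 0")
  case True
  assume t: "0 \<le> t"
  have i: "integrable M (zz 0 t)" by (rule J.z_integrable) (use t in auto)
  have "avg M p x t = (\<integral>\<omega>. zz 0 t \<omega> + sg * w t \<omega> \<partial>M)" unfolding avg_def True by (simp add: zz_def)
  also have "\<dots> = (\<integral>\<omega>. zz 0 t \<omega> \<partial>M) + sg * (\<integral>\<omega>. w t \<omega> \<partial>M)"
    using i W.w_moments(1)[OF t] by simp
  finally show ?thesis using W.w_moments(2)[OF t] True by (simp add: J.mean_def)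
qed (simp add: avg_def J.mean_def zz_def)

lemma avg_r: "avg M r (Suc x) t = J.mean (Suc (2 * x)) t"
  by (simp add: avg_def J.mean_def zz_def)

text \<open>The averaged stretch is continued by the force beyond the last bond, the convention of
  \<open>damped_chain\<close>.\<close>

theorem averages_damped_chain:
  "damped_chain \<gamma> n (force \<theta> Fbar Fhat n) (\<lambda>x t. if x \<le> n then avg M r x t else force \<theta> Fbar Fhat n t) (avg M p)"
proof
  show "\<gamma> > 0" by (rule \<gamma>_pos)
  show "continuous_on {0..} (force \<theta> Fbar Fhat n)" by (rule force_cont')
  show "(if 0 \<le> n then avg M r 0 t else force \<theta> Fbar Fhat n t) = 0" for t by (simp add: avg_def r_zero)
  show "(if Suc n \<le> n then avg M r (Suc n) t else force \<theta> Fbar Fhat n t) = force \<theta> Fbar Fhat n t" for t by simp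
  fix x and t :: real assume t: "0 \<le> t"
  show "((\<lambda>t. if Suc x \<le> n then avg M r (Suc x) t else force \<theta> Fbar Fhat n t) has_real_derivative avg M p (Suc x) t - avg M p x t) (at t within {0..})"
    if x: "x < n"
  proof -
    have "(\<lambda>t. if Suc x \<le> n then avg M r (Suc x) t else force \<theta> Fbar Fhat n t) = J.mean (Suc (2 * x))"
      using x by (auto simp: avg_r)
    moreover have "Suc (2 * x) < 2 * n" using x by presburger
    ultimately show ?thesis using mean_deriv[of "Suc (2 * x)" t] t x avg_p[of x t] avg_p[of "Suc x" t] by simp
  qed
  show "(avg M p x has_real_derivative (if Suc x \<le> n then avg M r (Suc x) t else force \<theta> Fbar Fhat n t)
     - (if x \<le> n then avg M r x t else force \<theta> Fbar Fhat n t) - 2 * \<gamma> * avg M p x t) (at t within {0..})"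
    if x: "x \<le> n"
  proof -
    have r: "(if 2 * x = 0 then 0 else J.mean (2 * x - 1) t) = avg M r x t"
    proof (cases x)
      case (Suc y)
      then show ?thesis by (simp add: avg_r)
    qed (simp add: avg_def r_zero)
    have e: "(if 2 * x < 2 * n then J.mean (Suc (2 * x)) t else force \<theta> Fbar Fhat n t) = (if Suc x \<le> n then avg M r (Suc x) t else force \<theta> Fbar Fhat n t)"
      by (simp add: avg_r Suc_le_eq)
    have d: "(J.mean (2 * x) has_real_derivative (if Suc x \<le> n then avg M r (Suc x) t else force \<theta> Fbar Fhat n t)
     - avg M r x t - 2 * \<gamma> * avg M p x t) (at t within {0..})"
      using mean_deriv[of "2 * x" t] t x unfolding r e avg_p[OF x t] by simp
    show ?thesis
      by (rule has_field_derivative_transform_within[where d = 1]) (use d t x avg_p[OF x] in auto)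
  qed
qed

end

section \<open>The force as a real Fourier series, and the conclusion\<close>

text \<open>Absolute summability permits splitting the sum over nonzero integers into the positive
  and the negative ones; conjugate symmetry makes the second half the conjugate of the first, so the
  real part doubles.\<close>

lemma force_oscillation:
  assumes cnj: "\<And>l. l \<noteq> 0 \<Longrightarrow> Fhat (- l) = cnj (Fhat l)" and decay: "rapidly_decaying Fhat"
  shows "summable (\<lambda>k. norm (Fhat (int (Suc k))))"
    "force \<theta> Fbar Fhat n t = Fbar + oscillation (angular_freq \<theta>) (\<lambda>k. Fhat (int (Suc k))) t / sqrt (real n)"
proof -
  let ?p = "\<lambda>k. int (Suc k)" and ?m = "\<lambda>k. - int (Suc k)"
  define f where "f l = Fhat l * exp (\<i> * of_int l * of_real (angular_freq \<theta>) * of_real t)" for l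
  have inj: "inj ?p" "inj ?m" by (auto simp: inj_on_def)
  have split: "- {0} = range ?p \<union> range ?m"
  proof (intro equalityI subsetI)
    fix l :: int assume "l \<in> - {0}"
    then consider "l > 0" | "l < 0" by force
    then show "l \<in> range ?p \<union> range ?m"
    proof cases
      case 1
      then have "l = ?p (nat (l - 1))" by simp
      then show ?thesis by blast
    next
      case 2
      then have "l = ?m (nat (- l - 1))" by simp
      then show ?thesis by blast
    qed
  qed auto
  have disj: "range ?p \<inter> range ?m = {}" by auto
  \<comment> \<open>The case k = 0 of rapid decay is the summability of the coefficients.\<close>
  have "(\<lambda>l. \<bar>real_of_int l\<bar> ^ 0 * norm (Fhat l)) summable_on - {0}"
    using decay unfolding rapidly_decaying_def by blast
  then have N: "(\<lambda>l. norm (Fhat l)) summable_on - {0}" by simp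
  have nf: "norm (f l) = norm (Fhat l)" for l
  proof -
    have "\<i> * of_int l * of_real (angular_freq \<theta>) * of_real t = \<i> * of_real (real_of_int l * angular_freq \<theta> * t)" by simp
    then show ?thesis unfolding f_def norm_mult by (simp only: norm_exp_i_times mult_1_right)
  qed
  have "(\<lambda>l. norm (Fhat l)) summable_on range ?p"
    by (rule summable_on_subset_banach[OF N]) (simp add: split)
  then have "((\<lambda>l. norm (Fhat l)) \<circ> ?p) summable_on UNIV"
    using summable_on_reindex[OF inj(1)] by blast
  then have "summable ((\<lambda>l. norm (Fhat l)) \<circ> ?p)"
    by (subst (asm) summable_on_UNIV_nonneg_real_iff) auto
  then show S: "summable (\<lambda>k. norm (Fhat (?p k)))" by (simp add: comp_def)
  have fa: "f summable_on - {0}"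
    by (rule abs_summable_summable) (simp add: nf N)
  have hs: "(f \<circ> h) sums infsum f (range h)" if "inj h" "range h \<subseteq> - {0}" for h :: "nat \<Rightarrow> int"
  proof -
    have "(f has_sum infsum f (range h)) (range h)"
      using summable_on_subset_banach[OF fa that(2)] by simp
    then have "((f \<circ> h) has_sum infsum f (range h)) UNIV"
      using has_sum_reindex[OF that(1)] by blast
    then show ?thesis by (rule has_sum_imp_sums)
  qed
  have sp: "(f \<circ> ?p) sums infsum f (range ?p)" by (rule hs[OF inj(1)]) (simp add: split)
  have sm: "(f \<circ> ?m) sums infsum f (range ?m)" by (rule hs[OF inj(2)]) (simp add: split)
  have fl: "f (- l) = cnj (f l)" if "l \<noteq> 0" for l
  proof -
    have e: "\<i> * of_int (- l) * of_real (angular_freq \<theta>) * of_real t = cnj (\<i> * of_int l * of_real (angular_freq \<theta>) * of_real t)"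
      by simp
    have "cnj (f l) = cnj (Fhat l) * exp (cnj (\<i> * of_int l * of_real (angular_freq \<theta>) * of_real t))"
      unfolding f_def exp_cnj[symmetric] by (rule complex_cnj_mult)
    then show ?thesis unfolding e[symmetric] f_def cnj[OF that, symmetric] by (rule sym)
  qed
  have fm: "f \<circ> ?m = (\<lambda>k. cnj ((f \<circ> ?p) k))"
  proof
    fix k show "(f \<circ> ?m) k = cnj ((f \<circ> ?p) k)" unfolding comp_def by (rule fl) simp
  qed
  have "(f \<circ> ?m) sums cnj (infsum f (range ?p))"
    unfolding fm sums_cnj by (rule sp)
  then have m: "infsum f (range ?m) = cnj (infsum f (range ?p))" by (rule sums_unique2[OF sm])
  have "infsum f (- {0}) = infsum f (range ?p) + infsum f (range ?m)"
    unfolding split by (rule infsum_Un_disjoint[OF _ _ disj]; rule summable_on_subset_banach[OF fa]) (simp_all add: split)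
  then have R: "Re (infsum f (- {0})) = 2 * Re (infsum f (range ?p))" unfolding m by simp
  have h: "harmonic (Fhat (?p k)) (real (Suc k) * angular_freq \<theta>) t = 2 * Re ((f \<circ> ?p) k)" for k
    by (simp add: harmonic_def f_def mult.assoc)
  have "(\<lambda>k. 2 * Re ((f \<circ> ?p) k)) sums (2 * Re (infsum f (range ?p)))"
    by (intro sums_mult sums_Re sp)
  moreover have "(\<lambda>k. 2 * Re ((f \<circ> ?p) k)) sums oscillation (angular_freq \<theta>) (\<lambda>k. Fhat (?p k)) t"
    using oscillation_sums[OF S, of "angular_freq \<theta>" t] unfolding h .
  ultimately have "oscillation (angular_freq \<theta>) (\<lambda>k. Fhat (?p k)) t = Re (infsum f (- {0}))"
    unfolding R by (rule sums_unique2[symmetric])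
  then show "force \<theta> Fbar Fhat n t = Fbar + oscillation (angular_freq \<theta>) (\<lambda>k. Fhat (?p k)) t / sqrt (real n)"
    unfolding force_def f_def[symmetric] by simp
qed

theorem theorem2p5:
  fixes \<gamma> Tminus \<theta> Fbar Hbar :: real
    and Fhat :: "int \<Rightarrow> complex"
    and M :: "nat \<Rightarrow> 'a measure"
    and \<mu> :: "nat \<Rightarrow> ((nat \<Rightarrow> real) \<times> (nat \<Rightarrow> real)) measure"
    and w :: "nat \<Rightarrow> real \<Rightarrow> 'a \<Rightarrow> real"
    and N :: "nat \<Rightarrow> nat \<Rightarrow> real \<Rightarrow> 'a \<Rightarrow> nat"
    and r p :: "nat \<Rightarrow> nat \<Rightarrow> real \<Rightarrow> 'a \<Rightarrow> real"
    and rini :: "real \<Rightarrow> real"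
    and \<rho> :: "real \<Rightarrow> real \<Rightarrow> real"
  assumes "\<gamma> > 0" and "Tminus > 0" and "\<theta> > 0"
    and "\<And>l. l \<noteq> 0 \<Longrightarrow> Fhat (- l) = cnj (Fhat l)"
    and "rapidly_decaying Fhat"
    and "\<And>n. n \<ge> 1 \<Longrightarrow> chain (M n) \<gamma> Tminus \<theta> Fbar Fhat n (\<mu> n) (w n) (N n) (r n) (p n)"
    and "Hbar > 0"
    and "\<And>n. n \<ge> 1 \<Longrightarrow>
           1 / real n * (\<Sum>x=0..n. (avg (M n) (r n) x 0)\<^sup>2 + (avg (M n) (p n) x 0)\<^sup>2) \<le> Hbar"
    and "continuous_on {0..1} rini"
    and "(\<lambda>n. 1 / real n * (\<Sum>x=1..n. (avg (M n) (r n) x 0 - rini (real x / real n))\<^sup>2))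
           \<longlonglongrightarrow> 0"
    and "stretch_density \<gamma> Fbar rini \<rho>"
    and "t > 0"
  shows "(\<lambda>n. work \<theta> Fbar Fhat n (M n) (p n) t) \<longlonglongrightarrow> limit_work \<gamma> \<theta> Fbar Fhat \<rho> t"
proof -
  define f where "f k = Fhat (int (Suc k))" for k
  define \<omega> where "\<omega> = angular_freq \<theta>"
  define R where "R n x t = (if x \<le> n then avg (M n) (r n) x t else force \<theta> Fbar Fhat n t)" for n x t
  define P where "P n = avg (M n) (p n)" for n
  have f: "summable (\<lambda>k. norm (f k))"
    unfolding f_def by (rule force_oscillation(1)[OF assms(4,5)])
  have F: "force \<theta> Fbar Fhat n = (\<lambda>t. Fbar + oscillation \<omega> f t / sqrt (real n))" for n
    unfolding f_def[abs_def] \<omega>_def by (rule ext) (rule force_oscillation(2)[OF assms(4,5)])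
  have Fc: "continuous_on A (force \<theta> Fbar Fhat n)" for A n
    unfolding F by (cases "n = 0") (auto intro!: continuous_intros oscillation_cont[OF f])
  have oc: "open_chain (M n) \<gamma> Tminus \<theta> Fbar Fhat n (\<mu> n) (w n) (N n) (r n) (p n)" if "n \<ge> 1" for n
    using assms(6)[OF that] assms(1) that Fc by (intro open_chain.intro open_chain_axioms.intro) auto
  have dc: "damped_chain \<gamma> n (force \<theta> Fbar Fhat n) (R n) (P n)" if "n \<ge> 1" for n
    using open_chain.averages_damped_chain[OF oc[OF that]] unfolding R_def[abs_def] P_def .
  have r0: "avg (M n) (r n) 0 s = 0" if "n \<ge> 1" for n s
    using chain.r_zero[OF assms(6)[OF that]] by (simp add: avg_def)
  interpret forced_chains \<gamma> Fbar \<omega> Hbar f R P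
  proof (rule forced_chains.intro)
    show "\<omega> > 0" using assms(3) by (simp add: \<omega>_def angular_freq_def)
    fix n :: nat assume n: "n \<ge> 1"
    show "damped_chain \<gamma> n (\<lambda>t. Fbar + oscillation \<omega> f t / sqrt (real n)) (R n) (P n)"
      using dc[OF n] unfolding F .
    have "damped_chain.energy n (R n) (P n) 0 = (\<Sum>x<n. (R n (Suc x) 0)\<^sup>2) + (\<Sum>x\<le>n. (P n x 0)\<^sup>2)"
      by (simp add: damped_chain.energy_def[OF dc[OF n]])
    also have "(\<Sum>x<n. (R n (Suc x) 0)\<^sup>2) = (\<Sum>x<n. (avg (M n) (r n) (Suc x) 0)\<^sup>2)"
      by (rule sum.cong) (auto simp: R_def)
    also have "\<dots> = (\<Sum>x\<le>n. (avg (M n) (r n) x 0)\<^sup>2)"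
      \<comment> \<open>The energy has no bond 0, whereas the hypothesis sums from 0; the extra term
        vanishes by \<open>r_zero\<close>.\<close>
      unfolding sum.atMost_shift by (simp add: r0[OF n])
    also have "\<dots> + (\<Sum>x\<le>n. (P n x 0)\<^sup>2) = (\<Sum>x=0..n. (avg (M n) (r n) x 0)\<^sup>2 + (avg (M n) (p n) x 0)\<^sup>2)"
      by (simp add: sum.distrib atLeast0AtMost P_def)
    also have "\<dots> \<le> Hbar * real n" using assms(8)[OF n] n by (simp add: divide_le_eq)
    finally show "damped_chain.energy n (R n) (P n) 0 \<le> Hbar * real n" .
  qed (use assms(1) f in auto)
  have init: "(\<lambda>n. 1 / real n * (\<Sum>x<n. (R n (Suc x) 0 - rini (real (Suc x) / real n))\<^sup>2)) \<longlonglongrightarrow> 0"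
  proof -
    have "(\<Sum>x<n. (R n (Suc x) 0 - rini (real (Suc x) / real n))\<^sup>2) = (\<Sum>x=1..n. (avg (M n) (r n) x 0 - rini (real x / real n))\<^sup>2)" for n
      unfolding One_nat_def sum.atLeast1_atMost_eq by (rule sum.cong) (auto simp: R_def)
    then show ?thesis using assms(10) by simp
  qed
  have W: "work \<theta> Fbar Fhat n (M n) (p n) t = 1 / real n * integral {0..t * (real n)\<^sup>2} (\<lambda>s. (Fbar + oscillation \<omega> f s / sqrt (real n)) * P n n s)" if n: "n \<ge> 1" for n
  proof -
    have c: "continuous_on {0..t * (real n)\<^sup>2} (\<lambda>s. force \<theta> Fbar Fhat n s * P n n s)"
      by (intro continuous_intros Fc continuous_on_subset[OF damped_chain.P_cont[OF dc[OF n] order_refl]]) auto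
    show ?thesis using lbint_eq_integral[OF c] unfolding work_def P_def F by simp
  qed
  have L: "limit_work \<gamma> \<theta> Fbar Fhat \<rho> t = Fbar / (2 * \<gamma>) * (LBINT s:{0..t}. vector_derivative (\<rho> s) (at 1 within {0..1})) +
    (\<Sum>k. (norm (f k))\<^sup>2 * (real (Suc k) * \<omega>) * Re (csqrt (4 / ((of_real (real (Suc k) * \<omega>))\<^sup>2 - 2 * \<i> * of_real \<gamma> * of_real (real (Suc k) * \<omega>)) - 1))) * t"
    by (simp only: limit_work_def work_Q_def Let_def f_def \<omega>_def)
  show ?thesis
    unfolding L
    by (rule Lim_transform_eventually[OF total_work_limit[OF assms(12,9) init assms(11)]])
      (rule eventually_sequentiallyI[of 1], rule W[symmetric])
qed

end
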